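(* Let $\epsilon\in\{-1,1\}$ be fixed. The essential kernel algebras of the classes $\mathcal K'^\epsilon$ and $\bar{\mathcal K}'$ coincide with $\langle\partial_t,u\partial_u\rangle$. A complete list of $G^\sim_{\mathcal K'^\epsilon}$-inequivalent (resp. $G^\sim_{\bar{\mathcal K}'}$-inequivalent) essential Lie-symmetry extensions in the class $\mathcal K'^\epsilon$ (resp. the class $\bar{\mathcal K}'$) is exhausted by the following cases, where $A=\epsilon$ for the class $\bar{\mathcal K}'$, $B=2\epsilon W_x/W$ with the given functions $W=W(x)$, and the vector fields listed are basis elements of the essential Lie invariance algebra $\mathfrak g^{\rm ess}_B$ besides $\partial_t$ and $u\partial_u$: 0. $W=W(x)$ (general case): no further basis elements; 1. $W=\sqrt{|x|}\cos(\alpha\ln|x|)$, $W=\sqrt{|x|}$, $W=\sqrt{|x|}\ln|x|$, $W=\sqrt{|x|}\,(a_1|x|^\alpha+a_2|x|^{-\alpha})$: $D_{B,0}(t)$, $D_{B,0}(t^2)$; $1'$. $W=\sqrt{|x|}\,\mathcal Z_\beta(x)$, $W=\sqrt{|x|}\,\tilde{\mathcal Z}_\gamma(x)$: $D_{B,1}(t)$, $D_{B,1}(t^2)$; $1''$. $W=\sqrt{|x|}\,\mathcal C_\beta(x)$, $W=\sqrt{|x|}\,\tilde{\mathcal C}_\gamma(x)$: $D_{B,-1}(t)$, $D_{B,-1}(t^2)$; 1a. $W=|x|^{-1/2}\,\mathrm{Re}\big((a_1-a_2\mathrm i)\mathrm W_{-\frac14\kappa\mathrm i,\frac12\nu}(\mathrm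 ix^2)\big)$: $D_{B,\kappa}(\cos4t)$, $D_{B,\kappa}(\sin4t)$; 1b. $W=|x|^{-1/2}\big(a_1\mathrm W_{\frac14\kappa,\frac12\nu}(x^2)+a_2\mathrm W_{-\frac14\kappa,\frac12\nu}(-x^2)\big)$: $D_{B,\kappa}(e^{4t})$, $D_{B,\kappa}(e^{-4t})$; 2. $W=1$, $W=x$: $P_B(1)$, $P_B(t)$, $D_{B,0}(t)$, $D_{B,0}(t^2)$; $2'$. $W=\cos x$: $P_B(1)$, $P_B(t)$, $D_{B,1}(t)$, $D_{B,1}(t^2)$; $2''$. $W=e^x$, $W=\cosh x$, $W=\sinh x$: $P_B(1)$, $P_B(t)$, $D_{B,-1}(t)$, $D_{B,-1}(t^2)$; 2a. $W=|x|^{-1/2}\,\mathrm{Re}\big((a_1-a_2\mathrm i)\mathrm W_{-\frac14\kappa\mathrm i,\frac14}(\mathrm ix^2)\big)$: $P_B(\sin2t)$, $P_B(\cos2t)$, $D_{B,\kappa}(\cos4t)$, $D_{B,\kappa}(\sin4t)$; 2b. $W=|x|^{-1/2}\big(a_1\mathrm W_{\frac14\kappa,\frac14}(x^2)+a_2\mathrm W_{-\frac14\kappa,\frac14}(-x^2)\big)$: $P_B(e^{2t})$, $P_B(e^{-2t})$, $D_{B,\kappa}(e^{4t})$, $D_{B,\kappa}(e^{-4t})$; 2c. $W=a_1\mathrm{Ai}(x)+a_2\mathrm{Bi}(x)$: $\bar P_B(1)$, $\bar P_B(t)$, $D_{B,0}(t)+\frac32\bar P_B(t^2)$, $D_{B,0}(t^2)+\bar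 P_B(t^3)$. Here $\kappa\in\mathbb R$, $\nu\in\mathbb R_{\geqslant0}\cup\mathrm i\mathbb R_{>0}$, $\alpha,\gamma\in\mathbb R_{>0}$, $\beta\in\mathbb R_{\geqslant0}$, $\alpha,\beta,\nu\neq\frac12$; $(a_1,a_2)\neq(0,0)$, and $(a_1,a_2)$ is defined up to a nonzero multiplier; \[ D_{B,\kappa}(f)=f\partial_t+\tfrac12f_tx\partial_x-\epsilon\big(\tfrac18f_{tt}x^2+\tfrac14\epsilon f_t-\kappa f+\tfrac14f_txB(x)\big)u\partial_u, \] \[ P_B(f)=f\partial_x-\tfrac12\epsilon\big(f_tx+fB(x)\big)u\partial_u,\qquad \bar P_B(f)=P_B(f)-\epsilon Fu\partial_u, \] where $F$ is a fixed antiderivative of $f=f(t)$.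
   Context: Everything is real, smooth and local; $W$ is considered where it is nonvanishing. The class $\bar{\mathcal K}'$ consists of the Kolmogorov equations $u_t=A(x)u_{xx}+B(x)u_x$ with time-independent $A\neq0$ and $B$; $\mathcal K'^\epsilon$ consists of the equations $u_t=\epsilon u_{xx}+B(x)u_x$. Equivalence groups. $G^\sim_{\bar{\mathcal K}'}$: $\tilde t=c_1t+c_2$, $\tilde x=X(x)$, $\tilde u=c_3u+c_4$, $\tilde A=\frac{X_x^2}{c_1}A$, $\tilde B=\frac{X_x}{c_1}B+\frac{X_{xx}}{c_1}A$ with $X_x\neq0$, $c_1c_3\ne0$. $G^\sim_{\mathcal K'^\epsilon}$: $\tilde t=c_1^2t+c_2$, $\tilde x=c_1x+c_3$, $\tilde u=c_4u+c_5$, $\tilde B=\frac1{c_1}B$ with $c_1c_4\ne0$. Equations of a class are equivalent with respect to its equivalence group if one of its elements maps one to the other. For an equation $E$ of these classes, the maximal Lie invariance algebra is $\mathfrak g_E=\mathfrak g_E^{\rm ess}\oplus\mathfrak g_E^{\rm lin}$ (as vector spaces), where $\mathfrak g_E^{\rm lin}=\{f(t,x)\partial_u\mid f\text{ solves }E\}$ is an ideal and the essential Lie invariance algebra $\mathfrak g_E^{\rm ess}$ is the subalgebra of vector fields in $\mathfrak g_E$ of the form $\tau(t)\partial_t+\xi(t,x)\partial_x+\eta(t,x)u\partial_u$. The essential kernel algebra of a class is the intersection of the algebras $\mathfrak g_E^{\rm ess}$ over all equations in the class. An essential Lie-symmetry extension is a value of the arbitrary elements for which $\mathfrak g_E^{\rm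 ess}$ strictly contains the essential kernel algebra. Case 0 is the general case, without extension. Special functions. The constants $a_1,a_2$ are real. $\mathcal Z_\beta$ and $\mathcal C_\beta$ are (nonzero real) linear combinations, of order $\beta$, of linearly independent Bessel functions and of linearly independent modified Bessel functions, respectively. With $\nu=\mathrm i\gamma$, \[ \tilde{\mathcal Z}_\gamma=\frac{a_1}2\big(e^{-\frac12\gamma\pi}\mathrm H^{(1)}_\nu+e^{\frac12\gamma\pi}\mathrm H^{(2)}_\nu\big)+\frac{a_2}{2\mathrm i}\big(e^{-\frac12\gamma\pi}\mathrm H^{(1)}_\nu-e^{\frac12\gamma\pi}\mathrm H^{(2)}_\nu\big),\qquad \tilde{\mathcal C}_\gamma=\frac{a_1\pi\mathrm i}{2\sin(\nu\pi)}\big(\mathrm I_\nu+\mathrm I_{-\nu}\big)+a_2\mathrm K_\nu, \] where $\mathrm H^{(1)}_\nu,\mathrm H^{(2)}_\nu$ are the Hankel functions and $\mathrm I_\nu,\mathrm K_\nu$ are the modified Bessel functions. $\mathrm{Ai},\mathrm{Bi}$ are the Airy functions of the first and second kind. $\mathrm W_{k,m}$ is the (standard) Whittaker function, which is a solution of $w''(z)+\big(-\frac14+\frac kz+\frac{1/4-m^2}{z^2}\big)w=0$.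
   Formalization: Corrected: α=1/2 is allowed in √|x|cos(α ln|x|); in 1b, 2b a1,a2 are complex with W real; for the power W of case 1 scalings of x also identify (a1,a2); completeness is local, off one point (W of 2a, 2b breaks at x=0). Bessel functions are taken at |x|. *)

theory Defs
  imports "HOL-Analysis.Analysis"
begin

section \<open>Smoothness and open intervals\<close>

fun C_k_on :: "nat \<Rightarrow> 'a set \<Rightarrow> ('a::real_normed_vector \<Rightarrow> 'b::real_normed_vector) \<Rightarrow> bool" where
  "C_k_on 0 S f = continuous_on S f"
| "C_k_on (Suc k) S f =
     ((\<forall>p\<in>S. f differentiable (at p)) \<and>
      (\<forall>v. C_k_on k S (\<lambda>p. frechet_derivative f (at p) v)))"

text \<open>Meant for open \<open>S\<close> only.\<close>
definition smooth_on :: "'a set \<Rightarrow> ('a::real_normed_vector \<Rightarrow> 'b::real_normed_vector) \<Rightarrow> bool" where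
  "smooth_on S f \<longleftrightarrow> (\<forall>k. C_k_on k S f)"

definition open_interval :: "real set \<Rightarrow> bool" where
  "open_interval I \<longleftrightarrow> open I \<and> connected I \<and> I \<noteq> {}"

section \<open>Vector fields and Lie symmetries of \<open>u\<^sub>t = A(x) u\<^sub>x\<^sub>x + B(x) u\<^sub>x\<close>\<close>

text \<open>
  A field \<open>Q\<close> with \<open>Q (t, x, u) = (\<tau>, \<xi>, \<eta>)\<close> stands for \<open>\<tau>\<partial>\<^sub>t + \<xi>\<partial>\<^sub>x + \<eta>\<partial>\<^sub>u\<close>. Fields live on
  \<open>T \<times> I \<times> UNIV\<close>; their values elsewhere are irrelevant.
\<close>
type_synonym point = "real \<times> real \<times> real"
type_synonym vfield = "point \<Rightarrow> point"

abbreviation dom3 :: "real set \<Rightarrow> real set \<Rightarrow> point set" where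
  "dom3 T I \<equiv> T \<times> I \<times> UNIV"

definition pd :: "point \<Rightarrow> (point \<Rightarrow> real) \<Rightarrow> point \<Rightarrow> real" where
  "pd v f p = frechet_derivative f (at p) v"

abbreviation pd_t :: "(point \<Rightarrow> real) \<Rightarrow> point \<Rightarrow> real" where "pd_t \<equiv> pd (1, 0, 0)"
abbreviation pd_x :: "(point \<Rightarrow> real) \<Rightarrow> point \<Rightarrow> real" where "pd_x \<equiv> pd (0, 1, 0)"
abbreviation pd_u :: "(point \<Rightarrow> real) \<Rightarrow> point \<Rightarrow> real" where "pd_u \<equiv> pd (0, 0, 1)"

text \<open>
  Total derivatives of a function of \<open>(t, x, u)\<close>; the jet coordinates
  \<open>u\<^sub>t, u\<^sub>x, u\<^sub>x\<^sub>x\<close> are the arguments \<open>ut, ux, uxx\<close>.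
\<close>
definition Dt :: "real \<Rightarrow> (point \<Rightarrow> real) \<Rightarrow> point \<Rightarrow> real" where
  "Dt ut f p = pd_t f p + ut * pd_u f p"

definition Dx :: "real \<Rightarrow> (point \<Rightarrow> real) \<Rightarrow> point \<Rightarrow> real" where
  "Dx ux f p = pd_x f p + ux * pd_u f p"

definition Dxx :: "real \<Rightarrow> real \<Rightarrow> (point \<Rightarrow> real) \<Rightarrow> point \<Rightarrow> real" where
  "Dxx ux uxx f p =
     pd_x (pd_x f) p + 2 * ux * pd_x (pd_u f) p + ux\<^sup>2 * pd_u (pd_u f) p + uxx * pd_u f p"

text \<open>Coefficients of the second prolongation of \<open>\<tau>\<partial>\<^sub>t + \<xi>\<partial>\<^sub>x + \<eta>\<partial>\<^sub>u\<close> at \<open>\<partial>/\<partial>u\<^sub>t\<close>, \<open>\<partial>/\<partial>u\<^sub>x\<close>, \<open>\<partial>/\<partial>u\<^sub>x\<^sub>x\<close>.\<close>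
definition prol_t ::
  "(point \<Rightarrow> real) \<Rightarrow> (point \<Rightarrow> real) \<Rightarrow> (point \<Rightarrow> real) \<Rightarrow> real \<Rightarrow> real \<Rightarrow> point \<Rightarrow> real" where
  "prol_t \<tau> \<xi> \<eta> ut ux p = Dt ut \<eta> p - ut * Dt ut \<tau> p - ux * Dt ut \<xi> p"

definition prol_x ::
  "(point \<Rightarrow> real) \<Rightarrow> (point \<Rightarrow> real) \<Rightarrow> (point \<Rightarrow> real) \<Rightarrow> real \<Rightarrow> real \<Rightarrow> point \<Rightarrow> real" where
  "prol_x \<tau> \<xi> \<eta> ut ux p = Dx ux \<eta> p - ut * Dx ux \<tau> p - ux * Dx ux \<xi> p"

definition prol_xx ::
  "(point \<Rightarrow> real) \<Rightarrow> (point \<Rightarrow> real) \<Rightarrow> (point \<Rightarrow> real) \<Rightarrow>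
   real \<Rightarrow> real \<Rightarrow> real \<Rightarrow> real \<Rightarrow> point \<Rightarrow> real" where
  "prol_xx \<tau> \<xi> \<eta> ut ux utx uxx p =
     Dxx ux uxx \<eta> p - ut * Dxx ux uxx \<tau> p - ux * Dxx ux uxx \<xi> p
     - 2 * utx * Dx ux \<tau> p - 2 * uxx * Dx ux \<xi> p"

text \<open>Maximal Lie invariance algebra, by the infinitesimal invariance criterion.\<close>
definition lie_algebra ::
  "real set \<Rightarrow> real set \<Rightarrow> (real \<Rightarrow> real) \<Rightarrow> (real \<Rightarrow> real) \<Rightarrow> vfield set" where
  "lie_algebra T I A B =
     {Q. smooth_on (dom3 T I) Q \<and>
         (let \<tau> = (\<lambda>p. fst (Q p)); \<xi> = (\<lambda>p. fst (snd (Q p))); \<eta> = (\<lambda>p. snd (snd (Q p))) in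
          \<forall>t\<in>T. \<forall>x\<in>I. \<forall>u ut ux utx uxx. ut = A x * uxx + B x * ux \<longrightarrow>
            prol_t \<tau> \<xi> \<eta> ut ux (t, x, u)
            - A x * prol_xx \<tau> \<xi> \<eta> ut ux utx uxx (t, x, u)
            - B x * prol_x \<tau> \<xi> \<eta> ut ux (t, x, u)
            - \<xi> (t, x, u) * (deriv A x * uxx + deriv B x * ux) = 0)}"

definition ess_algebra ::
  "real set \<Rightarrow> real set \<Rightarrow> (real \<Rightarrow> real) \<Rightarrow> (real \<Rightarrow> real) \<Rightarrow> vfield set" where
  "ess_algebra T I A B =
     {Q \<in> lie_algebra T I A B.
        \<exists>\<tau> \<xi> \<eta>. \<forall>t\<in>T. \<forall>x\<in>I. \<forall>u. Q (t, x, u) = (\<tau> t, \<xi> t x, \<eta> t x * u)}"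

definition lin_comb :: "vfield list \<Rightarrow> (nat \<Rightarrow> real) \<Rightarrow> vfield" where
  "lin_comb Qs c p = (\<Sum>i<length Qs. c i *\<^sub>R (Qs ! i) p)"

text \<open>\<open>Qs\<close> is a basis of the space \<open>V\<close> of fields on \<open>D\<close>, fields being identified if they agree on \<open>D\<close>.\<close>
definition has_basis :: "point set \<Rightarrow> vfield set \<Rightarrow> vfield list \<Rightarrow> bool" where
  "has_basis D V Qs \<longleftrightarrow>
     (\<forall>Q. Q \<in> V \<longleftrightarrow> (\<exists>c. \<forall>p\<in>D. Q p = lin_comb Qs c p)) \<and>
     (\<forall>c. (\<forall>p\<in>D. lin_comb Qs c p = 0) \<longrightarrow> (\<forall>i<length Qs. c i = 0))"

section \<open>The two classes, their kernels and equivalence groups\<close>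

text \<open>
  In the class with \<open>A = \<epsilon>\<close> an equation on \<open>I\<close> is given by \<open>B\<close>, in the larger class by \<open>(A, B)\<close>.
\<close>
definition in_K :: "real set \<Rightarrow> (real \<Rightarrow> real) \<Rightarrow> bool" where
  "in_K I B \<longleftrightarrow> smooth_on I B"

definition in_Kbar :: "real set \<Rightarrow> (real \<Rightarrow> real) \<Rightarrow> (real \<Rightarrow> real) \<Rightarrow> bool" where
  "in_Kbar I A B \<longleftrightarrow> smooth_on I A \<and> smooth_on I B \<and> (\<forall>x\<in>I. A x \<noteq> 0)"

definition kernel_K :: "real \<Rightarrow> real set \<Rightarrow> real set \<Rightarrow> vfield set" where
  "kernel_K \<epsilon> T I = \<Inter> {ess_algebra T I (\<lambda>_. \<epsilon>) B | B. in_K I B}"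

definition kernel_Kbar :: "real set \<Rightarrow> real set \<Rightarrow> vfield set" where
  "kernel_Kbar T I = \<Inter> {ess_algebra T I A B | A B. in_Kbar I A B}"

definition extension_K :: "real \<Rightarrow> real set \<Rightarrow> real set \<Rightarrow> (real \<Rightarrow> real) \<Rightarrow> bool" where
  "extension_K \<epsilon> T I B \<longleftrightarrow> in_K I B \<and> kernel_K \<epsilon> T I \<subset> ess_algebra T I (\<lambda>_. \<epsilon>) B"

definition extension_Kbar ::
  "real set \<Rightarrow> real set \<Rightarrow> (real \<Rightarrow> real) \<Rightarrow> (real \<Rightarrow> real) \<Rightarrow> bool" where
  "extension_Kbar T I A B \<longleftrightarrow> in_Kbar I A B \<and> kernel_Kbar T I \<subset> ess_algebra T I A B"

text \<open>
  Equivalence of the equation on \<open>I\<close> with the (tilded) equation on \<open>I'\<close>. The constants of the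
  equivalence groups that enter only the transformations of \<open>u\<close> and the shift of \<open>t\<close> do not act on
  the arbitrary elements and are omitted.
\<close>
definition equiv_K ::
  "real set \<Rightarrow> (real \<Rightarrow> real) \<Rightarrow> real set \<Rightarrow> (real \<Rightarrow> real) \<Rightarrow> bool" where
  "equiv_K I B I' B' \<longleftrightarrow>
     (\<exists>c\<^sub>1 c\<^sub>3. c\<^sub>1 \<noteq> 0 \<and> I' = (\<lambda>x. c\<^sub>1 * x + c\<^sub>3) ` I \<and>
        (\<forall>x\<in>I. B' (c\<^sub>1 * x + c\<^sub>3) = B x / c\<^sub>1))"

definition equiv_Kbar ::
  "real set \<Rightarrow> (real \<Rightarrow> real) \<Rightarrow> (real \<Rightarrow> real) \<Rightarrow>
   real set \<Rightarrow> (real \<Rightarrow> real) \<Rightarrow> (real \<Rightarrow> real) \<Rightarrow> bool" where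
  "equiv_Kbar I A B I' A' B' \<longleftrightarrow>
     (\<exists>c\<^sub>1 X. c\<^sub>1 \<noteq> 0 \<and> smooth_on I X \<and> (\<forall>x\<in>I. deriv X x \<noteq> 0) \<and> I' = X ` I \<and>
        (\<forall>x\<in>I. A' (X x) = (deriv X x)\<^sup>2 / c\<^sub>1 * A x) \<and>
        (\<forall>x\<in>I. B' (X x) = deriv X x / c\<^sub>1 * B x + deriv (deriv X) x / c\<^sub>1 * A x))"

section \<open>Special functions\<close>

text \<open>
  All powers are principal (\<open>- pi < Im (Ln z) \<le> pi\<close>). Where the usual connection formula has a
  removable singularity in the order, the value is the limit; elsewhere the limit is the value.
\<close>

definition bessel_J :: "complex \<Rightarrow> complex \<Rightarrow> complex" where
  "bessel_J \<nu> z =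
     (z / 2) powr \<nu> * (\<Sum>n. (- 1) ^ n * rGamma (\<nu> + of_nat n + 1) / fact n * (z / 2) ^ (2 * n))"

definition bessel_Y :: "complex \<Rightarrow> complex \<Rightarrow> complex" where
  "bessel_Y \<nu> z =
     Lim (at \<nu>) (\<lambda>\<mu>. (bessel_J \<mu> z * cos (\<mu> * of_real pi) - bessel_J (- \<mu>) z) / sin (\<mu> * of_real pi))"

definition hankel_H1 :: "complex \<Rightarrow> complex \<Rightarrow> complex" where
  "hankel_H1 \<nu> z = bessel_J \<nu> z + \<i> * bessel_Y \<nu> z"

definition hankel_H2 :: "complex \<Rightarrow> complex \<Rightarrow> complex" where
  "hankel_H2 \<nu> z = bessel_J \<nu> z - \<i> * bessel_Y \<nu> z"

definition bessel_I :: "complex \<Rightarrow> complex \<Rightarrow> complex" where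
  "bessel_I \<nu> z =
     (z / 2) powr \<nu> * (\<Sum>n. rGamma (\<nu> + of_nat n + 1) / fact n * (z / 2) ^ (2 * n))"

definition bessel_K :: "complex \<Rightarrow> complex \<Rightarrow> complex" where
  "bessel_K \<nu> z =
     Lim (at \<nu>) (\<lambda>\<mu>. of_real pi / 2 * (bessel_I (- \<mu>) z - bessel_I \<mu> z) / sin (\<mu> * of_real pi))"

text \<open>
  The next four functions are used for positive \<open>x\<close> only. There the complex expressions under
  \<open>Re\<close> are real, so \<open>Re\<close> is a mere coercion.
\<close>
definition cyl_Z :: "real \<Rightarrow> real \<Rightarrow> real \<Rightarrow> real \<Rightarrow> real" where
  "cyl_Z \<beta> a\<^sub>1 a\<^sub>2 x = Re (of_real a\<^sub>1 * bessel_J (of_real \<beta>) (of_real x)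
                        + of_real a\<^sub>2 * bessel_Y (of_real \<beta>) (of_real x))"

definition cyl_C :: "real \<Rightarrow> real \<Rightarrow> real \<Rightarrow> real \<Rightarrow> real" where
  "cyl_C \<beta> a\<^sub>1 a\<^sub>2 x = Re (of_real a\<^sub>1 * bessel_I (of_real \<beta>) (of_real x)
                        + of_real a\<^sub>2 * bessel_K (of_real \<beta>) (of_real x))"

definition cyl_Z_tilde :: "real \<Rightarrow> real \<Rightarrow> real \<Rightarrow> real \<Rightarrow> real" where
  "cyl_Z_tilde \<gamma> a\<^sub>1 a\<^sub>2 x =
     (let \<nu> = \<i> * of_real \<gamma>;
          h1 = of_real (exp (- \<gamma> * pi / 2)) * hankel_H1 \<nu> (of_real x);
          h2 = of_real (exp (\<gamma> * pi / 2)) * hankel_H2 \<nu> (of_real x)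
      in Re (of_real a\<^sub>1 / 2 * (h1 + h2) + of_real a\<^sub>2 / (2 * \<i>) * (h1 - h2)))"

definition cyl_C_tilde :: "real \<Rightarrow> real \<Rightarrow> real \<Rightarrow> real \<Rightarrow> real" where
  "cyl_C_tilde \<gamma> a\<^sub>1 a\<^sub>2 x =
     (let \<nu> = \<i> * of_real \<gamma>
      in Re (of_real a\<^sub>1 * of_real pi * \<i> / (2 * sin (\<nu> * of_real pi))
               * (bessel_I \<nu> (of_real x) + bessel_I (- \<nu>) (of_real x))
             + of_real a\<^sub>2 * bessel_K \<nu> (of_real x)))"

definition whittaker_M :: "complex \<Rightarrow> complex \<Rightarrow> complex \<Rightarrow> complex" where
  "whittaker_M k m z =
     exp (- z / 2) * z powr (1 / 2 + m) *
     (\<Sum>n. pochhammer (1 / 2 + m - k) n / (pochhammer (1 + 2 * m) n * fact n) * z ^ n)"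

definition whittaker_W :: "complex \<Rightarrow> complex \<Rightarrow> complex \<Rightarrow> complex" where
  "whittaker_W k m z =
     Lim (at m) (\<lambda>\<mu>. Gamma (- 2 * \<mu>) * rGamma (1 / 2 - \<mu> - k) * whittaker_M k \<mu> z
                    + Gamma (2 * \<mu>) * rGamma (1 / 2 + \<mu> - k) * whittaker_M k (- \<mu>) z)"

definition airy_f :: "real \<Rightarrow> real" where
  "airy_f x = (\<Sum>n. 3 ^ n * pochhammer (1 / 3) n * x ^ (3 * n) / fact (3 * n))"

definition airy_g :: "real \<Rightarrow> real" where
  "airy_g x = (\<Sum>n. 3 ^ n * pochhammer (2 / 3) n * x ^ (3 * n + 1) / fact (3 * n + 1))"

definition Airy_Ai :: "real \<Rightarrow> real" where
  "Airy_Ai x = airy_f x / (3 powr (2 / 3) * Gamma (2 / 3)) - airy_g x / (3 powr (1 / 3) * Gamma (1 / 3))"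

definition Airy_Bi :: "real \<Rightarrow> real" where
  "Airy_Bi x = sqrt 3 * (airy_f x / (3 powr (2 / 3) * Gamma (2 / 3))
                         + airy_g x / (3 powr (1 / 3) * Gamma (1 / 3)))"

section \<open>The classification list\<close>

datatype entry =
    C1_cos real                            \<comment> \<open>\<open>\<alpha>\<close>\<close>
  | C1_sqrt
  | C1_ln
  | C1_pow real real real                  \<comment> \<open>\<open>\<alpha>\<close>, \<open>a\<^sub>1\<close>, \<open>a\<^sub>2\<close>\<close>
  | C1p_Z real real real                   \<comment> \<open>\<open>\<beta>\<close>, \<open>a\<^sub>1\<close>, \<open>a\<^sub>2\<close>\<close>
  | C1p_Zt real real real                  \<comment> \<open>\<open>\<gamma>\<close>, \<open>a\<^sub>1\<close>, \<open>a\<^sub>2\<close>\<close>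
  | C1pp_C real real real                  \<comment> \<open>\<open>\<beta>\<close>, \<open>a\<^sub>1\<close>, \<open>a\<^sub>2\<close>\<close>
  | C1pp_Ct real real real                 \<comment> \<open>\<open>\<gamma>\<close>, \<open>a\<^sub>1\<close>, \<open>a\<^sub>2\<close>\<close>
  | C1a real complex real real             \<comment> \<open>\<open>\<kappa>\<close>, \<open>\<nu>\<close>, \<open>a\<^sub>1\<close>, \<open>a\<^sub>2\<close>\<close>
  | C1b real complex complex complex       \<comment> \<open>\<open>\<kappa>\<close>, \<open>\<nu>\<close>, \<open>a\<^sub>1\<close>, \<open>a\<^sub>2\<close>\<close>
  | C2_one
  | C2_id
  | C2p_cos
  | C2pp_exp
  | C2pp_cosh
  | C2pp_sinh
  | C2a real real real                     \<comment> \<open>\<open>\<kappa>\<close>, \<open>a\<^sub>1\<close>, \<open>a\<^sub>2\<close>\<close>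
  | C2b real complex complex               \<comment> \<open>\<open>\<kappa>\<close>, \<open>a\<^sub>1\<close>, \<open>a\<^sub>2\<close>\<close>
  | C2c real real                          \<comment> \<open>\<open>a\<^sub>1\<close>, \<open>a\<^sub>2\<close>\<close>

definition whit_comb_trig :: "real \<Rightarrow> complex \<Rightarrow> real \<Rightarrow> real \<Rightarrow> real \<Rightarrow> real" where
  "whit_comb_trig \<kappa> m a\<^sub>1 a\<^sub>2 x =
     \<bar>x\<bar> powr (- 1 / 2) *
     Re ((of_real a\<^sub>1 - of_real a\<^sub>2 * \<i>) * whittaker_W (- of_real \<kappa> * \<i> / 4) m (\<i> * (of_real x)\<^sup>2))"

definition whit_comb_exp :: "real \<Rightarrow> complex \<Rightarrow> complex \<Rightarrow> complex \<Rightarrow> real \<Rightarrow> complex" where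
  "whit_comb_exp \<kappa> m a\<^sub>1 a\<^sub>2 x =
     of_real (\<bar>x\<bar> powr (- 1 / 2)) *
     (a\<^sub>1 * whittaker_W (of_real \<kappa> / 4) m ((of_real x)\<^sup>2)
      + a\<^sub>2 * whittaker_W (- of_real \<kappa> / 4) m (- (of_real x)\<^sup>2))"

text \<open>
  Bessel functions are evaluated at \<open>\<bar>x\<bar>\<close>, since for noninteger order they are not real at
  negative arguments. For \<open>whit_comb_exp\<close>, \<open>Re\<close> is a mere coercion under \<open>valid_entry\<close>.
\<close>
fun W_of :: "entry \<Rightarrow> real \<Rightarrow> real" where
  "W_of (C1_cos \<alpha>) x = sqrt \<bar>x\<bar> * cos (\<alpha> * ln \<bar>x\<bar>)"
| "W_of C1_sqrt x = sqrt \<bar>x\<bar>"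
| "W_of C1_ln x = sqrt \<bar>x\<bar> * ln \<bar>x\<bar>"
| "W_of (C1_pow \<alpha> a\<^sub>1 a\<^sub>2) x = sqrt \<bar>x\<bar> * (a\<^sub>1 * \<bar>x\<bar> powr \<alpha> + a\<^sub>2 * \<bar>x\<bar> powr (- \<alpha>))"
| "W_of (C1p_Z \<beta> a\<^sub>1 a\<^sub>2) x = sqrt \<bar>x\<bar> * cyl_Z \<beta> a\<^sub>1 a\<^sub>2 \<bar>x\<bar>"
| "W_of (C1p_Zt \<gamma> a\<^sub>1 a\<^sub>2) x = sqrt \<bar>x\<bar> * cyl_Z_tilde \<gamma> a\<^sub>1 a\<^sub>2 \<bar>x\<bar>"
| "W_of (C1pp_C \<beta> a\<^sub>1 a\<^sub>2) x = sqrt \<bar>x\<bar> * cyl_C \<beta> a\<^sub>1 a\<^sub>2 \<bar>x\<bar>"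
| "W_of (C1pp_Ct \<gamma> a\<^sub>1 a\<^sub>2) x = sqrt \<bar>x\<bar> * cyl_C_tilde \<gamma> a\<^sub>1 a\<^sub>2 \<bar>x\<bar>"
| "W_of (C1a \<kappa> \<nu> a\<^sub>1 a\<^sub>2) x = whit_comb_trig \<kappa> (\<nu> / 2) a\<^sub>1 a\<^sub>2 x"
| "W_of (C1b \<kappa> \<nu> a\<^sub>1 a\<^sub>2) x = Re (whit_comb_exp \<kappa> (\<nu> / 2) a\<^sub>1 a\<^sub>2 x)"
| "W_of C2_one x = 1"
| "W_of C2_id x = x"
| "W_of C2p_cos x = cos x"
| "W_of C2pp_exp x = exp x"
| "W_of C2pp_cosh x = cosh x"
| "W_of C2pp_sinh x = sinh x"
| "W_of (C2a \<kappa> a\<^sub>1 a\<^sub>2) x = whit_comb_trig \<kappa> (1 / 4) a\<^sub>1 a\<^sub>2 x"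
| "W_of (C2b \<kappa> a\<^sub>1 a\<^sub>2) x = Re (whit_comb_exp \<kappa> (1 / 4) a\<^sub>1 a\<^sub>2 x)"
| "W_of (C2c a\<^sub>1 a\<^sub>2) x = a\<^sub>1 * Airy_Ai x + a\<^sub>2 * Airy_Bi x"

definition nu_range :: "complex \<Rightarrow> bool" where
  "nu_range \<nu> \<longleftrightarrow> (Im \<nu> = 0 \<and> Re \<nu> \<ge> 0) \<or> (Re \<nu> = 0 \<and> Im \<nu> > 0)"

text \<open>
  For \<open>C1_cos\<close> the value \<open>\<alpha> = 1/2\<close> is allowed: it gives \<open>W''/W = - 1/(2 x\<^sup>2)\<close>, a genuine extension
  not covered elsewhere; only for \<open>C1_pow\<close> does \<open>\<alpha> = 1/2\<close> reduce to \<open>W = 1\<close> or \<open>W = x\<close>.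

  The function \<open>W\<^bsub>-\<kappa>/4,m\<^esub>\<close> at the negative argument \<open>- x\<^sup>2\<close> is in general not real, so the
  coefficients in \<open>C1b\<close> and \<open>C2b\<close> are complex with the combination required to be real-valued;
  with real coefficients the real growing solutions of \<open>W'' = (x\<^sup>2 - \<kappa> + (\<nu>\<^sup>2 - 1/4)/x\<^sup>2) W\<close> would
  in general be missed.
\<close>
fun valid_entry :: "entry \<Rightarrow> bool" where
  "valid_entry (C1_cos \<alpha>) = (\<alpha> > 0)"
| "valid_entry (C1_pow \<alpha> a\<^sub>1 a\<^sub>2) = (\<alpha> > 0 \<and> \<alpha> \<noteq> 1 / 2 \<and> (a\<^sub>1, a\<^sub>2) \<noteq> (0, 0))"
| "valid_entry (C1p_Z \<beta> a\<^sub>1 a\<^sub>2) = (\<beta> \<ge> 0 \<and> \<beta> \<noteq> 1 / 2 \<and> (a\<^sub>1, a\<^sub>2) \<noteq> (0, 0))"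
| "valid_entry (C1p_Zt \<gamma> a\<^sub>1 a\<^sub>2) = (\<gamma> > 0 \<and> (a\<^sub>1, a\<^sub>2) \<noteq> (0, 0))"
| "valid_entry (C1pp_C \<beta> a\<^sub>1 a\<^sub>2) = (\<beta> \<ge> 0 \<and> \<beta> \<noteq> 1 / 2 \<and> (a\<^sub>1, a\<^sub>2) \<noteq> (0, 0))"
| "valid_entry (C1pp_Ct \<gamma> a\<^sub>1 a\<^sub>2) = (\<gamma> > 0 \<and> (a\<^sub>1, a\<^sub>2) \<noteq> (0, 0))"
| "valid_entry (C1a \<kappa> \<nu> a\<^sub>1 a\<^sub>2) = (nu_range \<nu> \<and> \<nu> \<noteq> 1 / 2 \<and> (a\<^sub>1, a\<^sub>2) \<noteq> (0, 0))"
| "valid_entry (C1b \<kappa> \<nu> a\<^sub>1 a\<^sub>2) = (nu_range \<nu> \<and> \<nu> \<noteq> 1 / 2 \<and> (a\<^sub>1, a\<^sub>2) \<noteq> (0, 0) \<and>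
                                     (\<forall>x. x \<noteq> 0 \<longrightarrow> whit_comb_exp \<kappa> (\<nu> / 2) a\<^sub>1 a\<^sub>2 x \<in> \<real>))"
| "valid_entry (C2a \<kappa> a\<^sub>1 a\<^sub>2) = ((a\<^sub>1, a\<^sub>2) \<noteq> (0, 0))"
| "valid_entry (C2b \<kappa> a\<^sub>1 a\<^sub>2) = ((a\<^sub>1, a\<^sub>2) \<noteq> (0, 0) \<and>
                                   (\<forall>x. x \<noteq> 0 \<longrightarrow> whit_comb_exp \<kappa> (1 / 4) a\<^sub>1 a\<^sub>2 x \<in> \<real>))"
| "valid_entry (C2c a\<^sub>1 a\<^sub>2) = ((a\<^sub>1, a\<^sub>2) \<noteq> (0, 0))"
| "valid_entry _ = True"

text \<open>
  Every \<open>W\<close> that involves \<open>\<bar>x\<bar>\<close> is \<open>0\<close> at \<open>x = 0\<close>, so the last conjunct also keeps \<open>I\<close>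
  away from the singular point.
\<close>
definition listed :: "entry \<Rightarrow> real set \<Rightarrow> bool" where
  "listed e I \<longleftrightarrow> valid_entry e \<and> open_interval I \<and> (\<forall>x\<in>I. W_of e x \<noteq> 0)"

definition B_of :: "real \<Rightarrow> entry \<Rightarrow> real \<Rightarrow> real" where
  "B_of \<epsilon> e x = 2 * \<epsilon> * deriv (W_of e) x / W_of e x"

subsection \<open>The basis fields\<close>

definition vf_dt :: vfield where
  "vf_dt = (\<lambda>(t, x, u). (1, 0, 0))"

definition vf_udu :: vfield where
  "vf_udu = (\<lambda>(t, x, u). (0, 0, u))"

definition vf_D :: "real \<Rightarrow> (real \<Rightarrow> real) \<Rightarrow> real \<Rightarrow> (real \<Rightarrow> real) \<Rightarrow> vfield" where
  "vf_D \<epsilon> B \<kappa> f = (\<lambda>(t, x, u).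
     (f t, 1 / 2 * deriv f t * x,
      - \<epsilon> * (1 / 8 * deriv (deriv f) t * x\<^sup>2 + 1 / 4 * \<epsilon> * deriv f t - \<kappa> * f t
             + 1 / 4 * deriv f t * x * B x) * u))"

definition vf_P :: "real \<Rightarrow> (real \<Rightarrow> real) \<Rightarrow> (real \<Rightarrow> real) \<Rightarrow> vfield" where
  "vf_P \<epsilon> B f = (\<lambda>(t, x, u). (0, f t, - 1 / 2 * \<epsilon> * (deriv f t * x + f t * B x) * u))"

definition antideriv :: "(real \<Rightarrow> real) \<Rightarrow> real \<Rightarrow> real" where
  "antideriv f = (SOME F. \<forall>t. (F has_real_derivative f t) (at t))"

definition vf_Pbar :: "real \<Rightarrow> (real \<Rightarrow> real) \<Rightarrow> (real \<Rightarrow> real) \<Rightarrow> vfield" where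
  "vf_Pbar \<epsilon> B f = (\<lambda>(t, x, u). vf_P \<epsilon> B f (t, x, u) - (0, 0, \<epsilon> * antideriv f t * u))"

fun fields :: "real \<Rightarrow> (real \<Rightarrow> real) \<Rightarrow> entry \<Rightarrow> vfield list" where
  "fields \<epsilon> B (C1_cos _) = [vf_D \<epsilon> B 0 (\<lambda>t. t), vf_D \<epsilon> B 0 (\<lambda>t. t\<^sup>2)]"
| "fields \<epsilon> B C1_sqrt = [vf_D \<epsilon> B 0 (\<lambda>t. t), vf_D \<epsilon> B 0 (\<lambda>t. t\<^sup>2)]"
| "fields \<epsilon> B C1_ln = [vf_D \<epsilon> B 0 (\<lambda>t. t), vf_D \<epsilon> B 0 (\<lambda>t. t\<^sup>2)]"
| "fields \<epsilon> B (C1_pow _ _ _) = [vf_D \<epsilon> B 0 (\<lambda>t. t), vf_D \<epsilon> B 0 (\<lambda>t. t\<^sup>2)]"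
| "fields \<epsilon> B (C1p_Z _ _ _) = [vf_D \<epsilon> B 1 (\<lambda>t. t), vf_D \<epsilon> B 1 (\<lambda>t. t\<^sup>2)]"
| "fields \<epsilon> B (C1p_Zt _ _ _) = [vf_D \<epsilon> B 1 (\<lambda>t. t), vf_D \<epsilon> B 1 (\<lambda>t. t\<^sup>2)]"
| "fields \<epsilon> B (C1pp_C _ _ _) = [vf_D \<epsilon> B (- 1) (\<lambda>t. t), vf_D \<epsilon> B (- 1) (\<lambda>t. t\<^sup>2)]"
| "fields \<epsilon> B (C1pp_Ct _ _ _) = [vf_D \<epsilon> B (- 1) (\<lambda>t. t), vf_D \<epsilon> B (- 1) (\<lambda>t. t\<^sup>2)]"
| "fields \<epsilon> B (C1a \<kappa> _ _ _) = [vf_D \<epsilon> B \<kappa> (\<lambda>t. cos (4 * t)), vf_D \<epsilon> B \<kappa> (\<lambda>t. sin (4 * t))]"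
| "fields \<epsilon> B (C1b \<kappa> _ _ _) = [vf_D \<epsilon> B \<kappa> (\<lambda>t. exp (4 * t)), vf_D \<epsilon> B \<kappa> (\<lambda>t. exp (- 4 * t))]"
| "fields \<epsilon> B C2_one =
     [vf_P \<epsilon> B (\<lambda>t. 1), vf_P \<epsilon> B (\<lambda>t. t), vf_D \<epsilon> B 0 (\<lambda>t. t), vf_D \<epsilon> B 0 (\<lambda>t. t\<^sup>2)]"
| "fields \<epsilon> B C2_id =
     [vf_P \<epsilon> B (\<lambda>t. 1), vf_P \<epsilon> B (\<lambda>t. t), vf_D \<epsilon> B 0 (\<lambda>t. t), vf_D \<epsilon> B 0 (\<lambda>t. t\<^sup>2)]"
| "fields \<epsilon> B C2p_cos =
     [vf_P \<epsilon> B (\<lambda>t. 1), vf_P \<epsilon> B (\<lambda>t. t), vf_D \<epsilon> B 1 (\<lambda>t. t), vf_D \<epsilon> B 1 (\<lambda>t. t\<^sup>2)]"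
| "fields \<epsilon> B C2pp_exp =
     [vf_P \<epsilon> B (\<lambda>t. 1), vf_P \<epsilon> B (\<lambda>t. t), vf_D \<epsilon> B (- 1) (\<lambda>t. t), vf_D \<epsilon> B (- 1) (\<lambda>t. t\<^sup>2)]"
| "fields \<epsilon> B C2pp_cosh =
     [vf_P \<epsilon> B (\<lambda>t. 1), vf_P \<epsilon> B (\<lambda>t. t), vf_D \<epsilon> B (- 1) (\<lambda>t. t), vf_D \<epsilon> B (- 1) (\<lambda>t. t\<^sup>2)]"
| "fields \<epsilon> B C2pp_sinh =
     [vf_P \<epsilon> B (\<lambda>t. 1), vf_P \<epsilon> B (\<lambda>t. t), vf_D \<epsilon> B (- 1) (\<lambda>t. t), vf_D \<epsilon> B (- 1) (\<lambda>t. t\<^sup>2)]"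
| "fields \<epsilon> B (C2a \<kappa> _ _) =
     [vf_P \<epsilon> B (\<lambda>t. sin (2 * t)), vf_P \<epsilon> B (\<lambda>t. cos (2 * t)),
      vf_D \<epsilon> B \<kappa> (\<lambda>t. cos (4 * t)), vf_D \<epsilon> B \<kappa> (\<lambda>t. sin (4 * t))]"
| "fields \<epsilon> B (C2b \<kappa> _ _) =
     [vf_P \<epsilon> B (\<lambda>t. exp (2 * t)), vf_P \<epsilon> B (\<lambda>t. exp (- 2 * t)),
      vf_D \<epsilon> B \<kappa> (\<lambda>t. exp (4 * t)), vf_D \<epsilon> B \<kappa> (\<lambda>t. exp (- 4 * t))]"
| "fields \<epsilon> B (C2c _ _) =
     [vf_Pbar \<epsilon> B (\<lambda>t. 1), vf_Pbar \<epsilon> B (\<lambda>t. t),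
      (\<lambda>p. vf_D \<epsilon> B 0 (\<lambda>t. t) p + (3 / 2) *\<^sub>R vf_Pbar \<epsilon> B (\<lambda>t. t\<^sup>2) p),
      (\<lambda>p. vf_D \<epsilon> B 0 (\<lambda>t. t\<^sup>2) p + vf_Pbar \<epsilon> B (\<lambda>t. t ^ 3) p)]"

subsection \<open>Identification of list entries\<close>

definition proportional :: "'a::field \<Rightarrow> 'a \<Rightarrow> 'a \<Rightarrow> 'a \<Rightarrow> bool" where
  "proportional a\<^sub>1 a\<^sub>2 b\<^sub>1 b\<^sub>2 \<longleftrightarrow> (\<exists>c. c \<noteq> 0 \<and> b\<^sub>1 = c * a\<^sub>1 \<and> b\<^sub>2 = c * a\<^sub>2)"

text \<open>
  Two entries of the list are the same if they agree up to a nonzero multiplier of \<open>(a\<^sub>1, a\<^sub>2)\<close>.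
  In \<open>C1_pow\<close> the scalings \<open>x \<mapsto> k x\<close> also change the ratio of \<open>a\<^sub>1\<close> and \<open>a\<^sub>2\<close>, so that there
  they have to be factored out as well.
\<close>
fun same_entry :: "entry \<Rightarrow> entry \<Rightarrow> bool" where
  "same_entry (C1_cos \<alpha>) e = (e = C1_cos \<alpha>)"
| "same_entry C1_sqrt e = (e = C1_sqrt)"
| "same_entry C1_ln e = (e = C1_ln)"
| "same_entry (C1_pow \<alpha> a\<^sub>1 a\<^sub>2) e =
     (\<exists>k b\<^sub>1 b\<^sub>2. k > 0 \<and> e = C1_pow \<alpha> b\<^sub>1 b\<^sub>2 \<and>
        proportional (a\<^sub>1 * k powr \<alpha>) (a\<^sub>2 * k powr (- \<alpha>)) b\<^sub>1 b\<^sub>2)"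
| "same_entry (C1p_Z \<beta> a\<^sub>1 a\<^sub>2) e =
     (\<exists>b\<^sub>1 b\<^sub>2. e = C1p_Z \<beta> b\<^sub>1 b\<^sub>2 \<and> proportional a\<^sub>1 a\<^sub>2 b\<^sub>1 b\<^sub>2)"
| "same_entry (C1p_Zt \<gamma> a\<^sub>1 a\<^sub>2) e =
     (\<exists>b\<^sub>1 b\<^sub>2. e = C1p_Zt \<gamma> b\<^sub>1 b\<^sub>2 \<and> proportional a\<^sub>1 a\<^sub>2 b\<^sub>1 b\<^sub>2)"
| "same_entry (C1pp_C \<beta> a\<^sub>1 a\<^sub>2) e =
     (\<exists>b\<^sub>1 b\<^sub>2. e = C1pp_C \<beta> b\<^sub>1 b\<^sub>2 \<and> proportional a\<^sub>1 a\<^sub>2 b\<^sub>1 b\<^sub>2)"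
| "same_entry (C1pp_Ct \<gamma> a\<^sub>1 a\<^sub>2) e =
     (\<exists>b\<^sub>1 b\<^sub>2. e = C1pp_Ct \<gamma> b\<^sub>1 b\<^sub>2 \<and> proportional a\<^sub>1 a\<^sub>2 b\<^sub>1 b\<^sub>2)"
| "same_entry (C1a \<kappa> \<nu> a\<^sub>1 a\<^sub>2) e =
     (\<exists>b\<^sub>1 b\<^sub>2. e = C1a \<kappa> \<nu> b\<^sub>1 b\<^sub>2 \<and> proportional a\<^sub>1 a\<^sub>2 b\<^sub>1 b\<^sub>2)"
| "same_entry (C1b \<kappa> \<nu> a\<^sub>1 a\<^sub>2) e =
     (\<exists>b\<^sub>1 b\<^sub>2. e = C1b \<kappa> \<nu> b\<^sub>1 b\<^sub>2 \<and> proportional a\<^sub>1 a\<^sub>2 b\<^sub>1 b\<^sub>2)"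
| "same_entry C2_one e = (e = C2_one)"
| "same_entry C2_id e = (e = C2_id)"
| "same_entry C2p_cos e = (e = C2p_cos)"
| "same_entry C2pp_exp e = (e = C2pp_exp)"
| "same_entry C2pp_cosh e = (e = C2pp_cosh)"
| "same_entry C2pp_sinh e = (e = C2pp_sinh)"
| "same_entry (C2a \<kappa> a\<^sub>1 a\<^sub>2) e =
     (\<exists>b\<^sub>1 b\<^sub>2. e = C2a \<kappa> b\<^sub>1 b\<^sub>2 \<and> proportional a\<^sub>1 a\<^sub>2 b\<^sub>1 b\<^sub>2)"
| "same_entry (C2b \<kappa> a\<^sub>1 a\<^sub>2) e =
     (\<exists>b\<^sub>1 b\<^sub>2. e = C2b \<kappa> b\<^sub>1 b\<^sub>2 \<and> proportional a\<^sub>1 a\<^sub>2 b\<^sub>1 b\<^sub>2)"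
| "same_entry (C2c a\<^sub>1 a\<^sub>2) e =
     (\<exists>b\<^sub>1 b\<^sub>2. e = C2c b\<^sub>1 b\<^sub>2 \<and> proportional a\<^sub>1 a\<^sub>2 b\<^sub>1 b\<^sub>2)"

end

(*
  After the gauge X' = |A|^(-1/2) one has A = s = +-1, and B = 2 s W'/W with W'' = q W for the
  potential q = B^2/4 + s B'/2. An essential symmetry is then determined by three functions
  tau, sigma, phi of t, subject to the single condition
    tau' (x q' + 2 q) + 2 sigma q' = tau''' x^2/4 + sigma'' x - 2 s phi' - s tau''/2.
  A solution with (tau', sigma) nonzero forces q = a y^2 + b y + r + e/y^2 in a shifted variable
  y = x - x0, with b = 0 unless e = 0. Completing squares and rescaling gives a short list of
  model potentials; the listed W are the solutions of W'' = q W for them (Bessel, Whittaker,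
  Airy and elementary functions). For each model potential the condition splits into linear
  equations with constant coefficients for tau and sigma, whose solutions are the listed fields.
  Equivalence rescales q, and the solution space of W'' = q W being two-dimensional, it can only
  identify entries with the same potential and proportional coefficients.
*)
theory Submission
  imports Defs "HOL-Complex_Analysis.Complex_Analysis"
begin

text \<open>The listed \<open>W\<close> are given by power series and by limits in the order, so the
  analytic obstacle is to show, also at integer orders, that they solve their equations and span the
  solutions. Bessel and Whittaker functions are treated as one family \<open>HH b c \<nu>\<close>
  (\<open>c = 0\<close> and \<open>c = 1\<close>), entire in the order and in the logarithm
  \<open>L\<close> of the argument; a rotation of the argument, as from \<open>x\<^sup>2\<close> to
  \<open>- x\<^sup>2\<close>, is then a shift of \<open>L\<close>. Wronskians of \<open>HH\<close>
  are read off as \<open>exp L\<close> tends to 0. The connection formulas become quotients by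
  \<open>sin (pi * \<nu>)\<close> whose numerators vanish at integer orders. The limit stays a
  solution because it is a Cauchy mean over a circle of orders, and its Wronskian is the constant
  one of the neighbouring orders. Independence then serves twice: it represents an arbitrary
  nonvanishing solution by a listed function, and it turns equality of two listed functions on an
  interval into equality of their coefficients.\<close>

section \<open>Calculus of \<open>C_k_on\<close> and \<open>smooth_on\<close> on open sets\<close>

lemma frechet_derivative_cong_open:
  assumes "open S" "p \<in> S" "\<And>p. p \<in> S \<Longrightarrow> f p = g p"
  shows "f differentiable (at p) \<longleftrightarrow> g differentiable (at p)"
    and "frechet_derivative f (at p) = frechet_derivative g (at p)"
proof -
  have *: "(f has_derivative D) (at p) \<longleftrightarrow> (g has_derivative D) (at p)" for D
    using assms by (metis has_derivative_transform_within_open)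
  show "f differentiable (at p) \<longleftrightarrow> g differentiable (at p)"
    unfolding differentiable_def * ..
  show "frechet_derivative f (at p) = frechet_derivative g (at p)"
    unfolding frechet_derivative_def * ..
qed

lemma C_k_on_cong:
  assumes "open S" "\<And>p. p \<in> S \<Longrightarrow> f p = g p"
  shows "C_k_on k S f \<longleftrightarrow> C_k_on k S g"
  using assms(2)
proof (induction k arbitrary: f g)
  case 0
  then show ?case by (auto intro: continuous_on_cong)
next
  case (Suc k)
  have "C_k_on k S (\<lambda>p. frechet_derivative f (at p) v) = C_k_on k S (\<lambda>p. frechet_derivative g (at p) v)" for v
    by (rule Suc.IH) (use frechet_derivative_cong_open(2)[OF assms(1) _ Suc.prems] in auto)
  then show ?case
    using frechet_derivative_cong_open(1)[OF assms(1) _ Suc.prems] by auto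
qed

text \<open>\<open>frechet_derivative\<close> is a choice operator. This rule lets a proof name the
  derivative \<open>f'\<close> itself; uniqueness of derivatives and the congruence on the open set
  then replace the choice.\<close>

lemma C_k_on_Suc_I:
  assumes "open S" "\<And>p. p \<in> S \<Longrightarrow> (f has_derivative f' p) (at p)"
    and "\<And>v. C_k_on k S (\<lambda>p. f' p v)"
  shows "C_k_on (Suc k) S f"
proof -
  have "C_k_on k S (\<lambda>p. frechet_derivative f (at p) v)" for v
    using C_k_on_cong[OF assms(1), of "\<lambda>p. frechet_derivative f (at p) v" "\<lambda>p. f' p v"]
      assms frechet_derivative_at by metis
  then show ?thesis using assms(2) by (auto simp: differentiable_def)
qed

lemma C_k_on_Suc_D: "C_k_on (Suc k) S f \<Longrightarrow> C_k_on k S f"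
proof (induction k arbitrary: f)
  case 0
  then show ?case
    by (simp add: continuous_at_imp_continuous_on differentiable_imp_continuous_within)
next
  case (Suc k)
  then show ?case by simp
qed

lemma C_k_on_subset: "C_k_on k S f \<Longrightarrow> U \<subseteq> S \<Longrightarrow> C_k_on k U f"
  by (induction k arbitrary: f) (auto intro: continuous_on_subset)

lemma C_k_on_differentiable:
  "C_k_on (Suc k) S f \<Longrightarrow> p \<in> S \<Longrightarrow> (f has_derivative frechet_derivative f (at p)) (at p)"
  by (simp add: frechet_derivative_works)

lemma C_k_on_const [simp]: "C_k_on k S (\<lambda>p. c)"
  by (induction k arbitrary: c) auto

lemma C_k_on_linear_comp:
  assumes "open S" "bounded_linear h" "C_k_on k S f"
  shows "C_k_on k S (\<lambda>p. h (f p))"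
  using assms(3)
proof (induction k arbitrary: f)
  case 0
  then show ?case using assms(2) by (simp add: bounded_linear.continuous_on)
next
  case (Suc k)
  show ?case
  proof (rule C_k_on_Suc_I[OF assms(1)])
    show "((\<lambda>p. h (f p)) has_derivative (\<lambda>v. h (frechet_derivative f (at p) v))) (at p)" if "p \<in> S" for p
      using C_k_on_differentiable[OF Suc.prems that] bounded_linear.has_derivative[OF assms(2)] by blast
  qed (use Suc in auto)
qed

lemma C_k_on_add:
  assumes "open S" "C_k_on k S f" "C_k_on k S g"
  shows "C_k_on k S (\<lambda>p. f p + g p)"
  using assms(2,3)
proof (induction k arbitrary: f g)
  case 0
  then show ?case by (simp add: continuous_on_add)
next
  case (Suc k)
  show ?case
    by (rule C_k_on_Suc_I[OF assms(1) has_derivative_add[OF C_k_on_differentiable[OF Suc.prems(1)]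
            C_k_on_differentiable[OF Suc.prems(2)]]])
      (use Suc in auto)
qed

lemma C_k_on_mult:
  fixes f g :: "'a::real_normed_vector \<Rightarrow> real"
  assumes "open S" "C_k_on k S f" "C_k_on k S g"
  shows "C_k_on k S (\<lambda>p. f p * g p)"
  using assms(2,3)
proof (induction k arbitrary: f g)
  case 0
  then show ?case by (simp add: continuous_on_mult)
next
  case (Suc k)
  have fg: "C_k_on k S f" "C_k_on k S g" using Suc.prems C_k_on_Suc_D by blast+
  show ?case
    by (rule C_k_on_Suc_I[OF assms(1) has_derivative_mult[OF C_k_on_differentiable[OF Suc.prems(1)]
            C_k_on_differentiable[OF Suc.prems(2)]]])
      (use Suc fg in \<open>auto intro!: C_k_on_add assms\<close>)
qed

lemma C_k_on_linear:
  assumes "bounded_linear h"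
  shows "C_k_on k S h"
proof (cases k)
  case 0
  then show ?thesis using assms by (simp add: linear_continuous_on)
next
  case (Suc j)
  have "frechet_derivative h (at p) = h" for p
    using frechet_derivative_at[OF bounded_linear_imp_has_derivative[OF assms]] by simp
  then show ?thesis
    using Suc assms by (auto simp: bounded_linear_imp_differentiable)
qed

text \<open>Serves to restrict a field to lines parallel to the axes and to lift functions of one
  variable to the space of \<open>(t, x, u)\<close>. The derivative is again a function composed
  with the same affine map, so the induction closes.\<close>

lemma C_k_on_affine_comp:
  assumes "open S" "open U" "bounded_linear l" "\<And>p. p \<in> U \<Longrightarrow> l p + c \<in> S" "C_k_on k S f"
  shows "C_k_on k U (\<lambda>p. f (l p + c))"
  using assms(5)
proof (induction k arbitrary: f)
  case 0
  show ?case
    using continuous_on_compose2[of S f U "\<lambda>p. l p + c"] 0 assms(4)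
      continuous_on_add[OF linear_continuous_on[OF assms(3)] continuous_on_const] by auto
next
  case (Suc k)
  show ?case
  proof (rule C_k_on_Suc_I[OF assms(2)])
    fix p assume "p \<in> U"
    have "((\<lambda>p. l p + c) has_derivative l) (at p)"
      using has_derivative_add[OF bounded_linear_imp_has_derivative[OF assms(3)] has_derivative_const[of c]]
      by simp
    then show "((\<lambda>p. f (l p + c)) has_derivative (\<lambda>v. frechet_derivative f (at (l p + c)) (l v))) (at p)"
      using has_derivative_compose C_k_on_differentiable[OF Suc.prems assms(4)[OF \<open>p \<in> U\<close>]] by blast
  qed (use Suc in auto)
qed

lemma smooth_on_cong: "open S \<Longrightarrow> (\<And>p. p \<in> S \<Longrightarrow> f p = g p) \<Longrightarrow> smooth_on S f \<longleftrightarrow> smooth_on S g"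
  unfolding smooth_on_def using C_k_on_cong by blast

lemma smooth_on_subset: "smooth_on S f \<Longrightarrow> U \<subseteq> S \<Longrightarrow> smooth_on U f"
  unfolding smooth_on_def using C_k_on_subset by blast

lemma smooth_on_const: "smooth_on S (\<lambda>p. c)"
  by (simp add: smooth_on_def)

lemma smooth_on_linear: "bounded_linear h \<Longrightarrow> smooth_on S h"
  by (simp add: smooth_on_def C_k_on_linear)

lemma smooth_on_id: "smooth_on S (\<lambda>p. p)"
  by (simp add: smooth_on_linear bounded_linear_ident)

lemma smooth_on_linear_comp:
  "open S \<Longrightarrow> bounded_linear h \<Longrightarrow> smooth_on S f \<Longrightarrow> smooth_on S (\<lambda>p. h (f p))"
  unfolding smooth_on_def using C_k_on_linear_comp by blast

lemma smooth_on_affine_comp: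
  "open S \<Longrightarrow> open U \<Longrightarrow> bounded_linear l \<Longrightarrow> (\<And>p. p \<in> U \<Longrightarrow> l p + c \<in> S) \<Longrightarrow> smooth_on S f \<Longrightarrow>
   smooth_on U (\<lambda>p. f (l p + c))"
  unfolding smooth_on_def using C_k_on_affine_comp by blast

lemma smooth_on_add: "open S \<Longrightarrow> smooth_on S f \<Longrightarrow> smooth_on S g \<Longrightarrow> smooth_on S (\<lambda>p. f p + g p)"
  unfolding smooth_on_def using C_k_on_add by blast

lemma smooth_on_mult:
  fixes f g :: "'a::real_normed_vector \<Rightarrow> real"
  shows "open S \<Longrightarrow> smooth_on S f \<Longrightarrow> smooth_on S g \<Longrightarrow> smooth_on S (\<lambda>p. f p * g p)"
  unfolding smooth_on_def using C_k_on_mult by blast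

lemma smooth_on_minus: "open S \<Longrightarrow> smooth_on S f \<Longrightarrow> smooth_on S (\<lambda>p. - f p)"
  using smooth_on_linear_comp[OF _ bounded_linear_minus[OF bounded_linear_ident]] by blast

lemma smooth_on_diff: "open S \<Longrightarrow> smooth_on S f \<Longrightarrow> smooth_on S g \<Longrightarrow> smooth_on S (\<lambda>p. f p - g p)"
  using smooth_on_add[of S f "\<lambda>p. - g p"] smooth_on_minus by auto

lemma smooth_on_power:
  fixes f :: "'a::real_normed_vector \<Rightarrow> real"
  shows "open S \<Longrightarrow> smooth_on S f \<Longrightarrow> smooth_on S (\<lambda>p. f p ^ n)"
  by (induction n) (auto intro: smooth_on_const smooth_on_mult)

lemma smooth_on_divide_const:
  fixes f :: "'a::real_normed_vector \<Rightarrow> real"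
  shows "open S \<Longrightarrow> smooth_on S f \<Longrightarrow> smooth_on S (\<lambda>p. f p / c)"
  using smooth_on_mult[OF _ _ smooth_on_const[of S "inverse c"]] by (simp add: divide_inverse)

lemma smooth_on_Pair:
  assumes "open S" "smooth_on S f" "smooth_on S g"
  shows "smooth_on S (\<lambda>p. (f p, g p))"
proof -
  have "smooth_on S (\<lambda>p. (f p, 0) + (0, g p))"
    using assms
    by (intro smooth_on_add smooth_on_linear_comp[of S "\<lambda>x. (x, 0)"] smooth_on_linear_comp[of S "\<lambda>x. (0, x)"]
        bounded_linear_Pair bounded_linear_ident bounded_linear_zero)
  then show ?thesis by simp
qed

lemma smooth_on_frechet: "smooth_on S f \<Longrightarrow> smooth_on S (\<lambda>p. frechet_derivative f (at p) v)"
  unfolding smooth_on_def by (metis C_k_on.simps(2))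

lemma smooth_on_differentiable: "smooth_on S f \<Longrightarrow> p \<in> S \<Longrightarrow> f differentiable (at p)"
  unfolding smooth_on_def by (metis C_k_on.simps(2))

lemma smooth_on_continuous: "smooth_on S f \<Longrightarrow> continuous_on S f"
  unfolding smooth_on_def by (metis C_k_on.simps(1))

lemma frechet_derivative_real:
  fixes f :: "real \<Rightarrow> real"
  assumes "(f has_real_derivative d) (at x)"
  shows "frechet_derivative f (at x) v = d * v"
  using frechet_derivative_at[OF assms[unfolded has_field_derivative_def]] by metis

lemma smooth_on_DERIV:
  fixes f :: "real \<Rightarrow> real"
  assumes "smooth_on S f" "x \<in> S"
  shows "(f has_real_derivative deriv f x) (at x)"
  using smooth_on_differentiable[OF assms] by (simp add: DERIV_deriv_iff_real_differentiable)

lemma smooth_on_deriv: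
  fixes f :: "real \<Rightarrow> real"
  assumes "open S" "smooth_on S f"
  shows "smooth_on S (deriv f)"
proof -
  have "smooth_on S (\<lambda>p. frechet_derivative f (at p) 1)" using assms by (simp add: smooth_on_frechet)
  then show ?thesis
    using smooth_on_cong[OF assms(1), of "\<lambda>p. frechet_derivative f (at p) 1" "deriv f"]
      frechet_derivative_real[OF smooth_on_DERIV[OF assms(2)]] by simp
qed

lemma C_k_on_real_Suc:
  fixes f :: "real \<Rightarrow> real"
  assumes "open S" "\<And>x. x \<in> S \<Longrightarrow> (f has_real_derivative f' x) (at x)" "C_k_on k S f'"
  shows "C_k_on (Suc k) S f"
  by (rule C_k_on_Suc_I[OF assms(1) assms(2)[unfolded has_field_derivative_def]])
    (use assms C_k_on_mult C_k_on_const in blast)+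

text \<open>Bootstrapping for solutions of first-order equations: regularity of \<open>f\<close>
  passes to its derivative \<open>f'\<close>, which raises the regularity of \<open>f\<close> by one
  order.\<close>

lemma smooth_on_real_I:
  fixes f :: "real \<Rightarrow> real"
  assumes "open S" "\<And>x. x \<in> S \<Longrightarrow> (f has_real_derivative f' x) (at x)"
    and "\<And>k. C_k_on k S f \<Longrightarrow> C_k_on k S f'"
  shows "smooth_on S f"
proof -
  have "C_k_on k S f" for k
  proof (induction k)
    case 0
    then show ?case
      using assms(2) by (auto intro!: DERIV_continuous_on intro: has_field_derivative_at_within)
  next
    case (Suc k)
    show ?case by (rule C_k_on_real_Suc[OF assms(1,2) assms(3)[OF Suc]])
  qed
  then show ?thesis by (simp add: smooth_on_def)
qed

lemma smooth_on_inverse: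
  fixes f :: "real \<Rightarrow> real"
  assumes "open S" "smooth_on S f" "\<And>x. x \<in> S \<Longrightarrow> f x \<noteq> 0"
  shows "smooth_on S (\<lambda>x. inverse (f x))"
proof (rule smooth_on_real_I[OF assms(1)])
  show "((\<lambda>x. inverse (f x)) has_real_derivative - deriv f x * (inverse (f x) * inverse (f x))) (at x)"
    if "x \<in> S" for x
    using DERIV_inverse_fun[OF smooth_on_DERIV[OF assms(2) that] assms(3)[OF that]] by (simp add: power2_eq_square)
  show "C_k_on k S (\<lambda>x. - deriv f x * (inverse (f x) * inverse (f x)))"
    if "C_k_on k S (\<lambda>x. inverse (f x))" for k
    using that smooth_on_minus[OF assms(1) smooth_on_deriv[OF assms(1,2)]]
    by (intro C_k_on_mult) (auto simp: assms smooth_on_def)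
qed

lemma smooth_on_real_power_comp:
  fixes f :: "real \<Rightarrow> real"
  assumes "open S" "smooth_on S f" "\<And>x. x \<in> S \<Longrightarrow> f x > 0"
  shows "smooth_on S (\<lambda>x. f x powr a)"
proof (rule smooth_on_real_I[OF assms(1)])
  show "((\<lambda>x. f x powr a) has_real_derivative (a * deriv f x * inverse (f x)) * f x powr a) (at x)"
    if "x \<in> S" for x
    using smooth_on_DERIV[OF assms(2) that] assms(3)[OF that]
    by (auto intro!: derivative_eq_intros simp: field_simps powr_diff)
  show "C_k_on k S (\<lambda>x. (a * deriv f x * inverse (f x)) * f x powr a)"
    if "C_k_on k S (\<lambda>x. f x powr a)" for k
  proof -
    have "smooth_on S (\<lambda>x. a * deriv f x * inverse (f x))"
      using assms by (intro smooth_on_mult smooth_on_const smooth_on_deriv smooth_on_inverse)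
        (auto simp: less_imp_neq[symmetric])
    then show ?thesis using that C_k_on_mult[OF assms(1)] unfolding smooth_on_def by blast
  qed
qed

lemmas smooth_on_intros = smooth_on_const smooth_on_id smooth_on_add smooth_on_diff smooth_on_minus
  smooth_on_mult smooth_on_power smooth_on_divide_const smooth_on_deriv

section \<open>One hypergeometric series for Bessel, Whittaker and Airy functions\<close>

text \<open>For \<open>c = 1\<close> the series is Kummer's function 1F1(a; \<nu> + 1; w) divided by
  Gamma(\<nu> + 1); for \<open>c = 0\<close> it is 0F1(; \<nu> + 1; a w) with the same factor. With
  \<open>rGamma\<close> inside the coefficients they are entire in \<nu>, so the poles at
  nonpositive integer values of \<nu> + 1 never appear.\<close>

definition hyp_coeff :: "complex \<Rightarrow> complex \<Rightarrow> complex \<Rightarrow> nat \<Rightarrow> complex" where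
  "hyp_coeff a c \<nu> n = (\<Prod>j<n. a + c * of_nat j) * rGamma (\<nu> + of_nat n + 1) / fact n"

definition hyp :: "complex \<Rightarrow> complex \<Rightarrow> complex \<Rightarrow> complex \<Rightarrow> complex" where
  "hyp a c \<nu> w = (\<Sum>n. hyp_coeff a c \<nu> n * w ^ n)"

lemma rGamma_rec: "rGamma (z::complex) = z * rGamma (z + 1)"
  by (simp add: rGamma_plus1)

lemma hyp_coeff_Suc:
  "hyp_coeff a c \<nu> n * (a + c * of_nat n) = of_nat (Suc n) * (\<nu> + of_nat n + 1) * hyp_coeff a c \<nu> (Suc n)"
proof -
  have "rGamma (\<nu> + of_nat n + 1) = (\<nu> + of_nat n + 1) * rGamma (\<nu> + of_nat (Suc n) + 1)"
    using rGamma_rec[of "\<nu> + of_nat n + 1"] by (simp add: algebra_simps)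
  then show ?thesis
    by (simp add: hyp_coeff_def field_simps del: of_nat_Suc)
qed

lemma hyp_coeff_shift: "of_nat (Suc n) * hyp_coeff a c \<nu> (Suc n) = a * hyp_coeff (a + c) c (\<nu> + 1) n"
proof -
  have "(\<Prod>j<Suc n. a + c * of_nat j) = a * (\<Prod>j<n. (a + c) + c * of_nat j)"
    by (subst prod.lessThan_Suc_shift) (simp add: algebra_simps)
  moreover have "\<nu> + of_nat (Suc n) + 1 = \<nu> + 1 + of_nat n + 1" by simp
  moreover have "of_nat (Suc n) * hyp_coeff a c \<nu> (Suc n) =
      (\<Prod>j<Suc n. a + c * of_nat j) * rGamma (\<nu> + of_nat (Suc n) + 1) / fact n"
    by (simp add: hyp_coeff_def del: of_nat_Suc prod.lessThan_Suc)
  ultimately show ?thesis by (simp only: hyp_coeff_def) simp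
qed

text \<open>Consecutive terms have ratio at most \<open>1/2\<close> from an index that depends on \<open>R\<close> only.\<close>
lemma hyp_term_bound:
  assumes "R \<ge> 1"
  obtains N where "\<And>a c \<nu> w n. norm a \<le> R \<Longrightarrow> norm c \<le> R \<Longrightarrow> norm \<nu> \<le> R \<Longrightarrow> norm w \<le> R \<Longrightarrow> n \<ge> N \<Longrightarrow>
     norm (hyp_coeff a c \<nu> n * w ^ n) \<le> norm (hyp_coeff a c \<nu> N * w ^ N) * (1/2) ^ (n - N)"
proof -
  \<comment> \<open>From this index on \<open>norm (\<nu> + n + 1)\<close> is at least
    \<open>(n + 1) / 2\<close>, the numerator of the ratio is at most
    \<open>R * (n + 1) * R\<close>, and \<open>4 * R * R\<close> is at most \<open>n + 1\<close>;
    together the ratio is at most \<open>1 / 2\<close>.\<close>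
  define N where "N = nat \<lceil>8 * R * R + 2 * R\<rceil>"
  have N: "real N \<ge> 8 * R * R + 2 * R" unfolding N_def by linarith
  have ratio: "norm (hyp_coeff a c \<nu> (Suc n) * w ^ Suc n) \<le> norm (hyp_coeff a c \<nu> n * w ^ n) * (1/2)"
    if b: "norm a \<le> R" "norm c \<le> R" "norm \<nu> \<le> R" "norm w \<le> R" and n: "n \<ge> N" for a c \<nu> w n
  proof -
    have nR: "real n \<ge> 8 * R * R + 2 * R" using N n by linarith
    have RR: "0 \<le> R * R" by simp
    have "norm (of_nat (Suc n) + \<nu>) \<ge> norm (of_nat (Suc n) :: complex) - norm \<nu>"
      by (rule norm_diff_ineq)
    moreover have "of_nat (Suc n) + \<nu> = \<nu> + of_nat n + 1" by simp
    moreover have "norm (of_nat (Suc n) :: complex) = real n + 1"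
      using norm_of_nat[of "Suc n", where 'a=complex] by (simp only: of_nat_Suc)
    ultimately have "norm (\<nu> + of_nat n + 1) \<ge> real n + 1 - norm \<nu>" by (simp only:)
    then have g: "norm (\<nu> + of_nat n + 1) \<ge> real (Suc n) / 2"
      proof -
      have X: "X \<ge> real (Suc n) / 2" if "X \<ge> real n + 1 - norm \<nu>" for X :: real
      proof -
        have "2 * R \<le> real n" using nR[unfolded mult.assoc] RR by linarith
        then show ?thesis using that b(3) by simp
      qed
      show ?thesis by (rule X) fact
    qed
    have "norm (a + c * of_nat n) \<le> R + R * real n"
      using b by (intro norm_triangle_le) (simp add: norm_mult add_mono mult_right_mono)
    then have f: "norm (a + c * of_nat n) * norm w \<le> (R * real (Suc n)) * R"
      using b assms by (intro mult_mono) (auto simp: algebra_simps)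
    have h: "4 * R * R \<le> real (Suc n)" using nR assms RR by simp
    have pos: "0 < real (Suc n) * (real (Suc n) / 2)" by simp
    have "real (Suc n) * norm (\<nu> + of_nat n + 1) * norm (hyp_coeff a c \<nu> (Suc n))
        = norm (hyp_coeff a c \<nu> n) * norm (a + c * of_nat n)"
      using arg_cong[OF hyp_coeff_Suc[of a c \<nu> n], of norm] by (simp only: norm_mult norm_of_nat)
    then have "real (Suc n) * norm (\<nu> + of_nat n + 1) * norm (hyp_coeff a c \<nu> (Suc n) * w ^ Suc n)
        = norm (hyp_coeff a c \<nu> n * w ^ n) * (norm (a + c * of_nat n) * norm w)"
      by (simp add: norm_mult norm_power mult_ac)
    also have "\<dots> \<le> norm (hyp_coeff a c \<nu> n * w ^ n) * ((R * real (Suc n)) * R)"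
      by (rule mult_left_mono[OF f]) simp
    also have "\<dots> \<le> norm (hyp_coeff a c \<nu> n * w ^ n) * (real (Suc n) * real (Suc n) / 4)"
      by (rule mult_left_mono) (use mult_right_mono[OF h, of "real (Suc n)"] in \<open>simp_all add: mult_ac del: of_nat_Suc\<close>)
    finally have 1: "real (Suc n) * norm (\<nu> + of_nat n + 1) * norm (hyp_coeff a c \<nu> (Suc n) * w ^ Suc n)
      \<le> real (Suc n) * (real (Suc n) / 2) * (norm (hyp_coeff a c \<nu> n * w ^ n) * (1/2))"
      by (simp add: algebra_simps)
    have "real (Suc n) * (real (Suc n) / 2) * norm (hyp_coeff a c \<nu> (Suc n) * w ^ Suc n)
      \<le> real (Suc n) * norm (\<nu> + of_nat n + 1) * norm (hyp_coeff a c \<nu> (Suc n) * w ^ Suc n)"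
      using g by (intro mult_right_mono mult_left_mono) auto
    from order_trans[OF this 1] show ?thesis using pos mult_le_cancel_left_pos by blast
  qed
  have "norm (hyp_coeff a c \<nu> n * w ^ n) \<le> norm (hyp_coeff a c \<nu> N * w ^ N) * (1/2) ^ (n - N)"
    if b: "norm a \<le> R" "norm c \<le> R" "norm \<nu> \<le> R" "norm w \<le> R" and n: "n \<ge> N" for a c \<nu> w n
    using n
  proof (induction n rule: dec_induct)
    case base
    then show ?case by simp
  next
    case (step n)
    have "norm (hyp_coeff a c \<nu> n * w ^ n) * (1/2) \<le> norm (hyp_coeff a c \<nu> N * w ^ N) * (1/2) ^ (Suc n - N)"
      using step by (simp add: Suc_diff_le)
    with ratio[OF b step(1)] show ?case by linarith
  qed
  then show ?thesis using that by blast
qed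

lemma hyp_summable: "summable (\<lambda>n. hyp_coeff a c \<nu> n * w ^ n)"
proof -
  define R where "R = 1 + norm a + norm c + norm \<nu> + norm w"
  obtain N where N: "\<And>n. n \<ge> N \<Longrightarrow>
     norm (hyp_coeff a c \<nu> n * w ^ n) \<le> norm (hyp_coeff a c \<nu> N * w ^ N) * (1/2) ^ (n - N)"
  proof -
    have R: "R \<ge> 1" "norm a \<le> R" "norm c \<le> R" "norm \<nu> \<le> R" "norm w \<le> R"
      by (auto simp: R_def add_nonneg_nonneg)
    show ?thesis
      by (rule hyp_term_bound[OF R(1)]) (use R that in blast)
  qed
  have "summable (\<lambda>n. norm (hyp_coeff a c \<nu> N * w ^ N) * (1/2) ^ n)"
    by (intro summable_mult summable_geometric) simp
  then have "summable (\<lambda>n. norm (hyp_coeff a c \<nu> N * w ^ N) * (1/2) ^ (n - N))"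
    by (subst summable_iff_shift[of _ N, symmetric]) simp
  then show ?thesis by (rule summable_comparison_test'[of _ N]) (use N in auto)
qed

lemma hyp_has_field_derivative:
  "((hyp a c \<nu>) has_field_derivative a * hyp (a + c) c (\<nu> + 1) w) (at w)"
proof -
  have "((\<lambda>w. \<Sum>n. hyp_coeff a c \<nu> n * w ^ n) has_field_derivative
      (\<Sum>n. diffs (hyp_coeff a c \<nu>) n * w ^ n)) (at w)"
    by (rule termdiffs_strong_converges_everywhere) (rule hyp_summable)
  moreover have "(\<Sum>n. diffs (hyp_coeff a c \<nu>) n * w ^ n) = a * hyp (a + c) c (\<nu> + 1) w"
    unfolding hyp_def diffs_def hyp_coeff_shift
    by (simp only: mult.assoc) (rule suminf_mult[OF hyp_summable])
  ultimately show ?thesis unfolding hyp_def by simp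
qed

lemma hyp_0: "hyp a c \<nu> 0 = rGamma (\<nu> + 1)"
  unfolding hyp_def by (subst powser_zero) (simp add: hyp_coeff_def)

text \<open>Kummer's equation \<open>w y'' + (\<nu> + 1 - c w) y' = a y\<close>, with both
  derivatives expressed by raised parameters and the common factor \<open>a\<close> cancelled.
  Comparison of coefficients yields this cancelled form directly, and it covers
  \<open>a = 0\<close>.\<close>

lemma hyp_ode:
  "w * (a + c) * hyp (a + c + c) c (\<nu> + 2) w + (\<nu> + 1 - c * w) * hyp (a + c) c (\<nu> + 1) w
     = hyp a c \<nu> w"
proof -
  let ?d = "hyp_coeff (a + c) c (\<nu> + 1)"
  have s1: "(\<lambda>n. of_nat n * ?d n * w ^ n) sums (w * ((a + c) * hyp (a + c + c) c (\<nu> + 2) w))"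
  proof -
    have "(\<lambda>n. (a + c) * (hyp_coeff (a + c + c) c (\<nu> + 1 + 1) n * w ^ n)) sums
        ((a + c) * hyp (a + c + c) c (\<nu> + 1 + 1) w)"
      unfolding hyp_def by (intro sums_mult summable_sums hyp_summable)
    then have "(\<lambda>n. w * ((a + c) * (hyp_coeff (a + c + c) c (\<nu> + 1 + 1) n * w ^ n))) sums
        (w * ((a + c) * hyp (a + c + c) c (\<nu> + 1 + 1) w))" by (rule sums_mult)
    moreover have "(\<lambda>n. w * ((a + c) * (hyp_coeff (a + c + c) c (\<nu> + 1 + 1) n * w ^ n))) =
        (\<lambda>n. of_nat (Suc n) * ?d (Suc n) * w ^ Suc n)"
      unfolding hyp_coeff_shift by (intro ext) simp
    moreover have "\<nu> + 1 + 1 = \<nu> + 2" by simp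
    ultimately have "(\<lambda>n. of_nat (Suc n) * ?d (Suc n) * w ^ Suc n) sums
        (w * ((a + c) * hyp (a + c + c) c (\<nu> + 2) w))" by (simp only:)
    from sums_Suc[OF this] show ?thesis by simp
  qed
  have s2: "(\<lambda>n. ?d n * w ^ n) sums hyp (a + c) c (\<nu> + 1) w"
    unfolding hyp_def by (intro summable_sums hyp_summable)
  have s3: "(\<lambda>n. hyp_coeff a c \<nu> n * w ^ n) sums hyp a c \<nu> w"
    unfolding hyp_def by (intro summable_sums hyp_summable)
  \<comment> \<open>Multiplication by \<open>w\<close> shifts the index by one; the value 0 at index
    0 is the missing term, so that all series can be compared termwise.\<close>
  have s4: "(\<lambda>n. (if n = 0 then 0 else ?d (n - 1) * w ^ (n - 1)) * w) sums (hyp (a + c) c (\<nu> + 1) w * w)"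
    by (rule sums_mult2) (use sums_Suc[of "\<lambda>n. if n = 0 then 0 else ?d (n - 1) * w ^ (n - 1)"] s2 in simp)
  have "(\<lambda>n. of_nat n * ?d n * w ^ n + (\<nu> + 1) * (?d n * w ^ n)
      - c * ((if n = 0 then 0 else ?d (n - 1) * w ^ (n - 1)) * w)) sums
    (w * ((a + c) * hyp (a + c + c) c (\<nu> + 2) w) + (\<nu> + 1) * hyp (a + c) c (\<nu> + 1) w
      - c * (hyp (a + c) c (\<nu> + 1) w * w))"
    by (intro sums_add sums_diff sums_mult s1 s2 s4)
  moreover have "of_nat n * ?d n * w ^ n + (\<nu> + 1) * (?d n * w ^ n)
      - c * ((if n = 0 then 0 else ?d (n - 1) * w ^ (n - 1)) * w) = hyp_coeff a c \<nu> n * w ^ n" for n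
  proof (cases n)
    case 0
    have "rGamma (\<nu> + 1) = (\<nu> + 1) * rGamma (\<nu> + 1 + 1)" by (rule rGamma_rec)
    then show ?thesis using 0 by (simp add: hyp_coeff_def algebra_simps)
  next
    case (Suc m)
    have "rGamma (\<nu> + of_nat n + 1) = (\<nu> + of_nat n + 1) * rGamma (\<nu> + 1 + of_nat n + 1)"
      using rGamma_rec[of "\<nu> + of_nat n + 1"] by (simp add: algebra_simps)
    moreover have "(\<Prod>j<n. a + c + c * of_nat j) * a = (\<Prod>j<n. a + c * of_nat j) * (a + c * of_nat n)"
      using prod.lessThan_Suc_shift[of "\<lambda>j. a + c * of_nat j" n] by (simp add: algebra_simps)
    have e1: "(\<nu> + of_nat n + 1) * ?d n = (\<Prod>j<n. a + c + c * of_nat j) * rGamma (\<nu> + of_nat n + 1) / fact n"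
      using calculation by (simp add: hyp_coeff_def)
    have p1: "(\<Prod>j<n. a + c + c * of_nat j) = (\<Prod>j<m. a + c + c * of_nat j) * (a + c * of_nat n)"
      using Suc by (simp add: algebra_simps)
    have p2: "(\<Prod>j<n. a + c * of_nat j) = a * (\<Prod>j<m. a + c + c * of_nat j)"
      using Suc prod.lessThan_Suc_shift[of "\<lambda>j. a + c * of_nat j" m] by (simp add: algebra_simps)
    have e2: "c * ?d m = c * of_nat n * ((\<Prod>j<m. a + c + c * of_nat j) * rGamma (\<nu> + of_nat n + 1) / fact n)"
    proof -
      have f: "fact n = (of_nat n :: complex) * fact m" using Suc by simp
      have g: "\<nu> + 1 + of_nat m + 1 = \<nu> + of_nat n + 1" using Suc by simp
      have "of_nat n \<noteq> (0 :: complex)" using Suc by (simp del: of_nat_Suc)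
      then have h: "c * (x / fact m) = c * of_nat n * (x / (of_nat n * fact m))" for x by simp
      show ?thesis unfolding hyp_coeff_def f g by (rule h)
    qed
    have "(\<nu> + of_nat n + 1) * ?d n - c * ?d m = hyp_coeff a c \<nu> n"
      unfolding e1 e2 unfolding hyp_coeff_def p1 p2 by (simp add: field_simps)
    then have "((\<nu> + of_nat n + 1) * ?d n - c * ?d m) * w ^ n = hyp_coeff a c \<nu> n * w ^ n" by simp
    then show ?thesis using Suc by (simp add: algebra_simps)
  qed
  ultimately have "(\<lambda>n. hyp_coeff a c \<nu> n * w ^ n) sums
    (w * ((a + c) * hyp (a + c + c) c (\<nu> + 2) w) + (\<nu> + 1) * hyp (a + c) c (\<nu> + 1) w
      - c * (hyp (a + c) c (\<nu> + 1) w * w))" by simp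
  from sums_unique2[OF this s3] show ?thesis by (simp add: algebra_simps)
qed

lemma continuous_on_rGamma_compose:
  "continuous_on S f \<Longrightarrow> continuous_on S (\<lambda>x. rGamma (f x :: complex))"
  using continuous_on_compose2[OF continuous_on_rGamma[of UNIV], of S f] by auto

text \<open>With \<open>a = b + c \<nu> / 2\<close> both signs of \<open>\<nu>\<close> lead to solutions of one equation.\<close>
definition psi :: "complex \<Rightarrow> complex \<Rightarrow> complex \<Rightarrow> complex \<Rightarrow> complex" where
  "psi b c \<nu> w = hyp (b + c * \<nu> / 2) c \<nu> w"

text \<open>The geometric majorant of \<open>hyp_term_bound\<close> depends only on a common bound
  of the parameters, and its leading term is bounded by continuity on a compact set. So the M-test
  applies in order and argument jointly.\<close>

lemma psi_uniform_limit:
  "uniform_limit (cball 0 R \<times> cball 0 R)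
     (\<lambda>n (\<nu>, w). \<Sum>i<n. hyp_coeff (b + c * \<nu> / 2) c \<nu> i * w ^ i) (\<lambda>(\<nu>, w). psi b c \<nu> w) sequentially"
proof -
  define R' where "R' = 1 + \<bar>R\<bar> + norm b + norm c + norm c * \<bar>R\<bar>"
  have R': "R' \<ge> 1" by (simp add: R'_def)
  from hyp_term_bound[OF R'] obtain N where N: "\<And>a c \<nu> w n. norm a \<le> R' \<Longrightarrow> norm c \<le> R' \<Longrightarrow> norm \<nu> \<le> R' \<Longrightarrow>
     norm w \<le> R' \<Longrightarrow> n \<ge> N \<Longrightarrow>
     norm (hyp_coeff a c \<nu> n * w ^ n) \<le> norm (hyp_coeff a c \<nu> N * w ^ N) * (1/2) ^ (n - N)" by metis
  let ?K = "cball 0 R \<times> cball 0 R :: (complex \<times> complex) set"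
  let ?t = "\<lambda>n p. hyp_coeff (b + c * fst p / 2) c (fst p) n * snd p ^ n"
  have "continuous_on ?K (?t N)"
    unfolding hyp_coeff_def by (intro continuous_intros continuous_on_rGamma_compose) auto
  then have "bounded (?t N ` ?K)"
    by (intro compact_imp_bounded compact_continuous_image compact_Times) auto
  then obtain M where M: "\<And>p. p \<in> ?K \<Longrightarrow> norm (?t N p) \<le> M" unfolding bounded_iff by blast
  have b: "norm (b + c * \<nu> / 2) \<le> R'" "norm c \<le> R'" "norm \<nu> \<le> R'" "norm w \<le> R'"
    if "(\<nu>, w) \<in> ?K" for \<nu> w
  proof -
    have R: "norm \<nu> \<le> \<bar>R\<bar>" "norm w \<le> \<bar>R\<bar>" using that by auto
    have "norm (b + c * \<nu> / 2) \<le> norm b + norm c * norm \<nu> / 2"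
      by (rule order_trans[OF norm_triangle_ineq]) (simp add: norm_mult)
    moreover have "norm c * norm \<nu> \<le> norm c * \<bar>R\<bar>" using R by (simp add: mult_left_mono)
    moreover have "0 \<le> norm c * norm \<nu>" by simp
    ultimately show "norm (b + c * \<nu> / 2) \<le> R'" unfolding R'_def
      using R norm_ge_zero[of c] norm_ge_zero[of \<nu>] by linarith
    show "norm c \<le> R'" "norm \<nu> \<le> R'" "norm w \<le> R'"
      unfolding R'_def using R norm_ge_zero[of c] norm_ge_zero[of b] mult_nonneg_nonneg[OF norm_ge_zero[of c] abs_ge_zero[of R]]
      by linarith+
  qed
  have "uniform_limit ?K (\<lambda>n p. \<Sum>i<n. ?t i p) (\<lambda>p. \<Sum>i. ?t i p) sequentially"
  proof (rule Weierstrass_m_test_ev)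
    show "\<forall>\<^sub>F n in sequentially. \<forall>p\<in>?K. norm (?t n p) \<le> M * (1/2) ^ (n - N)"
    proof (rule eventually_sequentiallyI[of N], intro ballI)
      fix n p assume n: "n \<ge> N" and p: "p \<in> ?K"
      then obtain \<nu> w where [simp]: "p = (\<nu>, w)" by (cases p)
      have "norm (?t n p) \<le> norm (?t N p) * (1/2) ^ (n - N)"
        using N[OF b[of \<nu> w] n] p by simp
      also have "\<dots> \<le> M * (1/2) ^ (n - N)" by (intro mult_right_mono M p) simp
      finally show "norm (?t n p) \<le> M * (1/2) ^ (n - N)" .
    qed
    have "summable (\<lambda>n. M * (1/2) ^ n)" by (intro summable_mult summable_geometric) simp
    then show "summable (\<lambda>n. M * (1/2) ^ (n - N))"
      by (subst summable_iff_shift[of _ N, symmetric]) simp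
  qed
  then show ?thesis by (simp add: case_prod_unfold psi_def hyp_def)
qed

lemma psi_continuous: "continuous_on UNIV (\<lambda>(\<nu>, w). psi b c \<nu> w)"
proof -
  have "continuous (at p) (\<lambda>(\<nu>, w). psi b c \<nu> w)" for p :: "complex \<times> complex"
  proof -
    define R where "R = norm (fst p) + norm (snd p) + 1"
    have c: "continuous_on (cball 0 R \<times> cball 0 R) (\<lambda>(\<nu>, w). psi b c \<nu> w)"
      by (rule uniform_limit_theorem[OF _ psi_uniform_limit])
        (auto intro!: always_eventually continuous_intros continuous_on_rGamma_compose simp: case_prod_unfold hyp_coeff_def)
    have "continuous_on (ball 0 R \<times> ball 0 R) (\<lambda>(\<nu>, w). psi b c \<nu> w)"
      by (rule continuous_on_subset[OF c]) (auto simp: less_imp_le)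
    moreover have "p \<in> ball 0 R \<times> ball 0 R" by (cases p) (auto simp: R_def add_strict_increasing2)
    moreover have "open (ball 0 R \<times> ball 0 R :: (complex \<times> complex) set)" by (intro open_Times) auto
    ultimately show ?thesis using continuous_on_eq_continuous_at by blast
  qed
  then show ?thesis by (simp add: continuous_at_imp_continuous_on)
qed

text \<open>Each partial sum is entire in the order because \<open>rGamma\<close> is, and locally
  uniform limits of holomorphic functions are holomorphic.\<close>

lemma psi_holomorphic: "(\<lambda>\<nu>. psi b c \<nu> w) holomorphic_on UNIV"
proof (rule holomorphic_uniform_sequence[OF open_UNIV])
  show "(\<lambda>\<nu>. \<Sum>i<n. hyp_coeff (b + c * \<nu> / 2) c \<nu> i * w ^ i) holomorphic_on UNIV" for n
    unfolding hyp_coeff_def by (intro holomorphic_intros) auto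
  fix \<nu>0 :: complex
  define R where "R = norm \<nu>0 + 1 + norm w"
  have "(\<lambda>\<nu>. (\<nu>, w)) \<in> cball \<nu>0 1 \<rightarrow> cball 0 R \<times> cball 0 R"
    proof (rule Pi_I)
      fix \<nu> assume "\<nu> \<in> cball \<nu>0 1"
      then have "norm \<nu> \<le> norm \<nu>0 + 1"
        using norm_triangle_sub[of \<nu> \<nu>0] by (simp add: dist_norm norm_minus_commute)
      then show "(\<nu>, w) \<in> cball 0 R \<times> cball 0 R" by (auto simp: R_def intro: add_increasing add_increasing2)
    qed
  from uniform_limit_compose'[OF psi_uniform_limit this]
  have "uniform_limit (cball \<nu>0 1) (\<lambda>n \<nu>. \<Sum>i<n. hyp_coeff (b + c * \<nu> / 2) c \<nu> i * w ^ i)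
      (\<lambda>\<nu>. psi b c \<nu> w) sequentially" by simp
  then show "\<exists>d>0. cball \<nu>0 d \<subseteq> UNIV \<and>
      uniform_limit (cball \<nu>0 d) (\<lambda>n \<nu>. \<Sum>i<n. hyp_coeff (b + c * \<nu> / 2) c \<nu> i * w ^ i) (\<lambda>\<nu>. psi b c \<nu> w) sequentially"
    by (intro exI[of _ 1]) auto
qed

section \<open>The functions \<open>HH\<close> of the order and the logarithmic argument\<close>

text \<open>In terms of \<open>w = exp L\<close> this is
  \<open>w powr (\<nu> / 2) * exp (- c * w / 2)\<close> times the hypergeometric factor. The
  variable \<open>L\<close> removes the branch of the power, and the prefactor is chosen so that the
  equation in \<open>L\<close> has no first-order term.\<close>

definition HH :: "complex \<Rightarrow> complex \<Rightarrow> complex \<Rightarrow> complex \<Rightarrow> complex" where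
  "HH b c \<nu> L = exp (\<nu> * L / 2 - c * exp L / 2) * psi b c \<nu> (exp L)"

definition psi' :: "complex \<Rightarrow> complex \<Rightarrow> complex \<Rightarrow> complex \<Rightarrow> complex" where
  "psi' b c \<nu> w = (b + c * \<nu> / 2) * psi (b + c / 2) c (\<nu> + 1) w"

definition HH' :: "complex \<Rightarrow> complex \<Rightarrow> complex \<Rightarrow> complex \<Rightarrow> complex" where
  "HH' b c \<nu> L = exp (\<nu> * L / 2 - c * exp L / 2) *
     ((\<nu> / 2 - c * exp L / 2) * psi b c \<nu> (exp L) + exp L * psi' b c \<nu> (exp L))"

text \<open>\<open>HH b c \<nu>\<close> solves \<open>Y'' = pot b c \<nu> * Y\<close> in
  \<open>L\<close>. Only the square of the order enters, so \<open>HH b c (- \<nu>)\<close> solves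
  the same equation. Bessel functions have \<open>c = 0\<close>; Whittaker's equation has
  \<open>c = 1\<close> and \<open>b = 1 / 2 - k\<close>.\<close>

definition pot :: "complex \<Rightarrow> complex \<Rightarrow> complex \<Rightarrow> complex \<Rightarrow> complex" where
  "pot b c \<nu> L = \<nu>\<^sup>2 / 4 + (b - c / 2) * exp L + c\<^sup>2 * (exp L)\<^sup>2 / 4"

lemma psi_deriv: "(psi b c \<nu> has_field_derivative psi' b c \<nu> w) (at w)"
proof -
  have "b + c / 2 + c * (\<nu> + 1) / 2 = b + c * \<nu> / 2 + c" by (simp add: field_simps)
  then show ?thesis
    using hyp_has_field_derivative[of "b + c * \<nu> / 2" c \<nu> w]
    unfolding psi_def[abs_def] psi'_def by (simp only:)
qed

lemma psi'_deriv:
  "(psi' b c \<nu> has_field_derivative (b + c * \<nu> / 2) * psi' (b + c / 2) c (\<nu> + 1) w) (at w)"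
  unfolding psi'_def[of b] by (intro DERIV_cmult psi_deriv)

lemma psi_ode:
  "w * ((b + c * \<nu> / 2) * psi' (b + c / 2) c (\<nu> + 1) w) + (\<nu> + 1 - c * w) * psi' b c \<nu> w
     = (b + c * \<nu> / 2) * psi b c \<nu> w"
proof -
  let ?a = "b + c * \<nu> / 2"
  have e: "b + c / 2 + c * (\<nu> + 1) / 2 = ?a + c" "b + c / 2 + c / 2 + c * (\<nu> + 2) / 2 = ?a + c + c"
    "\<nu> + 1 + 1 = \<nu> + 2"
    by (simp_all add: field_simps)
  have "?a * (w * (?a + c) * hyp (?a + c + c) c (\<nu> + 2) w + (\<nu> + 1 - c * w) * hyp (?a + c) c (\<nu> + 1) w)
     = ?a * hyp ?a c \<nu> w" unfolding hyp_ode ..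
  moreover have "w * (A * (D * h2)) + X * (A * h1) = A * h" if "A * (w * D * h2 + X * h1) = A * h"
    for A D X h h1 h2 :: complex
    using that by (simp add: algebra_simps)
  ultimately show ?thesis unfolding psi'_def psi_def e(3) e(1,2) by blast
qed

lemma psi_exp_deriv:
  "((\<lambda>L. psi b c \<nu> (exp L)) has_field_derivative psi' b c \<nu> (exp L) * exp L) (at L)"
  "((\<lambda>L. psi' b c \<nu> (exp L)) has_field_derivative
     (b + c * \<nu> / 2) * psi' (b + c / 2) c (\<nu> + 1) (exp L) * exp L) (at L)"
  by (rule DERIV_chain2[OF psi_deriv DERIV_exp] DERIV_chain2[OF psi'_deriv DERIV_exp])+

lemma HH_deriv: "(HH b c \<nu> has_field_derivative HH' b c \<nu> L) (at L)"
  unfolding HH_def[abs_def] HH'_def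
  by (auto intro!: derivative_eq_intros psi_exp_deriv simp: algebra_simps)

lemma HH'_deriv: "(HH' b c \<nu> has_field_derivative pot b c \<nu> L * HH b c \<nu> L) (at L)"
proof -
  let ?w = "exp L" and ?E = "exp (\<nu> * L / 2 - c * exp L / 2)" and ?al = "\<nu> / 2 - c * exp L / 2"
  let ?p = "psi b c \<nu> (exp L)" and ?p1 = "psi' b c \<nu> (exp L)"
  let ?p2 = "(b + c * \<nu> / 2) * psi' (b + c / 2) c (\<nu> + 1) (exp L)"
  have dE: "((\<lambda>L. exp (\<nu> * L / 2 - c * exp L / 2)) has_field_derivative ?E * ?al) (at L)"
    by (auto intro!: derivative_eq_intros simp: field_simps)
  have dI: "((\<lambda>L. (\<nu> / 2 - c * exp L / 2) * psi b c \<nu> (exp L) + exp L * psi' b c \<nu> (exp L)) has_field_derivative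
      - c * ?w / 2 * ?p + ?al * (?p1 * ?w) + (?w * ?p1 + ?w * (?p2 * ?w))) (at L)"
    by (auto intro!: derivative_eq_intros psi_exp_deriv simp: algebra_simps)
  \<comment> \<open>\<open>psi_ode\<close> eliminates the second derivative of the hypergeometric
    factor; the terms with the first derivative then cancel and the order is left only as a
    square.\<close>
  have alg: "E * al * (al * p + w * p1) + (- c * w / 2 * p + al * (p1 * w) + (w * p1 + w * (p2 * w))) * E
      = (\<nu>\<^sup>2 / 4 + (b - c / 2) * w + c\<^sup>2 * w\<^sup>2 / 4) * (E * p)"
    if "w * p2 + (\<nu> + 1 - c * w) * p1 = (b + c * \<nu> / 2) * p" "al = \<nu> / 2 - c * w / 2"
    for E al p w p1 p2 :: complex
  proof -
    have 1: "w * p2 = (b + c * \<nu> / 2) * p - (\<nu> + 1 - c * w) * p1" using that(1) by (simp add: algebra_simps)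
    have "E * al * (al * p + w * p1) + (- c * w / 2 * p + al * (p1 * w) + (w * p1 + w * (p2 * w))) * E
      = E * (al\<^sup>2 * p + 2 * al * w * p1 - c * w / 2 * p + w * p1 + w * (w * p2))"
      by (simp add: algebra_simps power2_eq_square)
    also have "\<dots> = (\<nu>\<^sup>2 / 4 + (b - c / 2) * w + c\<^sup>2 * w\<^sup>2 / 4) * (E * p)"
      unfolding 1 that(2) by (simp add: field_simps power2_eq_square)
    finally show ?thesis .
  qed
  show ?thesis
    using DERIV_mult[OF dE dI] unfolding alg[OF psi_ode refl]
    unfolding HH_def pot_def HH'_def[abs_def] .
qed

lemma wronskian_entire_const:
  fixes f g f' g' P :: "complex \<Rightarrow> complex"
  assumes "\<And>z. (f has_field_derivative f' z) (at z)" "\<And>z. (f' has_field_derivative P z * f z) (at z)"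
    and "\<And>z. (g has_field_derivative g' z) (at z)" "\<And>z. (g' has_field_derivative P z * g z) (at z)"
  shows "f z * g' z - f' z * g z = f y * g' y - f' y * g y"
proof -
  have "((\<lambda>z. f z * g' z - f' z * g z) has_field_derivative 0) (at z)" for z
    by (rule derivative_eq_intros assms refl)+ (simp add: algebra_simps)
  then show ?thesis
    using has_field_derivative_zero_constant[OF convex_UNIV, of "\<lambda>z. f z * g' z - f' z * g z"] by (metis UNIV_I)
qed

lemma psi_0: "psi b c \<nu> 0 = rGamma (\<nu> + 1)"
  by (simp add: psi_def hyp_0)

lemma isCont_psi: "isCont (psi b c \<nu>) w" "isCont (psi' b c \<nu>) w"
  using psi_deriv psi'_deriv DERIV_isCont by blast+

lemma HH_shift_deriv:
  "((\<lambda>L. HH b c \<nu> (L + \<theta>)) has_field_derivative HH' b c \<nu> (L + \<theta>)) (at L)"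
  "((\<lambda>L. HH' b c \<nu> (L + \<theta>)) has_field_derivative pot b c \<nu> (L + \<theta>) * HH b c \<nu> (L + \<theta>)) (at L)"
proof -
  have d: "((\<lambda>L. L + \<theta>) has_field_derivative 1) (at L)" by (auto intro!: derivative_eq_intros)
  show "((\<lambda>L. HH b c \<nu> (L + \<theta>)) has_field_derivative HH' b c \<nu> (L + \<theta>)) (at L)"
    "((\<lambda>L. HH' b c \<nu> (L + \<theta>)) has_field_derivative pot b c \<nu> (L + \<theta>) * HH b c \<nu> (L + \<theta>)) (at L)"
    using DERIV_chain2[OF HH_deriv d] DERIV_chain2[OF HH'_deriv d] by simp_all
qed

text \<open>The assumptions say that the shift of \<open>L\<close> by \<open>\<theta>\<close>
  carries one potential into the other: it multiplies \<open>exp L\<close> by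
  \<open>exp \<theta>\<close>. Both functions thus solve one equation, and their Wronskian is
  constant.\<close>

lemma HH_wronskian_const:
  assumes "b - c / 2 = (b' - c' / 2) * exp \<theta>" "c\<^sup>2 = c'\<^sup>2 * (exp \<theta>)\<^sup>2" "\<nu>\<^sup>2 = \<nu>'\<^sup>2"
  shows "HH b c \<nu> L * HH' b' c' \<nu>' (L + \<theta>) - HH' b c \<nu> L * HH b' c' \<nu>' (L + \<theta>)
    = HH b c \<nu> L' * HH' b' c' \<nu>' (L' + \<theta>) - HH' b c \<nu> L' * HH b' c' \<nu>' (L' + \<theta>)"
proof -
  have P: "pot b' c' \<nu>' (L + \<theta>) = pot b c \<nu> L" for L
    unfolding pot_def assms(1-3) by (simp add: exp_add power_mult_distrib mult_ac)
  show ?thesis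
    by (rule wronskian_entire_const[of "HH b c \<nu>" "HH' b c \<nu>" "pot b c \<nu>"
          "\<lambda>L. HH b' c' \<nu>' (L + \<theta>)" "\<lambda>L. HH' b' c' \<nu>' (L + \<theta>)"])
      (rule HH_deriv HH'_deriv HH_shift_deriv[of b' c' \<nu>' \<theta>, unfolded P])+
qed

text \<open>All singular behaviour at \<open>exp L = 0\<close> is split off as an exponential. The
  remaining factor \<open>K\<close> is continuous at 0, where
  \<open>psi b c \<nu> 0 = rGamma (\<nu> + 1)\<close> gives its value; a Wronskian known to be
  constant is determined by that value.\<close>

lemma HH_wronskian_eq:
  "\<exists>K. (\<forall>L. HH b c \<nu> L * HH' b' c' \<nu>' (L + \<theta>) - HH' b c \<nu> L * HH b' c' \<nu>' (L + \<theta>)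
       = exp (\<nu>' * \<theta> / 2) * exp ((\<nu> + \<nu>') * L / 2) * K (exp L)) \<and>
    isCont K 0 \<and> K 0 = (\<nu>' - \<nu>) / 2 * rGamma (\<nu> + 1) * rGamma (\<nu>' + 1)"
proof (intro exI conjI allI)
  let ?K = "\<lambda>w. exp (- (c + c' * exp \<theta>) * w / 2) *
     (psi b c \<nu> w * ((\<nu>' / 2 - c' * (exp \<theta> * w) / 2) * psi b' c' \<nu>' (exp \<theta> * w)
        + exp \<theta> * w * psi' b' c' \<nu>' (exp \<theta> * w))
      - ((\<nu> / 2 - c * w / 2) * psi b c \<nu> w + w * psi' b c \<nu> w) * psi b' c' \<nu>' (exp \<theta> * w))"
  show "HH b c \<nu> L * HH' b' c' \<nu>' (L + \<theta>) - HH' b c \<nu> L * HH b' c' \<nu>' (L + \<theta>)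
       = exp (\<nu>' * \<theta> / 2) * exp ((\<nu> + \<nu>') * L / 2) * ?K (exp L)" for L
  proof -
    have e: "exp (L + \<theta>) = exp \<theta> * exp L" by (simp add: exp_add)
    have E: "exp (\<nu> * L / 2 - c * exp L / 2) * exp (\<nu>' * (L + \<theta>) / 2 - c' * (exp \<theta> * exp L) / 2)
      = exp (\<nu>' * \<theta> / 2) * exp ((\<nu> + \<nu>') * L / 2) * exp (- (c + c' * exp \<theta>) * exp L / 2)"
      unfolding exp_add[symmetric] by (rule arg_cong[of _ _ exp]) (simp add: field_simps exp_add)
    have "E1 * p * (E2 * q') - E1 * p' * (E2 * q) = X * Y * (Z * (p * q' - p' * q))"
      if "E1 * E2 = X * Y * Z" for E1 E2 X Y Z p q p' q' :: complex
    proof -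
      have "E1 * p * (E2 * q') - E1 * p' * (E2 * q) = (E1 * E2) * (p * q' - p' * q)"
        by (simp add: algebra_simps)
      then show ?thesis unfolding that by simp
    qed
    from this[OF E] show ?thesis unfolding HH_def HH'_def e .
  qed
  have c2: "isCont (\<lambda>w. psi b' c' \<nu>' (exp \<theta> * w)) 0" "isCont (\<lambda>w. psi' b' c' \<nu>' (exp \<theta> * w)) 0"
    by (rule isCont_o2[OF _ isCont_psi(1)] isCont_o2[OF _ isCont_psi(2)], simp)+
  show "isCont ?K 0"
    by (intro continuous_intros c2 isCont_psi) auto
  show "?K 0 = (\<nu>' - \<nu>) / 2 * rGamma (\<nu> + 1) * rGamma (\<nu>' + 1)"
    by (simp add: psi_0 algebra_simps diff_divide_distrib)
qed

lemma rGamma_minus_plus: "\<nu> * rGamma (\<nu> + 1) * rGamma (1 - \<nu>) = sin (of_real pi * \<nu>) / (of_real pi :: complex)"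
  using rGamma_reflection_complex[of \<nu>] rGamma_rec[of \<nu>] by simp

text \<open>The Wronskian is constant, so it equals its limit as \<open>exp L \<rightarrow> 0\<close>.\<close>
lemma HH_wronskian_opposite:
  assumes "b - c / 2 = (b' - c' / 2) * exp \<theta>" "c\<^sup>2 = c'\<^sup>2 * (exp \<theta>)\<^sup>2"
  shows "HH b c \<nu> L * HH' b' c' (- \<nu>) (L + \<theta>) - HH' b c \<nu> L * HH b' c' (- \<nu>) (L + \<theta>)
    = - exp (- \<nu> * \<theta> / 2) * sin (of_real pi * \<nu>) / of_real pi"
proof -
  define Wr where "Wr = (\<lambda>L. HH b c \<nu> L * HH' b' c' (- \<nu>) (L + \<theta>) - HH' b c \<nu> L * HH b' c' (- \<nu>) (L + \<theta>))"
  obtain K where K: "\<And>L. Wr L = exp (- \<nu> * \<theta> / 2) * exp ((\<nu> + - \<nu>) * L / 2) * K (exp L)" "isCont K 0"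
      "K 0 = (- \<nu> - \<nu>) / 2 * rGamma (\<nu> + 1) * rGamma (- \<nu> + 1)"
    using HH_wronskian_eq[of b c \<nu> b' c' "- \<nu>" \<theta>] unfolding Wr_def by blast
  have const: "Wr L = Wr L'" for L L'
    unfolding Wr_def by (rule HH_wronskian_const[OF assms]) simp
  define X where "X = Wr L"
  \<comment> \<open>Every nonzero \<open>w\<close> is \<open>exp (Ln w)\<close>, so the constant is
    expressed by \<open>K\<close> on a punctured neighbourhood of 0, and the limit can be taken in
    \<open>w\<close>.\<close>
  have X: "X = exp (- \<nu> * \<theta> / 2) * K w" if "w \<noteq> 0" for w
  proof -
    have "exp (Ln w) = w" using that by simp
    then show ?thesis using K(1)[of "Ln w"] const[of L "Ln w"] unfolding X_def by simp
  qed
  have "((\<lambda>w. exp (- \<nu> * \<theta> / 2) * K w) \<longlongrightarrow> X) (at 0)"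
    by (rule tendsto_eventually) (unfold eventually_at_filter, rule always_eventually, blast intro: X[symmetric])
  moreover have "((\<lambda>w. exp (- \<nu> * \<theta> / 2) * K w) \<longlongrightarrow> exp (- \<nu> * \<theta> / 2) * K 0) (at 0)"
    using K(2) unfolding isCont_def by (intro tendsto_intros)
  ultimately have "Wr L = exp (- \<nu> * \<theta> / 2) * K 0"
    unfolding X_def using LIM_unique by blast
  also have "K 0 = - (\<nu> * rGamma (\<nu> + 1) * rGamma (1 - \<nu>))" unfolding K(3) by simp
  also have "\<dots> = - sin (of_real pi * \<nu>) / of_real pi" unfolding rGamma_minus_plus by simp
  finally show ?thesis unfolding Wr_def by simp
qed

lemma HH_holomorphic: "(\<lambda>\<nu>. HH b c \<nu> L) holomorphic_on S"
  unfolding HH_def by (intro holomorphic_intros holomorphic_on_subset[OF psi_holomorphic]) auto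

lemma psi_holomorphic_shift: "(\<lambda>\<nu>. psi b c (\<nu> + 1) w) holomorphic_on S"
proof -
  have "(\<lambda>\<nu>. \<nu> + 1) holomorphic_on S" by (intro holomorphic_intros)
  from holomorphic_on_compose_gen[OF this psi_holomorphic, of b c w] show ?thesis by (simp add: o_def)
qed

lemma HH'_holomorphic: "(\<lambda>\<nu>. HH' b c \<nu> L) holomorphic_on S"
  unfolding HH'_def psi'_def
  by (intro holomorphic_intros holomorphic_on_subset[OF psi_holomorphic] psi_holomorphic_shift) auto

lemma continuous_on_psi2:
  assumes "continuous_on S f" "continuous_on S g"
  shows "continuous_on S (\<lambda>x. psi b c (f x) (g x))"
  using continuous_on_compose2[OF psi_continuous continuous_on_Pair[OF assms]] by auto

lemma continuous_on_HH2:
  assumes "continuous_on S f" "continuous_on S g"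
  shows "continuous_on S (\<lambda>x. HH b c (f x) (g x))" "continuous_on S (\<lambda>x. HH' b c (f x) (g x))"
  unfolding HH_def HH'_def psi'_def
  by (intro continuous_intros continuous_on_psi2 assms; simp)+

text \<open>For \<open>Re \<nu> > 0\<close> the factor \<open>exp (\<nu> * L)\<close> decays as
  \<open>L\<close> tends to minus infinity along the reals, so the constant Wronskian is 0. This
  argument breaks down for the other orders; there the identity theorem applies, as the Wronskian is
  entire in the order.\<close>

lemma HH_wronskian_same:
  assumes "b - c / 2 = (b' - c' / 2) * exp \<theta>" "c\<^sup>2 = c'\<^sup>2 * (exp \<theta>)\<^sup>2"
  shows "HH b c \<nu> L * HH' b' c' \<nu> (L + \<theta>) - HH' b c \<nu> L * HH b' c' \<nu> (L + \<theta>) = 0"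
proof -
  define Wr where "Wr = (\<lambda>\<nu> L. HH b c \<nu> L * HH' b' c' \<nu> (L + \<theta>) - HH' b c \<nu> L * HH b' c' \<nu> (L + \<theta>))"
  have hol: "(\<lambda>\<nu>. Wr \<nu> L) holomorphic_on UNIV"
    unfolding Wr_def by (intro holomorphic_intros HH_holomorphic HH'_holomorphic)
  have z: "Wr \<nu> L = 0" if \<nu>: "Re \<nu> > 0" for \<nu>
  proof -
    obtain K where K': "\<And>L. Wr \<nu> L = exp (\<nu> * \<theta> / 2) * exp ((\<nu> + \<nu>) * L / 2) * K (exp L)" "isCont K 0"
      using HH_wronskian_eq[of b c \<nu> b' c' \<nu> \<theta>] unfolding Wr_def by blast
    have K: "Wr \<nu> L = exp (\<nu> * \<theta> / 2) * exp (\<nu> * L) * K (exp L)" for L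
      using K'(1)[of L] by simp
    have const: "Wr \<nu> L = Wr \<nu> L'" for L L'
      unfolding Wr_def by (rule HH_wronskian_const[OF assms refl])
    have ex: "((\<lambda>t::real. exp (\<nu> * of_real (- t))) \<longlongrightarrow> 0) at_top" if "Re \<nu> > 0" for \<nu>
    proof (rule tendsto_norm_zero_cancel)
      have "((\<lambda>t. exp (- (Re \<nu> * t))) \<longlongrightarrow> 0) at_top"
        by (intro filterlim_compose[OF exp_at_bot] filterlim_compose[OF filterlim_uminus_at_bot_at_top]
            filterlim_tendsto_pos_mult_at_top[OF tendsto_const that] filterlim_ident)
      then show "((\<lambda>t::real. norm (exp (\<nu> * of_real (- t)))) \<longlongrightarrow> 0) at_top" by simp
    qed
    have "((\<lambda>t::real. exp (of_real (- t)) :: complex) \<longlongrightarrow> 0) at_top" using ex[of 1] by simp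
    then have "((\<lambda>t::real. K (exp (of_real (- t)))) \<longlongrightarrow> K 0) at_top"
      using K'(2) isCont_tendsto_compose by blast
    from tendsto_mult[OF tendsto_mult[OF tendsto_const ex[OF \<nu>]] this]
    have "((\<lambda>t::real. Wr \<nu> (of_real (- t))) \<longlongrightarrow> 0) at_top" unfolding K by simp
    moreover have "(\<lambda>t::real. Wr \<nu> (of_real (- t))) = (\<lambda>t. Wr \<nu> L)" by (intro ext) (rule const)
    ultimately have "((\<lambda>t::real. Wr \<nu> L) \<longlongrightarrow> 0) at_top" by simp
    then show ?thesis by (simp add: tendsto_const_iff)
  qed
  have "Wr \<nu> L = 0"
    by (rule analytic_continuation_open[of "{\<nu>. Re \<nu> > 0}" UNIV "\<lambda>\<nu>. Wr \<nu> L" "\<lambda>_. 0"])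
      (use hol z in \<open>auto simp: open_halfspace_Re_gt intro: exI[of _ 1]\<close>)
  then show ?thesis by (simp add: Wr_def)
qed

lemma hyp_coeff_negative_order:
  "hyp_coeff a c (- of_nat n) (i + n) = (\<Prod>j<n. a + c * of_nat j) * hyp_coeff (a + c * of_nat n) c (of_nat n) i"
proof -
  have "(\<Prod>j<i + n. a + c * of_nat j) = (\<Prod>j<n. a + c * of_nat j) * (\<Prod>j<i. a + c * of_nat n + c * of_nat j)"
    by (induction i) (auto simp: algebra_simps)
  moreover have "rGamma (of_nat k + 1 :: complex) = inverse (fact k)" for k
    using Gamma_fact[of k, where 'a=complex] by (simp add: rGamma_inverse_Gamma add.commute)
  moreover have "- of_nat n + of_nat (i + n) + 1 = (of_nat i + 1 :: complex)"
      "of_nat n + of_nat i + 1 = (of_nat (i + n) + 1 :: complex)" by simp_all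
  ultimately show ?thesis by (simp only: hyp_coeff_def divide_inverse) (simp add: mult_ac)
qed

text \<open>\<open>rGamma\<close> vanishes at the nonpositive integers and kills the first
  \<open>n\<close> coefficients; the others are those of order \<open>n\<close>, shifted by
  \<open>n\<close>. So the orders \<open>n\<close> and \<open>- n\<close> are linearly dependent,
  and second solutions of integer order have to be obtained as limits.\<close>

lemma hyp_negative_order:
  "hyp a c (- of_nat n) w = (\<Prod>j<n. a + c * of_nat j) * w ^ n * hyp (a + c * of_nat n) c (of_nat n) w"
proof -
  have z: "hyp_coeff a c (- of_nat n) i = 0" if "i < n" for i
  proof -
    have "- of_nat n + of_nat i + 1 = (- of_nat (n - i - 1) :: complex)"
      using that by (simp add: of_nat_diff)
    then have "rGamma (- of_nat n + of_nat i + 1 :: complex) = 0"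
      by (simp add: rGamma_eq_zero_iff)
    then show ?thesis by (simp add: hyp_coeff_def)
  qed
  have "hyp a c (- of_nat n) w = (\<Sum>i. hyp_coeff a c (- of_nat n) (i + n) * w ^ (i + n))
      + (\<Sum>i<n. hyp_coeff a c (- of_nat n) i * w ^ i)"
    unfolding hyp_def by (rule suminf_split_initial_segment[OF hyp_summable])
  also have "(\<Sum>i<n. hyp_coeff a c (- of_nat n) i * w ^ i) = 0" by (simp add: z)
  also have "(\<lambda>i. hyp_coeff a c (- of_nat n) (i + n) * w ^ (i + n)) =
      (\<lambda>i. ((\<Prod>j<n. a + c * of_nat j) * w ^ n) * (hyp_coeff (a + c * of_nat n) c (of_nat n) i * w ^ i))"
    unfolding hyp_coeff_negative_order power_add by (simp add: mult_ac)
  finally show ?thesis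
    unfolding hyp_def by (simp only: suminf_mult[OF hyp_summable] add_0_right)
qed

lemma HH_negative_order:
  "HH b c (- of_nat n) L = (\<Prod>j<n. b - c * of_nat n / 2 + c * of_nat j) * HH b c (of_nat n) L"
proof -
  have e: "exp (- of_nat n * L / 2 - c * exp L / 2) * exp L ^ n = exp (of_nat n * L / 2 - c * exp L / 2)"
    unfolding exp_of_nat_mult[symmetric] exp_add[symmetric] by (rule arg_cong[of _ _ exp]) (simp add: field_simps)
  have "b + c * (- of_nat n) / 2 + c * of_nat n = b + c * of_nat n / 2" by (simp add: field_simps)
  moreover have "X * (P * W * H) = P * (Y * H)" if "X * W = Y" for X P W H Y :: complex
    unfolding that[symmetric] by (simp only: mult_ac)
  moreover have "b + c * (- of_nat n) / 2 = b - c * of_nat n / 2" by simp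
  ultimately show ?thesis unfolding HH_def psi_def hyp_negative_order using e by (simp only:)
qed

section \<open>Passing to the limit in the order\<close>

text \<open>Cauchy's formula at the centre of a circle, parametrised over a fixed real interval so
  that differentiation under the integral sign becomes available.\<close>

lemma mean_value_circle:
  assumes "f holomorphic_on cball z r" "r > 0"
  shows "((\<lambda>\<theta>. f (z + of_real r * exp (2 * of_real pi * \<i> * of_real \<theta>))) has_integral f z) {0..1}"
proof -
  have "((\<lambda>u. f u / (u - z)) has_contour_integral (2 * of_real pi * \<i> * f z)) (circlepath z r)"
    by (rule Cauchy_integral_circlepath_simple) (use assms in auto)
  then have "((\<lambda>\<theta>. f (circlepath z r \<theta>) / (circlepath z r \<theta> - z) *
      vector_derivative (circlepath z r) (at \<theta> within {0..1})) has_integral (2 * of_real pi * \<i> * f z)) {0..1}"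
    by (simp add: has_contour_integral_def)
  then have "((\<lambda>\<theta>. 2 * of_real pi * \<i> * f (z + of_real r * exp (2 * of_real pi * \<i> * of_real \<theta>)))
      has_integral (2 * of_real pi * \<i> * f z)) {0..1}"
  proof (rule has_integral_eq[rotated])
    fix \<theta> :: real assume "\<theta> \<in> {0..1}"
    then have "vector_derivative (circlepath z r) (at \<theta> within {0..1})
        = 2 * of_real pi * \<i> * of_real r * exp (2 * of_real pi * \<i> * of_real \<theta>)"
      by (simp add: vector_derivative_circlepath01)
    then show "f (circlepath z r \<theta>) / (circlepath z r \<theta> - z) *
        vector_derivative (circlepath z r) (at \<theta> within {0..1})
      = 2 * of_real pi * \<i> * f (z + of_real r * exp (2 * of_real pi * \<i> * of_real \<theta>))"
      using assms(2) by (simp add: circlepath)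
  qed
  from has_integral_mult_right[OF this, of "inverse (2 * of_real pi * \<i>)"]
  show ?thesis by (simp add: field_simps)
qed

text \<open>If \<open>s m = 0\<close>, the zero is simple and \<open>h\<close> vanishes there as
  well. The difference quotients of \<open>h\<close> and \<open>s\<close> at \<open>m\<close> extend
  holomorphically, that of \<open>s\<close> without zeros, and their quotient is the
  extension.\<close>

lemma removable_quotient:
  fixes h s :: "complex \<Rightarrow> complex"
  assumes "r > 0" "h holomorphic_on ball m r" "s holomorphic_on ball m r"
    and "\<And>\<nu>. \<nu> \<in> ball m r \<Longrightarrow> \<nu> \<noteq> m \<Longrightarrow> s \<nu> \<noteq> 0"
    and "s m \<noteq> 0 \<or> deriv s m \<noteq> 0 \<and> h m = 0"
  shows "\<exists>g. g holomorphic_on ball m r \<and> (\<forall>\<nu>\<in>ball m r - {m}. g \<nu> = h \<nu> / s \<nu>)"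
proof (cases "s m = 0")
  case False
  then have "s \<nu> \<noteq> 0" if "\<nu> \<in> ball m r" for \<nu>
    using assms(4) that by (cases "\<nu> = m") auto
  then have "(\<lambda>\<nu>. h \<nu> / s \<nu>) holomorphic_on ball m r"
    by (rule holomorphic_on_divide[OF assms(2,3)])
  then show ?thesis by (intro exI[of _ "\<lambda>\<nu>. h \<nu> / s \<nu>"]) auto
next
  case True
  with assms(5) have m: "deriv s m \<noteq> 0" "h m = 0" by auto
  have i: "m \<in> interior (ball m r)" using assms(1) by (simp add: interior_open)
  define q where "q = (\<lambda>f \<nu>. if \<nu> = m then deriv f m else (f \<nu> - f m) / (\<nu> - m) :: complex)"
  have q: "q h holomorphic_on ball m r" "q s holomorphic_on ball m r"
    unfolding q_def by (rule pole_lemma[OF assms(2) i], rule pole_lemma[OF assms(3) i])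
  have "q s \<nu> \<noteq> 0" if "\<nu> \<in> ball m r" for \<nu>
    using that assms(4)[of \<nu>] m True by (auto simp: q_def)
  then have "(\<lambda>\<nu>. q h \<nu> / q s \<nu>) holomorphic_on ball m r"
    by (intro holomorphic_on_divide q)
  then show ?thesis
    by (intro exI[of _ "\<lambda>\<nu>. q h \<nu> / q s \<nu>"]) (auto simp: q_def True m)
qed

text \<open>
  The limit is an average over a circle around \<open>m\<close>, and differentiation in \<open>t\<close> passes under
  that integral.
\<close>
lemma limit_solves_ode:
  fixes N N' P :: "complex \<Rightarrow> real \<Rightarrow> complex" and s :: "complex \<Rightarrow> complex"
  assumes r: "r > 0"
    and hol: "\<And>t. (\<lambda>\<nu>. N \<nu> t) holomorphic_on ball m r" "\<And>t. (\<lambda>\<nu>. N' \<nu> t) holomorphic_on ball m r"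
      "\<And>t. (\<lambda>\<nu>. P \<nu> t) holomorphic_on ball m r"
    and der: "\<And>\<nu> t. (N \<nu> has_vector_derivative N' \<nu> t) (at t)"
      "\<And>\<nu> t. (N' \<nu> has_vector_derivative P \<nu> t * N \<nu> t) (at t)"
    and cont: "continuous_on UNIV (\<lambda>(\<nu>, t). N \<nu> t)" "continuous_on UNIV (\<lambda>(\<nu>, t). N' \<nu> t)"
      "continuous_on UNIV (\<lambda>(\<nu>, t). P \<nu> t)"
    and s: "s holomorphic_on ball m r" "\<And>\<nu>. \<nu> \<in> ball m r \<Longrightarrow> \<nu> \<noteq> m \<Longrightarrow> s \<nu> \<noteq> 0"
    and m: "s m \<noteq> 0 \<or> deriv s m \<noteq> 0 \<and> (\<forall>t. N m t = 0)"
  shows "\<exists>Y Y'. \<forall>t. ((\<lambda>\<nu>. N \<nu> t / s \<nu>) \<longlongrightarrow> Y t) (at m) \<and> ((\<lambda>\<nu>. N' \<nu> t / s \<nu>) \<longlongrightarrow> Y' t) (at m) \<and>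
    (Y has_vector_derivative Y' t) (at t) \<and> (Y' has_vector_derivative P m t * Y t) (at t)"
proof -
  \<comment> \<open>A numerator that vanishes at \<open>m\<close> for all \<open>t\<close> has
    vanishing \<open>t\<close>-derivative there, so the quotient for the derivative has a removable
    singularity too.\<close>
  have m': "s m \<noteq> 0 \<or> deriv s m \<noteq> 0 \<and> N' m t = 0" for t
  proof -
    have "N' m t = 0" if "\<forall>t. N m t = 0"
    proof -
      have "N m = (\<lambda>t. 0)" using that by auto
      then have "(N m has_vector_derivative 0) (at t)" by simp
      then show ?thesis using der(1) vector_derivative_unique_at by blast
    qed
    then show ?thesis using m by blast
  qed
  have "\<forall>t. \<exists>g. g holomorphic_on ball m r \<and> (\<forall>\<nu>\<in>ball m r - {m}. g \<nu> = N \<nu> t / s \<nu>)"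
    using removable_quotient[OF r hol(1) s] m by blast
  then obtain G where G: "\<And>t. G t holomorphic_on ball m r" "\<And>t \<nu>. \<nu> \<in> ball m r \<Longrightarrow> \<nu> \<noteq> m \<Longrightarrow> G t \<nu> = N \<nu> t / s \<nu>"
    by (metis DiffI singletonD)
  have "\<forall>t. \<exists>g. g holomorphic_on ball m r \<and> (\<forall>\<nu>\<in>ball m r - {m}. g \<nu> = N' \<nu> t / s \<nu>)"
    using removable_quotient[OF r hol(2) s] m' by blast
  then obtain G' where G': "\<And>t. G' t holomorphic_on ball m r" "\<And>t \<nu>. \<nu> \<in> ball m r \<Longrightarrow> \<nu> \<noteq> m \<Longrightarrow> G' t \<nu> = N' \<nu> t / s \<nu>"
    by (metis DiffI singletonD)
  have lim: "((\<lambda>\<nu>. f \<nu>) \<longlongrightarrow> g m) (at m)" if "g holomorphic_on ball m r"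
    "\<And>\<nu>. \<nu> \<in> ball m r \<Longrightarrow> \<nu> \<noteq> m \<Longrightarrow> g \<nu> = f \<nu>" for f g :: "complex \<Rightarrow> complex"
  proof -
    have "isCont g m" using holomorphic_on_imp_continuous_on[OF that(1)] r
      by (simp add: continuous_on_eq_continuous_at)
    then have "(g \<longlongrightarrow> g m) (at m)" by (simp add: isCont_def)
    then show ?thesis
      by (rule Lim_transform_within_open[of _ _ _ _ "ball m r"]) (use r that(2) in auto)
  qed
  \<comment> \<open>The circle of radius \<open>r / 2\<close> avoids \<open>m\<close>: the
    integrands are the explicit quotients, and the extensions \<open>G\<close> and \<open>G'\<close>
    enter only as mean values.\<close>
  define z where "z = (\<lambda>\<theta>. m + of_real (r / 2) * exp (2 * of_real pi * \<i> * of_real \<theta>))"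
  have z: "z \<theta> \<in> ball m r" "z \<theta> \<noteq> m" for \<theta>
    using r by (auto simp: z_def dist_norm norm_mult)
  have zc: "continuous_on S z" for S unfolding z_def by (intro continuous_intros)
  have sz: "s (z \<theta>) \<noteq> 0" for \<theta> using s(2) z by blast
  have sub: "cball m (r / 2) \<subseteq> ball m r" using r by auto
  have mv: "((\<lambda>\<theta>. f (z \<theta>)) has_integral g m) {0..1}" if "g holomorphic_on ball m r"
    "\<And>\<nu>. \<nu> \<in> ball m r \<Longrightarrow> \<nu> \<noteq> m \<Longrightarrow> g \<nu> = f \<nu>" for f g :: "complex \<Rightarrow> complex"
  proof -
    have "((\<lambda>\<theta>. g (z \<theta>)) has_integral g m) {0..1}"
      unfolding z_def by (rule mean_value_circle[OF holomorphic_on_subset[OF that(1) sub]]) (use r in simp)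
    then show ?thesis using that(2) z by simp
  qed
  have cs: "continuous_on ((UNIV :: real set) \<times> cbox 0 1) (\<lambda>(t, \<theta>). s (z \<theta>))"
    unfolding case_prod_unfold
    by (rule continuous_on_compose2[OF holomorphic_on_imp_continuous_on[OF s(1)]])
      (use z in \<open>auto intro!: continuous_on_compose2[OF zc[of UNIV]] continuous_intros\<close>)
  have cz: "continuous_on ((UNIV :: real set) \<times> cbox 0 1) (\<lambda>(t, \<theta>). F (z \<theta>) t)"
    if "continuous_on UNIV (\<lambda>(\<nu>, t). F \<nu> t)" for F :: "complex \<Rightarrow> real \<Rightarrow> complex"
  proof -
    have "continuous_on ((UNIV :: real set) \<times> cbox 0 1) (\<lambda>p. (\<lambda>(\<nu>, t). F \<nu> t) (z (snd p), fst p))"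
      by (rule continuous_on_compose2[OF that])
        (auto intro!: continuous_on_compose2[OF zc[of UNIV]] continuous_intros)
    then show ?thesis by (simp add: case_prod_unfold)
  qed
  have leibniz: "((\<lambda>t. integral (cbox 0 1) (\<lambda>\<theta>. F (z \<theta>) t / s (z \<theta>))) has_vector_derivative
      integral (cbox 0 1) (\<lambda>\<theta>. F' (z \<theta>) t / s (z \<theta>))) (at t)"
    if "\<And>\<nu> t. (F \<nu> has_vector_derivative F' \<nu> t) (at t)"
      "\<And>t. (\<lambda>\<theta>. F (z \<theta>) t / s (z \<theta>)) integrable_on cbox 0 1"
      "continuous_on UNIV (\<lambda>(\<nu>, t). F' \<nu> t)" for F F' :: "complex \<Rightarrow> real \<Rightarrow> complex" and t :: real
  proof -
    have "((\<lambda>t. integral (cbox 0 1) (\<lambda>\<theta>. F (z \<theta>) t / s (z \<theta>))) has_vector_derivative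
      integral (cbox 0 1) (\<lambda>\<theta>. F' (z \<theta>) t / s (z \<theta>))) (at t within UNIV)"
    proof (rule leibniz_rule_vector_derivative)
      show "((\<lambda>t. F (z \<theta>) t / s (z \<theta>)) has_vector_derivative F' (z \<theta>) t / s (z \<theta>)) (at t within UNIV)" for t \<theta>
        using that(1) by (intro has_vector_derivative_divide) auto
      show "continuous_on (UNIV \<times> cbox 0 1) (\<lambda>(t, \<theta>). F' (z \<theta>) t / s (z \<theta>))"
        using continuous_on_divide[OF cz[OF that(3)] cs] sz by (simp add: case_prod_unfold)
    qed (use that(2) in auto)
    then show ?thesis by simp
  qed
  have int: "integral (cbox 0 1) (\<lambda>\<theta>. N (z \<theta>) t / s (z \<theta>)) = G t m"
    "(\<lambda>\<theta>. N (z \<theta>) t / s (z \<theta>)) integrable_on cbox 0 1"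
    "integral (cbox 0 1) (\<lambda>\<theta>. N' (z \<theta>) t / s (z \<theta>)) = G' t m"
    "(\<lambda>\<theta>. N' (z \<theta>) t / s (z \<theta>)) integrable_on cbox 0 1" for t
    using mv[OF G(1)[of t] G(2)] mv[OF G'(1)[of t] G'(2)]
    by (auto simp: integrable_on_def)
  have int2: "integral (cbox 0 1) (\<lambda>\<theta>. P (z \<theta>) t * N (z \<theta>) t / s (z \<theta>)) = P m t * G t m" for t
  proof -
    have "((\<lambda>\<theta>. P (z \<theta>) t * N (z \<theta>) t / s (z \<theta>)) has_integral P m t * G t m) {0..1}"
      by (rule mv[of "\<lambda>\<nu>. P \<nu> t * G t \<nu>" "\<lambda>\<nu>. P \<nu> t * N \<nu> t / s \<nu>"])
        (use G hol in \<open>auto intro!: holomorphic_intros\<close>)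
    then show ?thesis by auto
  qed
  have cPN: "continuous_on UNIV (\<lambda>(\<nu>, t). P \<nu> t * N \<nu> t)"
    using continuous_on_mult[OF cont(3) cont(1)] by (simp add: case_prod_unfold)
  show ?thesis
  proof (rule exI[of _ "\<lambda>t. G t m"], rule exI[of _ "\<lambda>t. G' t m"], intro allI conjI)
    fix t
    show "((\<lambda>\<nu>. N \<nu> t / s \<nu>) \<longlongrightarrow> G t m) (at m)" by (rule lim[OF G])
    show "((\<lambda>\<nu>. N' \<nu> t / s \<nu>) \<longlongrightarrow> G' t m) (at m)" by (rule lim[OF G'])
    show "((\<lambda>t. G t m) has_vector_derivative G' t m) (at t)"
      using leibniz[OF der(1) int(2) cont(2), of t] unfolding int .
    show "((\<lambda>t. G' t m) has_vector_derivative P m t * G t m) (at t)"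
      using leibniz[OF der(2) int(4) cPN, of t] unfolding int int2 .
  qed
qed

section \<open>Linear second-order equations: solutions and fundamental systems\<close>

text \<open>The values lie in any real normed field, so that real solutions and complex solutions
  for the same real potential share one theory.\<close>

definition sol :: "real set \<Rightarrow> (real \<Rightarrow> real) \<Rightarrow> (real \<Rightarrow> 'a::real_normed_field) \<Rightarrow> (real \<Rightarrow> 'a) \<Rightarrow> bool" where
  "sol J q y y' \<longleftrightarrow> (\<forall>t\<in>J. (y has_vector_derivative y' t) (at t) \<and> (y' has_vector_derivative q t *\<^sub>R y t) (at t))"

text \<open>\<open>D\<close> may be disconnected, as \<open>- {0}\<close> is. The Wronskian is
  therefore required to be nonzero at each point, and representation by constants is claimed later
  only on intervals within \<open>D\<close>.\<close>

definition fund :: "real set \<Rightarrow> (real \<Rightarrow> real) \<Rightarrow> (real \<Rightarrow> 'a::real_normed_field) \<Rightarrow> (real \<Rightarrow> 'a) \<Rightarrow> bool" where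
  "fund D q f g \<longleftrightarrow> (\<exists>f' g'. sol D q f f' \<and> sol D q g g' \<and> (\<forall>t\<in>D. f t * g' t - f' t * g t \<noteq> 0))"

lemma sol_subset: "sol D q y y' \<Longrightarrow> J \<subseteq> D \<Longrightarrow> sol J q y y'"
  by (auto simp: sol_def)

lemma sol_cong:
  assumes "sol D q y y'" "\<And>t. t \<in> D \<Longrightarrow> q t = q2 t"
  shows "sol D q2 y y'"
  using assms by (auto simp: sol_def)

lemma fund_cong: "fund D q f g \<Longrightarrow> (\<And>t. t \<in> D \<Longrightarrow> q t = q2 t) \<Longrightarrow> fund D q2 f g"
  unfolding fund_def using sol_cong by blast

lemma open_interval_convex: "open_interval J \<Longrightarrow> convex J"
  by (simp add: open_interval_def is_interval_connected_1[symmetric] is_interval_convex_1)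

lemma zero_derivative_const:
  fixes f :: "real \<Rightarrow> 'a::real_normed_vector"
  assumes "open_interval J" "\<And>t. t \<in> J \<Longrightarrow> (f has_vector_derivative 0) (at t)" "s \<in> J" "t \<in> J"
  shows "f s = f t"
proof -
  have "(f has_derivative (\<lambda>h. 0)) (at t within J)" if "t \<in> J" for t
    using assms(2)[OF that] by (simp add: has_vector_derivative_def has_derivative_at_withinI)
  then show ?thesis
    using has_derivative_zero_unique[OF open_interval_convex[OF assms(1)]] assms(3,4) by metis
qed

lemma sol_wronskian_const:
  assumes "open_interval J" "sol J q f f'" "sol J q g g'" "s \<in> J" "t \<in> J"
  shows "f s * g' s - f' s * g s = f t * g' t - f' t * g t"
proof (rule zero_derivative_const[OF assms(1) _ assms(4,5)])
  fix t assume t: "t \<in> J"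
  have "((\<lambda>t. f t * g' t - f' t * g t) has_vector_derivative
      (f t * (q t *\<^sub>R g t) + f' t * g' t) - (f' t * g' t + (q t *\<^sub>R f t) * g t)) (at t)"
    using assms(2,3) t unfolding sol_def
    by (intro has_vector_derivative_diff has_vector_derivative_mult) auto
  then show "((\<lambda>t. f t * g' t - f' t * g t) has_vector_derivative 0) (at t)" by simp
qed

text \<open>Cramer's rule: the coefficients are quotients of Wronskians of \<open>y\<close> with
  \<open>f\<close> and \<open>g\<close>, all of which are constant on the interval.\<close>

lemma fund_rep:
  assumes "open_interval J" "J \<subseteq> D" "fund D q f g" "sol J q y y'"
  obtains a b where "\<And>t. t \<in> J \<Longrightarrow> y t = a * f t + b * g t"
proof -
  from assms(2,3) obtain f' g' where fg: "sol J q f f'" "sol J q g g'" "\<And>t. t \<in> J \<Longrightarrow> f t * g' t - f' t * g t \<noteq> 0"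
    unfolding fund_def using sol_subset by blast
  obtain s where s: "s \<in> J" using assms(1) by (auto simp: open_interval_def)
  define w where "w = f s * g' s - f' s * g s"
  have "y t = ((y s * g' s - y' s * g s) / w) * f t + (- (y s * f' s - y' s * f s) / w) * g t" if t: "t \<in> J" for t
  proof -
    have w: "w = f t * g' t - f' t * g t" "w \<noteq> 0"
      unfolding w_def using sol_wronskian_const[OF assms(1) fg(1,2) s t] fg(3)[OF s] by auto
    have e: "y s * g' s - y' s * g s = y t * g' t - y' t * g t" "y s * f' s - y' s * f s = y t * f' t - y' t * f t"
      by (rule sol_wronskian_const[OF assms(1,4) fg(2) s t] sol_wronskian_const[OF assms(1,4) fg(1) s t])+
    have "y t * w = (y t * g' t - y' t * g t) * f t - (y t * f' t - y' t * f t) * g t"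
      unfolding w(1) by (simp add: algebra_simps)
    then have "y t = ((y t * g' t - y' t * g t) * f t - (y t * f' t - y' t * f t) * g t) / w"
      using w(2) by (simp add: eq_divide_eq)
    moreover have "(U * f t - V * g t) / w = U / w * f t + - V / w * g t" for U V
      by (simp add: diff_divide_distrib)
    ultimately show ?thesis unfolding e by simp
  qed
  then show ?thesis using that by blast
qed

lemma has_vector_derivative_transform_open:
  assumes "(f has_vector_derivative f') (at t)" "open J" "t \<in> J" "\<And>s. s \<in> J \<Longrightarrow> f s = g s"
  shows "(g has_vector_derivative f') (at t)"
  using assms unfolding has_vector_derivative_def by (metis has_derivative_transform_within_open)

lemma sol_lincomb:
  assumes "sol J q f f'" "sol J q g g'"
  shows "sol J q (\<lambda>t. a * f t + b * g t) (\<lambda>t. a * f' t + b * g' t)"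
  unfolding sol_def
proof (intro ballI conjI)
  fix t assume t: "t \<in> J"
  show "((\<lambda>t. a * f t + b * g t) has_vector_derivative a * f' t + b * g' t) (at t)"
    using assms t by (intro has_vector_derivative_add has_vector_derivative_mult_right) (auto simp: sol_def)
  have "((\<lambda>t. a * f' t + b * g' t) has_vector_derivative a * (q t *\<^sub>R f t) + b * (q t *\<^sub>R g t)) (at t)"
    using assms t by (intro has_vector_derivative_add has_vector_derivative_mult_right) (auto simp: sol_def)
  then show "((\<lambda>t. a * f' t + b * g' t) has_vector_derivative q t *\<^sub>R (a * f t + b * g t)) (at t)"
    by (simp add: scaleR_add_right)
qed

text \<open>Differentiation of the relation gives a second linear equation for \<open>a\<close> and
  \<open>b\<close>; the determinant of the two is the Wronskian.\<close>

lemma fund_coeff_zero: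
  assumes "open_interval J" "J \<subseteq> D" "fund D q f g" "\<And>t. t \<in> J \<Longrightarrow> a * f t + b * g t = 0"
  shows "a = 0 \<and> b = 0"
proof -
  from assms(2,3) obtain f' g' where fg: "sol J q f f'" "sol J q g g'" "\<And>t. t \<in> J \<Longrightarrow> f t * g' t - f' t * g t \<noteq> 0"
    unfolding fund_def using sol_subset by blast
  obtain s where s: "s \<in> J" "open J" using assms(1) by (auto simp: open_interval_def)
  have "((\<lambda>t. a * f t + b * g t) has_vector_derivative a * f' s + b * g' s) (at s)"
    using sol_lincomb[OF fg(1,2)] s by (simp add: sol_def)
  moreover have "((\<lambda>t. a * f t + b * g t) has_vector_derivative 0) (at s)"
    by (rule has_vector_derivative_transform_open[OF has_vector_derivative_const s(2,1)]) (simp add: assms(4))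
  ultimately have d: "a * f' s + b * g' s = 0" using vector_derivative_unique_at by blast
  have z: "a * f s + b * g s = 0" using assms(4) s by blast
  have "a * (f s * g' s - f' s * g s) = (a * f s + b * g s) * g' s - (a * f' s + b * g' s) * g s"
    "b * (f s * g' s - f' s * g s) = f s * (a * f' s + b * g' s) - f' s * (a * f s + b * g s)"
    by (simp_all add: algebra_simps)
  then show ?thesis using d z fg(3)[OF s(1)] by simp
qed

lemma fund_coeff_unique:
  assumes "open_interval J" "J \<subseteq> D" "fund D q f g" "\<And>t. t \<in> J \<Longrightarrow> a * f t + b * g t = c * f t + d * g t"
  shows "a = c \<and> b = d"
proof -
  have "(a - c) * f t + (b - d) * g t = 0" if "t \<in> J" for t
    using assms(4)[OF that] by (simp add: algebra_simps)
  from fund_coeff_zero[OF assms(1-3) this] show ?thesis by simp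
qed

lemma has_derivative_abs_argument:
  fixes f :: "real \<Rightarrow> real"
  assumes "x \<noteq> 0" "(f has_real_derivative d) (at \<bar>x\<bar>)"
  shows "((\<lambda>x. f \<bar>x\<bar>) has_real_derivative sgn x * d) (at x)"
proof (cases "x > 0")
  case True
  then have "(f has_real_derivative d) (at x)" using assms by simp
  then have "((\<lambda>x. f \<bar>x\<bar>) has_real_derivative d) (at x)"
    by (rule has_field_derivative_transform_within_open[of _ _ _ "{0<..}"]) (use True in auto)
  then show ?thesis using True by simp
next
  case False
  then have x: "x < 0" using assms(1) by simp
  then have "(f has_real_derivative d) (at (- x))" using assms by simp
  then have "((\<lambda>x. f (- x)) has_real_derivative d * - 1) (at x)"
    by (rule DERIV_chain2) (auto intro!: derivative_eq_intros)
  then have "((\<lambda>x. f \<bar>x\<bar>) has_real_derivative d * - 1) (at x)"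
    by (rule has_field_derivative_transform_within_open[of _ _ _ "{..<0}"]) (use x in auto)
  then show ?thesis using x by simp
qed

lemma ln_abs_deriv: "x \<noteq> 0 \<Longrightarrow> ((\<lambda>x. ln \<bar>x\<bar>) has_real_derivative 1 / x) (at x)" for x :: real
  using has_derivative_abs_argument[of x ln "1 / \<bar>x\<bar>"] DERIV_ln_divide[of "\<bar>x\<bar>"]
  by (simp add: sgn_if split: if_splits)

lemma sqrt_abs_deriv: "x \<noteq> 0 \<Longrightarrow> ((\<lambda>x. sqrt \<bar>x\<bar>) has_real_derivative sqrt \<bar>x\<bar> / (2 * x)) (at x)" for x :: real
proof -
  assume x: "x \<noteq> 0"
  have "inverse (sqrt \<bar>x\<bar>) = sqrt \<bar>x\<bar> / \<bar>x\<bar>" using sqrt_divide_self_eq[of "\<bar>x\<bar>"] by simp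
  then have "sgn x * (inverse (sqrt \<bar>x\<bar>) / 2) = sqrt \<bar>x\<bar> / (2 * x)"
    using x by (auto simp: sgn_if)
  then show ?thesis
    using has_derivative_abs_argument[OF x DERIV_real_sqrt] x by (simp add: mult.commute)
qed

text \<open>The logarithmic change of variable turns \<open>Y'' = P Y\<close> into an equation with a double pole.\<close>
lemma sol_lift:
  fixes Y :: "real \<Rightarrow> 'a::real_normed_field"
  assumes "sol UNIV P Y Y'"
  shows "sol (- {0}) (\<lambda>x. (4 * P (2 * ln \<bar>x\<bar> + d) - 1 / 4) / x\<^sup>2)
    (\<lambda>x. sqrt \<bar>x\<bar> *\<^sub>R Y (2 * ln \<bar>x\<bar> + d))
    (\<lambda>x. (sqrt \<bar>x\<bar> / x) *\<^sub>R ((1 / 2) *\<^sub>R Y (2 * ln \<bar>x\<bar> + d) + 2 *\<^sub>R Y' (2 * ln \<bar>x\<bar> + d)))"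
  unfolding sol_def
proof (intro ballI)
  fix x :: real assume "x \<in> - {0}"
  then have x: "x \<noteq> 0" by simp
  let ?L = "2 * ln \<bar>x\<bar> + d" and ?S = "sqrt \<bar>x\<bar>"
  have L: "((\<lambda>x. 2 * ln \<bar>x\<bar> + d) has_vector_derivative 2 / x) (at x)"
    using DERIV_add[OF DERIV_cmult[OF ln_abs_deriv[OF x], of 2] DERIV_const[of d]]
    by (simp add: has_real_derivative_iff_has_vector_derivative)
  have Yd: "((\<lambda>x. Y (2 * ln \<bar>x\<bar> + d)) has_vector_derivative (2 / x) *\<^sub>R Y' ?L) (at x)"
    "((\<lambda>x. Y' (2 * ln \<bar>x\<bar> + d)) has_vector_derivative (2 / x) *\<^sub>R (P ?L *\<^sub>R Y ?L)) (at x)"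
    using vector_diff_chain_at[OF L, of Y "Y' ?L"] vector_diff_chain_at[OF L, of Y' "P ?L *\<^sub>R Y ?L"] assms
    unfolding sol_def o_def by blast+
  have sc: "((\<lambda>x. c *\<^sub>R h x) has_vector_derivative c *\<^sub>R h') (at x)" if "(h has_vector_derivative h') (at x)"
    for c h and h' :: 'a
    by (rule bounded_linear.has_vector_derivative[OF bounded_linear_scaleR_right that])
  have S: "((\<lambda>x. sqrt \<bar>x\<bar> / x) has_real_derivative - ?S / (2 * x\<^sup>2)) (at x)"
    by (rule derivative_eq_intros sqrt_abs_deriv[OF x] refl x)+ (use x in \<open>simp add: field_simps power2_eq_square\<close>)
  have "((\<lambda>x. sqrt \<bar>x\<bar> *\<^sub>R Y (2 * ln \<bar>x\<bar> + d)) has_vector_derivative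
      ?S *\<^sub>R ((2 / x) *\<^sub>R Y' ?L) + (?S / (2 * x)) *\<^sub>R Y ?L) (at x)"
    by (intro has_vector_derivative_scaleR sqrt_abs_deriv[OF x] Yd)
  moreover have "((\<lambda>x. (sqrt \<bar>x\<bar> / x) *\<^sub>R ((1 / 2) *\<^sub>R Y (2 * ln \<bar>x\<bar> + d) + 2 *\<^sub>R Y' (2 * ln \<bar>x\<bar> + d))) has_vector_derivative
      (?S / x) *\<^sub>R ((1 / 2) *\<^sub>R ((2 / x) *\<^sub>R Y' ?L) + 2 *\<^sub>R ((2 / x) *\<^sub>R (P ?L *\<^sub>R Y ?L)))
      + (- ?S / (2 * x\<^sup>2)) *\<^sub>R ((1 / 2) *\<^sub>R Y ?L + 2 *\<^sub>R Y' ?L)) (at x)"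
    by (rule has_vector_derivative_scaleR[OF S has_vector_derivative_add[OF sc[OF Yd(1)] sc[OF Yd(2)]]])
  moreover have "?S *\<^sub>R ((2 / x) *\<^sub>R Y' ?L) + (?S / (2 * x)) *\<^sub>R Y ?L =
      (?S / x) *\<^sub>R ((1 / 2) *\<^sub>R Y ?L + 2 *\<^sub>R Y' ?L)"
    by (simp add: scaleR_add_right)
  moreover have "(?S / x) *\<^sub>R ((1 / 2) *\<^sub>R ((2 / x) *\<^sub>R Y' ?L) + 2 *\<^sub>R ((2 / x) *\<^sub>R (P ?L *\<^sub>R Y ?L)))
      + (- ?S / (2 * x\<^sup>2)) *\<^sub>R ((1 / 2) *\<^sub>R Y ?L + 2 *\<^sub>R Y' ?L)
      = ((4 * P ?L - 1 / 4) / x\<^sup>2) *\<^sub>R (?S *\<^sub>R Y ?L)"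
  proof -
    have f: "(?S / x) * (4 / x) * P ?L + (- ?S / (2 * x\<^sup>2)) * (1 / 2) = (4 * P ?L - 1 / 4) / x\<^sup>2 * ?S"
      "(?S / x) * (1 / x) + (- ?S / (2 * x\<^sup>2)) * 2 = 0"
      using x by (simp_all add: field_simps power2_eq_square)
    have gen: "k *\<^sub>R ((1 / 2) *\<^sub>R ((2 / x) *\<^sub>R A) + 2 *\<^sub>R ((2 / x) *\<^sub>R (p *\<^sub>R B))) + m *\<^sub>R ((1 / 2) *\<^sub>R B + 2 *\<^sub>R A)
      = (k * (1 / x) + m * 2) *\<^sub>R A + (k * (4 / x) * p + m * (1 / 2)) *\<^sub>R B" for k m p :: real and A B :: 'a
      by (simp add: scaleR_add_right scaleR_add_left mult_ac)
    show ?thesis unfolding gen f by simp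
  qed
  ultimately show "((\<lambda>x. sqrt \<bar>x\<bar> *\<^sub>R Y (2 * ln \<bar>x\<bar> + d)) has_vector_derivative
        (?S / x) *\<^sub>R ((1 / 2) *\<^sub>R Y ?L + 2 *\<^sub>R Y' ?L)) (at x) \<and>
     ((\<lambda>x. (sqrt \<bar>x\<bar> / x) *\<^sub>R ((1 / 2) *\<^sub>R Y (2 * ln \<bar>x\<bar> + d) + 2 *\<^sub>R Y' (2 * ln \<bar>x\<bar> + d)))
        has_vector_derivative ((4 * P ?L - 1 / 4) / x\<^sup>2) *\<^sub>R (?S *\<^sub>R Y ?L)) (at x)"
    by simp
qed

text \<open>The change of variable multiplies the Wronskian by \<open>2 * sgn x\<close>. The doubled
  logarithm is the logarithm of \<open>x\<^sup>2\<close>, which suits series in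
  \<open>(x / 2)\<^sup>2\<close> and in \<open>x\<^sup>2\<close>; the shift \<open>d\<close> takes
  up the constant factor.\<close>

lemma fund_lift:
  fixes Y Z :: "real \<Rightarrow> 'a::real_normed_field"
  assumes "fund UNIV P Y Z" "\<And>x. x \<noteq> 0 \<Longrightarrow> q x = (4 * P (2 * ln \<bar>x\<bar> + d) - 1 / 4) / x\<^sup>2"
  shows "fund (- {0}) q (\<lambda>x. sqrt \<bar>x\<bar> *\<^sub>R Y (2 * ln \<bar>x\<bar> + d)) (\<lambda>x. sqrt \<bar>x\<bar> *\<^sub>R Z (2 * ln \<bar>x\<bar> + d))"
proof -
  from assms(1) obtain Y' Z' where YZ: "sol UNIV P Y Y'" "sol UNIV P Z Z'" "\<And>t. Y t * Z' t - Y' t * Z t \<noteq> 0"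
    by (auto simp: fund_def)
  have "fund (- {0}) (\<lambda>x. (4 * P (2 * ln \<bar>x\<bar> + d) - 1 / 4) / x\<^sup>2)
    (\<lambda>x. sqrt \<bar>x\<bar> *\<^sub>R Y (2 * ln \<bar>x\<bar> + d)) (\<lambda>x. sqrt \<bar>x\<bar> *\<^sub>R Z (2 * ln \<bar>x\<bar> + d))"
    unfolding fund_def
  proof (intro exI conjI, rule sol_lift[OF YZ(1)], rule sol_lift[OF YZ(2)], intro ballI)
    fix x :: real assume "x \<in> - {0}"
    then have x: "x \<noteq> 0" by simp
    let ?L = "2 * ln \<bar>x\<bar> + d" and ?S = "sqrt \<bar>x\<bar>"
    have "?S *\<^sub>R Y ?L * ((?S / x) *\<^sub>R ((1 / 2) *\<^sub>R Z ?L + 2 *\<^sub>R Z' ?L))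
        - (?S / x) *\<^sub>R ((1 / 2) *\<^sub>R Y ?L + 2 *\<^sub>R Y' ?L) * (?S *\<^sub>R Z ?L)
      = (?S * (?S / x) * 2) *\<^sub>R (Y ?L * Z' ?L - Y' ?L * Z ?L)"
    proof -
      have "s *\<^sub>R A * (k *\<^sub>R ((1 / 2) *\<^sub>R B + 2 *\<^sub>R B')) - k *\<^sub>R ((1 / 2) *\<^sub>R A + 2 *\<^sub>R A') * (s *\<^sub>R B)
        = (s * k * 2) *\<^sub>R (A * B' - A' * B)" for s k :: real and A A' B B' :: 'a
        by (simp add: scaleR_conv_of_real algebra_simps)
      then show ?thesis .
    qed
    moreover have "?S * (?S / x) * 2 \<noteq> 0" using x by simp
    ultimately show "?S *\<^sub>R Y ?L * ((?S / x) *\<^sub>R ((1 / 2) *\<^sub>R Z ?L + 2 *\<^sub>R Z' ?L))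
        - (?S / x) *\<^sub>R ((1 / 2) *\<^sub>R Y ?L + 2 *\<^sub>R Y' ?L) * (?S *\<^sub>R Z ?L) \<noteq> 0"
      using YZ(3)[of ?L] by (simp only: scaleR_eq_0_iff) blast
  qed
  then show ?thesis by (rule fund_cong) (use assms(2) in auto)
qed

lemma sol_linear:
  assumes h: "bounded_linear h" and Y: "sol D q Y Y'"
  shows "sol D q (\<lambda>t. h (Y t)) (\<lambda>t. h (Y' t))"
  unfolding sol_def
proof (intro ballI conjI)
  fix t assume t: "t \<in> D"
  show "((\<lambda>t. h (Y t)) has_vector_derivative h (Y' t)) (at t)"
    using bounded_linear.has_vector_derivative[OF h] Y t by (auto simp: sol_def)
  have "((\<lambda>t. h (Y' t)) has_vector_derivative h (q t *\<^sub>R Y t)) (at t)"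
    using bounded_linear.has_vector_derivative[OF h] Y t by (auto simp: sol_def)
  then show "((\<lambda>t. h (Y' t)) has_vector_derivative q t *\<^sub>R h (Y t)) (at t)"
    by (simp add: linear_scale[OF bounded_linear.linear[OF h]])
qed

lemma sol_Re_Im:
  fixes Y :: "real \<Rightarrow> complex"
  assumes "sol D q Y Y'"
  shows "sol D q (\<lambda>t. Re (Y t)) (\<lambda>t. Re (Y' t))" "sol D q (\<lambda>t. Im (Y t)) (\<lambda>t. Im (Y' t))"
    "sol D q (\<lambda>t. cnj (Y t)) (\<lambda>t. cnj (Y' t))"
  by (rule sol_linear[OF bounded_linear_Re assms] sol_linear[OF bounded_linear_Im assms]
      sol_linear[OF bounded_linear_cnj assms])+

lemma sol_of_real: "sol D q y y' \<Longrightarrow> sol D q (\<lambda>t. complex_of_real (y t)) (\<lambda>t. complex_of_real (y' t))"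
  by (rule sol_linear[OF bounded_linear_of_real])

text \<open>The Wronskian of \<open>Y\<close> with its conjugate is \<open>- 2 * \<i>\<close> times
  that of the real and imaginary parts.\<close>

lemma fund_Re_Im:
  fixes Y :: "real \<Rightarrow> complex"
  assumes "fund D q Y (\<lambda>t. cnj (Y t))"
  shows "fund D q (\<lambda>t. Re (Y t)) (\<lambda>t. Im (Y t))"
proof -
  from assms obtain Y' Z' where YZ: "sol D q Y Y'" "sol D q (\<lambda>t. cnj (Y t)) Z'"
    "\<And>t. t \<in> D \<Longrightarrow> Y t * Z' t - Y' t * cnj (Y t) \<noteq> 0"
    by (auto simp: fund_def)
  have "Re (Y t) * Im (Y' t) - Re (Y' t) * Im (Y t) \<noteq> 0" if "t \<in> D" for t
  proof -
    have "Z' t = cnj (Y' t)"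
      using YZ(2) sol_Re_Im(3)[OF YZ(1)] that vector_derivative_unique_at unfolding sol_def by blast
    with YZ(3)[OF that] show ?thesis by (auto simp: complex_eq_iff algebra_simps)
  qed
  then show ?thesis using sol_Re_Im(1,2)[OF YZ(1)] by (auto simp: fund_def)
qed

section \<open>Numerators of the connection formulas and the Wronskians of their limits\<close>

text \<open>The second solutions are quotients of such a combination by
  \<open>sin (pi * \<nu>)\<close>. The coefficient functions \<open>l1\<close> and \<open>l2\<close>
  depend on the order and characterise the special function.\<close>

definition NN :: "complex \<Rightarrow> complex \<Rightarrow> (complex \<Rightarrow> complex) \<Rightarrow> (complex \<Rightarrow> complex) \<Rightarrow> complex \<Rightarrow> complex \<Rightarrow> complex" where
  "NN b c l1 l2 \<nu> L = l1 \<nu> * HH b c \<nu> L + l2 \<nu> * HH b c (- \<nu>) L"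

definition NN' :: "complex \<Rightarrow> complex \<Rightarrow> (complex \<Rightarrow> complex) \<Rightarrow> (complex \<Rightarrow> complex) \<Rightarrow> complex \<Rightarrow> complex \<Rightarrow> complex" where
  "NN' b c l1 l2 \<nu> L = l1 \<nu> * HH' b c \<nu> L + l2 \<nu> * HH' b c (- \<nu>) L"

lemma HH_minus_holomorphic: "(\<lambda>\<nu>. HH b c (- \<nu>) L) holomorphic_on S" "(\<lambda>\<nu>. HH' b c (- \<nu>) L) holomorphic_on S"
proof -
  have "(\<lambda>\<nu>. - \<nu>) holomorphic_on S" by (intro holomorphic_intros)
  from holomorphic_on_compose_gen[OF this HH_holomorphic[of _ _ _ UNIV]]
    holomorphic_on_compose_gen[OF this HH'_holomorphic[of _ _ _ UNIV]]
  show "(\<lambda>\<nu>. HH b c (- \<nu>) L) holomorphic_on S" "(\<lambda>\<nu>. HH' b c (- \<nu>) L) holomorphic_on S"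
    by (simp_all add: o_def)
qed

lemma HH_line_deriv:
  "((\<lambda>t. HH b c \<nu> (of_real t + \<theta>)) has_vector_derivative HH' b c \<nu> (of_real t + \<theta>)) (at t)"
  "((\<lambda>t. HH' b c \<nu> (of_real t + \<theta>)) has_vector_derivative pot b c \<nu> (of_real t + \<theta>) * HH b c \<nu> (of_real t + \<theta>)) (at t)"
  by (rule has_vector_derivative_real_field HH_shift_deriv)+

lemma pot_minus: "pot b c (- \<nu>) L = pot b c \<nu> L"
  by (simp add: pot_def)

lemma NN_line_deriv:
  "((\<lambda>t. NN b c l1 l2 \<nu> (of_real t + \<theta>)) has_vector_derivative NN' b c l1 l2 \<nu> (of_real t + \<theta>)) (at t)"
  "((\<lambda>t. NN' b c l1 l2 \<nu> (of_real t + \<theta>)) has_vector_derivative pot b c \<nu> (of_real t + \<theta>) * NN b c l1 l2 \<nu> (of_real t + \<theta>)) (at t)"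
proof -
  show "((\<lambda>t. NN b c l1 l2 \<nu> (of_real t + \<theta>)) has_vector_derivative NN' b c l1 l2 \<nu> (of_real t + \<theta>)) (at t)"
    unfolding NN_def NN'_def
    by (intro has_vector_derivative_add has_vector_derivative_mult_right HH_line_deriv)
  have "((\<lambda>t. NN' b c l1 l2 \<nu> (of_real t + \<theta>)) has_vector_derivative
     l1 \<nu> * (pot b c \<nu> (of_real t + \<theta>) * HH b c \<nu> (of_real t + \<theta>))
     + l2 \<nu> * (pot b c (- \<nu>) (of_real t + \<theta>) * HH b c (- \<nu>) (of_real t + \<theta>))) (at t)"
    unfolding NN'_def
    by (intro has_vector_derivative_add has_vector_derivative_mult_right HH_line_deriv)
  then show "((\<lambda>t. NN' b c l1 l2 \<nu> (of_real t + \<theta>)) has_vector_derivative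
      pot b c \<nu> (of_real t + \<theta>) * NN b c l1 l2 \<nu> (of_real t + \<theta>)) (at t)"
    by (simp add: NN_def pot_minus algebra_simps)
qed

lemma sin_pi_eq_0_iff: "sin (of_real pi * \<nu>) = 0 \<longleftrightarrow> (\<nu> :: complex) \<in> \<int>"
proof -
  have "sin (of_real pi * \<nu>) = 0 \<longleftrightarrow> (\<exists>n::int. of_real pi * \<nu> = of_real (n * pi))"
    using sin_eq_0[of "of_real pi * \<nu>"] by simp
  also have "\<dots> \<longleftrightarrow> (\<exists>n::int. \<nu> = of_int n)" by (simp add: mult.commute)
  finally show ?thesis by (auto simp: Ints_def)
qed

lemma sin_pi_isolated:
  obtains r where "r > 0" "\<And>\<nu>. \<nu> \<in> ball m r \<Longrightarrow> \<nu> \<noteq> m \<Longrightarrow> sin (of_real pi * \<nu> :: complex) \<noteq> 0"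
proof (cases "m \<in> \<int>")
  case True
  then obtain k where k: "m = of_int k" by (auto elim: Ints_cases)
  show ?thesis
  proof (rule that[of 1])
    fix \<nu> assume n: "\<nu> \<in> ball m 1" "\<nu> \<noteq> m"
    show "sin (of_real pi * \<nu> :: complex) \<noteq> 0"
      unfolding sin_pi_eq_0_iff
    proof
      assume "\<nu> \<in> \<int>"
      then obtain j where j: "\<nu> = of_int j" by (auto elim: Ints_cases)
      have "norm (of_int (k - j) :: complex) < 1" using n(1) unfolding k j by (simp add: dist_norm)
      then have "k = j" unfolding norm_of_int by linarith
      then show False using n k j by simp
    qed
  qed simp
next
  case False
  then have "sin (of_real pi * m) \<noteq> 0" by (simp add: sin_pi_eq_0_iff)
  moreover have "isCont (\<lambda>\<nu>. sin (of_real pi * \<nu> :: complex)) m" by (intro continuous_intros)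
  ultimately have "\<exists>e>0. \<forall>y. dist m y < e \<longrightarrow> sin (of_real pi * y) \<noteq> 0"
    using continuous_at_avoid by blast
  then show ?thesis using that by (auto simp: ball_def)
qed

text \<open>At order \<open>n\<close> the function of order \<open>- n\<close> is a multiple of that
  of order \<open>n\<close>, and \<open>int\<close> says that the total factor is 0. The numerator
  then vanishes identically in \<open>t\<close> where the sine has its simple zero.
  \<open>Re \<nu>0 \<ge> 0\<close> makes every integer order a natural number.\<close>

lemma HH_limit:
  assumes l: "l1 holomorphic_on UNIV" "l2 holomorphic_on UNIV" and nu: "Re \<nu>0 \<ge> 0"
    and int: "\<And>n. \<nu>0 = of_nat n \<Longrightarrow>
      l1 (of_nat n) + l2 (of_nat n) * (\<Prod>j<n. b - c * of_nat n / 2 + c * of_nat j) = 0"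
  shows "\<exists>Y Y'. \<forall>t. ((\<lambda>\<nu>. NN b c l1 l2 \<nu> (of_real t + \<theta>) / sin (of_real pi * \<nu>)) \<longlongrightarrow> Y t) (at \<nu>0) \<and>
     ((\<lambda>\<nu>. NN' b c l1 l2 \<nu> (of_real t + \<theta>) / sin (of_real pi * \<nu>)) \<longlongrightarrow> Y' t) (at \<nu>0) \<and>
     (Y has_vector_derivative Y' t) (at t) \<and>
     (Y' has_vector_derivative pot b c \<nu>0 (of_real t + \<theta>) * Y t) (at t)"
proof -
  obtain r where r: "r > 0" "\<And>\<nu>. \<nu> \<in> ball \<nu>0 r \<Longrightarrow> \<nu> \<noteq> \<nu>0 \<Longrightarrow> sin (of_real pi * \<nu> :: complex) \<noteq> 0"
    using sin_pi_isolated by blast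
  have lc: "continuous_on S l1" "continuous_on S l2" for S
    using l holomorphic_on_imp_continuous_on continuous_on_subset by blast+
  have lc2: "continuous_on S (\<lambda>x. l1 (f x))" "continuous_on S (\<lambda>x. l2 (f x))" if "continuous_on S f"
    for S :: "(complex \<times> real) set" and f
    by (rule continuous_on_compose2[OF lc(1)[of UNIV] that] continuous_on_compose2[OF lc(2)[of UNIV] that]; simp)+
  have lh: "l1 holomorphic_on S" "l2 holomorphic_on S" for S
    using l holomorphic_on_subset by blast+
  show ?thesis
  proof (rule limit_solves_ode[where r = r and N = "\<lambda>\<nu> t. NN b c l1 l2 \<nu> (of_real t + \<theta>)"
        and N' = "\<lambda>\<nu> t. NN' b c l1 l2 \<nu> (of_real t + \<theta>)" and P = "\<lambda>\<nu> t. pot b c \<nu> (of_real t + \<theta>)"])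
    show "(\<lambda>\<nu>. NN b c l1 l2 \<nu> (of_real t + \<theta>)) holomorphic_on ball \<nu>0 r" for t
      unfolding NN_def by (intro holomorphic_intros lh HH_holomorphic HH_minus_holomorphic)
    show "(\<lambda>\<nu>. NN' b c l1 l2 \<nu> (of_real t + \<theta>)) holomorphic_on ball \<nu>0 r" for t
      unfolding NN'_def by (intro holomorphic_intros lh HH'_holomorphic HH_minus_holomorphic)
    show "(\<lambda>\<nu>. pot b c \<nu> (of_real t + \<theta>)) holomorphic_on ball \<nu>0 r" for t
      unfolding pot_def by (intro holomorphic_intros) auto
    show "continuous_on UNIV (\<lambda>(\<nu>, t). NN b c l1 l2 \<nu> (of_real t + \<theta>))"
      unfolding case_prod_unfold NN_def by (intro continuous_intros lc2 continuous_on_HH2)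
    show "continuous_on UNIV (\<lambda>(\<nu>, t). NN' b c l1 l2 \<nu> (of_real t + \<theta>))"
      unfolding case_prod_unfold NN'_def by (intro continuous_intros lc2 continuous_on_HH2)
    show "continuous_on UNIV (\<lambda>(\<nu>, t). pot b c \<nu> (of_real t + \<theta>))"
      unfolding case_prod_unfold pot_def by (intro continuous_intros) auto
    show "(\<lambda>\<nu>. sin (of_real pi * \<nu>)) holomorphic_on ball \<nu>0 r"
      by (intro holomorphic_intros)
    show "sin (of_real pi * \<nu>0) \<noteq> 0 \<or> deriv (\<lambda>\<nu>. sin (of_real pi * \<nu>)) \<nu>0 \<noteq> 0 \<and>
        (\<forall>t. NN b c l1 l2 \<nu>0 (of_real t + \<theta>) = 0)"
    proof (cases "sin (of_real pi * \<nu>0) = 0")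
      case True
      then obtain k :: int where "\<nu>0 = of_int k" by (auto simp: sin_pi_eq_0_iff elim: Ints_cases)
      then have n: "\<nu>0 = of_nat (nat k)" using nu by (simp add: of_nat_nat)
      have "((\<lambda>\<nu>. sin (of_real pi * \<nu>)) has_field_derivative of_real pi * cos (of_real pi * \<nu>0)) (at \<nu>0)"
        by (auto intro!: derivative_eq_intros)
      then have "deriv (\<lambda>\<nu>. sin (of_real pi * \<nu>)) \<nu>0 = of_real pi * cos (of_real pi * \<nu>0)"
        by (rule DERIV_imp_deriv)
      moreover have "cos (of_real pi * \<nu>0) \<noteq> 0" using sin_cos_squared_add[of "of_real pi * \<nu>0"] True by auto
      moreover have "NN b c l1 l2 \<nu>0 L = 0" for L
      proof -
        have "NN b c l1 l2 \<nu>0 L = (l1 (of_nat (nat k)) + l2 (of_nat (nat k)) *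
            (\<Prod>j<nat k. b - c * of_nat (nat k) / 2 + c * of_nat j)) * HH b c (of_nat (nat k)) L"
          unfolding NN_def n HH_negative_order by (simp add: algebra_simps)
        then show ?thesis using int[OF n] by simp
      qed
      ultimately show ?thesis by simp
    qed simp
  qed (use r NN_line_deriv in auto)
qed

text \<open>Of the four products of orders, the two with equal signs have Wronskian 0; the two with
  opposite signs contribute sines of opposite sign.\<close>

lemma NN_wronskian:
  assumes "b - c / 2 = (b' - c' / 2) * exp \<theta>" "c\<^sup>2 = c'\<^sup>2 * (exp \<theta>)\<^sup>2"
  shows "NN b c l1 l2 \<nu> L * NN' b' c' m1 m2 \<nu> (L + \<theta>) - NN' b c l1 l2 \<nu> L * NN b' c' m1 m2 \<nu> (L + \<theta>)
    = (l2 \<nu> * m1 \<nu> * exp (\<nu> * \<theta> / 2) - l1 \<nu> * m2 \<nu> * exp (- \<nu> * \<theta> / 2)) * sin (of_real pi * \<nu>) / of_real pi"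
proof -
  note o1 = HH_wronskian_opposite[OF assms, of \<nu> L] and o2 = HH_wronskian_opposite[OF assms, of "- \<nu>" L, unfolded minus_minus]
  note s1 = HH_wronskian_same[OF assms, of \<nu> L] and s2 = HH_wronskian_same[OF assms, of "- \<nu>" L]
  have gen: "(a1 * h + a2 * k) * (d1 * h' + d2 * k') - (a1 * g + a2 * f) * (d1 * g' + d2 * f')
    = a1 * d1 * (h * h' - g * g') + a1 * d2 * (h * k' - g * f') + a2 * d1 * (k * h' - f * g') + a2 * d2 * (k * k' - f * f')"
    for a1 a2 d1 d2 h k h' k' g f g' f' :: complex
    by (simp add: algebra_simps)
  show ?thesis unfolding NN_def NN'_def gen o1 o2 s1 s2
    by (simp add: algebra_simps diff_divide_distrib)
qed

text \<open>Near \<open>\<nu>0\<close>, where the sine is nonzero, assumption \<open>w\<close> gives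
  the two quotients the Wronskian \<open>w0\<close>. As functions and derivatives both converge, the
  limits inherit it. The shift \<open>\<theta>\<close> admits a second solution with rotated
  argument, such as a Whittaker function of \<open>- z\<close> next to one of
  \<open>z\<close>.\<close>

lemma HH_fund:
  assumes l: "l1 holomorphic_on UNIV" "l2 holomorphic_on UNIV" "m1 holomorphic_on UNIV" "m2 holomorphic_on UNIV"
    and nu: "Re \<nu>0 \<ge> 0"
    and int: "\<And>n. \<nu>0 = of_nat n \<Longrightarrow>
      l1 (of_nat n) + l2 (of_nat n) * (\<Prod>j<n. b - c * of_nat n / 2 + c * of_nat j) = 0"
      "\<And>n. \<nu>0 = of_nat n \<Longrightarrow>
      m1 (of_nat n) + m2 (of_nat n) * (\<Prod>j<n. b' - c' * of_nat n / 2 + c' * of_nat j) = 0"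
    and rel: "b - c / 2 = (b' - c' / 2) * exp \<theta>" "c\<^sup>2 = c'\<^sup>2 * (exp \<theta>)\<^sup>2"
    and P: "\<And>t. pot b c \<nu>0 (of_real t + \<theta>0) = of_real (P t)"
    and w: "\<And>\<nu>. sin (of_real pi * \<nu>) \<noteq> 0 \<Longrightarrow>
      l2 \<nu> * m1 \<nu> * exp (\<nu> * \<theta> / 2) - l1 \<nu> * m2 \<nu> * exp (- \<nu> * \<theta> / 2) = w0 * of_real pi * sin (of_real pi * \<nu>)"
  shows "\<exists>Y Y' Z Z'. sol UNIV P Y Y' \<and> sol UNIV P Z Z' \<and> (\<forall>t. Y t * Z' t - Y' t * Z t = w0) \<and>
    (\<forall>t. ((\<lambda>\<nu>. NN b c l1 l2 \<nu> (of_real t + \<theta>0) / sin (of_real pi * \<nu>)) \<longlongrightarrow> Y t) (at \<nu>0)) \<and>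
    (\<forall>t. ((\<lambda>\<nu>. NN b' c' m1 m2 \<nu> (of_real t + (\<theta>0 + \<theta>)) / sin (of_real pi * \<nu>)) \<longlongrightarrow> Z t) (at \<nu>0))"
proof -
  from HH_limit[OF l(1,2) nu int(1), of \<theta>0] obtain Y Y' where Y:
    "\<And>t. ((\<lambda>\<nu>. NN b c l1 l2 \<nu> (of_real t + \<theta>0) / sin (of_real pi * \<nu>)) \<longlongrightarrow> Y t) (at \<nu>0)"
    "\<And>t. ((\<lambda>\<nu>. NN' b c l1 l2 \<nu> (of_real t + \<theta>0) / sin (of_real pi * \<nu>)) \<longlongrightarrow> Y' t) (at \<nu>0)"
    "\<And>t. (Y has_vector_derivative Y' t) (at t)"
    "\<And>t. (Y' has_vector_derivative pot b c \<nu>0 (of_real t + \<theta>0) * Y t) (at t)" by blast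
  from HH_limit[OF l(3,4) nu int(2), of "\<theta>0 + \<theta>"] obtain Z Z' where Z:
    "\<And>t. ((\<lambda>\<nu>. NN b' c' m1 m2 \<nu> (of_real t + (\<theta>0 + \<theta>)) / sin (of_real pi * \<nu>)) \<longlongrightarrow> Z t) (at \<nu>0)"
    "\<And>t. ((\<lambda>\<nu>. NN' b' c' m1 m2 \<nu> (of_real t + (\<theta>0 + \<theta>)) / sin (of_real pi * \<nu>)) \<longlongrightarrow> Z' t) (at \<nu>0)"
    "\<And>t. (Z has_vector_derivative Z' t) (at t)"
    "\<And>t. (Z' has_vector_derivative pot b' c' \<nu>0 (of_real t + (\<theta>0 + \<theta>)) * Z t) (at t)" by blast
  have P': "pot b' c' \<nu>0 (of_real t + (\<theta>0 + \<theta>)) = of_real (P t)" for t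
    unfolding P[symmetric] pot_def rel by (simp add: exp_add power_mult_distrib mult_ac)
  have wr: "Y t * Z' t - Y' t * Z t = w0" for t
  proof -
    have "((\<lambda>\<nu>. NN b c l1 l2 \<nu> (of_real t + \<theta>0) / sin (of_real pi * \<nu>) *
          (NN' b' c' m1 m2 \<nu> (of_real t + (\<theta>0 + \<theta>)) / sin (of_real pi * \<nu>)) -
        NN' b c l1 l2 \<nu> (of_real t + \<theta>0) / sin (of_real pi * \<nu>) *
          (NN b' c' m1 m2 \<nu> (of_real t + (\<theta>0 + \<theta>)) / sin (of_real pi * \<nu>))) \<longlongrightarrow> Y t * Z' t - Y' t * Z t) (at \<nu>0)"
      by (intro tendsto_intros Y Z)
    moreover have "((\<lambda>\<nu>. NN b c l1 l2 \<nu> (of_real t + \<theta>0) / sin (of_real pi * \<nu>) *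
          (NN' b' c' m1 m2 \<nu> (of_real t + (\<theta>0 + \<theta>)) / sin (of_real pi * \<nu>)) -
        NN' b c l1 l2 \<nu> (of_real t + \<theta>0) / sin (of_real pi * \<nu>) *
          (NN b' c' m1 m2 \<nu> (of_real t + (\<theta>0 + \<theta>)) / sin (of_real pi * \<nu>))) \<longlongrightarrow> w0) (at \<nu>0)"
    proof (rule tendsto_eventually)
      obtain r where r: "r > 0" "\<And>\<nu>. \<nu> \<in> ball \<nu>0 r \<Longrightarrow> \<nu> \<noteq> \<nu>0 \<Longrightarrow> sin (of_real pi * \<nu> :: complex) \<noteq> 0"
        using sin_pi_isolated by blast
      show "\<forall>\<^sub>F \<nu> in at \<nu>0. NN b c l1 l2 \<nu> (of_real t + \<theta>0) / sin (of_real pi * \<nu>) *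
          (NN' b' c' m1 m2 \<nu> (of_real t + (\<theta>0 + \<theta>)) / sin (of_real pi * \<nu>)) -
        NN' b c l1 l2 \<nu> (of_real t + \<theta>0) / sin (of_real pi * \<nu>) *
          (NN b' c' m1 m2 \<nu> (of_real t + (\<theta>0 + \<theta>)) / sin (of_real pi * \<nu>)) = w0"
        unfolding eventually_at
      proof (intro exI conjI ballI impI, rule r(1))
        fix \<nu> assume "\<nu> \<noteq> \<nu>0 \<and> dist \<nu> \<nu>0 < r"
        then have s: "sin (of_real pi * \<nu>) \<noteq> 0" using r(2) by (simp add: dist_commute)
        show "NN b c l1 l2 \<nu> (of_real t + \<theta>0) / sin (of_real pi * \<nu>) *
          (NN' b' c' m1 m2 \<nu> (of_real t + (\<theta>0 + \<theta>)) / sin (of_real pi * \<nu>)) -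
        NN' b c l1 l2 \<nu> (of_real t + \<theta>0) / sin (of_real pi * \<nu>) *
          (NN b' c' m1 m2 \<nu> (of_real t + (\<theta>0 + \<theta>)) / sin (of_real pi * \<nu>)) = w0"
          using NN_wronskian[OF rel, of l1 l2 \<nu> "of_real t + \<theta>0" m1 m2] s w[OF s]
          by (simp add: add.assoc diff_divide_distrib[symmetric])
      qed
    qed
    ultimately show ?thesis using LIM_unique by blast
  qed
  have "sol UNIV P Y Y'" "sol UNIV P Z Z'"
    using Y(3,4) Z(3,4) unfolding sol_def P P' by (simp_all add: scaleR_conv_of_real)
  then show ?thesis using wr Y(1) Z(1) by blast
qed

section \<open>Two-parameter families of solutions; elementary functions\<close>

text \<open>Makes \<open>a\<close> and \<open>b\<close> the coordinates of a solution while hiding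
  the fundamental pair, so that listed functions are handled through their parameters alone.\<close>

definition family :: "real set \<Rightarrow> (real \<Rightarrow> real) \<Rightarrow> ('a \<Rightarrow> 'a \<Rightarrow> real \<Rightarrow> 'a::real_normed_field) \<Rightarrow> bool" where
  "family D q F \<longleftrightarrow> (\<exists>f g. fund D q f g \<and> (\<forall>a b. \<forall>x\<in>D. F a b x = a * f x + b * g x))"

lemma fund_scale:
  fixes f g :: "real \<Rightarrow> 'a::real_normed_field"
  assumes "fund D q f g" "\<alpha> \<noteq> 0" "\<beta> \<noteq> 0"
  shows "fund D q (\<lambda>x. \<alpha> * f x) (\<lambda>x. \<beta> * g x)"
proof -
  from assms(1) obtain f' g' where fg: "sol D q f f'" "sol D q g g'" "\<And>t. t \<in> D \<Longrightarrow> f t * g' t - f' t * g t \<noteq> 0"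
    by (auto simp: fund_def)
  have "sol D q (\<lambda>x. \<alpha> * f x) (\<lambda>x. \<alpha> * f' x)" "sol D q (\<lambda>x. \<beta> * g x) (\<lambda>x. \<beta> * g' x)"
    using sol_lincomb[OF fg(1,1), of \<alpha> 0] sol_lincomb[OF fg(2,2), of \<beta> 0] by simp_all
  moreover have "\<alpha> * f t * (\<beta> * g' t) - \<alpha> * f' t * (\<beta> * g t) \<noteq> 0" if "t \<in> D" for t
  proof -
    have "\<alpha> * f t * (\<beta> * g' t) - \<alpha> * f' t * (\<beta> * g t) = \<alpha> * \<beta> * (f t * g' t - f' t * g t)"
      by (simp add: algebra_simps)
    then show ?thesis using fg(3)[OF that] assms(2,3) by simp
  qed
  ultimately show ?thesis unfolding fund_def by blast
qed

lemma familyI: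
  assumes "fund D q f g" "\<And>a b x. x \<in> D \<Longrightarrow> F a b x = a * f x + b * g x"
  shows "family D q F"
  using assms unfolding family_def by blast

lemma fund_realI:
  assumes "\<And>t. (f has_real_derivative f' t) (at t)" "\<And>t. (f' has_real_derivative q t * f t) (at t)"
    and "\<And>t. (g has_real_derivative g' t) (at t)" "\<And>t. (g' has_real_derivative q t * g t) (at t)"
    and "\<And>t. f t * g' t - f' t * g t \<noteq> 0"
  shows "fund UNIV q f g"
  unfolding fund_def
proof (intro exI conjI ballI)
  show "sol UNIV q f f'" "sol UNIV q g g'"
    using assms(1-4) by (simp_all add: sol_def flip: has_real_derivative_iff_has_vector_derivative)
qed (rule assms(5))

lemma fund_linear: "fund UNIV (\<lambda>_. 0) (\<lambda>t::real. 1::real) (\<lambda>t. t)"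
  by (rule fund_realI[of _ "\<lambda>_. 0" _ _ "\<lambda>_. 1"]) (auto intro!: derivative_eq_intros)

lemma fund_trig: "\<omega> \<noteq> 0 \<Longrightarrow> fund UNIV (\<lambda>_. - \<omega>\<^sup>2) (\<lambda>t::real. cos (\<omega> * t)) (\<lambda>t. sin (\<omega> * t))"
proof (rule fund_realI[of _ "\<lambda>t. - \<omega> * sin (\<omega> * t)" _ _ "\<lambda>t. \<omega> * cos (\<omega> * t)"])
  assume w: "\<omega> \<noteq> 0"
  fix t
  have "C * (\<omega> * C) - - \<omega> * S * S = \<omega> * (C * C + S * S)" for C S by (simp add: algebra_simps)
  from this[of "cos (\<omega> * t)" "sin (\<omega> * t)"] show "cos (\<omega> * t) * (\<omega> * cos (\<omega> * t)) - - \<omega> * sin (\<omega> * t) * sin (\<omega> * t) \<noteq> 0"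
    using w by simp
qed (auto intro!: derivative_eq_intros simp: power2_eq_square)

lemma fund_exp: "\<omega> \<noteq> 0 \<Longrightarrow> fund UNIV (\<lambda>_. \<omega>\<^sup>2) (\<lambda>t::real. exp (\<omega> * t)) (\<lambda>t. exp (- \<omega> * t))"
proof (rule fund_realI[of _ "\<lambda>t. \<omega> * exp (\<omega> * t)" _ _ "\<lambda>t. - \<omega> * exp (- \<omega> * t)"])
  assume w: "\<omega> \<noteq> 0"
  fix t
  have "exp (\<omega> * t) * exp (- \<omega> * t) = 1" by (simp add: exp_minus)
  then have "exp (\<omega> * t) * (- \<omega> * exp (- \<omega> * t)) - \<omega> * exp (\<omega> * t) * exp (- \<omega> * t) = - 2 * \<omega>"
    by (simp add: algebra_simps)
  then show "exp (\<omega> * t) * (- \<omega> * exp (- \<omega> * t)) - \<omega> * exp (\<omega> * t) * exp (- \<omega> * t) \<noteq> 0"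
    using w by simp
qed (auto intro!: derivative_eq_intros simp: power2_eq_square)

text \<open>A potential proportional to the inverse square is one with constant coefficients in the
  logarithm. The frequency there is \<open>\<alpha> / 2\<close> because \<open>fund_lift\<close>
  doubles the logarithm.\<close>

lemma family_euler_trig:
  "\<alpha> > 0 \<Longrightarrow> family (- {0}) (\<lambda>x. (- \<alpha>\<^sup>2 - 1 / 4) / x\<^sup>2)
     (\<lambda>a b x. sqrt \<bar>x\<bar> * (a * cos (\<alpha> * ln \<bar>x\<bar>) + b * sin (\<alpha> * ln \<bar>x\<bar>)))"
  by (rule familyI[OF fund_lift[OF fund_trig[of "\<alpha> / 2"], where d = 0]])
    (auto simp: field_simps power2_eq_square)

lemma family_euler_ln:
  "family (- {0}) (\<lambda>x. (- 1 / 4) / x\<^sup>2) (\<lambda>a b x. sqrt \<bar>x\<bar> * (a + b * ln \<bar>x\<bar>))"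
  by (rule familyI[OF fund_scale[OF fund_lift[OF fund_linear, where d = 0], of _ 1 "1/2"]])
    (auto simp: field_simps)

lemma family_euler_pow:
  "\<alpha> > 0 \<Longrightarrow> family (- {0}) (\<lambda>x. (\<alpha>\<^sup>2 - 1 / 4) / x\<^sup>2)
     (\<lambda>a b x. sqrt \<bar>x\<bar> * (a * \<bar>x\<bar> powr \<alpha> + b * \<bar>x\<bar> powr (- \<alpha>)))"
  by (rule familyI[OF fund_lift[OF fund_exp[of "\<alpha> / 2"], where d = 0]])
    (auto simp: field_simps power2_eq_square powr_def)

lemma family_linear: "family UNIV (\<lambda>_. 0) (\<lambda>a b x. a + b * x)"
  by (rule familyI[OF fund_linear]) simp

lemma family_trig: "family UNIV (\<lambda>_. - 1) (\<lambda>a b x. a * cos x + b * sin x)"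
  using familyI[OF fund_trig[of 1]] by simp

lemma family_exp: "family UNIV (\<lambda>_. 1) (\<lambda>a b x. a * exp x + b * exp (- x))"
  using familyI[OF fund_exp[of 1]] by simp

section \<open>Bessel functions\<close>

lemma bessel_arg:
  assumes "x > 0"
  shows "exp (of_real (2 * ln (x / 2))) = (of_real x / 2 :: complex)\<^sup>2"
    "(of_real x / 2 :: complex) powr \<nu> = exp (\<nu> * of_real (2 * ln (x / 2)) / 2)"
proof -
  have "exp (2 * ln (x / 2)) = (x / 2)\<^sup>2"
    using assms by (simp add: exp_double)
  then show "exp (of_real (2 * ln (x / 2))) = (of_real x / 2 :: complex)\<^sup>2"
    by (metis exp_of_real of_real_divide of_real_numeral of_real_power)
  have "Ln (of_real (x / 2)) = of_real (ln (x / 2))" by (rule Ln_of_real) (use assms in simp)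
  then have "Ln (of_real x / 2) = of_real (ln (x / 2))" by simp
  then show "(of_real x / 2 :: complex) powr \<nu> = exp (\<nu> * of_real (2 * ln (x / 2)) / 2)"
    using assms by (simp add: powr_def)
qed

text \<open>With \<open>c = 0\<close> the product in \<open>hyp_coeff\<close> is a power of
  \<open>a\<close>; \<open>a = - 1\<close> gives the alternating series of J and
  \<open>a = 1\<close> that of I.\<close>

lemma bessel_J_HH: "x > 0 \<Longrightarrow> bessel_J \<nu> (of_real x) = HH (- 1) 0 \<nu> (of_real (2 * ln (x / 2)))"
  unfolding bessel_J_def HH_def psi_def hyp_def hyp_coeff_def bessel_arg
  by (simp add: power_mult[symmetric])

lemma bessel_I_HH: "x > 0 \<Longrightarrow> bessel_I \<nu> (of_real x) = HH 1 0 \<nu> (of_real (2 * ln (x / 2)))"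
  unfolding bessel_I_def HH_def psi_def hyp_def hyp_coeff_def bessel_arg
  by (simp add: power_mult[symmetric])

lemma suminf_cnj: "summable f \<Longrightarrow> cnj (\<Sum>n. f n) = (\<Sum>n. cnj (f n))"
  using sums_cnj summable_sums sums_unique by metis

text \<open>Conjugation passes through the series to the parameters. This yields real values for
  real orders, and conjugate pairs for the imaginary orders \<open>\<nu>\<close> and
  \<open>- \<nu>\<close>.\<close>

lemma cnj_HH: "cnj (HH b c \<nu> L) = HH (cnj b) (cnj c) (cnj \<nu>) (cnj L)"
  unfolding HH_def psi_def hyp_def
  unfolding complex_cnj_mult suminf_cnj[OF hyp_summable]
  by (simp add: exp_cnj hyp_coeff_def cnj_rGamma)

text \<open>\<open>\<sigma> = -1\<close> is the case of the Bessel functions, \<open>\<sigma> = 1\<close> that of the modified ones.\<close>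
lemma bessel_pot:
  assumes "Im (\<nu>\<^sup>2) = 0"
  shows "pot (of_real \<sigma>) 0 \<nu> (of_real t + 0) = of_real (Re (\<nu>\<^sup>2) / 4 + \<sigma> * exp t)"
  using assms by (simp add: pot_def complex_eq_iff flip: exp_of_real)

lemma bessel_lift_q:
  fixes x :: real
  assumes "x \<noteq> 0"
  shows "(4 * (\<rho> / 4 + \<sigma> * exp (2 * ln \<bar>x\<bar> + - 2 * ln 2)) - 1 / 4) / x\<^sup>2 = \<sigma> + (\<rho> - 1 / 4) / x\<^sup>2"
proof -
  have "exp (2 * ln \<bar>x\<bar> + - 2 * ln 2) = (exp (ln \<bar>x\<bar>))\<^sup>2 / (exp (ln 2))\<^sup>2"
    unfolding exp_double[symmetric] by (simp add: exp_diff)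
  also have "\<dots> = x\<^sup>2 / 4" using assms by simp
  finally show ?thesis using assms by (simp add: field_simps)
qed

text \<open>The numerator \<open>sin (pi * \<nu>)\<close> with second coefficient 0 makes the first
  solution \<open>HH\<close> itself, which is real. Hence the real part of the Wronskian with any
  complex second solution is the Wronskian of the real parts, and \<open>w0\<close> survives the
  passage to \<open>Re\<close>.\<close>

lemma bessel_fund_real:
  fixes \<beta> \<sigma> w0 :: real
  assumes "\<beta> \<ge> 0" "m1 holomorphic_on UNIV" "m2 holomorphic_on UNIV" "w0 \<noteq> 0"
    and "\<And>n. m1 (of_nat n) + m2 (of_nat n) * of_real \<sigma> ^ n = 0"
    and "\<And>\<nu>. - (sin (of_real pi * \<nu>) * m2 \<nu>) = of_real w0 * of_real pi * sin (of_real pi * \<nu>)"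
  shows "\<exists>Z. (\<forall>t. ((\<lambda>\<nu>. NN (of_real \<sigma>) 0 m1 m2 \<nu> (of_real t) / sin (of_real pi * \<nu>)) \<longlongrightarrow> Z t) (at (of_real \<beta>))) \<and>
    fund (- {0}) (\<lambda>x. \<sigma> + (\<beta>\<^sup>2 - 1 / 4) / x\<^sup>2)
      (\<lambda>x. sqrt \<bar>x\<bar> * Re (HH (of_real \<sigma>) 0 (of_real \<beta>) (of_real (2 * ln \<bar>x\<bar> + - 2 * ln 2))))
      (\<lambda>x. sqrt \<bar>x\<bar> * Re (Z (2 * ln \<bar>x\<bar> + - 2 * ln 2)))"
proof -
  define P where "P = (\<lambda>t. Re ((of_real \<beta> :: complex)\<^sup>2) / 4 + \<sigma> * exp t)"
  have "\<exists>Y Y' Z Z'. sol UNIV P Y Y' \<and> sol UNIV P Z Z' \<and> (\<forall>t. Y t * Z' t - Y' t * Z t = of_real w0) \<and>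
    (\<forall>t. ((\<lambda>\<nu>. NN (of_real \<sigma>) 0 (\<lambda>\<nu>. sin (of_real pi * \<nu>)) (\<lambda>_. 0) \<nu> (of_real t + 0) / sin (of_real pi * \<nu>)) \<longlongrightarrow> Y t) (at (of_real \<beta>))) \<and>
    (\<forall>t. ((\<lambda>\<nu>. NN (of_real \<sigma>) 0 m1 m2 \<nu> (of_real t + (0 + 0)) / sin (of_real pi * \<nu>)) \<longlongrightarrow> Z t) (at (of_real \<beta>)))"
  proof (rule HH_fund)
    show "pot (of_real \<sigma>) 0 (of_real \<beta>) (of_real t + 0) = of_real (P t)" for t
      unfolding P_def by (rule bessel_pot) (simp flip: of_real_power)
    show "sin (of_real pi * of_nat n) + 0 * (\<Prod>j<n. of_real \<sigma> - 0 * of_nat n / 2 + 0 * of_nat j) = (0::complex)" for n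
      by (simp add: sin_pi_eq_0_iff)
  qed (use assms in \<open>auto intro!: holomorphic_intros simp: sin_pi_eq_0_iff\<close>)
  then obtain Y Y' Z Z' where YZ: "sol UNIV P Y Y'" "sol UNIV P Z Z'" "\<And>t. Y t * Z' t - Y' t * Z t = of_real w0"
    "\<And>t. ((\<lambda>\<nu>. NN (of_real \<sigma>) 0 (\<lambda>\<nu>. sin (of_real pi * \<nu>)) (\<lambda>_. 0) \<nu> (of_real t) / sin (of_real pi * \<nu>)) \<longlongrightarrow> Y t) (at (of_real \<beta>))"
    "\<And>t. ((\<lambda>\<nu>. NN (of_real \<sigma>) 0 m1 m2 \<nu> (of_real t) / sin (of_real pi * \<nu>)) \<longlongrightarrow> Z t) (at (of_real \<beta>))"
    by auto
  have Y: "Y t = HH (of_real \<sigma>) 0 (of_real \<beta>) (of_real t)" for t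
  proof -
    obtain r where r: "r > 0" "\<And>\<nu>. \<nu> \<in> ball (of_real \<beta>) r \<Longrightarrow> \<nu> \<noteq> of_real \<beta> \<Longrightarrow> sin (of_real pi * \<nu> :: complex) \<noteq> 0"
      using sin_pi_isolated by blast
    have "isCont (\<lambda>\<nu>. HH (of_real \<sigma>) 0 \<nu> (of_real t)) (of_real \<beta>)"
      using continuous_on_HH2(1)[OF continuous_on_id continuous_on_const, of UNIV]
      by (simp add: continuous_on_eq_continuous_at)
    then have "((\<lambda>\<nu>. HH (of_real \<sigma>) 0 \<nu> (of_real t)) \<longlongrightarrow> HH (of_real \<sigma>) 0 (of_real \<beta>) (of_real t)) (at (of_real \<beta>))"
      by (simp add: isCont_def)
    then have "((\<lambda>\<nu>. NN (of_real \<sigma>) 0 (\<lambda>\<nu>. sin (of_real pi * \<nu>)) (\<lambda>_. 0) \<nu> (of_real t) / sin (of_real pi * \<nu>))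
        \<longlongrightarrow> HH (of_real \<sigma>) 0 (of_real \<beta>) (of_real t)) (at (of_real \<beta>))"
      by (rule Lim_transform_within_open[of _ _ _ _ "ball (of_real \<beta>) r"]) (use r in \<open>auto simp: NN_def\<close>)
    then show ?thesis using YZ(4) LIM_unique by blast
  qed
  have Im0: "Im (Y t) = 0" for t
  proof -
    have "cnj (Y t) = Y t" unfolding Y by (simp add: cnj_HH)
    then show ?thesis by (simp add: complex_eq_iff)
  qed
  have Im0': "Im (Y' t) = 0" for t
  proof -
    have "((\<lambda>t. Im (Y t)) has_vector_derivative Im (Y' t)) (at t)"
      using sol_Re_Im(2)[OF YZ(1)] by (simp add: sol_def)
    then have "((\<lambda>t. 0) has_vector_derivative Im (Y' t)) (at t)" by (simp add: Im0)
    then show ?thesis using vector_derivative_unique_at has_vector_derivative_const by blast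
  qed
  have "Re (Y t) * Re (Z' t) - Re (Y' t) * Re (Z t) = w0" for t
    using arg_cong[OF YZ(3)[of t], of Re] by (simp add: Im0 Im0')
  then have "fund UNIV P (\<lambda>t. Re (Y t)) (\<lambda>t. Re (Z t))"
    unfolding fund_def
    using sol_Re_Im(1)[OF YZ(1)] sol_Re_Im(1)[OF YZ(2)] assms(4) by (metis (no_types, lifting))
  from fund_lift[OF this, where d = "- 2 * ln 2" and q = "\<lambda>x. \<sigma> + (\<beta>\<^sup>2 - 1 / 4) / x\<^sup>2"]
  have "fund (- {0}) (\<lambda>x. \<sigma> + (\<beta>\<^sup>2 - 1 / 4) / x\<^sup>2)
      (\<lambda>x. sqrt \<bar>x\<bar> *\<^sub>R Re (Y (2 * ln \<bar>x\<bar> + - 2 * ln 2))) (\<lambda>x. sqrt \<bar>x\<bar> *\<^sub>R Re (Z (2 * ln \<bar>x\<bar> + - 2 * ln 2)))"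
    unfolding P_def bessel_lift_q[of _ _ \<sigma>] using bessel_lift_q[of _ "\<beta>\<^sup>2" \<sigma>] by (simp flip: of_real_power)
  then show ?thesis using YZ(5) unfolding Y by (intro exI[of _ Z]) simp
qed

lemma ln_half: "x > 0 \<Longrightarrow> 2 * ln (x / 2) = 2 * ln x - 2 * ln 2" for x :: real
  by (simp add: ln_div)

lemma family_Z:
  assumes "\<beta> \<ge> 0"
  shows "family (- {0}) (\<lambda>x. - 1 + (\<beta>\<^sup>2 - 1 / 4) / x\<^sup>2) (\<lambda>a b. W_of (C1p_Z \<beta> a b))"
proof -
  \<comment> \<open>Numerator coefficients of the Bessel function Y. The value \<open>1 / pi\<close>
    below is the Wronskian \<open>2 / (pi * x)\<close> of J and Y times \<open>x / 2\<close>, the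
    factor of the variable \<open>2 * ln (x / 2)\<close>.\<close>
  let ?m1 = "\<lambda>\<nu>. cos (of_real pi * \<nu>)" and ?m2 = "\<lambda>\<nu>::complex. - 1 :: complex"
  have "\<exists>Z. (\<forall>t. ((\<lambda>\<nu>. NN (of_real (- 1)) 0 ?m1 ?m2 \<nu> (of_real t) / sin (of_real pi * \<nu>)) \<longlongrightarrow> Z t) (at (of_real \<beta>))) \<and>
    fund (- {0}) (\<lambda>x. - 1 + (\<beta>\<^sup>2 - 1 / 4) / x\<^sup>2)
      (\<lambda>x. sqrt \<bar>x\<bar> * Re (HH (of_real (- 1)) 0 (of_real \<beta>) (of_real (2 * ln \<bar>x\<bar> + - 2 * ln 2))))
      (\<lambda>x. sqrt \<bar>x\<bar> * Re (Z (2 * ln \<bar>x\<bar> + - 2 * ln 2)))"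
  proof (rule bessel_fund_real[OF assms, where ?w0.0 = "1 / pi"])
    show "?m1 (of_nat n) + ?m2 (of_nat n) * of_real (- 1) ^ n = 0" for n
    proof -
      have "cos (of_real pi * of_nat n) = complex_of_real (cos (pi * real n))"
        by (subst cos_of_real[symmetric]) (simp only: of_real_mult of_real_of_nat_eq)
      then show ?thesis by (simp add: cos_npi2)
    qed
  qed (auto intro!: holomorphic_intros)
  then obtain Z where Z: "\<And>t. ((\<lambda>\<nu>. NN (- 1) 0 ?m1 ?m2 \<nu> (of_real t) / sin (of_real pi * \<nu>)) \<longlongrightarrow> Z t) (at (of_real \<beta>))"
    "fund (- {0}) (\<lambda>x. - 1 + (\<beta>\<^sup>2 - 1 / 4) / x\<^sup>2)
      (\<lambda>x. sqrt \<bar>x\<bar> * Re (HH (- 1) 0 (of_real \<beta>) (of_real (2 * ln \<bar>x\<bar> + - 2 * ln 2))))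
      (\<lambda>x. sqrt \<bar>x\<bar> * Re (Z (2 * ln \<bar>x\<bar> + - 2 * ln 2)))" by auto
  have "bessel_Y (of_real \<beta>) (of_real x) = Z (2 * ln (x / 2))" if "x > 0" for x
    unfolding bessel_Y_def bessel_J_HH[OF that]
    using Z(1)[of "2 * ln (x / 2)"] by (intro tendsto_Lim) (simp_all add: NN_def mult.commute)
  then show ?thesis
    by (intro familyI[OF Z(2)])
      (simp add: cyl_Z_def bessel_J_HH ln_half algebra_simps del: of_real_mult)
qed

lemma family_C:
  assumes "\<beta> \<ge> 0"
  shows "family (- {0}) (\<lambda>x. 1 + (\<beta>\<^sup>2 - 1 / 4) / x\<^sup>2) (\<lambda>a b. W_of (C1pp_C \<beta> a b))"
proof -
  \<comment> \<open>Numerator coefficients of K. In the same way \<open>- 1 / 2\<close> is the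
    Wronskian \<open>- 1 / x\<close> of I and K times \<open>x / 2\<close>.\<close>
  let ?m1 = "\<lambda>\<nu>::complex. - of_real pi / 2 :: complex" and ?m2 = "\<lambda>\<nu>::complex. of_real pi / 2 :: complex"
  have "\<exists>Z. (\<forall>t. ((\<lambda>\<nu>. NN (of_real 1) 0 ?m1 ?m2 \<nu> (of_real t) / sin (of_real pi * \<nu>)) \<longlongrightarrow> Z t) (at (of_real \<beta>))) \<and>
    fund (- {0}) (\<lambda>x. 1 + (\<beta>\<^sup>2 - 1 / 4) / x\<^sup>2)
      (\<lambda>x. sqrt \<bar>x\<bar> * Re (HH (of_real 1) 0 (of_real \<beta>) (of_real (2 * ln \<bar>x\<bar> + - 2 * ln 2))))
      (\<lambda>x. sqrt \<bar>x\<bar> * Re (Z (2 * ln \<bar>x\<bar> + - 2 * ln 2)))"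
    by (rule bessel_fund_real[OF assms, where ?w0.0 = "- 1 / 2"]) (auto intro!: holomorphic_intros)
  then obtain Z where Z: "\<And>t. ((\<lambda>\<nu>. NN 1 0 ?m1 ?m2 \<nu> (of_real t) / sin (of_real pi * \<nu>)) \<longlongrightarrow> Z t) (at (of_real \<beta>))"
    "fund (- {0}) (\<lambda>x. 1 + (\<beta>\<^sup>2 - 1 / 4) / x\<^sup>2)
      (\<lambda>x. sqrt \<bar>x\<bar> * Re (HH 1 0 (of_real \<beta>) (of_real (2 * ln \<bar>x\<bar> + - 2 * ln 2))))
      (\<lambda>x. sqrt \<bar>x\<bar> * Re (Z (2 * ln \<bar>x\<bar> + - 2 * ln 2)))" by auto
  have "bessel_K (of_real \<beta>) (of_real x) = Z (2 * ln (x / 2))" if "x > 0" for x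
    unfolding bessel_K_def bessel_I_HH[OF that]
    using Z(1)[of "2 * ln (x / 2)"] by (intro tendsto_Lim) (simp_all add: NN_def algebra_simps)
  then show ?thesis
    by (intro familyI[OF Z(2)])
      (simp add: cyl_C_def bessel_I_HH ln_half algebra_simps del: of_real_mult)
qed

lemma sin_cos_imaginary:
  fixes \<gamma> :: real
  shows "sin (\<i> * of_real \<gamma> * of_real pi) = \<i> * of_real (sinh (\<gamma> * pi))"
    "cos (\<i> * of_real \<gamma> * of_real pi) = of_real (cosh (\<gamma> * pi))"
proof -
  have e: "\<i> * (\<i> * of_real \<gamma> * of_real pi) = complex_of_real (- (\<gamma> * pi))"
    by (simp flip: mult.assoc)
  show "sin (\<i> * of_real \<gamma> * of_real pi) = \<i> * of_real (sinh (\<gamma> * pi))"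
    unfolding sin_exp_eq e of_real_minus[symmetric] minus_minus exp_of_real sinh_field_def
    by (simp add: field_simps)
  show "cos (\<i> * of_real \<gamma> * of_real pi) = of_real (cosh (\<gamma> * pi))"
    unfolding cos_exp_eq e of_real_minus[symmetric] minus_minus exp_of_real cosh_field_def
    by simp
qed

text \<open>At order \<open>\<i> * \<gamma>\<close> the sine is \<open>\<i>\<close> times a nonzero
  hyperbolic sine, so the orders \<open>\<nu>\<close> and \<open>- \<nu>\<close> are independent;
  they are conjugate to each other, so real and imaginary part form a real fundamental
  system.\<close>

lemma bessel_fund_imag:
  fixes \<gamma> \<sigma> :: real
  assumes "\<gamma> > 0"
  defines "H \<equiv> \<lambda>x. HH (of_real \<sigma>) 0 (\<i> * of_real \<gamma>) (of_real (2 * ln \<bar>x\<bar> + - 2 * ln 2))"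
  shows "fund (- {0}) (\<lambda>x. \<sigma> + (- \<gamma>\<^sup>2 - 1 / 4) / x\<^sup>2) (\<lambda>x. sqrt \<bar>x\<bar> * Re (H x)) (\<lambda>x. sqrt \<bar>x\<bar> * Im (H x))"
proof -
  let ?\<nu> = "\<i> * of_real \<gamma> :: complex"
  let ?b = "of_real \<sigma> :: complex"
  define P where "P = (\<lambda>t. - \<gamma>\<^sup>2 / 4 + \<sigma> * exp t)"
  have nu: "?\<nu>\<^sup>2 = of_real (- \<gamma>\<^sup>2)" by (simp add: power_mult_distrib)
  have pot: "pot ?b 0 \<nu> (of_real t + 0) = of_real (P t)" if "\<nu>\<^sup>2 = of_real (- \<gamma>\<^sup>2)" for \<nu> t
    using bessel_pot[of \<nu> \<sigma> t] that by (simp add: P_def)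
  have s: "sol UNIV P (\<lambda>t. HH ?b 0 \<nu> (of_real t)) (\<lambda>t. HH' ?b 0 \<nu> (of_real t))" if "\<nu>\<^sup>2 = of_real (- \<gamma>\<^sup>2)" for \<nu>
    using HH_line_deriv[of ?b 0 \<nu> 0] pot[OF that] by (simp add: sol_def scaleR_conv_of_real)
  have m: "(- ?\<nu>)\<^sup>2 = of_real (- \<gamma>\<^sup>2)" using nu by simp
  have "fund UNIV P (\<lambda>t. HH ?b 0 ?\<nu> (of_real t)) (\<lambda>t. HH ?b 0 (- ?\<nu>) (of_real t))"
    unfolding fund_def
  proof (intro exI conjI ballI)
    show "sol UNIV P (\<lambda>t. HH ?b 0 ?\<nu> (of_real t)) (\<lambda>t. HH' ?b 0 ?\<nu> (of_real t))" by (rule s[OF nu])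
    show "sol UNIV P (\<lambda>t. HH ?b 0 (- ?\<nu>) (of_real t)) (\<lambda>t. HH' ?b 0 (- ?\<nu>) (of_real t))" by (rule s[OF m])
    fix t
    have "sin (of_real pi * ?\<nu>) \<noteq> 0"
      using sin_cos_imaginary(1)[of \<gamma>] assms(1) by (simp add: mult_ac)
    then show "HH ?b 0 ?\<nu> (of_real t) * HH' ?b 0 (- ?\<nu>) (of_real t) - HH' ?b 0 ?\<nu> (of_real t) * HH ?b 0 (- ?\<nu>) (of_real t) \<noteq> 0"
      using HH_wronskian_opposite[of ?b 0 ?b 0 0 ?\<nu> "of_real t"] by simp
  qed
  moreover have "HH ?b 0 (- ?\<nu>) (of_real t) = cnj (HH ?b 0 ?\<nu> (of_real t))" for t
    by (simp add: cnj_HH)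
  ultimately have "fund UNIV P (\<lambda>t. HH ?b 0 ?\<nu> (of_real t)) (\<lambda>t. cnj (HH ?b 0 ?\<nu> (of_real t)))" by simp
  from fund_lift[OF fund_Re_Im[OF this], where d = "- 2 * ln 2" and q = "\<lambda>x. \<sigma> + (- \<gamma>\<^sup>2 - 1 / 4) / x\<^sup>2"]
  show ?thesis unfolding H_def P_def
    using bessel_lift_q[of _ "- \<gamma>\<^sup>2" \<sigma>] by simp
qed

text \<open>Off the integers the connection formula is continuous in the order, so the limit in the
  definition is its value.\<close>

lemma bessel_nonint:
  assumes "x > 0" "sin (of_real pi * \<nu>) \<noteq> 0"
  shows "bessel_Y \<nu> (of_real x) = (bessel_J \<nu> (of_real x) * cos (\<nu> * of_real pi) - bessel_J (- \<nu>) (of_real x)) / sin (\<nu> * of_real pi)"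
    "bessel_K \<nu> (of_real x) = of_real pi / 2 * (bessel_I (- \<nu>) (of_real x) - bessel_I \<nu> (of_real x)) / sin (\<nu> * of_real pi)"
proof -
  have c: "isCont (\<lambda>\<mu>. HH b 0 \<mu> L) \<nu>" "isCont (\<lambda>\<mu>. HH b 0 (- \<mu>) L) \<nu>" for b L
    using continuous_on_HH2(1)[OF continuous_on_id continuous_on_const, of UNIV]
      continuous_on_HH2(1)[OF continuous_on_minus[OF continuous_on_id] continuous_on_const, of UNIV]
    by (simp_all add: continuous_on_eq_continuous_at)
  have s: "sin (\<nu> * of_real pi) \<noteq> 0" using assms(2) by (simp add: mult.commute)
  show "bessel_Y \<nu> (of_real x) = (bessel_J \<nu> (of_real x) * cos (\<nu> * of_real pi) - bessel_J (- \<nu>) (of_real x)) / sin (\<nu> * of_real pi)"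
    unfolding bessel_Y_def bessel_J_HH[OF assms(1)]
    by (rule tendsto_Lim, simp) (use c s in \<open>intro tendsto_intros; simp add: isCont_def\<close>)
  show "bessel_K \<nu> (of_real x) = of_real pi / 2 * (bessel_I (- \<nu>) (of_real x) - bessel_I \<nu> (of_real x)) / sin (\<nu> * of_real pi)"
    unfolding bessel_K_def bessel_I_HH[OF assms(1)]
    by (rule tendsto_Lim, simp) (use c s in \<open>intro tendsto_intros; simp add: isCont_def\<close>)
qed

lemma family_Zt:
  assumes "\<gamma> > 0"
  shows "family (- {0}) (\<lambda>x. - 1 + (- \<gamma>\<^sup>2 - 1 / 4) / x\<^sup>2) (\<lambda>a b. W_of (C1p_Zt \<gamma> a b))"
proof -
  let ?\<nu> = "\<i> * of_real \<gamma> :: complex"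
  \<comment> \<open>\<open>B\<close> and \<open>A\<close> are the weights of the first and the
    second Hankel function. Since \<open>A * B = 1\<close>, the hyperbolic functions of
    \<open>\<gamma> * pi\<close> are combinations of \<open>A * A\<close> and \<open>B * B\<close>,
    and the function reduces to the real and imaginary part of J with the nonzero factors
    \<open>(A - B) / S\<close> and \<open>(A + B) / S\<close>.\<close>
  define A B S where "A = exp (\<gamma> * pi / 2)" and "B = exp (- \<gamma> * pi / 2)" and "S = sinh (\<gamma> * pi)"
  have AB: "A > B" "B > 0" "S > 0" using assms by (simp_all add: A_def B_def S_def)
  have A2: "exp (\<gamma> * pi) = A * A" "exp (- (\<gamma> * pi)) = B * B" "A * B = 1"
    by (simp_all add: A_def B_def flip: exp_add)
  have SC: "S = (A * A - B * B) / 2" "cosh (\<gamma> * pi) = (A * A + B * B) / 2"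
    unfolding S_def sinh_field_def cosh_field_def A2 by simp_all
  have W: "W_of (C1p_Zt \<gamma> a b) x = a * ((A - B) / S * (sqrt \<bar>x\<bar> * Re (HH (of_real (- 1)) 0 ?\<nu> (of_real (2 * ln \<bar>x\<bar> + - 2 * ln 2)))))
      + b * ((A + B) / S * (sqrt \<bar>x\<bar> * Im (HH (of_real (- 1)) 0 ?\<nu> (of_real (2 * ln \<bar>x\<bar> + - 2 * ln 2)))))"
    if "x \<in> - {0}" for a b x
  proof -
    have x: "\<bar>x\<bar> > 0" using that by simp
    define H where "H = bessel_J ?\<nu> (of_real \<bar>x\<bar>)"
    have H: "H = HH (of_real (- 1)) 0 ?\<nu> (of_real (2 * ln \<bar>x\<bar> + - 2 * ln 2))"
      unfolding H_def bessel_J_HH[OF x] using ln_half[OF x] by simp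
    have Hc: "bessel_J (- ?\<nu>) (of_real \<bar>x\<bar>) = cnj H"
      unfolding H_def bessel_J_HH[OF x] by (simp add: cnj_HH)
    have "sin (of_real pi * ?\<nu>) \<noteq> 0"
      using sin_cos_imaginary(1)[of \<gamma>] assms(1) by (simp add: mult_ac)
    from bessel_nonint(1)[OF x this]
    have Y: "bessel_Y ?\<nu> (of_real \<bar>x\<bar>) = (H * of_real ((A * A + B * B) / 2) - cnj H) / (\<i> * of_real S)"
      unfolding sin_cos_imaginary Hc SC(2) S_def H_def .
    have S0: "of_real S \<noteq> (0::complex)" using AB by simp
    have iY: "\<i> * bessel_Y ?\<nu> (of_real \<bar>x\<bar>) = (H * of_real ((A * A + B * B) / 2) - cnj H) / of_real S"
      unfolding Y by simp
    have h1: "of_real B * hankel_H1 ?\<nu> (of_real \<bar>x\<bar>) = (of_real A * H - of_real B * cnj H) / of_real S"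
    proof -
      have "of_real B * hankel_H1 ?\<nu> (of_real \<bar>x\<bar>) = of_real B * ((of_real S + of_real ((A * A + B * B) / 2)) * H - cnj H) / of_real S"
        unfolding hankel_H1_def iY H_def[symmetric] using S0 by (simp add: field_simps)
      also have "of_real S + of_real ((A * A + B * B) / 2) = complex_of_real (A * A)"
        unfolding SC(1) of_real_add[symmetric] by (rule arg_cong[of _ _ of_real]) (simp add: field_simps)
      also have "of_real B * (of_real (A * A) * H - cnj H) = of_real (A * (A * B)) * H - of_real B * cnj H"
        by (simp add: algebra_simps)
      finally show ?thesis unfolding A2 by simp
    qed
    have h2: "of_real A * hankel_H2 ?\<nu> (of_real \<bar>x\<bar>) = (of_real A * cnj H - of_real B * H) / of_real S"
    proof -
      have "of_real A * hankel_H2 ?\<nu> (of_real \<bar>x\<bar>) = of_real A * ((of_real S - of_real ((A * A + B * B) / 2)) * H + cnj H) / of_real S"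
        unfolding hankel_H2_def iY H_def[symmetric] using S0 by (simp add: field_simps)
      also have "of_real S - of_real ((A * A + B * B) / 2) = complex_of_real (- (B * B))"
        unfolding SC(1) of_real_diff[symmetric] by (rule arg_cong[of _ _ of_real]) (simp add: field_simps)
      also have "of_real A * (of_real (- (B * B)) * H + cnj H) = of_real A * cnj H - of_real (A * B * B) * H"
        by (simp add: algebra_simps)
      finally show ?thesis unfolding A2 by simp
    qed
    have "cyl_Z_tilde \<gamma> a b \<bar>x\<bar> = Re (of_real a / 2 * ((of_real A * H - of_real B * cnj H) / of_real S + (of_real A * cnj H - of_real B * H) / of_real S)
        + of_real b / (2 * \<i>) * ((of_real A * H - of_real B * cnj H) / of_real S - (of_real A * cnj H - of_real B * H) / of_real S))"
      unfolding cyl_Z_tilde_def Let_def h1[unfolded B_def] h2[unfolded A_def] A_def B_def ..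
    also have "\<dots> = a * ((A - B) / S * Re H) + b * ((A + B) / S * Im H)"
      using AB by (simp add: Re_divide Im_divide field_simps power2_eq_square)
    finally have C: "cyl_Z_tilde \<gamma> a b \<bar>x\<bar> = \<dots>" .
    show ?thesis unfolding W_of.simps C H by (simp add: algebra_simps)
  qed
  have nz: "(A - B) / S \<noteq> 0" "(A + B) / S \<noteq> 0" using AB by auto
  show ?thesis
    by (rule familyI[OF fund_scale[OF _ nz]], rule bessel_fund_imag[OF assms, of "- 1"]) (rule W)
qed

lemma family_Ct:
  assumes "\<gamma> > 0"
  shows "family (- {0}) (\<lambda>x. 1 + (- \<gamma>\<^sup>2 - 1 / 4) / x\<^sup>2) (\<lambda>a b. W_of (C1pp_Ct \<gamma> a b))"
proof -
  let ?\<nu> = "\<i> * of_real \<gamma> :: complex"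
  define S where "S = sinh (\<gamma> * pi)"
  have S: "S > 0" using assms by (simp add: S_def)
  have W: "W_of (C1pp_Ct \<gamma> a b) x = a * (pi / S * (sqrt \<bar>x\<bar> * Re (HH (of_real 1) 0 ?\<nu> (of_real (2 * ln \<bar>x\<bar> + - 2 * ln 2)))))
      + b * (- pi / S * (sqrt \<bar>x\<bar> * Im (HH (of_real 1) 0 ?\<nu> (of_real (2 * ln \<bar>x\<bar> + - 2 * ln 2)))))"
    if "x \<in> - {0}" for a b x
  proof -
    have x: "\<bar>x\<bar> > 0" using that by simp
    define H where "H = bessel_I ?\<nu> (of_real \<bar>x\<bar>)"
    have H: "H = HH (of_real 1) 0 ?\<nu> (of_real (2 * ln \<bar>x\<bar> + - 2 * ln 2))"
      unfolding H_def bessel_I_HH[OF x] using ln_half[OF x] by simp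
    have Hc: "bessel_I (- ?\<nu>) (of_real \<bar>x\<bar>) = cnj H"
      unfolding H_def bessel_I_HH[OF x] by (simp add: cnj_HH)
    have "sin (of_real pi * ?\<nu>) \<noteq> 0"
      using sin_cos_imaginary(1)[of \<gamma>] assms(1) by (simp add: mult_ac)
    from bessel_nonint(2)[OF x this]
    have K: "bessel_K ?\<nu> (of_real \<bar>x\<bar>) = of_real pi / 2 * (cnj H - H) / (\<i> * of_real S)"
      unfolding sin_cos_imaginary Hc S_def H_def .
    have "cyl_C_tilde \<gamma> a b \<bar>x\<bar> = Re (of_real a * of_real pi * \<i> / (2 * (\<i> * of_real S)) * (H + cnj H)
        + of_real b * (of_real pi / 2 * (cnj H - H) / (\<i> * of_real S)))"
      unfolding cyl_C_tilde_def Let_def K Hc sin_cos_imaginary S_def H_def ..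
    also have "\<dots> = a * (pi / S * Re H) + b * (- pi / S * Im H)"
      using S by (simp add: Re_divide Im_divide field_simps power2_eq_square)
    finally have C: "cyl_C_tilde \<gamma> a b \<bar>x\<bar> = \<dots>" .
    show ?thesis unfolding W_of.simps C H by (simp add: algebra_simps)
  qed
  have nz: "pi / S \<noteq> 0" "- pi / S \<noteq> 0" using S by auto
  show ?thesis
    by (rule familyI[OF fund_scale[OF _ nz]], rule bessel_fund_imag[OF assms, of 1]) (rule W)
qed

section \<open>Whittaker functions\<close>

text \<open>This is \<open>exp (- L / 2)\<close> times Whittaker's W with second index
  \<open>\<nu> / 2\<close>, at noninteger \<open>\<nu>\<close>. The products of Gamma functions in
  \<open>\<nu>\<close> alone collapse to \<open>pi / sin (pi * \<nu>)\<close> up to sign by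
  reflection, which leaves reciprocal Gamma functions as entire coefficients.\<close>

definition WF :: "complex \<Rightarrow> complex \<Rightarrow> complex \<Rightarrow> complex" where
  "WF k \<nu> L = NN (1 / 2 - k) 1 (\<lambda>\<nu>. - of_real pi * rGamma (1 / 2 - \<nu> / 2 - k))
     (\<lambda>\<nu>. of_real pi * rGamma (1 / 2 + \<nu> / 2 - k)) \<nu> L / sin (of_real pi * \<nu>)"

lemma WF_minus: "WF k (- \<nu>) L = WF k \<nu> L"
  by (simp add: WF_def NN_def divide_simps)

lemma WF_cnj: "cnj (WF k \<nu> L) = WF (cnj k) (cnj \<nu>) (cnj L)"
  by (simp add: WF_def NN_def cnj_HH cnj_rGamma cnj_sin)

text \<open>The assumption \<open>Ln z = L\<close> fixes the branch: the principal power of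
  \<open>z\<close> is then the exponential of a multiple of \<open>L\<close>.\<close>

lemma whittaker_M_HH:
  assumes "sin (of_real pi * (2 * \<mu>)) \<noteq> 0" "z = exp L" "Ln z = L"
  shows "whittaker_M k \<mu> z = Gamma (1 + 2 * \<mu>) * exp (L / 2) * HH (1 / 2 - k) 1 (2 * \<mu>) L"
proof -
  have ni: "1 + 2 * \<mu> \<notin> \<int>"
    using assms(1) by (simp add: sin_pi_eq_0_iff)
  then have g: "Gamma (1 + 2 * \<mu>) * rGamma (1 + 2 * \<mu>) = 1"
    by (metis Gamma_eq_zero_iff nonpos_Ints_Int rGamma_inverse_Gamma right_inverse)
  have t: "pochhammer (1 / 2 + \<mu> - k) n / (pochhammer (1 + 2 * \<mu>) n * fact n) * z ^ n
    = Gamma (1 + 2 * \<mu>) * (hyp_coeff (1 / 2 - k + 1 * (2 * \<mu>) / 2) 1 (2 * \<mu>) n * exp L ^ n)" for n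
  proof -
    have a: "1 / 2 + \<mu> - k = 1 / 2 - k + 1 * (2 * \<mu>) / 2" by simp
    have p: "pochhammer (1 / 2 + \<mu> - k) n = (\<Prod>j<n. 1 / 2 - k + 1 * (2 * \<mu>) / 2 + 1 * of_nat j)"
      unfolding a by (simp add: pochhammer_prod atLeast0LessThan)
    have "1 = Gamma (1 + 2 * \<mu>) * (pochhammer (1 + 2 * \<mu>) n * rGamma (1 + 2 * \<mu> + of_nat n))"
      using g unfolding pochhammer_rGamma[of "1 + 2 * \<mu>" n, symmetric] by simp
    then have "1 / pochhammer (1 + 2 * \<mu>) n = Gamma (1 + 2 * \<mu>) * rGamma (2 * \<mu> + of_nat n + 1)"
      by (auto simp: divide_eq_eq mult_ac add_ac)
    moreover have "A / (B * C) * D = 1 / B * (A * D / C)" for A B C D :: complex by simp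
    ultimately show ?thesis unfolding hyp_coeff_def p assms(2) by (simp only:) (simp add: mult_ac)
  qed
  have z: "z \<noteq> 0" using assms(2) by simp
  have e: "exp (- z / 2) * z powr (1 / 2 + \<mu>) = exp (L / 2) * exp (2 * \<mu> * L / 2 - 1 * exp L / 2)"
    using z assms(2,3) by (simp add: powr_def algebra_simps flip: exp_add)
  show ?thesis
    unfolding whittaker_M_def t suminf_mult[OF hyp_summable] e HH_def psi_def hyp_def
    by (simp only: mult_ac)
qed

lemma whittaker_term:
  assumes "sin (of_real pi * (2 * \<mu>)) \<noteq> 0" "z = exp L" "Ln z = L"
  shows "Gamma (- 2 * \<mu>) * rGamma (1 / 2 - \<mu> - k) * whittaker_M k \<mu> z
      + Gamma (2 * \<mu>) * rGamma (1 / 2 + \<mu> - k) * whittaker_M k (- \<mu>) z = exp (L / 2) * WF k (2 * \<mu>) L"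
proof -
  have s: "sin (of_real pi * (2 * - \<mu>)) \<noteq> 0" using assms(1) by simp
  note M = whittaker_M_HH[OF assms, of k] whittaker_M_HH[OF s assms(2,3), of k]
  have G: "Gamma (- 2 * \<mu>) * Gamma (1 + 2 * \<mu>) = - of_real pi / sin (of_real pi * (2 * \<mu>))"
    "Gamma (2 * \<mu>) * Gamma (1 + 2 * - \<mu>) = of_real pi / sin (of_real pi * (2 * \<mu>))"
    using Gamma_reflection_complex[of "- 2 * \<mu>"] Gamma_reflection_complex[of "2 * \<mu>"] by simp_all
  have "g1 * r1 * (G1 * E * h1) + g2 * r2 * (G2 * E * h2) = E * ((g1 * G1) * r1 * h1 + (g2 * G2) * r2 * h2)"
    for g1 r1 G1 E h1 g2 r2 G2 h2 :: complex by (simp add: algebra_simps)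
  from this[of "Gamma (- 2 * \<mu>)" "rGamma (1 / 2 - \<mu> - k)" "Gamma (1 + 2 * \<mu>)" "exp (L / 2)" "HH (1 / 2 - k) 1 (2 * \<mu>) L"
     "Gamma (2 * \<mu>)" "rGamma (1 / 2 + \<mu> - k)" "Gamma (1 + 2 * - \<mu>)" "HH (1 / 2 - k) 1 (2 * - \<mu>) L"]
  show ?thesis unfolding M G WF_def NN_def by (simp add: add_divide_distrib diff_divide_distrib)
qed

text \<open>The index of W is half the order of \<open>WF\<close>, and the defining expression
  agrees with \<open>WF\<close> only off the zeros of the sine; the limit is compared on a punctured
  ball that avoids them.\<close>

lemma whittaker_W_limit:
  assumes z: "z = exp L" "Ln z = L" and lim: "((\<lambda>\<nu>. WF k \<nu> L) \<longlongrightarrow> Y) (at (2 * m))"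
  shows "whittaker_W k m z = exp (L / 2) * Y"
proof -
  have f: "filterlim (\<lambda>\<mu>. 2 * \<mu>) (at (2 * m)) (at m)"
    unfolding filterlim_at
  proof
    show "((\<lambda>\<mu>. 2 * \<mu>) \<longlongrightarrow> 2 * m) (at m)" by (intro tendsto_intros)
  qed (simp add: eventually_at_filter)
  have "((\<lambda>\<mu>. WF k (2 * \<mu>) L) \<longlongrightarrow> Y) (at m)" by (rule filterlim_compose[OF lim f])
  then have lim': "((\<lambda>\<mu>. exp (L / 2) * WF k (2 * \<mu>) L) \<longlongrightarrow> exp (L / 2) * Y) (at m)" by (intro tendsto_intros)
  obtain r where r: "r > 0" "\<And>\<nu>. \<nu> \<in> ball (2 * m) r \<Longrightarrow> \<nu> \<noteq> 2 * m \<Longrightarrow> sin (of_real pi * \<nu> :: complex) \<noteq> 0"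
    using sin_pi_isolated by blast
  have "((\<lambda>\<mu>. Gamma (- 2 * \<mu>) * rGamma (1 / 2 - \<mu> - k) * whittaker_M k \<mu> z
      + Gamma (2 * \<mu>) * rGamma (1 / 2 + \<mu> - k) * whittaker_M k (- \<mu>) z) \<longlongrightarrow> exp (L / 2) * Y) (at m)"
  proof (rule Lim_transform_within_open[OF lim', of "ball m (r / 2)"])
    fix \<mu> assume \<mu>: "\<mu> \<in> ball m (r / 2)" "\<mu> \<noteq> m"
    have "sin (of_real pi * (2 * \<mu>)) \<noteq> 0"
    proof (rule r(2))
      have "dist (2 * m) (2 * \<mu>) = norm (2 * (m - \<mu>))" unfolding dist_norm right_diff_distrib ..
      also have "\<dots> = 2 * dist m \<mu>" unfolding norm_mult dist_norm by simp
      finally have "dist (2 * m) (2 * \<mu>) = 2 * dist m \<mu>" .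
      then show "2 * \<mu> \<in> ball (2 * m) r" using \<mu> by simp
    qed (use \<mu> in simp)
    then show "exp (L / 2) * WF k (2 * \<mu>) L = Gamma (- 2 * \<mu>) * rGamma (1 / 2 - \<mu> - k) * whittaker_M k \<mu> z
      + Gamma (2 * \<mu>) * rGamma (1 / 2 + \<mu> - k) * whittaker_M k (- \<mu>) z"
      by (rule whittaker_term[OF _ z, symmetric])
  qed (use r(1) in auto)
  then show ?thesis unfolding whittaker_W_def by (rule tendsto_Lim[rotated]) simp
qed

lemma rGamma_half_reflection: "rGamma (1 / 2 + a) * rGamma (1 / 2 - a) = cos (of_real pi * a) / (of_real pi :: complex)"
proof -
  have "sin (of_real pi * (1 / 2 + a)) = cos (of_real pi * a)"
    using sin_cos_eq[of "of_real pi * (1 / 2 + a)"] cos_minus[of "of_real pi * a"]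
    by (simp add: algebra_simps)
  moreover have "1 - (1 / 2 + a) = 1 / 2 - a" by (simp add: algebra_simps)
  ultimately show ?thesis using rGamma_reflection_complex[of "1 / 2 + a"] by simp
qed

text \<open>The Wronskian condition of \<open>HH_fund\<close> for index \<open>k\<close> and
  argument \<open>z\<close> against index \<open>- k\<close> and argument \<open>z\<close> rotated
  by \<open>\<i> * pi\<close>. The reflection formula around \<open>1 / 2\<close> turns the Gamma
  products into cosines; in \<open>A\<close> and \<open>V\<close> all exponentials are monomials and
  the claim is an identity of Laurent polynomials.\<close>

lemma whittaker_wronskian:
  fixes k \<nu> :: complex
  shows "of_real pi * rGamma (1 / 2 + \<nu> / 2 - k) * (- of_real pi * rGamma (1 / 2 - \<nu> / 2 - - k)) * exp (\<nu> * (\<i> * of_real pi) / 2)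
    - - of_real pi * rGamma (1 / 2 - \<nu> / 2 - k) * (of_real pi * rGamma (1 / 2 + \<nu> / 2 - - k)) * exp (- \<nu> * (\<i> * of_real pi) / 2)
    = - \<i> * exp (- (\<i> * of_real pi * k)) * of_real pi * sin (of_real pi * \<nu>)"
proof -
  define A V where "A = exp (\<i> * of_real pi * k)" and "V = exp (\<i> * of_real pi * \<nu> / 2)"
  have nz: "A \<noteq> 0" "V \<noteq> 0" by (simp_all add: A_def V_def)
  have a: "\<nu> * (\<i> * of_real pi) / 2 = \<i> * of_real pi * \<nu> / 2"
    "- \<nu> * (\<i> * of_real pi) / 2 = - (\<i> * of_real pi * \<nu> / 2)" by (simp_all add: mult_ac)
  have e: "exp (\<nu> * (\<i> * of_real pi) / 2) = V" "exp (- \<nu> * (\<i> * of_real pi) / 2) = 1 / V"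
    "exp (- (\<i> * of_real pi * k)) = 1 / A"
    unfolding A_def V_def a exp_minus inverse_eq_divide by (rule refl)+
  have x: "exp (\<i> * (of_real pi * (k - \<nu> / 2))) = A / V" "exp (- (\<i> * (of_real pi * (k - \<nu> / 2)))) = V / A"
    unfolding A_def V_def exp_diff[symmetric] by (rule arg_cong[of _ _ exp], simp add: algebra_simps)+
  have y: "exp (\<i> * (of_real pi * (k + \<nu> / 2))) = A * V" "exp (\<i> * (of_real pi * \<nu>)) = V * V"
    unfolding A_def V_def exp_add[symmetric] by (rule arg_cong[of _ _ exp], simp add: algebra_simps)+
  have y': "exp (- (\<i> * (of_real pi * (k + \<nu> / 2)))) = 1 / (A * V)" "exp (- (\<i> * (of_real pi * \<nu>))) = 1 / (V * V)"
    unfolding exp_minus y inverse_eq_divide by (rule refl)+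
  have c: "cos (of_real pi * (k - \<nu> / 2)) = (A / V + V / A) / 2" "cos (of_real pi * (k + \<nu> / 2)) = (A * V + 1 / (A * V)) / 2"
    "sin (of_real pi * \<nu>) = (V * V - 1 / (V * V)) / (2 * \<i>)"
    unfolding cos_exp_eq sin_exp_eq x y y' by (rule refl)+
  have r: "rGamma (1 / 2 + \<nu> / 2 - k) * rGamma (1 / 2 - \<nu> / 2 - - k) = (A / V + V / A) / 2 / of_real pi"
    "rGamma (1 / 2 - \<nu> / 2 - k) * rGamma (1 / 2 + \<nu> / 2 - - k) = (A * V + 1 / (A * V)) / 2 / of_real pi"
  proof -
    have a: "1 / 2 + \<nu> / 2 - k = 1 / 2 - (k - \<nu> / 2)" "1 / 2 - \<nu> / 2 - - k = 1 / 2 + (k - \<nu> / 2)"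
      "1 / 2 - \<nu> / 2 - k = 1 / 2 - (k + \<nu> / 2)" "1 / 2 + \<nu> / 2 - - k = 1 / 2 + (k + \<nu> / 2)" by simp_all
    show "rGamma (1 / 2 + \<nu> / 2 - k) * rGamma (1 / 2 - \<nu> / 2 - - k) = (A / V + V / A) / 2 / of_real pi"
      unfolding a(1,2) c(1)[symmetric] by (subst mult.commute) (rule rGamma_half_reflection)
    show "rGamma (1 / 2 - \<nu> / 2 - k) * rGamma (1 / 2 + \<nu> / 2 - - k) = (A * V + 1 / (A * V)) / 2 / of_real pi"
      unfolding a(3,4) c(2)[symmetric] by (subst mult.commute) (rule rGamma_half_reflection)
  qed
  have gen: "p * r1 * (- p * s1) * v - - p * r2 * (p * s2) * v' = p * p * (r2 * s2 * v' - r1 * s1 * v)"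
    for p r1 s1 v r2 s2 v' :: complex by (simp add: algebra_simps)
  have "of_real pi * rGamma (1 / 2 + \<nu> / 2 - k) * (- of_real pi * rGamma (1 / 2 - \<nu> / 2 - - k)) * exp (\<nu> * (\<i> * of_real pi) / 2)
    - - of_real pi * rGamma (1 / 2 - \<nu> / 2 - k) * (of_real pi * rGamma (1 / 2 + \<nu> / 2 - - k)) * exp (- \<nu> * (\<i> * of_real pi) / 2)
    = of_real pi * of_real pi * ((A * V + 1 / (A * V)) / 2 / of_real pi * (1 / V) - (A / V + V / A) / 2 / of_real pi * V)"
    unfolding e gen r ..
  also have "\<dots> = - \<i> * (1 / A) * of_real pi * ((V * V - 1 / (V * V)) / (2 * \<i>))"
  proof -
    have l: "p * p * ((A * V + 1 / (A * V)) / 2 / p * (1 / V) - (A / V + V / A) / 2 / p * V)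
        = p * (1 / (A * (V * V)) - V * V / A) / 2" if "p \<noteq> 0" for p
    proof -
      have f: "p * p * (X / 2 / p * v - Y / 2 / p * V) = p * (X * v - Y * V) / 2" for X Y v
        using that by (simp add: right_diff_distrib diff_divide_distrib)
      have g: "(A * V + 1 / (A * V)) * (1 / V) = A + 1 / (A * (V * V))"
        using nz by (simp add: add_divide_distrib)
      have h: "(A / V + V / A) * V = A + V * V / A"
        using nz by (simp add: distrib_right)
      show ?thesis unfolding f g h by simp
    qed
    have r: "- \<i> * (1 / A) * p * ((V * V - 1 / (V * V)) / (2 * \<i>)) = p * (1 / (A * (V * V)) - V * V / A) / 2" for p
    proof -
      have "X / (2 * \<i>) = - \<i> * (X / 2)" for X :: complex
        by (simp add: divide_eq_eq)
      then have "- \<i> * (1 / A) * p * ((V * V - 1 / (V * V)) / (2 * \<i>)) = (\<i> * \<i>) * ((1 / A) * p * ((V * V - 1 / (V * V)) / 2))"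
        by (simp only: mult_minus_left mult_minus_right minus_minus mult_ac)
      also have "\<dots> = - (1 / A) * p * (V * V - 1 / (V * V)) / 2"
        by simp
      also have "\<dots> = p * (1 / (A * (V * V)) - V * V / A) / 2"
        by (simp add: right_diff_distrib diff_divide_distrib)
      finally show ?thesis .
    qed
    show ?thesis unfolding r by (rule l) simp
  qed
  finally show ?thesis unfolding e c .
qed

lemma whittaker_fund:
  assumes nu: "Re \<nu> \<ge> 0" and P: "\<And>t. pot (1 / 2 - k) 1 \<nu> (of_real t + \<theta>) = of_real (P t)"
  shows "\<exists>Y Z. fund UNIV P Y Z \<and> (\<forall>t. ((\<lambda>\<nu>. WF k \<nu> (of_real t + \<theta>)) \<longlongrightarrow> Y t) (at \<nu>)) \<and>
    (\<forall>t. ((\<lambda>\<nu>. WF (- k) \<nu> (of_real t + (\<theta> + \<i> * of_real pi))) \<longlongrightarrow> Z t) (at \<nu>))"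
proof -
  have hol: "(\<lambda>\<nu>. - of_real pi * rGamma (1 / 2 - \<nu> / 2 - k)) holomorphic_on UNIV"
    "(\<lambda>\<nu>. of_real pi * rGamma (1 / 2 + \<nu> / 2 - k)) holomorphic_on UNIV" for k :: complex
    by (intro holomorphic_intros; simp)+
  \<comment> \<open>The product is a Pochhammer symbol that leads from the argument of one
    reciprocal Gamma function to that of the other, so the two terms cancel.\<close>
  have int: "- of_real pi * rGamma (1 / 2 - of_nat n / 2 - k) + of_real pi * rGamma (1 / 2 + of_nat n / 2 - k) *
      (\<Prod>j<n. 1 / 2 - k - 1 * of_nat n / 2 + 1 * of_nat j) = 0" for k :: complex and n
  proof -
    have "(\<Prod>j<n. 1 / 2 - k - 1 * of_nat n / 2 + 1 * of_nat j) = pochhammer (1 / 2 - of_nat n / 2 - k) n"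
      by (simp add: pochhammer_prod atLeast0LessThan algebra_simps)
    moreover have "1 / 2 - of_nat n / 2 - k + of_nat n = 1 / 2 + of_nat n / 2 - k" by simp
    ultimately show ?thesis using pochhammer_rGamma[of "1 / 2 - of_nat n / 2 - k" n] by (simp only:) simp
  qed
  have "\<exists>Y Y' Z Z'. sol UNIV P Y Y' \<and> sol UNIV P Z Z' \<and>
      (\<forall>t. Y t * Z' t - Y' t * Z t = - \<i> * exp (- (\<i> * of_real pi * k))) \<and>
    (\<forall>t. ((\<lambda>\<nu>. NN (1 / 2 - k) 1 (\<lambda>\<nu>. - of_real pi * rGamma (1 / 2 - \<nu> / 2 - k))
     (\<lambda>\<nu>. of_real pi * rGamma (1 / 2 + \<nu> / 2 - k)) \<nu> (of_real t + \<theta>) / sin (of_real pi * \<nu>)) \<longlongrightarrow> Y t) (at \<nu>)) \<and>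
    (\<forall>t. ((\<lambda>\<nu>. NN (1 / 2 - - k) 1 (\<lambda>\<nu>. - of_real pi * rGamma (1 / 2 - \<nu> / 2 - - k))
     (\<lambda>\<nu>. of_real pi * rGamma (1 / 2 + \<nu> / 2 - - k)) \<nu> (of_real t + (\<theta> + \<i> * of_real pi)) / sin (of_real pi * \<nu>)) \<longlongrightarrow> Z t) (at \<nu>))"
    by (rule HH_fund[OF hol hol nu int int _ _ P whittaker_wronskian]) simp_all
  then obtain Y Y' Z Z' where YZ: "sol UNIV P Y Y'" "sol UNIV P Z Z'"
      "\<And>t. Y t * Z' t - Y' t * Z t = - \<i> * exp (- (\<i> * of_real pi * k))"
      "\<And>t. ((\<lambda>\<nu>. WF k \<nu> (of_real t + \<theta>)) \<longlongrightarrow> Y t) (at \<nu>)"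
      "\<And>t. ((\<lambda>\<nu>. WF (- k) \<nu> (of_real t + (\<theta> + \<i> * of_real pi))) \<longlongrightarrow> Z t) (at \<nu>)"
    unfolding WF_def by blast
  have "fund UNIV P Y Z" unfolding fund_def
    by (intro exI conjI ballI, rule YZ(1), rule YZ(2)) (simp add: YZ(3))
  then show ?thesis using YZ(4,5) by blast
qed

lemma nu_range_sq: "nu_range \<nu> \<Longrightarrow> Im (\<nu>\<^sup>2) = 0" "nu_range \<nu> \<Longrightarrow> Re \<nu> \<ge> 0"
  by (auto simp: nu_range_def power2_eq_square)

lemma abs_powr_minus_half: "x \<noteq> 0 \<Longrightarrow> \<bar>x\<bar> powr (- 1 / 2) * \<bar>x\<bar> = sqrt \<bar>x\<bar>" for x :: real
  using powr_mult_base[of "\<bar>x\<bar>" "- 1 / 2"] by (simp add: powr_half_sqrt mult.commute)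

lemma exp_ln_abs: "x \<noteq> 0 \<Longrightarrow> exp (2 * ln \<bar>x\<bar>) = x\<^sup>2" for x :: real
  by (simp add: exp_double)

lemma exp_ln_abs_complex: "x \<noteq> 0 \<Longrightarrow> exp (complex_of_real (2 * ln \<bar>x\<bar>)) = (of_real x)\<^sup>2"
  using arg_cong[OF exp_ln_abs, of x complex_of_real] by (simp only: exp_of_real of_real_power simp_thms)

lemma exp_half_ln_abs: "x \<noteq> 0 \<Longrightarrow> exp ((complex_of_real (2 * ln \<bar>x\<bar>) + \<theta>) / 2) = of_real \<bar>x\<bar> * exp (\<theta> / 2)"
proof -
  assume x: "x \<noteq> 0"
  have "(complex_of_real (2 * ln \<bar>x\<bar>) + \<theta>) / 2 = of_real (ln \<bar>x\<bar>) + \<theta> / 2" by (simp add: field_simps)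
  then show ?thesis using x by (simp only: exp_add exp_of_real) simp
qed

lemma whittaker_lift_q:
  fixes x :: real
  assumes "x \<noteq> 0"
  shows "(4 * (\<rho> / 4 - \<kappa> / 4 * exp (2 * ln \<bar>x\<bar> + 0) + \<delta> * (exp (2 * ln \<bar>x\<bar> + 0))\<^sup>2 / 4) - 1 / 4) / x\<^sup>2
    = \<delta> * x\<^sup>2 - \<kappa> + (\<rho> - 1 / 4) / x\<^sup>2"
  using assms unfolding add_0_right exp_ln_abs[OF assms] by (simp add: field_simps power2_eq_square)

lemma fund_swap:
  assumes "fund D q f g"
  shows "fund D q g f"
proof -
  from assms obtain f' g' where fg: "sol D q f f'" "sol D q g g'" "\<And>t. t \<in> D \<Longrightarrow> f t * g' t - f' t * g t \<noteq> 0"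
    by (auto simp: fund_def)
  have "g t * f' t - g' t * f t = - (f t * g' t - f' t * g t)" for t by (simp add: mult.commute)
  then have "g t * f' t - g' t * f t \<noteq> 0" if "t \<in> D" for t using fg(3)[OF that] by (metis neg_equal_0_iff_equal)
  then show ?thesis unfolding fund_def using fg(1,2) by blast
qed

text \<open>With imaginary index \<open>k\<close>, conjugation exchanges the functions with index
  \<open>k\<close> at \<open>\<i> * x\<^sup>2\<close> and index \<open>- k\<close> at
  \<open>- \<i> * x\<^sup>2\<close>. These arguments differ by a rotation by \<open>pi\<close>, so
  they form a fundamental pair, and the real and imaginary part of one of them span the real
  solutions.\<close>

lemma family_whit_trig:
  assumes nu: "nu_range \<nu>"
  shows "family (- {0}) (\<lambda>x. - x\<^sup>2 - \<kappa> + (Re (\<nu>\<^sup>2) - 1 / 4) / x\<^sup>2) (whit_comb_trig \<kappa> (\<nu> / 2))"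
proof -
  let ?k = "- of_real \<kappa> * \<i> / 4 :: complex" and ?th = "\<i> * of_real pi / 2"
  define P where "P = (\<lambda>t. Re (\<nu>\<^sup>2) / 4 - \<kappa> / 4 * exp t + - 1 * (exp t)\<^sup>2 / 4)"
  have "?th = \<i> * complex_of_real (pi / 2)" by simp
  then have "exp ?th = \<i>" using cis_conv_exp[of "pi / 2"] by (simp only: cis_pi_half)
  then have ph: "exp (- ?th) = - \<i>" "exp ?th = \<i>" by (simp_all add: exp_minus)
  obtain \<rho> where \<rho>: "\<nu>\<^sup>2 = of_real \<rho>" using nu_range_sq(1)[OF nu] by (metis complex_is_Real_iff Reals_cases)
  have P: "pot (1 / 2 - - ?k) 1 \<nu> (of_real t + - ?th) = of_real (P t)" for t
    unfolding pot_def P_def exp_add ph exp_of_real \<rho> Re_complex_of_real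
    by (simp add: complex_eq_iff power2_eq_square)
  from whittaker_fund[OF nu_range_sq(2)[OF nu] P] obtain Y Z where YZ: "fund UNIV P Y Z"
    "\<And>t. ((\<lambda>\<nu>. WF (- ?k) \<nu> (of_real t + - ?th)) \<longlongrightarrow> Y t) (at \<nu>)"
    "\<And>t. ((\<lambda>\<nu>. WF (- (- ?k)) \<nu> (of_real t + (- ?th + \<i> * of_real pi))) \<longlongrightarrow> Z t) (at \<nu>)" by blast
  have th: "- ?th + \<i> * of_real pi = ?th" by simp
  have Z: "((\<lambda>\<nu>. WF ?k \<nu> (of_real t + ?th)) \<longlongrightarrow> Z t) (at \<nu>)" for t
    using YZ(3)[of t] unfolding th by simp
  have Y: "Y t = cnj (Z t)" for t
  proof -
    have cj: "cnj ?k = - ?k" "cnj (of_real t + ?th) = of_real t + - ?th" by simp_all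
    have "((\<lambda>\<nu>. cnj (WF ?k \<nu> (of_real t + ?th))) \<longlongrightarrow> cnj (Z t)) (at \<nu>)"
      by (rule tendsto_cnj[OF Z])
    then have 1: "((\<lambda>\<nu>. WF (- ?k) (cnj \<nu>) (of_real t + - ?th)) \<longlongrightarrow> cnj (Z t)) (at \<nu>)"
      unfolding WF_cnj cj .
    \<comment> \<open>Conjugation fixes a real order and maps an imaginary one to its negative. As
      \<open>WF\<close> is even in the order, both cases are limits at \<open>\<nu>\<close>
      itself.\<close>
    have "((\<lambda>\<nu>. WF (- ?k) (cnj \<nu>) (of_real t + - ?th)) \<longlongrightarrow> Y t) (at \<nu>)"
    proof (cases "Im \<nu> = 0")
      case True
      then have "cnj \<nu> = \<nu>" by (simp add: complex_eq_iff)
      then have "(cnj \<longlongrightarrow> \<nu>) (at \<nu>)" using tendsto_cnj[OF tendsto_ident_at, of \<nu> UNIV] by simp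
      moreover have "\<forall>\<^sub>F x in at \<nu>. cnj x \<in> UNIV \<and> cnj x \<noteq> \<nu>"
        unfolding eventually_at_filter by (rule always_eventually) (metis UNIV_I \<open>cnj \<nu> = \<nu>\<close> complex_cnj_cnj)
      ultimately have "filterlim cnj (at \<nu>) (at \<nu>)" unfolding filterlim_at by blast
      then show ?thesis by (rule filterlim_compose[OF YZ(2)])
    next
      case False
      then have r: "Re \<nu> = 0" using nu by (simp add: nu_range_def)
      then have e: "- cnj \<nu> = \<nu>" by (simp add: complex_eq_iff)
      then have "((\<lambda>\<nu>. - cnj \<nu>) \<longlongrightarrow> \<nu>) (at \<nu>)"
        using tendsto_minus[OF tendsto_cnj[OF tendsto_ident_at, of \<nu> UNIV]] by simp
      moreover have "\<forall>\<^sub>F x in at \<nu>. - cnj x \<in> UNIV \<and> - cnj x \<noteq> \<nu>"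
        unfolding eventually_at_filter
        by (rule always_eventually) (metis UNIV_I e complex_cnj_cnj minus_minus complex_cnj_minus)
      ultimately have "filterlim (\<lambda>\<nu>. - cnj \<nu>) (at \<nu>) (at \<nu>)" unfolding filterlim_at by blast
      then have "((\<lambda>\<nu>. WF (- ?k) (- cnj \<nu>) (of_real t + - ?th)) \<longlongrightarrow> Y t) (at \<nu>)"
        by (rule filterlim_compose[OF YZ(2)])
      then show ?thesis unfolding WF_minus .
    qed
    then show ?thesis using 1 LIM_unique by blast
  qed
  \<comment> \<open>The constant factor is the phase of \<open>exp (L / 2)\<close>, by which
    Whittaker's function differs from the limit of \<open>WF\<close>.\<close>
  define g where "g = (\<lambda>t. exp (?th / 2) * Z t)"
  have "fund UNIV P Z Y" by (rule fund_swap[OF YZ(1)])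
  then have "fund UNIV P g (\<lambda>t. cnj (g t))"
    unfolding g_def complex_cnj_mult Y by (rule fund_scale) simp_all
  from fund_lift[OF fund_Re_Im[OF this], where d = 0 and q = "\<lambda>x. - x\<^sup>2 - \<kappa> + (Re (\<nu>\<^sup>2) - 1 / 4) / x\<^sup>2"]
  have F: "fund (- {0}) (\<lambda>x. - x\<^sup>2 - \<kappa> + (Re (\<nu>\<^sup>2) - 1 / 4) / x\<^sup>2)
     (\<lambda>x. sqrt \<bar>x\<bar> *\<^sub>R Re (g (2 * ln \<bar>x\<bar> + 0))) (\<lambda>x. sqrt \<bar>x\<bar> *\<^sub>R Im (g (2 * ln \<bar>x\<bar> + 0)))"
    unfolding P_def using whittaker_lift_q[of _ "Re (\<nu>\<^sup>2)" \<kappa> "- 1"] by simp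
  show ?thesis
  proof (rule familyI[OF F])
    fix a b x :: real assume "x \<in> - {0}"
    then have x: "x \<noteq> 0" by simp
    let ?L = "complex_of_real (2 * ln \<bar>x\<bar>) + ?th"
    have z: "\<i> * (of_real x)\<^sup>2 = exp ?L" unfolding exp_add exp_ln_abs_complex[OF x] ph by simp
    have L: "Ln (\<i> * (of_real x)\<^sup>2) = ?L" unfolding z by (rule Ln_exp) auto
    have W: "whittaker_W ?k (\<nu> / 2) (\<i> * (of_real x)\<^sup>2) = of_real \<bar>x\<bar> * g (2 * ln \<bar>x\<bar>)"
      using whittaker_W_limit[OF z L, of ?k "Z (2 * ln \<bar>x\<bar>)" "\<nu> / 2"] Z[of "2 * ln \<bar>x\<bar>"]
      unfolding exp_half_ln_abs[OF x] g_def by simp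
    have "Re ((of_real a - of_real b * \<i>) * (of_real \<bar>x\<bar> * w)) = \<bar>x\<bar> * (a * Re w + b * Im w)" for w
      by (simp add: algebra_simps)
    then have "whit_comb_trig \<kappa> (\<nu> / 2) a b x = (\<bar>x\<bar> powr (- 1 / 2) * \<bar>x\<bar>) * (a * Re (g (2 * ln \<bar>x\<bar>)) + b * Im (g (2 * ln \<bar>x\<bar>)))"
      unfolding whit_comb_trig_def W by (simp only: mult.assoc)
    then show "whit_comb_trig \<kappa> (\<nu> / 2) a b x = a * (sqrt \<bar>x\<bar> *\<^sub>R Re (g (2 * ln \<bar>x\<bar> + 0))) + b * (sqrt \<bar>x\<bar> *\<^sub>R Im (g (2 * ln \<bar>x\<bar> + 0)))"
      unfolding abs_powr_minus_half[OF x] by (simp add: algebra_simps)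
  qed
qed

text \<open>The principal logarithm of \<open>- x\<^sup>2\<close> is
  \<open>2 * ln \<bar>x\<bar> + \<i> * pi\<close>, so the two functions are the pair of
  \<open>whittaker_fund\<close> with \<open>\<theta> = 0\<close>. The family is taken over complex
  parameters, because the second function need not be real.\<close>

lemma family_whit_exp:
  assumes nu: "nu_range \<nu>"
  shows "family (- {0}) (\<lambda>x. x\<^sup>2 - \<kappa> + (Re (\<nu>\<^sup>2) - 1 / 4) / x\<^sup>2) (whit_comb_exp \<kappa> (\<nu> / 2))"
proof -
  let ?k = "of_real \<kappa> / 4 :: complex" and ?th = "\<i> * of_real pi"
  define P where "P = (\<lambda>t. Re (\<nu>\<^sup>2) / 4 - \<kappa> / 4 * exp t + 1 * (exp t)\<^sup>2 / 4)"
  have P: "pot (1 / 2 - ?k) 1 \<nu> (of_real t + 0) = of_real (P t)" for t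
    unfolding pot_def P_def using nu_range_sq(1)[OF nu]
    by (simp add: complex_eq_iff exp_of_real flip: exp_of_real)
  from whittaker_fund[OF nu_range_sq(2)[OF nu] P] obtain Y Z where YZ: "fund UNIV P Y Z"
    "\<And>t. ((\<lambda>\<nu>. WF ?k \<nu> (of_real t + 0)) \<longlongrightarrow> Y t) (at \<nu>)"
    "\<And>t. ((\<lambda>\<nu>. WF (- ?k) \<nu> (of_real t + (0 + ?th))) \<longlongrightarrow> Z t) (at \<nu>)" by blast
  have "fund UNIV P (\<lambda>t. 1 * Y t) (\<lambda>t. exp (?th / 2) * Z t)"
    by (rule fund_scale[OF YZ(1)]) simp_all
  from fund_lift[OF this, where d = 0 and q = "\<lambda>x. x\<^sup>2 - \<kappa> + (Re (\<nu>\<^sup>2) - 1 / 4) / x\<^sup>2"]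
  have F: "fund (- {0}) (\<lambda>x. x\<^sup>2 - \<kappa> + (Re (\<nu>\<^sup>2) - 1 / 4) / x\<^sup>2)
     (\<lambda>x. sqrt \<bar>x\<bar> *\<^sub>R (1 * Y (2 * ln \<bar>x\<bar> + 0))) (\<lambda>x. sqrt \<bar>x\<bar> *\<^sub>R (exp (?th / 2) * Z (2 * ln \<bar>x\<bar> + 0)))"
    unfolding P_def using whittaker_lift_q[of _ "Re (\<nu>\<^sup>2)" \<kappa> 1] by simp
  show ?thesis
  proof (rule familyI[OF F])
    fix a b :: complex and x :: real assume "x \<in> - {0}"
    then have x: "x \<noteq> 0" by simp
    let ?L1 = "complex_of_real (2 * ln \<bar>x\<bar>) + 0" and ?L2 = "complex_of_real (2 * ln \<bar>x\<bar>) + ?th"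
    have z: "(of_real x)\<^sup>2 = exp ?L1" "- (of_real x)\<^sup>2 = exp ?L2"
      unfolding exp_add exp_ln_abs_complex[OF x] by simp_all
    have L: "Ln ((of_real x)\<^sup>2) = ?L1" "Ln (- (of_real x)\<^sup>2) = ?L2" by (subst z(1), rule Ln_exp; auto) (subst z(2), rule Ln_exp; auto)
    have W: "whittaker_W ?k (\<nu> / 2) ((of_real x)\<^sup>2) = of_real \<bar>x\<bar> * Y (2 * ln \<bar>x\<bar>)"
      "whittaker_W (- ?k) (\<nu> / 2) (- (of_real x)\<^sup>2) = of_real \<bar>x\<bar> * (exp (?th / 2) * Z (2 * ln \<bar>x\<bar>))"
      using whittaker_W_limit[OF z(1) L(1), of ?k "Y (2 * ln \<bar>x\<bar>)" "\<nu> / 2"] YZ(2)[of "2 * ln \<bar>x\<bar>"]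
        whittaker_W_limit[OF z(2) L(2), of "- ?k" "Z (2 * ln \<bar>x\<bar>)" "\<nu> / 2"] YZ(3)[of "2 * ln \<bar>x\<bar>"]
      unfolding exp_half_ln_abs[OF x] by simp_all
    have m: "- of_real \<kappa> / 4 = - ?k" by simp
    have "whit_comb_exp \<kappa> (\<nu> / 2) a b x = of_real (\<bar>x\<bar> powr (- 1 / 2) * \<bar>x\<bar>) * (a * Y (2 * ln \<bar>x\<bar>) + b * (exp (?th / 2) * Z (2 * ln \<bar>x\<bar>)))"
      unfolding whit_comb_exp_def m W by (simp add: algebra_simps)
    then show "whit_comb_exp \<kappa> (\<nu> / 2) a b x = a * (sqrt \<bar>x\<bar> *\<^sub>R (1 * Y (2 * ln \<bar>x\<bar> + 0))) + b * (sqrt \<bar>x\<bar> *\<^sub>R (exp (?th / 2) * Z (2 * ln \<bar>x\<bar> + 0)))"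
      unfolding abs_powr_minus_half[OF x] by (simp add: algebra_simps scaleR_conv_of_real)
  qed
qed

section \<open>Airy functions\<close>

text \<open>Triplication of the factorial. It rewrites the Airy series with step 3 as series in
  \<open>x ^ 3 / 9\<close> that contain one Pochhammer symbol.\<close>

lemma pochhammer_triple_fact:
  fixes n :: nat
  shows "9 ^ n * 3 ^ n * pochhammer (1 / 3) n * pochhammer (2 / 3) n * fact n = (fact (3 * n) :: real)"
    "9 ^ n * 3 ^ n * pochhammer (2 / 3) n * pochhammer (4 / 3) n * fact n = (fact (3 * n + 1) :: real)"
proof -
  have s: "3 * Suc n = Suc (Suc (Suc (3 * n)))" for n by simp
  show "9 ^ n * 3 ^ n * pochhammer (1 / 3) n * pochhammer (2 / 3) n * fact n = (fact (3 * n) :: real)"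
  proof (induction n)
    case (Suc n)
    have "9 ^ Suc n * 3 ^ Suc n * pochhammer (1 / 3) (Suc n) * pochhammer (2 / 3) (Suc n) * fact (Suc n)
      = (9 ^ n * 3 ^ n * pochhammer (1 / 3) n * pochhammer (2 / 3) n * fact n) *
        (27 * (1 / 3 + real n) * (2 / 3 + real n) * real (Suc n))"
      by (simp add: pochhammer_Suc mult_ac)
    then show ?case unfolding Suc s by (simp add: field_simps)
  qed simp
  show "9 ^ n * 3 ^ n * pochhammer (2 / 3) n * pochhammer (4 / 3) n * fact n = (fact (3 * n + 1) :: real)"
  proof (induction n)
    case (Suc n)
    have "9 ^ Suc n * 3 ^ Suc n * pochhammer (2 / 3) (Suc n) * pochhammer (4 / 3) (Suc n) * fact (Suc n)
      = (9 ^ n * 3 ^ n * pochhammer (2 / 3) n * pochhammer (4 / 3) n * fact n) *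
        (27 * (2 / 3 + real n) * (4 / 3 + real n) * real (Suc n))"
      by (simp add: pochhammer_Suc mult_ac)
    then show ?case unfolding Suc s by (simp add: field_simps)
  qed simp
qed

lemma hyp_airy_coeff:
  assumes "a > 0"
  shows "Gamma (of_real a) * hyp_coeff 1 0 (of_real a - 1) n = of_real (1 / (pochhammer a n * fact n))"
proof -
  have p: "pochhammer a n > 0" using assms by (rule pochhammer_pos)
  have g: "rGamma (of_real a :: complex) = of_real (pochhammer a n) * rGamma (of_real a + of_nat n)"
    using pochhammer_rGamma[of "of_real a :: complex" n] by (simp add: pochhammer_of_real)
  have "(of_real a :: complex) \<notin> \<int>\<^sub>\<le>\<^sub>0"
  proof
    assume "(of_real a :: complex) \<in> \<int>\<^sub>\<le>\<^sub>0"
    then obtain n where "(of_real a :: complex) = of_int n" "n \<le> 0" by (auto elim: nonpos_Ints_cases)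
    then show False using assms by (metis of_int_le_0_iff not_le of_real_eq_iff of_real_of_int_eq)
  qed
  then have "Gamma (of_real a :: complex) * rGamma (of_real a) = 1"
    by (simp add: rGamma_inverse_Gamma Gamma_eq_zero_iff)
  then have "Gamma (of_real a :: complex) * rGamma (of_real a + of_nat n) = 1 / of_real (pochhammer a n)"
    using p unfolding g by (simp add: field_simps)
  then show ?thesis by (simp add: hyp_coeff_def field_simps)
qed

text \<open>The function 0F1(; a; w), with value 1 at the origin for \<open>a > 0\<close>;
  \<open>airy_h'\<close> and \<open>airy_h''\<close> are its derivatives.\<close>

definition airy_h :: "real \<Rightarrow> real \<Rightarrow> real" where
  "airy_h a w = Re (Gamma (of_real a) * hyp 1 0 (of_real a - 1) (of_real w))"

definition airy_h' :: "real \<Rightarrow> real \<Rightarrow> real" where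
  "airy_h' a w = Re (Gamma (of_real a) * hyp 1 0 (of_real a) (of_real w))"

definition airy_h'' :: "real \<Rightarrow> real \<Rightarrow> real" where
  "airy_h'' a w = Re (Gamma (of_real a) * hyp 1 0 (of_real a + 1) (of_real w))"

lemma Re_deriv:
  assumes "(f has_field_derivative f') (at (of_real w))"
  shows "((\<lambda>w. Re (f (of_real w))) has_real_derivative Re f') (at w)"
proof -
  have "((\<lambda>w. f (of_real w)) has_vector_derivative f') (at w)"
    by (rule has_vector_derivative_real_field[OF assms])
  from bounded_linear.has_vector_derivative[OF bounded_linear_Re this]
  show ?thesis by (simp add: has_real_derivative_iff_has_vector_derivative)
qed

lemma airy_h_deriv:
  "(airy_h a has_real_derivative airy_h' a w) (at w)" "(airy_h' a has_real_derivative airy_h'' a w) (at w)"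
proof -
  show "(airy_h a has_real_derivative airy_h' a w) (at w)"
    unfolding airy_h_def[abs_def] airy_h'_def
    by (rule Re_deriv, rule DERIV_cmult)
      (use hyp_has_field_derivative[of 1 0 "of_real a - 1" "of_real w"] in simp)
  show "(airy_h' a has_real_derivative airy_h'' a w) (at w)"
    unfolding airy_h'_def[abs_def] airy_h''_def
    by (rule Re_deriv, rule DERIV_cmult)
      (use hyp_has_field_derivative[of 1 0 "of_real a" "of_real w"] in simp)
qed

lemma airy_h_ode: "w * airy_h'' a w + a * airy_h' a w = airy_h a w"
proof -
  have "Gamma (of_real a) * (of_real w * hyp 1 0 (of_real a + 1) (of_real w) + of_real a * hyp 1 0 (of_real a) (of_real w))
    = Gamma (of_real a) * hyp 1 0 (of_real a - 1) (of_real w)"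
    using hyp_ode[of "of_real w" 1 0 "of_real a - 1"] by (simp add: algebra_simps)
  from arg_cong[OF this, of Re] show ?thesis
    unfolding airy_h_def airy_h'_def airy_h''_def by (simp add: algebra_simps)
qed

lemma airy_h_sums:
  assumes "a > 0"
  shows "(\<lambda>n. w ^ n / (pochhammer a n * fact n)) sums airy_h a w"
proof -
  have "(\<lambda>n. Gamma (of_real a) * (hyp_coeff 1 0 (of_real a - 1) n * of_real w ^ n)) sums
      (Gamma (of_real a) * hyp 1 0 (of_real a - 1) (of_real w))"
    unfolding hyp_def by (intro sums_mult summable_sums hyp_summable)
  then have "(\<lambda>n. of_real (w ^ n / (pochhammer a n * fact n))) sums
      (Gamma (of_real a) * hyp 1 0 (of_real a - 1) (complex_of_real w))"
    using hyp_airy_coeff[OF assms] by (simp flip: mult.assoc)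
  from sums_Re[OF this] show ?thesis unfolding airy_h_def Re_complex_of_real .
qed

lemma airy_h_series: "a > 0 \<Longrightarrow> airy_h a w = (\<Sum>n. w ^ n / (pochhammer a n * fact n))"
  using sums_unique[OF airy_h_sums] .

lemma power_cube_swap: "(x ^ n) ^ 3 = (x ^ 3) ^ n" for x :: real
  by (simp add: mult.commute flip: power_mult)

lemma airy_f_eq: "airy_f x = airy_h (2 / 3) (x ^ 3 / 9)"
  unfolding airy_f_def airy_h_series[of "2 / 3", simplified] pochhammer_triple_fact(1)[symmetric]
proof (rule suminf_cong)
  fix n
  have "pochhammer (1 / 3) n > (0::real)" by (rule pochhammer_pos) simp
  moreover have "pochhammer (2 / 3) n > (0::real)" by (rule pochhammer_pos) simp
  ultimately show "3 ^ n * pochhammer (1 / 3) n * x ^ (3 * n) / (9 ^ n * 3 ^ n * pochhammer (1 / 3) n * pochhammer (2 / 3) n * fact n)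
    = (x ^ 3 / 9) ^ n / (pochhammer (2 / 3) n * fact n)"
    by (simp add: field_simps power_mult power_cube_swap)
qed

lemma airy_g_eq: "airy_g x = x * airy_h (4 / 3) (x ^ 3 / 9)"
proof -
  have t: "3 ^ n * pochhammer (2 / 3) n * x ^ (3 * n + 1) / fact (3 * n + 1)
    = x * ((x ^ 3 / 9) ^ n / (pochhammer (4 / 3) n * fact n))" for n
  proof -
    have "pochhammer (2 / 3) n > (0::real)" by (rule pochhammer_pos) simp
    moreover have "pochhammer (4 / 3) n > (0::real)" by (rule pochhammer_pos) simp
    ultimately show ?thesis unfolding pochhammer_triple_fact(2)[symmetric]
      by (simp add: field_simps power_mult power_cube_swap)
  qed
  have "summable (\<lambda>n. (x ^ 3 / 9) ^ n / (pochhammer (4 / 3) n * fact n :: real))"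
    by (rule sums_summable[OF airy_h_sums]) simp
  from suminf_mult[OF this] show ?thesis unfolding airy_g_def t using airy_h_series[of "4 / 3"] by simp
qed

text \<open>Under \<open>w = x ^ 3 / 9\<close> the Airy equation becomes the equation of
  \<open>airy_h\<close> with \<open>a = 2 / 3\<close>, and with \<open>a = 4 / 3\<close> after
  splitting off a factor \<open>x\<close>. The Wronskian is constant and its value is found at the
  origin.\<close>

lemma fund_airy: "fund UNIV (\<lambda>x. x) airy_f airy_g"
proof -
  define F' where "F' = (\<lambda>x. airy_h' (2 / 3) (x ^ 3 / 9) * (x\<^sup>2 / 3))"
  define G' where "G' = (\<lambda>x. airy_h (4 / 3) (x ^ 3 / 9) + x * (airy_h' (4 / 3) (x ^ 3 / 9) * (x\<^sup>2 / 3)))"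
  have c: "((\<lambda>x. x ^ 3 / 9) has_real_derivative x\<^sup>2 / 3) (at x)" for x :: real
    by (auto intro!: derivative_eq_intros)
  note h = DERIV_chain2[OF airy_h_deriv(1) c] DERIV_chain2[OF airy_h_deriv(2) c]
  have F1: "(airy_f has_real_derivative F' x) (at x)" for x
    unfolding airy_f_eq[abs_def] F'_def by (rule h(1))
  have G1: "(airy_g has_real_derivative G' x) (at x)" for x
    unfolding airy_g_eq[abs_def] G'_def by (rule derivative_eq_intros h refl)+ simp
  have q: "((\<lambda>x. x\<^sup>2 / 3) has_real_derivative 2 * x / 3) (at x)" for x :: real
    by (auto intro!: derivative_eq_intros)
  have F2: "(F' has_real_derivative x * airy_f x) (at x)" for x
  proof -
    have "(F' has_real_derivative (airy_h'' (2 / 3) (x ^ 3 / 9) * (x\<^sup>2 / 3)) * (x\<^sup>2 / 3)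
        + 2 * x / 3 * airy_h' (2 / 3) (x ^ 3 / 9)) (at x)"
      unfolding F'_def by (rule DERIV_mult[OF h(2) q])
    moreover have "(airy_h'' (2 / 3) (x ^ 3 / 9) * (x\<^sup>2 / 3)) * (x\<^sup>2 / 3) + 2 * x / 3 * airy_h' (2 / 3) (x ^ 3 / 9)
      = x * (x ^ 3 / 9 * airy_h'' (2 / 3) (x ^ 3 / 9) + 2 / 3 * airy_h' (2 / 3) (x ^ 3 / 9))"
      by (simp add: field_simps power2_eq_square power3_eq_cube)
    ultimately show ?thesis unfolding airy_h_ode airy_f_eq by simp
  qed
  have G2: "(G' has_real_derivative x * airy_g x) (at x)" for x
  proof -
    have "(G' has_real_derivative airy_h' (4 / 3) (x ^ 3 / 9) * (x\<^sup>2 / 3)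
        + (1 * (airy_h' (4 / 3) (x ^ 3 / 9) * (x\<^sup>2 / 3)) +
        ((airy_h'' (4 / 3) (x ^ 3 / 9) * (x\<^sup>2 / 3)) * (x\<^sup>2 / 3)
        + 2 * x / 3 * airy_h' (4 / 3) (x ^ 3 / 9)) * x)) (at x)"
      unfolding G'_def by (rule DERIV_add[OF h(1) DERIV_mult[OF DERIV_ident DERIV_mult[OF h(2) q]]])
    moreover have "airy_h' (4 / 3) (x ^ 3 / 9) * (x\<^sup>2 / 3)
        + (1 * (airy_h' (4 / 3) (x ^ 3 / 9) * (x\<^sup>2 / 3)) +
        ((airy_h'' (4 / 3) (x ^ 3 / 9) * (x\<^sup>2 / 3)) * (x\<^sup>2 / 3)
        + 2 * x / 3 * airy_h' (4 / 3) (x ^ 3 / 9)) * x)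
      = x * (x * (x ^ 3 / 9 * airy_h'' (4 / 3) (x ^ 3 / 9) + 4 / 3 * airy_h' (4 / 3) (x ^ 3 / 9)))"
      by (simp add: field_simps power2_eq_square power3_eq_cube)
    ultimately show ?thesis unfolding airy_h_ode airy_g_eq by simp
  qed
  have sol: "sol UNIV (\<lambda>x. x) airy_f F'" "sol UNIV (\<lambda>x. x) airy_g G'"
    using F1 F2 G1 G2 by (simp_all add: sol_def flip: has_real_derivative_iff_has_vector_derivative)
  have h0: "airy_h a 0 = 1" if "a > 0" for a
    unfolding airy_h_series[OF that] by (subst suminf_finite[of "{0}"]) auto
  have U: "open_interval UNIV" by (auto simp: open_interval_def)
  have wr: "airy_f t * G' t - F' t * airy_g t = 1" for t
    using sol_wronskian_const[OF U sol, of t 0] by (simp add: G'_def F'_def airy_f_eq airy_g_eq h0)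
  show ?thesis unfolding fund_def
    by (intro exI conjI ballI, rule sol(1), rule sol(2)) (simp add: wr)
qed

lemma family_airy: "family UNIV (\<lambda>x. x) (\<lambda>a b. W_of (C2c a b))"
proof -
  define p q where "p = inverse (3 powr (2 / 3) * Gamma (2 / 3 :: real))" and "q = inverse (3 powr (1 / 3) * Gamma (1 / 3 :: real))"
  have pq: "p \<noteq> 0" "q \<noteq> 0"
    unfolding p_def q_def using Gamma_real_pos[of "2 / 3", OF divide_pos_pos] Gamma_real_pos[of "1 / 3", OF divide_pos_pos]
    by (simp_all add: less_imp_neq[symmetric])
  from fund_airy obtain f' g' where fg: "sol UNIV (\<lambda>x. x) airy_f f'" "sol UNIV (\<lambda>x. x) airy_g g'"
    "\<And>t. airy_f t * g' t - f' t * airy_g t \<noteq> 0" by (auto simp: fund_def)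
  have AB: "Airy_Ai = (\<lambda>x. p * airy_f x + - q * airy_g x)" "Airy_Bi = (\<lambda>x. sqrt 3 * p * airy_f x + sqrt 3 * q * airy_g x)"
    by (auto simp: Airy_Ai_def Airy_Bi_def p_def q_def field_simps)
  have "fund UNIV (\<lambda>x. x) Airy_Ai Airy_Bi" unfolding fund_def AB
  proof (intro exI conjI ballI, rule sol_lincomb[OF fg(1,2)], rule sol_lincomb[OF fg(1,2)])
    fix t
    have "(p * airy_f t + - q * airy_g t) * (sqrt 3 * p * f' t + sqrt 3 * q * g' t) -
      (p * f' t + - q * g' t) * (sqrt 3 * p * airy_f t + sqrt 3 * q * airy_g t)
      = 2 * sqrt 3 * p * q * (airy_f t * g' t - f' t * airy_g t)" by (simp add: algebra_simps)
    then show "(p * airy_f t + - q * airy_g t) * (sqrt 3 * p * f' t + sqrt 3 * q * g' t) -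
      (p * f' t + - q * g' t) * (sqrt 3 * p * airy_f t + sqrt 3 * q * airy_g t) \<noteq> 0"
      using fg(3)[of t] pq by simp
  qed
  then show ?thesis by (rule familyI) simp
qed

section \<open>Determining equations\<close>

lemma open_dom3: "open T \<Longrightarrow> open I \<Longrightarrow> open (dom3 T I)"
  by (intro open_Times) auto

lemma pd_lines:
  assumes "f differentiable (at (t, x, u))"
  shows "((\<lambda>s. f (s, x, u)) has_real_derivative pd_t f (t, x, u)) (at t)"
    "((\<lambda>y. f (t, y, u)) has_real_derivative pd_x f (t, x, u)) (at x)"
    "((\<lambda>v. f (t, x, v)) has_real_derivative pd_u f (t, x, u)) (at u)"
proof -
  let ?D = "frechet_derivative f (at (t, x, u))"
  have D: "(f has_derivative ?D) (at (t, x, u))" using assms by (simp add: frechet_derivative_works)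
  then have lin: "?D (h *\<^sub>R v) = h *\<^sub>R ?D v" for h v
    using linear_scale[OF has_derivative_linear[OF D]] by blast
  have "?D (h, 0, 0) = ?D (1, 0, 0) * h" "?D (0, h, 0) = ?D (0, 1, 0) * h" "?D (0, 0, h) = ?D (0, 0, 1) * h" for h
    using lin[of h "(1, 0, 0)"] lin[of h "(0, 1, 0)"] lin[of h "(0, 0, 1)"] by simp_all
  then have e: "(\<lambda>h. ?D (h, 0, 0)) = (*) (?D (1, 0, 0))" "(\<lambda>h. ?D (0, h, 0)) = (*) (?D (0, 1, 0))"
    "(\<lambda>h. ?D (0, 0, h)) = (*) (?D (0, 0, 1))" by blast+
  have i: "((\<lambda>s. (s, x, u)) has_derivative (\<lambda>h. (h, 0, 0))) (at t)"
    "((\<lambda>y. (t, y, u)) has_derivative (\<lambda>h. (0, h, 0))) (at x)"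
    "((\<lambda>v. (t, x, v)) has_derivative (\<lambda>h. (0, 0, h))) (at u)"
    by (intro has_derivative_Pair has_derivative_ident has_derivative_const)+
  show "((\<lambda>s. f (s, x, u)) has_real_derivative pd_t f (t, x, u)) (at t)"
    using has_derivative_compose[OF i(1) D] unfolding has_field_derivative_def pd_def e(1) .
  show "((\<lambda>y. f (t, y, u)) has_real_derivative pd_x f (t, x, u)) (at x)"
    using has_derivative_compose[OF i(2) D] unfolding has_field_derivative_def pd_def e(2) .
  show "((\<lambda>v. f (t, x, v)) has_real_derivative pd_u f (t, x, u)) (at u)"
    using has_derivative_compose[OF i(3) D] unfolding has_field_derivative_def pd_def e(3) .
qed

text \<open>The field is described by \<open>\<phi>\<close> on
  \<open>T \<times> I \<times> UNIV\<close> only. Partial derivatives are computed along lines, on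
  which \<open>F\<close> and \<open>\<phi>\<close> agree near the point.\<close>

lemma pd_eq:
  assumes "open T" "open I" "smooth_on (dom3 T I) F" "t \<in> T" "x \<in> I"
    and F: "\<And>t x u. t \<in> T \<Longrightarrow> x \<in> I \<Longrightarrow> F (t, x, u) = \<phi> t x u"
  shows "((\<lambda>s. \<phi> s x u) has_real_derivative d) (at t) \<Longrightarrow> pd_t F (t, x, u) = d"
    "((\<lambda>y. \<phi> t y u) has_real_derivative d) (at x) \<Longrightarrow> pd_x F (t, x, u) = d"
    "((\<lambda>v. \<phi> t x v) has_real_derivative d) (at u) \<Longrightarrow> pd_u F (t, x, u) = d"
proof -
  have d: "F differentiable (at (t, x, u))" using assms by (intro smooth_on_differentiable) auto
  note l = pd_lines[OF d]
  show "pd_t F (t, x, u) = d" if "((\<lambda>s. \<phi> s x u) has_real_derivative d) (at t)"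
    by (rule DERIV_unique[OF has_field_derivative_transform_within_open[OF l(1) assms(1,4)] that]) (simp add: F assms)
  show "pd_x F (t, x, u) = d" if "((\<lambda>y. \<phi> t y u) has_real_derivative d) (at x)"
    by (rule DERIV_unique[OF has_field_derivative_transform_within_open[OF l(2) assms(2,5)] that]) (simp add: F assms)
  show "pd_u F (t, x, u) = d" if "((\<lambda>v. \<phi> t x v) has_real_derivative d) (at u)"
    by (rule DERIV_unique[OF has_field_derivative_transform_within_open[OF l(3) open_UNIV UNIV_I] that]) (simp add: F assms)
qed

lemma smooth_on_pd: "smooth_on S f \<Longrightarrow> smooth_on S (pd v f)"
  unfolding pd_def[abs_def] by (rule smooth_on_frechet)

text \<open>Once \<open>ut\<close> is eliminated, the condition on a field of essential form is
  linear in \<open>u\<close>, \<open>ux\<close> and \<open>uxx\<close>; \<open>utx\<close> drops out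
  because \<tau> depends on \<open>t\<close> only. These jet coordinates are free, so each
  coefficient vanishes.\<close>

lemma lie_algebra_criterion:
  assumes op: "open T" "open I" and Q: "smooth_on (dom3 T I) Q"
    and form: "\<And>t x u. t \<in> T \<Longrightarrow> x \<in> I \<Longrightarrow> Q (t, x, u) = (\<tau> t, \<xi> t x, \<eta> t x * u)"
    and d: "\<And>t. t \<in> T \<Longrightarrow> (\<tau> has_real_derivative \<tau>t t) (at t)"
      "\<And>t x. t \<in> T \<Longrightarrow> x \<in> I \<Longrightarrow> ((\<lambda>s. \<xi> s x) has_real_derivative \<xi>t t x) (at t)"
      "\<And>t x. t \<in> T \<Longrightarrow> x \<in> I \<Longrightarrow> (\<xi> t has_real_derivative \<xi>x t x) (at x)"
      "\<And>t x. t \<in> T \<Longrightarrow> x \<in> I \<Longrightarrow> (\<xi>x t has_real_derivative \<xi>xx t x) (at x)"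
      "\<And>t x. t \<in> T \<Longrightarrow> x \<in> I \<Longrightarrow> ((\<lambda>s. \<eta> s x) has_real_derivative \<eta>t t x) (at t)"
      "\<And>t x. t \<in> T \<Longrightarrow> x \<in> I \<Longrightarrow> (\<eta> t has_real_derivative \<eta>x t x) (at x)"
      "\<And>t x. t \<in> T \<Longrightarrow> x \<in> I \<Longrightarrow> (\<eta>x t has_real_derivative \<eta>xx t x) (at x)"
  shows "Q \<in> lie_algebra T I A B \<longleftrightarrow> (\<forall>t\<in>T. \<forall>x\<in>I.
      (2 * \<xi>x t x - \<tau>t t) * A x = \<xi> t x * deriv A x \<and>
      2 * A x * \<eta>x t x = A x * \<xi>xx t x + B x * \<xi>x t x - B x * \<tau>t t - \<xi>t t x - \<xi> t x * deriv B x \<and>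
      \<eta>t t x = A x * \<eta>xx t x + B x * \<eta>x t x)"
proof -
  define f g h where "f = (\<lambda>p. fst (Q p))" and "g = (\<lambda>p. fst (snd (Q p)))" and "h = (\<lambda>p. snd (snd (Q p)))"
  have bl: "bounded_linear (fst :: point \<Rightarrow> real)" "bounded_linear (\<lambda>p :: point. fst (snd p))" "bounded_linear (\<lambda>p :: point. snd (snd p))"
    by (intro bounded_linear_fst bounded_linear_fst_comp bounded_linear_snd_comp bounded_linear_snd)+
  have sm: "smooth_on (dom3 T I) f" "smooth_on (dom3 T I) g" "smooth_on (dom3 T I) h"
    unfolding f_def g_def h_def
    by (rule smooth_on_linear_comp[OF open_dom3[OF op] bl(1) Q] smooth_on_linear_comp[OF open_dom3[OF op] bl(2) Q]
        smooth_on_linear_comp[OF open_dom3[OF op] bl(3) Q])+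
  have f: "f (t, x, u) = \<tau> t" and g: "g (t, x, u) = \<xi> t x" and h: "h (t, x, u) = \<eta> t x * u"
    if "t \<in> T" "x \<in> I" for t x u
    using form[OF that] by (simp_all add: f_def g_def h_def)
  note pf = pd_eq[OF op sm(1) _ _ f] and pg = pd_eq[OF op sm(2) _ _ g] and ph = pd_eq[OF op sm(3) _ _ h]
  have f1: "pd_t f (t, x, u) = \<tau>t t" "pd_x f (t, x, u) = 0" "pd_u f (t, x, u) = 0"
    and g1: "pd_t g (t, x, u) = \<xi>t t x" "pd_x g (t, x, u) = \<xi>x t x" "pd_u g (t, x, u) = 0"
    and h1: "pd_t h (t, x, u) = \<eta>t t x * u" "pd_x h (t, x, u) = \<eta>x t x * u" "pd_u h (t, x, u) = \<eta> t x"
    if "t \<in> T" "x \<in> I" for t x u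
    using that d by (auto intro!: pf pg ph DERIV_cmult_right derivative_eq_intros)
  note s2 = smooth_on_pd[OF sm(1)] smooth_on_pd[OF sm(2)] smooth_on_pd[OF sm(3)]
  have f2: "pd_x (pd_x f) (t, x, u) = 0" "pd_x (pd_u f) (t, x, u) = 0" "pd_u (pd_u f) (t, x, u) = 0"
    and g2: "pd_x (pd_x g) (t, x, u) = \<xi>xx t x" "pd_x (pd_u g) (t, x, u) = 0" "pd_u (pd_u g) (t, x, u) = 0"
    and h2: "pd_x (pd_x h) (t, x, u) = \<eta>xx t x * u" "pd_x (pd_u h) (t, x, u) = \<eta>x t x" "pd_u (pd_u h) (t, x, u) = 0"
    if tx: "t \<in> T" "x \<in> I" for t x u
  proof -
    note e = pd_eq[OF op _ tx]
    show "pd_x (pd_x f) (t, x, u) = 0" by (rule e(2)[OF s2(1) f1(2)]) auto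
    show "pd_x (pd_u f) (t, x, u) = 0" by (rule e(2)[OF s2(1) f1(3)]) auto
    show "pd_u (pd_u f) (t, x, u) = 0" by (rule e(3)[OF s2(1) f1(3)]) auto
    show "pd_x (pd_x g) (t, x, u) = \<xi>xx t x" by (rule e(2)[OF s2(2) g1(2)]) (use d tx in auto)
    show "pd_x (pd_u g) (t, x, u) = 0" by (rule e(2)[OF s2(2) g1(3)]) auto
    show "pd_u (pd_u g) (t, x, u) = 0" by (rule e(3)[OF s2(2) g1(3)]) auto
    show "pd_x (pd_x h) (t, x, u) = \<eta>xx t x * u"
      by (rule e(2)[OF s2(3) h1(2)]) (use d tx in \<open>auto intro!: DERIV_cmult_right\<close>)
    show "pd_x (pd_u h) (t, x, u) = \<eta>x t x" by (rule e(2)[OF s2(3) h1(3)]) (use d tx in auto)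
    show "pd_u (pd_u h) (t, x, u) = 0" by (rule e(3)[OF s2(3) h1(3)]) auto
  qed
  define E where "E = (\<lambda>t x u ux uxx. u * (\<eta>t t x - A x * \<eta>xx t x - B x * \<eta>x t x)
      + uxx * ((2 * \<xi>x t x - \<tau>t t) * A x - \<xi> t x * deriv A x)
      + ux * (A x * \<xi>xx t x + B x * \<xi>x t x - B x * \<tau>t t - \<xi>t t x - \<xi> t x * deriv B x - 2 * A x * \<eta>x t x))"
  have E: "prol_t f g h ut ux (t, x, u) - A x * prol_xx f g h ut ux utx uxx (t, x, u)
      - B x * prol_x f g h ut ux (t, x, u) - g (t, x, u) * (deriv A x * uxx + deriv B x * ux) = E t x u ux uxx"
    if "t \<in> T" "x \<in> I" "ut = A x * uxx + B x * ux" for t x u ut ux utx uxx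
    unfolding prol_t_def prol_x_def prol_xx_def Dt_def Dx_def Dxx_def E_def
    using that by (simp add: f1 g1 h1 f2 g2 h2 g algebra_simps)
  have gq: "fst (snd (Q p)) = g p" for p by (simp add: g_def)
  have "Q \<in> lie_algebra T I A B \<longleftrightarrow> (\<forall>t\<in>T. \<forall>x\<in>I. \<forall>u ux uxx. E t x u ux uxx = 0)"
    unfolding lie_algebra_def Let_def f_def[symmetric] g_def[symmetric] h_def[symmetric] mem_Collect_eq
    using E Q by (auto simp: gq)
  also have "\<dots> \<longleftrightarrow> (\<forall>t\<in>T. \<forall>x\<in>I. E t x 1 0 0 = 0 \<and> E t x 0 1 0 = 0 \<and> E t x 0 0 1 = 0)"
  proof -
    have "E t x u ux uxx = u * E t x 1 0 0 + ux * E t x 0 1 0 + uxx * E t x 0 0 1" for t x u ux uxx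
      by (simp add: E_def)
    then show ?thesis by (metis add_0_right mult_zero_right)
  qed
  also have "\<dots> \<longleftrightarrow> (\<forall>t\<in>T. \<forall>x\<in>I.
      (2 * \<xi>x t x - \<tau>t t) * A x = \<xi> t x * deriv A x \<and>
      2 * A x * \<eta>x t x = A x * \<xi>xx t x + B x * \<xi>x t x - B x * \<tau>t t - \<xi>t t x - \<xi> t x * deriv B x \<and>
      \<eta>t t x = A x * \<eta>xx t x + B x * \<eta>x t x)"
  proof -
    have "E t x 1 0 0 = 0 \<longleftrightarrow> \<eta>t t x = A x * \<eta>xx t x + B x * \<eta>x t x"
      "E t x 0 1 0 = 0 \<longleftrightarrow> 2 * A x * \<eta>x t x = A x * \<xi>xx t x + B x * \<xi>x t x - B x * \<tau>t t - \<xi>t t x - \<xi> t x * deriv B x"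
      "E t x 0 0 1 = 0 \<longleftrightarrow> (2 * \<xi>x t x - \<tau>t t) * A x = \<xi> t x * deriv A x" for t x
      unfolding E_def by auto
    then show ?thesis by blast
  qed
  finally show ?thesis .
qed

text \<open>Membership provides the components only as functions that agree with \<open>Q\<close>
  pointwise. Their smoothness is recovered by restricting \<open>Q\<close> to lines in
  \<open>t\<close> and in \<open>x\<close> at \<open>u = 1\<close>.\<close>

lemma ess_algebra_D:
  assumes op: "open T" "open I" and Q: "Q \<in> ess_algebra T I A B"
  obtains \<tau> \<xi> \<eta> where "\<And>t x u. t \<in> T \<Longrightarrow> x \<in> I \<Longrightarrow> Q (t, x, u) = (\<tau> t, \<xi> t x, \<eta> t x * u)"
    "I \<noteq> {} \<Longrightarrow> smooth_on T \<tau>" "\<And>x. x \<in> I \<Longrightarrow> smooth_on T (\<lambda>t. \<xi> t x)" "\<And>t. t \<in> T \<Longrightarrow> smooth_on I (\<xi> t)"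
    "\<And>x. x \<in> I \<Longrightarrow> smooth_on T (\<lambda>t. \<eta> t x)" "\<And>t. t \<in> T \<Longrightarrow> smooth_on I (\<eta> t)"
    "\<And>t x. t \<in> T \<Longrightarrow> x \<in> I \<Longrightarrow> (2 * deriv (\<xi> t) x - deriv \<tau> t) * A x = \<xi> t x * deriv A x"
    "\<And>t x. t \<in> T \<Longrightarrow> x \<in> I \<Longrightarrow> 2 * A x * deriv (\<eta> t) x = A x * deriv (deriv (\<xi> t)) x + B x * deriv (\<xi> t) x
       - B x * deriv \<tau> t - deriv (\<lambda>s. \<xi> s x) t - \<xi> t x * deriv B x"
    "\<And>t x. t \<in> T \<Longrightarrow> x \<in> I \<Longrightarrow> deriv (\<lambda>s. \<eta> s x) t = A x * deriv (deriv (\<eta> t)) x + B x * deriv (\<eta> t) x"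
proof -
  from Q obtain \<tau> \<xi> \<eta> where form: "\<And>t x u. t \<in> T \<Longrightarrow> x \<in> I \<Longrightarrow> Q (t, x, u) = (\<tau> t, \<xi> t x, \<eta> t x * u)"
    and L: "Q \<in> lie_algebra T I A B" unfolding ess_algebra_def by blast
  have sQ: "smooth_on (dom3 T I) Q" using L by (simp add: lie_algebra_def)
  have tl: "smooth_on T (\<lambda>t. Q (t, x, u))" if "x \<in> I" for x u
  proof -
    have "smooth_on T (\<lambda>t. Q ((t, 0, 0) + (0, x, u)))"
      by (rule smooth_on_affine_comp[OF open_dom3[OF op] op(1) _ _ sQ])
        (use that in \<open>auto intro!: bounded_linear_Pair bounded_linear_ident bounded_linear_zero\<close>)
    then show ?thesis by simp
  qed
  have xl: "smooth_on I (\<lambda>x. Q (t, x, u))" if "t \<in> T" for t u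
  proof -
    have "smooth_on I (\<lambda>x. Q ((0, x, 0) + (t, 0, u)))"
      by (rule smooth_on_affine_comp[OF open_dom3[OF op] op(2) _ _ sQ])
        (use that in \<open>auto intro!: bounded_linear_Pair bounded_linear_ident bounded_linear_zero\<close>)
    then show ?thesis by simp
  qed
  have bl: "bounded_linear (fst :: point \<Rightarrow> real)" "bounded_linear (\<lambda>p :: point. fst (snd p))" "bounded_linear (\<lambda>p :: point. snd (snd p))"
    by (intro bounded_linear_fst bounded_linear_fst_comp bounded_linear_snd_comp bounded_linear_snd)+
  have s: "smooth_on T \<tau>" "smooth_on T (\<lambda>t. \<xi> t x)" "smooth_on T (\<lambda>t. \<eta> t x)" if x: "x \<in> I" for x
  proof -
    have a: "smooth_on T (\<lambda>t. fst (Q (t, x, 1)))" "smooth_on T (\<lambda>t. fst (snd (Q (t, x, 1))))" "smooth_on T (\<lambda>t. snd (snd (Q (t, x, 1))))"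
      using smooth_on_linear_comp[OF op(1) bl(1) tl[OF x]] smooth_on_linear_comp[OF op(1) bl(2) tl[OF x]]
        smooth_on_linear_comp[OF op(1) bl(3) tl[OF x]] by blast+
    show "smooth_on T \<tau>" by (rule iffD1[OF smooth_on_cong[OF op(1)] a(1)]) (simp add: form x)
    show "smooth_on T (\<lambda>t. \<xi> t x)" by (rule iffD1[OF smooth_on_cong[OF op(1)] a(2)]) (simp add: form x)
    show "smooth_on T (\<lambda>t. \<eta> t x)" by (rule iffD1[OF smooth_on_cong[OF op(1)] a(3)]) (simp add: form x)
  qed
  have s': "smooth_on I (\<xi> t)" "smooth_on I (\<eta> t)" if t: "t \<in> T" for t
  proof -
    have a: "smooth_on I (\<lambda>x. fst (snd (Q (t, x, 1))))" "smooth_on I (\<lambda>x. snd (snd (Q (t, x, 1))))"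
      using smooth_on_linear_comp[OF op(2) bl(2) xl[OF t]] smooth_on_linear_comp[OF op(2) bl(3) xl[OF t]] by blast+
    show "smooth_on I (\<xi> t)" by (rule iffD1[OF smooth_on_cong[OF op(2)] a(1)]) (simp add: form t)
    show "smooth_on I (\<eta> t)" by (rule iffD1[OF smooth_on_cong[OF op(2)] a(2)]) (simp add: form t)
  qed
  have "Q \<in> lie_algebra T I A B \<longleftrightarrow> (\<forall>t\<in>T. \<forall>x\<in>I.
      (2 * deriv (\<xi> t) x - deriv \<tau> t) * A x = \<xi> t x * deriv A x \<and>
      2 * A x * deriv (\<eta> t) x = A x * deriv (deriv (\<xi> t)) x + B x * deriv (\<xi> t) x
        - B x * deriv \<tau> t - deriv (\<lambda>s. \<xi> s x) t - \<xi> t x * deriv B x \<and>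
      deriv (\<lambda>s. \<eta> s x) t = A x * deriv (deriv (\<eta> t)) x + B x * deriv (\<eta> t) x)" if "I \<noteq> {}"
    using that by (intro lie_algebra_criterion[OF op sQ form]) (auto intro!: smooth_on_DERIV s s' smooth_on_deriv op)
  then show ?thesis using L s s' form by (intro that[of \<tau> \<xi> \<eta>]) auto
qed

section \<open>Integration of the determining equations for constant \<open>A\<close>\<close>

text \<open>The general solution of the first two determining equations for \<open>A = s\<close>:
  the first makes the \<open>x\<close>-component affine in \<open>x\<close>, the second is
  integrated in \<open>x\<close>, and \<open>\<phi>\<close> is the constant of that
  integration.\<close>

definition ess_field :: "real \<Rightarrow> (real \<Rightarrow> real) \<Rightarrow> (real \<Rightarrow> real) \<Rightarrow> (real \<Rightarrow> real) \<Rightarrow> (real \<Rightarrow> real) \<Rightarrow> vfield" where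
  "ess_field s B \<tau> \<sigma> \<phi> = (\<lambda>(t, x, u). (\<tau> t, deriv \<tau> t * x / 2 + \<sigma> t,
     (- (s / 2) * (deriv (deriv \<tau>) t * x\<^sup>2 / 4 + deriv \<sigma> t * x + (deriv \<tau> t * x / 2 + \<sigma> t) * B x) + \<phi> t) * u))"

text \<open>For \<open>B = 2 * s * W' / W\<close> with \<open>s * s = 1\<close> this is
  \<open>W'' / W\<close>.\<close>

definition potq :: "real \<Rightarrow> (real \<Rightarrow> real) \<Rightarrow> real \<Rightarrow> real" where
  "potq s B x = (B x)\<^sup>2 / 4 + s * deriv B x / 2"

definition classifying :: "real \<Rightarrow> (real \<Rightarrow> real) \<Rightarrow> (real \<Rightarrow> real) \<Rightarrow> (real \<Rightarrow> real) \<Rightarrow> (real \<Rightarrow> real) \<Rightarrow> real \<Rightarrow> real \<Rightarrow> bool" where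
  "classifying s q \<tau> \<sigma> \<phi> t x \<longleftrightarrow> deriv \<tau> t * (x * deriv q x + 2 * q x) + 2 * \<sigma> t * deriv q x =
     deriv (deriv (deriv \<tau>)) t * x\<^sup>2 / 4 + deriv (deriv \<sigma>) t * x - 2 * s * deriv \<phi> t - s * deriv (deriv \<tau>) t / 2"

lemma potq_deriv:
  assumes "open I" "smooth_on I B" "x \<in> I"
  shows "(potq s B has_real_derivative B x * deriv B x / 2 + s * deriv (deriv B) x / 2) (at x)"
  unfolding potq_def[abs_def]
  by (auto intro!: derivative_eq_intros smooth_on_DERIV[OF assms(2,3)] smooth_on_DERIV[OF smooth_on_deriv[OF assms(1,2)] assms(3)])

lemma smooth_on_proj:
  assumes op: "open T" "open I"
  shows "smooth_on T f \<Longrightarrow> smooth_on (dom3 T I) (\<lambda>p. f (fst p))"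
    "smooth_on I f \<Longrightarrow> smooth_on (dom3 T I) (\<lambda>p. f (fst (snd p)))"
    "smooth_on (dom3 T I) (\<lambda>p. fst (snd p))" "smooth_on (dom3 T I) (\<lambda>p. snd (snd p))"
proof -
  have bl: "bounded_linear (fst :: point \<Rightarrow> real)" "bounded_linear (\<lambda>p :: point. fst (snd p))" "bounded_linear (\<lambda>p :: point. snd (snd p))"
    by (intro bounded_linear_fst bounded_linear_fst_comp bounded_linear_snd_comp bounded_linear_snd)+
  show "smooth_on T f \<Longrightarrow> smooth_on (dom3 T I) (\<lambda>p. f (fst p))"
    using smooth_on_affine_comp[OF op(1) open_dom3[OF op] bl(1), of 0 f] by auto
  show "smooth_on I f \<Longrightarrow> smooth_on (dom3 T I) (\<lambda>p. f (fst (snd p)))"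
    using smooth_on_affine_comp[OF op(2) open_dom3[OF op] bl(2), of 0 f] by auto
  show "smooth_on (dom3 T I) (\<lambda>p. fst (snd p))" "smooth_on (dom3 T I) (\<lambda>p. snd (snd p))"
    by (rule smooth_on_linear[OF bl(2)], rule smooth_on_linear[OF bl(3)])
qed

lemma ess_field_smooth:
  assumes op: "open T" "open I" and s: "smooth_on T \<tau>" "smooth_on T \<sigma>" "smooth_on T \<phi>" "smooth_on I B"
  shows "smooth_on (dom3 T I) (ess_field s B \<tau> \<sigma> \<phi>)"
proof -
  note s' = s(1-3) smooth_on_deriv[OF op(1) s(1)] smooth_on_deriv[OF op(1) smooth_on_deriv[OF op(1) s(1)]]
    smooth_on_deriv[OF op(1) s(2)]
  note p = s'[THEN smooth_on_proj(1)[OF op]] smooth_on_proj(2)[OF op s(4)] smooth_on_proj(3,4)[OF op]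
  show ?thesis
    unfolding ess_field_def case_prod_unfold
    by (intro smooth_on_Pair p smooth_on_intros open_dom3 op)
qed

lemma ess_field_lie:
  assumes op: "open T" "open I" and s: "smooth_on T \<tau>" "smooth_on T \<sigma>" "smooth_on T \<phi>" "smooth_on I B"
    and sg: "s * s = 1" and Q: "\<And>p. p \<in> dom3 T I \<Longrightarrow> Q p = ess_field s B \<tau> \<sigma> \<phi> p"
  shows "Q \<in> lie_algebra T I (\<lambda>_. s) B \<longleftrightarrow> (\<forall>t\<in>T. \<forall>x\<in>I. classifying s (potq s B) \<tau> \<sigma> \<phi> t x)"
proof -
  let ?xi = "\<lambda>t x. deriv \<tau> t * x / 2 + \<sigma> t"
  let ?eta = "\<lambda>t x. - (s / 2) * (deriv (deriv \<tau>) t * x\<^sup>2 / 4 + deriv \<sigma> t * x + ?xi t x * B x) + \<phi> t"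
  have sQ: "smooth_on (dom3 T I) Q"
    using smooth_on_cong[OF open_dom3[OF op], of Q "ess_field s B \<tau> \<sigma> \<phi>"] Q ess_field_smooth[OF op s] by blast
  have form: "Q (t, x, u) = (\<tau> t, ?xi t x, ?eta t x * u)" if "t \<in> T" "x \<in> I" for t x u
    using Q that by (simp add: ess_field_def)
  note d = smooth_on_DERIV[OF s(1)] smooth_on_DERIV[OF smooth_on_deriv[OF op(1) s(1)]]
    smooth_on_DERIV[OF smooth_on_deriv[OF op(1) smooth_on_deriv[OF op(1) s(1)]]]
    smooth_on_DERIV[OF s(2)] smooth_on_DERIV[OF smooth_on_deriv[OF op(1) s(2)]]
    smooth_on_DERIV[OF s(3)] smooth_on_DERIV[OF s(4)] smooth_on_DERIV[OF smooth_on_deriv[OF op(2) s(4)]]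
  let ?xit = "\<lambda>t x. deriv (deriv \<tau>) t * x / 2 + deriv \<sigma> t"
  let ?etat = "\<lambda>t x. - (s / 2) * (deriv (deriv (deriv \<tau>)) t * x\<^sup>2 / 4 + deriv (deriv \<sigma>) t * x + ?xit t x * B x) + deriv \<phi> t"
  let ?etax = "\<lambda>t x. - (s / 2) * (deriv (deriv \<tau>) t * x / 2 + deriv \<sigma> t + (deriv \<tau> t / 2 * B x + ?xi t x * deriv B x))"
  let ?etaxx = "\<lambda>t x. - (s / 2) * (deriv (deriv \<tau>) t / 2 + (deriv \<tau> t / 2 * deriv B x + (deriv \<tau> t / 2 * deriv B x + ?xi t x * deriv (deriv B) x)))"
  have "Q \<in> lie_algebra T I (\<lambda>_. s) B \<longleftrightarrow> (\<forall>t\<in>T. \<forall>x\<in>I.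
      (2 * (deriv \<tau> t / 2) - deriv \<tau> t) * s = ?xi t x * deriv (\<lambda>_. s) x \<and>
      2 * s * ?etax t x = s * 0 + B x * (deriv \<tau> t / 2) - B x * deriv \<tau> t - ?xit t x - ?xi t x * deriv B x \<and>
      ?etat t x = s * ?etaxx t x + B x * ?etax t x)"
    by (rule lie_algebra_criterion[OF op sQ form])
      (auto intro!: derivative_eq_intros d simp: field_simps power2_eq_square)
  moreover have "2 * s * ?etax t x = s * 0 + B x * (deriv \<tau> t / 2) - B x * deriv \<tau> t - ?xit t x - ?xi t x * deriv B x" for t x
  proof -
    have 1: "2 * s * ?etax t x = - (s * s) * (deriv (deriv \<tau>) t * x / 2 + deriv \<sigma> t + (deriv \<tau> t / 2 * B x + ?xi t x * deriv B x))"
      by (simp add: algebra_simps)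
    show ?thesis unfolding 1 sg by (simp add: algebra_simps)
  qed
  moreover have "?etat t x = s * ?etaxx t x + B x * ?etax t x \<longleftrightarrow> classifying s (potq s B) \<tau> \<sigma> \<phi> t x"
    if "t \<in> T" "x \<in> I" for t x
  proof -
    have dq: "deriv (potq s B) x = B x * deriv B x / 2 + s * deriv (deriv B) x / 2"
      by (rule DERIV_imp_deriv[OF potq_deriv[OF op(2) s(4) that(2)]])
    define X where "X = ?etat t x - (s * ?etaxx t x + B x * ?etax t x)"
    define Y where "Y = deriv \<tau> t * (x * deriv (potq s B) x + 2 * potq s B x) + 2 * \<sigma> t * deriv (potq s B) x -
       (deriv (deriv (deriv \<tau>)) t * x\<^sup>2 / 4 + deriv (deriv \<sigma>) t * x - 2 * s * deriv \<phi> t - s * deriv (deriv \<tau>) t / 2)"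
    \<comment> \<open>The residuals of the third determining equation and of the classifying
      condition agree, up to the factor \<open>2 * s\<close>, modulo
      \<open>s * s - 1\<close>.\<close>
    have "2 * s * X - Y = (s * s - 1) * (deriv \<tau> t * (s * deriv B x + (B x)\<^sup>2 / 2) + ?xi t x * (s * deriv (deriv B) x + B x * deriv B x)
        + s * deriv (deriv \<tau>) t / 2 - deriv (deriv (deriv \<tau>)) t * x\<^sup>2 / 4 - deriv (deriv \<sigma>) t * x)"
      unfolding X_def Y_def dq potq_def by (simp add: field_simps power2_eq_square)
    then have "2 * s * X = Y" by (simp add: sg)
    moreover have "s \<noteq> 0" using sg by auto
    ultimately have "X = 0 \<longleftrightarrow> Y = 0" by auto
    then show ?thesis unfolding classifying_def X_def Y_def by simp
  qed
  ultimately show ?thesis by simp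
qed

lemma open_intervalD: "open_interval I \<Longrightarrow> open I" "open_interval I \<Longrightarrow> connected I" "open_interval I \<Longrightarrow> I \<noteq> {}"
  by (auto simp: open_interval_def)

lemma DERIV_zero_interval:
  fixes f :: "real \<Rightarrow> real"
  assumes "open_interval J" "\<And>t. t \<in> J \<Longrightarrow> (f has_real_derivative 0) (at t)" "s \<in> J" "t \<in> J"
  shows "f s = f t"
  using zero_derivative_const[OF assms(1) _ assms(3,4), of f] assms(2)
  by (simp add: has_real_derivative_iff_has_vector_derivative)

text \<open>The interval may be unbounded on either side, so it is described by its end points in
  the extended reals.\<close>

lemma antiderivative_exists:
  fixes f :: "real \<Rightarrow> real"
  assumes I: "open_interval I" and f: "continuous_on I f"
  shows "\<exists>F. \<forall>x\<in>I. (F has_real_derivative f x) (at x)"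
proof -
  define a b where "a = Inf (ereal ` I)" and "b = Sup (ereal ` I)"
  note o = open_intervalD[OF I]
  have iff: "x \<in> I \<longleftrightarrow> a < ereal x \<and> ereal x < b" for x
  proof
    assume x: "x \<in> I"
    obtain e where e: "e > 0" "ball x e \<subseteq> I" using o(1) x open_contains_ball by blast
    have "x - e / 2 \<in> I" "x + e / 2 \<in> I" using e by (auto intro!: subsetD[OF e(2)] simp: dist_real_def)
    then have "a \<le> ereal (x - e / 2)" "ereal (x + e / 2) \<le> b"
      unfolding a_def b_def by (auto intro: Inf_lower Sup_upper)
    moreover have "ereal (x - e / 2) < ereal x" "ereal x < ereal (x + e / 2)" using e(1) by simp_all
    ultimately show "a < ereal x \<and> ereal x < b" using order.strict_trans1 order.strict_trans2 by blast
  next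
    assume "a < ereal x \<and> ereal x < b"
    then obtain y z where yz: "y \<in> I" "z \<in> I" "y < x" "x < z"
      unfolding a_def b_def Inf_less_iff less_Sup_iff by auto
    then show "x \<in> I" using connected_contains_Icc[OF o(2) yz(1,2)] by auto
  qed
  obtain x0 where "x0 \<in> I" using o(3) by blast
  then have "a < b" using iff by (meson order.strict_trans)
  moreover have "isCont f x" if "a < ereal x" "ereal x < b" for x
    using f o(1) that iff continuous_on_eq_continuous_at by blast
  ultimately obtain F where "\<forall>x. a < ereal x \<longrightarrow> ereal x < b \<longrightarrow> (F has_vector_derivative f x) (at x)"
    using einterval_antiderivative[of a b f] by blast
  then show ?thesis using iff by (auto simp: has_real_derivative_iff_has_vector_derivative)
qed

text \<open>An interval is infinite, a nonzero polynomial has finitely many roots. This is the means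
  of splitting a condition in \<open>x\<close>; the shift \<open>x0\<close> allows an expansion
  about a pole.\<close>

lemma poly_zero_on_interval:
  fixes p :: "real poly"
  assumes "open_interval I" "\<And>x. x \<in> I \<Longrightarrow> poly p (x - x0) = 0"
  shows "p = 0"
proof (rule ccontr)
  assume "p \<noteq> 0"
  then have "finite {y. poly p y = 0}" by (rule poly_roots_finite)
  moreover have "(\<lambda>x. x - x0) ` I \<subseteq> {y. poly p y = 0}" using assms(2) by auto
  ultimately have "finite ((\<lambda>x. x - x0) ` I)" by (rule rev_finite_subset)
  then have "finite I" by (rule finite_imageD) (simp add: inj_on_def)
  moreover have "infinite I"
    using open_intervalD(1,3)[OF assms(1)] finite_imp_not_open by blast
  ultimately show False by simp
qed

text \<open>The determining equations for the components alone, so that these can be carried to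
  another coordinate without building a field there first.\<close>

definition detsys :: "real set \<Rightarrow> real set \<Rightarrow> (real \<Rightarrow> real) \<Rightarrow> (real \<Rightarrow> real) \<Rightarrow>
    (real \<Rightarrow> real) \<Rightarrow> (real \<Rightarrow> real \<Rightarrow> real) \<Rightarrow> (real \<Rightarrow> real \<Rightarrow> real) \<Rightarrow> bool" where
  "detsys T I A B \<tau> \<xi> \<eta> \<longleftrightarrow> smooth_on T \<tau> \<and>
     (\<forall>x\<in>I. smooth_on T (\<lambda>t. \<xi> t x) \<and> smooth_on T (\<lambda>t. \<eta> t x)) \<and>
     (\<forall>t\<in>T. smooth_on I (\<xi> t) \<and> smooth_on I (\<eta> t)) \<and>
     (\<forall>t\<in>T. \<forall>x\<in>I. (2 * deriv (\<xi> t) x - deriv \<tau> t) * A x = \<xi> t x * deriv A x \<and>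
       2 * A x * deriv (\<eta> t) x = A x * deriv (deriv (\<xi> t)) x + B x * deriv (\<xi> t) x
         - B x * deriv \<tau> t - deriv (\<lambda>s. \<xi> s x) t - \<xi> t x * deriv B x \<and>
       deriv (\<lambda>s. \<eta> s x) t = A x * deriv (deriv (\<eta> t)) x + B x * deriv (\<eta> t) x)"

lemma ess_detsys:
  assumes "open T" "open I" "I \<noteq> {}" "Q \<in> ess_algebra T I A B"
  obtains \<tau> \<xi> \<eta> where "\<And>t x u. t \<in> T \<Longrightarrow> x \<in> I \<Longrightarrow> Q (t, x, u) = (\<tau> t, \<xi> t x, \<eta> t x * u)"
    "detsys T I A B \<tau> \<xi> \<eta>"
proof (rule ess_algebra_D[OF assms(1,2,4)])
  fix \<tau> \<xi> \<eta>
  assume *: "\<And>t x u. t \<in> T \<Longrightarrow> x \<in> I \<Longrightarrow> Q (t, x, u) = (\<tau> t, \<xi> t x, \<eta> t x * u)"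
    "I \<noteq> {} \<Longrightarrow> smooth_on T \<tau>" "\<And>x. x \<in> I \<Longrightarrow> smooth_on T (\<lambda>t. \<xi> t x)" "\<And>t. t \<in> T \<Longrightarrow> smooth_on I (\<xi> t)"
    "\<And>x. x \<in> I \<Longrightarrow> smooth_on T (\<lambda>t. \<eta> t x)" "\<And>t. t \<in> T \<Longrightarrow> smooth_on I (\<eta> t)"
    "\<And>t x. t \<in> T \<Longrightarrow> x \<in> I \<Longrightarrow> (2 * deriv (\<xi> t) x - deriv \<tau> t) * A x = \<xi> t x * deriv A x"
    "\<And>t x. t \<in> T \<Longrightarrow> x \<in> I \<Longrightarrow> 2 * A x * deriv (\<eta> t) x = A x * deriv (deriv (\<xi> t)) x + B x * deriv (\<xi> t) x
       - B x * deriv \<tau> t - deriv (\<lambda>s. \<xi> s x) t - \<xi> t x * deriv B x"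
    "\<And>t x. t \<in> T \<Longrightarrow> x \<in> I \<Longrightarrow> deriv (\<lambda>s. \<eta> s x) t = A x * deriv (deriv (\<eta> t)) x + B x * deriv (\<eta> t) x"
  show thesis by (rule that[OF *(1)]) (use * assms(3) in \<open>simp_all add: detsys_def\<close>)
qed

text \<open>By the first equation \<xi> minus \<open>deriv \<tau> t * x / 2\<close> does not depend
  on \<open>x\<close>, by the second neither does \<eta> plus \<open>G\<close>. Evaluation at a base
  point \<open>x0\<close> defines \<sigma> and \<phi> and shows their smoothness in
  \<open>t\<close>.\<close>

lemma detsys_const:
  assumes T: "open_interval T" and I: "open_interval I" and s: "s * s = 1" and B: "smooth_on I B"
    and d: "detsys T I (\<lambda>_. s) B \<tau> \<xi> \<eta>"
  obtains \<sigma> \<phi> where "smooth_on T \<tau>" "smooth_on T \<sigma>" "smooth_on T \<phi>"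
    "\<And>t x u. t \<in> T \<Longrightarrow> x \<in> I \<Longrightarrow> ess_field s B \<tau> \<sigma> \<phi> (t, x, u) = (\<tau> t, \<xi> t x, \<eta> t x * u)"
    "\<And>t x. t \<in> T \<Longrightarrow> x \<in> I \<Longrightarrow> classifying s (potq s B) \<tau> \<sigma> \<phi> t x"
proof -
  note oT = open_intervalD(1)[OF T] and oI = open_intervalD(1)[OF I]
  have d1: "smooth_on T \<tau>" "\<And>x. x \<in> I \<Longrightarrow> smooth_on T (\<lambda>t. \<xi> t x)" "\<And>x. x \<in> I \<Longrightarrow> smooth_on T (\<lambda>t. \<eta> t x)"
    "\<And>t. t \<in> T \<Longrightarrow> smooth_on I (\<xi> t)" "\<And>t. t \<in> T \<Longrightarrow> smooth_on I (\<eta> t)"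
    and eq: "\<And>t x. t \<in> T \<Longrightarrow> x \<in> I \<Longrightarrow> (2 * deriv (\<xi> t) x - deriv \<tau> t) * s = 0"
    "\<And>t x. t \<in> T \<Longrightarrow> x \<in> I \<Longrightarrow> 2 * s * deriv (\<eta> t) x = s * deriv (deriv (\<xi> t)) x + B x * deriv (\<xi> t) x
         - B x * deriv \<tau> t - deriv (\<lambda>s. \<xi> s x) t - \<xi> t x * deriv B x"
    "\<And>t x. t \<in> T \<Longrightarrow> x \<in> I \<Longrightarrow> deriv (\<lambda>s. \<eta> s x) t = s * deriv (deriv (\<eta> t)) x + B x * deriv (\<eta> t) x"
    using d by (auto simp: detsys_def)
  have s0: "s \<noteq> 0" using s by auto
  obtain x0 where x0: "x0 \<in> I" using open_intervalD(3)[OF I] by blast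
  have xx: "deriv (\<xi> t) x = deriv \<tau> t / 2" if "t \<in> T" "x \<in> I" for t x
    using eq(1)[OF that] s0 by simp
  define \<sigma> where "\<sigma> = (\<lambda>t. \<xi> t x0 - deriv \<tau> t * x0 / 2)"
  have ss: "smooth_on T \<sigma>" unfolding \<sigma>_def by (intro smooth_on_intros oT d1 x0)
  have xi: "\<xi> t x = deriv \<tau> t * x / 2 + \<sigma> t" if t: "t \<in> T" and x: "x \<in> I" for t x
  proof -
    have "\<xi> t x - deriv \<tau> t * x / 2 = \<xi> t x0 - deriv \<tau> t * x0 / 2"
      by (rule DERIV_zero_interval[OF I _ x x0])
        (use xx[OF t] smooth_on_DERIV[OF d1(4)[OF t]] in \<open>auto intro!: derivative_eq_intros\<close>)
    then show ?thesis by (simp add: \<sigma>_def)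
  qed
  have xit: "deriv (\<lambda>s. \<xi> s x) t = deriv (deriv \<tau>) t * x / 2 + deriv \<sigma> t" if t: "t \<in> T" and x: "x \<in> I" for t x
  proof -
    have "((\<lambda>t. deriv \<tau> t * x / 2 + \<sigma> t) has_real_derivative deriv (deriv \<tau>) t * x / 2 + deriv \<sigma> t) (at t)"
      by (auto intro!: derivative_eq_intros smooth_on_DERIV[OF ss t] smooth_on_DERIV[OF smooth_on_deriv[OF oT d1(1)] t])
    then have "((\<lambda>s. \<xi> s x) has_real_derivative deriv (deriv \<tau>) t * x / 2 + deriv \<sigma> t) (at t)"
      by (rule has_field_derivative_transform_within_open[OF _ oT t]) (simp add: xi x)
    then show ?thesis by (rule DERIV_imp_deriv)
  qed
  have xxx: "deriv (deriv (\<xi> t)) x = 0" if t: "t \<in> T" and x: "x \<in> I" for t x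
  proof -
    have "((\<lambda>_. deriv \<tau> t / 2) has_real_derivative 0) (at x)" by simp
    then have "(deriv (\<xi> t) has_real_derivative 0) (at x)"
      by (rule has_field_derivative_transform_within_open[OF _ oI x]) (simp add: xx t)
    then show ?thesis by (rule DERIV_imp_deriv)
  qed
  define G where "G = (\<lambda>t x. (s / 2) * (deriv (deriv \<tau>) t * x\<^sup>2 / 4 + deriv \<sigma> t * x + (deriv \<tau> t * x / 2 + \<sigma> t) * B x))"
  define \<phi> where "\<phi> = (\<lambda>t. \<eta> t x0 + G t x0)"
  have sp: "smooth_on T \<phi>" unfolding \<phi>_def G_def by (intro smooth_on_intros oT d1 x0 ss)
  have eta: "\<eta> t x = - G t x + \<phi> t" if t: "t \<in> T" and x: "x \<in> I" for t x
  proof -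
    have "\<eta> t x + G t x = \<eta> t x0 + G t x0"
    proof (rule DERIV_zero_interval[OF I _ x x0])
      fix x assume x: "x \<in> I"
      have "2 * s * deriv (\<eta> t) x = - (deriv (deriv \<tau>) t * x / 2 + deriv \<sigma> t + deriv \<tau> t / 2 * B x + (deriv \<tau> t * x / 2 + \<sigma> t) * deriv B x)"
        using eq(2)[OF t x] unfolding xx[OF t x] xxx[OF t x] xit[OF t x] xi[OF t x] by (simp add: algebra_simps)
      moreover have "d + (s / 2) * Z = 0" if "2 * s * d = - Z" for d Z
      proof -
        have "s * (2 * s * d) = s * - Z" using that by simp
        then have "2 * ((s * s) * d) = - (s * Z)" by (simp add: algebra_simps)
        then show ?thesis unfolding s by simp
      qed
      ultimately have "deriv (\<eta> t) x + (s / 2) * (deriv (deriv \<tau>) t * x / 2 + deriv \<sigma> t + (deriv \<tau> t / 2 * B x + (deriv \<tau> t * x / 2 + \<sigma> t) * deriv B x)) = 0"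
        by (simp only: add.assoc)
      moreover have "((\<lambda>x. \<eta> t x + G t x) has_real_derivative deriv (\<eta> t) x + (s / 2) * (deriv (deriv \<tau>) t * x / 2 + deriv \<sigma> t + (deriv \<tau> t / 2 * B x + (deriv \<tau> t * x / 2 + \<sigma> t) * deriv B x))) (at x)"
        unfolding G_def
        by (auto intro!: derivative_eq_intros smooth_on_DERIV[OF d1(5)[OF t] x] smooth_on_DERIV[OF B x] simp: field_simps power2_eq_square)
      ultimately show "((\<lambda>x. \<eta> t x + G t x) has_real_derivative 0) (at x)" by simp
    qed
    then show ?thesis by (simp add: \<phi>_def)
  qed
  have form: "ess_field s B \<tau> \<sigma> \<phi> (t, x, u) = (\<tau> t, \<xi> t x, \<eta> t x * u)" if "t \<in> T" "x \<in> I" for t x u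
    unfolding ess_field_def xi[OF that] eta[OF that] G_def by simp
  have "ess_field s B \<tau> \<sigma> \<phi> \<in> lie_algebra T I (\<lambda>_. s) B \<longleftrightarrow> (\<forall>t\<in>T. \<forall>x\<in>I.
      (2 * deriv (\<xi> t) x - deriv \<tau> t) * s = \<xi> t x * deriv (\<lambda>_. s) x \<and>
      2 * s * deriv (\<eta> t) x = s * deriv (deriv (\<xi> t)) x + B x * deriv (\<xi> t) x
        - B x * deriv \<tau> t - deriv (\<lambda>s. \<xi> s x) t - \<xi> t x * deriv B x \<and>
      deriv (\<lambda>s. \<eta> s x) t = s * deriv (deriv (\<eta> t)) x + B x * deriv (\<eta> t) x)"
    by (rule lie_algebra_criterion[OF oT oI ess_field_smooth[OF oT oI d1(1) ss sp B] form])
      (auto intro!: smooth_on_DERIV d1 smooth_on_deriv oT oI)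
  then have "ess_field s B \<tau> \<sigma> \<phi> \<in> lie_algebra T I (\<lambda>_. s) B" using eq by simp
  then have "\<forall>t\<in>T. \<forall>x\<in>I. classifying s (potq s B) \<tau> \<sigma> \<phi> t x"
    using ess_field_lie[OF oT oI d1(1) ss sp B s] by blast
  then show ?thesis using that[OF d1(1) ss sp form] by blast
qed

lemma ess_algebra_const_iff:
  assumes T: "open_interval T" and I: "open_interval I" and s: "s * s = 1" and B: "smooth_on I B"
  shows "Q \<in> ess_algebra T I (\<lambda>_. s) B \<longleftrightarrow> (\<exists>\<tau> \<sigma> \<phi>. smooth_on T \<tau> \<and> smooth_on T \<sigma> \<and> smooth_on T \<phi> \<and>
    (\<forall>p\<in>dom3 T I. Q p = ess_field s B \<tau> \<sigma> \<phi> p) \<and> (\<forall>t\<in>T. \<forall>x\<in>I. classifying s (potq s B) \<tau> \<sigma> \<phi> t x))"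
proof
  note oT = open_intervalD(1)[OF T] and oI = open_intervalD(1)[OF I]
  assume "Q \<in> ess_algebra T I (\<lambda>_. s) B"
  then obtain \<tau> \<xi> \<eta> where Q: "\<And>t x u. t \<in> T \<Longrightarrow> x \<in> I \<Longrightarrow> Q (t, x, u) = (\<tau> t, \<xi> t x, \<eta> t x * u)"
    "detsys T I (\<lambda>_. s) B \<tau> \<xi> \<eta>" using ess_detsys[OF oT oI open_intervalD(3)[OF I]] by metis
  obtain \<sigma> \<phi> where "smooth_on T \<tau>" "smooth_on T \<sigma>" "smooth_on T \<phi>"
    "\<And>t x u. t \<in> T \<Longrightarrow> x \<in> I \<Longrightarrow> ess_field s B \<tau> \<sigma> \<phi> (t, x, u) = (\<tau> t, \<xi> t x, \<eta> t x * u)"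
    "\<And>t x. t \<in> T \<Longrightarrow> x \<in> I \<Longrightarrow> classifying s (potq s B) \<tau> \<sigma> \<phi> t x"
    using detsys_const[OF T I s B Q(2)] by metis
  then show "\<exists>\<tau> \<sigma> \<phi>. smooth_on T \<tau> \<and> smooth_on T \<sigma> \<and> smooth_on T \<phi> \<and>
    (\<forall>p\<in>dom3 T I. Q p = ess_field s B \<tau> \<sigma> \<phi> p) \<and> (\<forall>t\<in>T. \<forall>x\<in>I. classifying s (potq s B) \<tau> \<sigma> \<phi> t x)"
    using Q(1) by (intro exI[of _ \<tau>] exI[of _ \<sigma>] exI[of _ \<phi>]) auto
next
  note oT = open_intervalD(1)[OF T] and oI = open_intervalD(1)[OF I]
  assume "\<exists>\<tau> \<sigma> \<phi>. smooth_on T \<tau> \<and> smooth_on T \<sigma> \<and> smooth_on T \<phi> \<and>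
    (\<forall>p\<in>dom3 T I. Q p = ess_field s B \<tau> \<sigma> \<phi> p) \<and> (\<forall>t\<in>T. \<forall>x\<in>I. classifying s (potq s B) \<tau> \<sigma> \<phi> t x)"
  then obtain \<tau> \<sigma> \<phi> where sm: "smooth_on T \<tau>" "smooth_on T \<sigma>" "smooth_on T \<phi>"
    and Q: "\<And>p. p \<in> dom3 T I \<Longrightarrow> Q p = ess_field s B \<tau> \<sigma> \<phi> p"
    and c: "\<forall>t\<in>T. \<forall>x\<in>I. classifying s (potq s B) \<tau> \<sigma> \<phi> t x" by blast
  have "Q \<in> lie_algebra T I (\<lambda>_. s) B" using ess_field_lie[OF oT oI sm B s Q] c by blast
  moreover have "\<exists>\<tau> \<xi> \<eta>. \<forall>t\<in>T. \<forall>x\<in>I. \<forall>u. Q (t, x, u) = (\<tau> t, \<xi> t x, \<eta> t x * u)"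
    by (rule exI[of _ \<tau>], rule exI[of _ "\<lambda>t x. deriv \<tau> t * x / 2 + \<sigma> t"],
        rule exI[of _ "\<lambda>t x. - (s / 2) * (deriv (deriv \<tau>) t * x\<^sup>2 / 4 + deriv \<sigma> t * x + (deriv \<tau> t * x / 2 + \<sigma> t) * B x) + \<phi> t"])
      (use Q in \<open>auto simp: ess_field_def\<close>)
  ultimately show "Q \<in> ess_algebra T I (\<lambda>_. s) B" unfolding ess_algebra_def by blast
qed

section \<open>Model potentials\<close>

lemma deriv_zero_on_open:
  fixes f :: "real \<Rightarrow> real"
  assumes "open T" "\<And>t. t \<in> T \<Longrightarrow> f t = c" "t \<in> T"
  shows "deriv f t = 0"
proof -
  have "((\<lambda>_. c) has_real_derivative 0) (at t)" by simp
  then have "(f has_real_derivative 0) (at t)"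
    by (rule has_field_derivative_transform_within_open[OF _ assms(1,3)]) (simp add: assms(2))
  then show ?thesis by (rule DERIV_imp_deriv)
qed

text \<open>At one time \<open>t0\<close> with nonzero derivative of \<tau> the condition is a
  first-order equation for \<open>q\<close>, centred at
  \<open>x0 = - 2 * \<sigma> / \<tau>'\<close>, and the inverse square is its homogeneous solution.
  That no linear term stands beside it follows from all times: the cubic pole of \<open>q'\<close>
  forces \<open>h = \<sigma> + \<tau>' * x0 / 2\<close> to vanish, so \<open>h'' = 0\<close>, and
  the linear coefficient reduces to \<open>3 * \<tau>' * b\<close>. If \<tau> is constant in
  \<open>t\<close>, \<open>q'\<close> is affine in \<open>x\<close>.\<close>

lemma potential_shape:
  assumes T: "open_interval T" and I: "open_interval I"
    and q: "\<And>x. x \<in> I \<Longrightarrow> (q has_real_derivative deriv q x) (at x)"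
    and sm: "smooth_on T \<tau>" "smooth_on T \<sigma>"
    and c: "\<And>t x. t \<in> T \<Longrightarrow> x \<in> I \<Longrightarrow> classifying s q \<tau> \<sigma> \<phi> t x"
    and nt: "\<exists>t\<in>T. deriv \<tau> t \<noteq> 0 \<or> \<sigma> t \<noteq> 0"
  obtains x0 a b r e where "\<And>x. x \<in> I \<Longrightarrow> q x = a * (x - x0)\<^sup>2 + b * (x - x0) + r + e / (x - x0)\<^sup>2"
    "e \<noteq> 0 \<Longrightarrow> b = 0 \<and> x0 \<notin> I"
proof (cases "\<exists>t\<in>T. deriv \<tau> t \<noteq> 0")
  case True
  then obtain t0 where t0: "t0 \<in> T" "deriv \<tau> t0 \<noteq> 0" by blast
  define R where "R = (\<lambda>t. - 2 * s * deriv \<phi> t - s * deriv (deriv \<tau>) t / 2)"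
  define k x0 where "k = deriv \<tau> t0" and "x0 = - 2 * \<sigma> t0 / deriv \<tau> t0"
  define \<alpha> \<beta> where "\<alpha> = deriv (deriv (deriv \<tau>)) t0 / 4" and "\<beta> = deriv (deriv \<sigma>) t0"
  define a b r where "a = \<alpha> / (4 * k)" and "b = (2 * \<alpha> * x0 + \<beta>) / (3 * k)"
    and "r = (\<alpha> * x0\<^sup>2 + \<beta> * x0 + R t0) / (2 * k)"
  have k: "k \<noteq> 0" using t0 by (simp add: k_def)
  have main: "(x - x0) * deriv q x + 2 * q x = 4 * a * (x - x0)\<^sup>2 + 3 * b * (x - x0) + 2 * r" if x: "x \<in> I" for x
  proof -
    have kx: "k * x0 = - 2 * \<sigma> t0" using k unfolding x0_def k_def by simp
    have "k * ((x - x0) * deriv q x + 2 * q x) = k * (x * deriv q x + 2 * q x) - (k * x0) * deriv q x"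
      by (simp add: algebra_simps)
    also have "\<dots> = k * (x * deriv q x + 2 * q x) + 2 * \<sigma> t0 * deriv q x" unfolding kx by simp
    also have "\<dots> = \<alpha> * x\<^sup>2 + \<beta> * x + R t0"
      using c[OF t0(1) x] unfolding classifying_def k_def \<alpha>_def \<beta>_def R_def by simp
    also have "\<dots> = k * (4 * a * (x - x0)\<^sup>2 + 3 * b * (x - x0) + 2 * r)"
      unfolding a_def b_def r_def using k by (simp add: field_simps power2_eq_square)
    finally show ?thesis using k by simp
  qed
  obtain x1 where x1: "x1 \<in> I" using open_intervalD(3)[OF I] by blast
  define F where "F = (\<lambda>x. (x - x0)\<^sup>2 * (q x - (a * (x - x0)\<^sup>2 + b * (x - x0) + r)))"
  define e where "e = F x1"
  have F: "F x = e" if x: "x \<in> I" for x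
    unfolding e_def
  proof (rule DERIV_zero_interval[OF I _ x x1])
    fix x assume x: "x \<in> I"
    have "(F has_real_derivative (x - x0) * (((x - x0) * deriv q x + 2 * q x) - (4 * a * (x - x0)\<^sup>2 + 3 * b * (x - x0) + 2 * r))) (at x)"
      unfolding F_def
      by (auto intro!: derivative_eq_intros q[OF x] simp: algebra_simps power2_eq_square)
    then show "(F has_real_derivative 0) (at x)" using main[OF x] by simp
  qed
  have qx: "q x = a * (x - x0)\<^sup>2 + b * (x - x0) + r + e / (x - x0)\<^sup>2" if x: "x \<in> I" for x
  proof (cases "x = x0")
    \<comment> \<open>At the centre the equation itself gives the value \<open>r\<close>, and the
      last summand is 0 because division by 0 yields 0.\<close>
    case True
    then show ?thesis using main[OF x] by simp
  next
    case False
    then have "q x - (a * (x - x0)\<^sup>2 + b * (x - x0) + r) = e / (x - x0)\<^sup>2"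
      using F[OF x] unfolding F_def by (simp add: field_simps)
    then show ?thesis by simp
  qed
  moreover have "b = 0 \<and> x0 \<notin> I" if e: "e \<noteq> 0"
  proof
    show x0: "x0 \<notin> I" using F[of x0] e by (auto simp: F_def)
    define h where "h = (\<lambda>t. \<sigma> t + deriv \<tau> t * x0 / 2)"
    \<comment> \<open>The coefficients, in powers of \<open>y = x - x0\<close>, of the condition
      multiplied by \<open>y ^ 3\<close>.\<close>
    define P where "P = (\<lambda>t. [: - 4 * h t * e, 0, 0,
      2 * deriv \<tau> t * r + 2 * h t * b - (deriv (deriv (deriv \<tau>)) t * x0\<^sup>2 / 4 + deriv (deriv \<sigma>) t * x0 + R t),
      3 * deriv \<tau> t * b + 4 * h t * a - (deriv (deriv (deriv \<tau>)) t * x0 / 2 + deriv (deriv \<sigma>) t),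
      4 * deriv \<tau> t * a - deriv (deriv (deriv \<tau>)) t / 4 :])"
    have P0: "P t = 0" if t: "t \<in> T" for t
    proof (rule poly_zero_on_interval[OF I])
      fix x assume x: "x \<in> I"
      define y where "y = x - x0"
      have y0: "y \<noteq> 0" using x x0 by (auto simp: y_def)
      have "((\<lambda>x. a * (x - x0)\<^sup>2 + b * (x - x0) + r + e / (x - x0)\<^sup>2) has_real_derivative (2 * a * y + b - 2 * e / y ^ 3)) (at x)"
      proof -
        have "((\<lambda>y. a * y\<^sup>2 + b * y + r + e / y\<^sup>2) has_real_derivative 2 * a * y + b - 2 * e / y ^ 3) (at y)"
          using y0 by (auto intro!: derivative_eq_intros simp: field_simps power2_eq_square power3_eq_cube)
        then show ?thesis
          unfolding y_def by (rule DERIV_chain2[of _ _ _ _ 1, simplified]) (auto intro!: derivative_eq_intros)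
      qed
      then have "(q has_real_derivative (2 * a * y + b - 2 * e / y ^ 3)) (at x)"
        by (rule has_field_derivative_transform_within_open[OF _ open_intervalD(1)[OF I] x]) (simp add: qx)
      then have dq: "deriv q x = 2 * a * y + b - 2 * e / y ^ 3" by (rule DERIV_imp_deriv)
      have xy: "x = y + x0" by (simp add: y_def)
      have "deriv \<tau> t * (x * deriv q x + 2 * q x) + 2 * \<sigma> t * deriv q x
         = deriv (deriv (deriv \<tau>)) t * x\<^sup>2 / 4 + deriv (deriv \<sigma>) t * x + R t"
        using c[OF t x] unfolding classifying_def R_def by simp
      then have "0 = y ^ 3 * (deriv \<tau> t * (y * deriv q x + 2 * q x) + 2 * h t * deriv q x
         - (deriv (deriv (deriv \<tau>)) t * (y + x0)\<^sup>2 / 4 + deriv (deriv \<sigma>) t * (y + x0) + R t))"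
        unfolding h_def xy by (simp add: algebra_simps)
      also have "\<dots> = y ^ 3 * (deriv \<tau> t * (4 * a * y\<^sup>2 + 3 * b * y + 2 * r)
         - (deriv (deriv (deriv \<tau>)) t * (y + x0)\<^sup>2 / 4 + deriv (deriv \<sigma>) t * (y + x0) + R t))
         + 2 * h t * (2 * a * y ^ 4 + b * y ^ 3 - 2 * e)"
      proof -
        have "y * deriv q x + 2 * q x = 4 * a * y\<^sup>2 + 3 * b * y + 2 * r"
          using main[OF x] by (simp add: y_def)
        moreover have "y ^ 3 * deriv q x = 2 * a * y ^ 4 + b * y ^ 3 - 2 * e"
          unfolding dq using y0 by (simp add: field_simps power4_eq_xxxx power3_eq_cube)
        ultimately show ?thesis
          by (simp add: right_diff_distrib distrib_left mult.left_commute[of "y ^ 3"])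
      qed
      also have "\<dots> = poly (P t) y"
        unfolding P_def by (simp add: field_simps power2_eq_square power3_eq_cube power4_eq_xxxx)
      finally show "poly (P t) (x - x0) = 0" by (simp add: y_def)
    qed
    have h0: "h t = 0" if "t \<in> T" for t using P0[OF that] e by (simp add: P_def)
    have oT: "open T" using open_intervalD(1)[OF T] .
    have dh: "deriv h t = deriv \<sigma> t + deriv (deriv \<tau>) t * x0 / 2" if t: "t \<in> T" for t
      unfolding h_def
      by (rule DERIV_imp_deriv)
        (auto intro!: derivative_eq_intros smooth_on_DERIV[OF sm(2) t] smooth_on_DERIV[OF smooth_on_deriv[OF oT sm(1)] t])
    have ddh: "deriv (\<lambda>t. deriv \<sigma> t + deriv (deriv \<tau>) t * x0 / 2) t = deriv (deriv \<sigma>) t + deriv (deriv (deriv \<tau>)) t * x0 / 2" if t: "t \<in> T" for t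
      by (rule DERIV_imp_deriv)
        (auto intro!: derivative_eq_intros smooth_on_DERIV[OF smooth_on_deriv[OF oT sm(2)] t]
          smooth_on_DERIV[OF smooth_on_deriv[OF oT smooth_on_deriv[OF oT sm(1)]] t])
    have "deriv h t = 0" if "t \<in> T" for t by (rule deriv_zero_on_open[OF oT h0 that])
    then have "deriv \<sigma> t + deriv (deriv \<tau>) t * x0 / 2 = 0" if "t \<in> T" for t using that dh by simp
    then have "deriv (deriv \<sigma>) t0 + deriv (deriv (deriv \<tau>)) t0 * x0 / 2 = 0"
      using ddh[OF t0(1)] deriv_zero_on_open[OF oT _ t0(1), of "\<lambda>t. deriv \<sigma> t + deriv (deriv \<tau>) t * x0 / 2" 0] by simp
    then have "3 * deriv \<tau> t0 * b = 0" using P0[OF t0(1)] h0[OF t0(1)] by (simp add: P_def)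
    then show "b = 0" using t0(2) by simp
  qed
  ultimately show ?thesis using that by blast
next
  case False
  then have z: "deriv \<tau> t = 0" if "t \<in> T" for t using that by blast
  obtain t0 where t0: "t0 \<in> T" "\<sigma> t0 \<noteq> 0" using nt z by blast
  have oT: "open T" using open_intervalD(1)[OF T] .
  have z2: "deriv (deriv \<tau>) t = 0" if "t \<in> T" for t by (rule deriv_zero_on_open[OF oT z that])
  have z3: "deriv (deriv (deriv \<tau>)) t = 0" if "t \<in> T" for t by (rule deriv_zero_on_open[OF oT z2 that])
  define a b where "a = deriv (deriv \<sigma>) t0 / (4 * \<sigma> t0)" and "b = - s * deriv \<phi> t0 / \<sigma> t0"
  obtain x1 where x1: "x1 \<in> I" using open_intervalD(3)[OF I] by blast
  have "q x - (a * x\<^sup>2 + b * x) = q x1 - (a * x1\<^sup>2 + b * x1)" if x: "x \<in> I" for x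
  proof (rule DERIV_zero_interval[OF I _ x x1])
    fix x assume x: "x \<in> I"
    have "2 * \<sigma> t0 * deriv q x = deriv (deriv \<sigma>) t0 * x - 2 * s * deriv \<phi> t0"
      using c[OF t0(1) x] z z2 z3 t0(1) by (simp add: classifying_def)
    then have "deriv q x = 2 * a * x + b" unfolding a_def b_def using t0(2) by (simp add: field_simps)
    moreover have "((\<lambda>x. q x - (a * x\<^sup>2 + b * x)) has_real_derivative deriv q x - (2 * a * x + b)) (at x)"
      by (auto intro!: derivative_eq_intros q[OF x])
    ultimately show "((\<lambda>x. q x - (a * x\<^sup>2 + b * x)) has_real_derivative 0) (at x)" by simp
  qed
  then have "q x = a * (x - 0)\<^sup>2 + b * (x - 0) + (q x1 - (a * x1\<^sup>2 + b * x1)) + 0 / (x - 0)\<^sup>2" if "x \<in> I" for x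
    using that by (simp add: algebra_simps)
  then show ?thesis by (rule that) simp_all
qed

text \<open>The coefficient \<open>e\<close> of the inverse square is invariant under
  \<open>q \<mapsto> c\<^sup>2 * q (c * x)\<close>, so only the other three are normalised.\<close>

definition normal_coeffs :: "real \<Rightarrow> real \<Rightarrow> real \<Rightarrow> real \<Rightarrow> bool" where
  "normal_coeffs \<delta> \<beta> \<sigma> e \<longleftrightarrow> (\<beta> = 0 \<and> \<delta> \<in> {- 1, 1}) \<or> (\<delta> = 0 \<and> \<beta> = 0 \<and> \<sigma> \<in> {- 1, 0, 1})
     \<or> (\<delta> = 0 \<and> \<beta> = 1 \<and> \<sigma> = 0 \<and> e = 0)"

definition model_pot :: "real \<Rightarrow> real \<Rightarrow> real \<Rightarrow> real \<Rightarrow> real \<Rightarrow> real" where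
  "model_pot \<delta> \<beta> \<sigma> e z = \<delta> * z\<^sup>2 + \<beta> * z + \<sigma> + e / z\<^sup>2"

text \<open>\<open>c1\<close> is the fourth root of \<open>\<bar>a\<bar>\<close>, the cube root of
  \<open>b\<close> or the square root of \<open>\<bar>r\<bar>\<close>, according to the leading
  term; a negative \<open>b\<close> has a negative root and leads to a reflection. Completing the
  square moves the origin only if \<open>b\<close> is nonzero, that is, only in the absence of a
  pole.\<close>

lemma normalize_potential:
  assumes "e \<noteq> 0 \<Longrightarrow> b = 0"
  shows "\<exists>c1 c3 \<delta> \<beta> \<sigma>. c1 \<noteq> 0 \<and> normal_coeffs \<delta> \<beta> \<sigma> e \<and>
    (\<forall>x. a * (x - x0)\<^sup>2 + b * (x - x0) + r + e / (x - x0)\<^sup>2 = c1\<^sup>2 * model_pot \<delta> \<beta> \<sigma> e (c1 * x + c3))"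
proof -
  consider "a \<noteq> 0" | "a = 0" "b \<noteq> 0" | "a = 0" "b = 0" by blast
  then show ?thesis
  proof cases
    case 1
    define c1 where "c1 = sqrt (sqrt \<bar>a\<bar>)"
    have c1: "c1 > 0" "c1\<^sup>2 * c1\<^sup>2 = \<bar>a\<bar>" using 1 by (simp_all add: c1_def)
    have "a * (x - x0)\<^sup>2 + b * (x - x0) + r + e / (x - x0)\<^sup>2 =
      c1\<^sup>2 * model_pot (sgn a) 0 ((r - b\<^sup>2 / (4 * a)) / c1\<^sup>2) e (c1 * x + c1 * (b / (2 * a) - x0))" for x
    proof -
      define y where "y = x - x0"
      have z: "c1 * x + c1 * (b / (2 * a) - x0) = c1 * (y + b / (2 * a))" by (simp add: y_def algebra_simps)
      have ee: "c1\<^sup>2 * (e / (c1 * (y + b / (2 * a)))\<^sup>2) = e / y\<^sup>2"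
        using c1(1) assms by (cases "e = 0") (simp_all add: power_mult_distrib)
      have "c1\<^sup>2 * (sgn a * (c1 * (y + b / (2 * a)))\<^sup>2) = (c1\<^sup>2 * c1\<^sup>2) * sgn a * (y + b / (2 * a))\<^sup>2"
        by (simp add: power_mult_distrib)
      also have "\<dots> = a * (y + b / (2 * a))\<^sup>2" unfolding c1(2) by (simp add: mult.commute[of "\<bar>a\<bar>"] sgn_mult_abs)
      also have "\<dots> = a * y\<^sup>2 + b * y + b\<^sup>2 / (4 * a)" using 1 by (simp add: field_simps power2_eq_square)
      finally have aa: "c1\<^sup>2 * (sgn a * (c1 * (y + b / (2 * a)))\<^sup>2) = a * y\<^sup>2 + b * y + b\<^sup>2 / (4 * a)" .
      have rr: "c1\<^sup>2 * ((r - b\<^sup>2 / (4 * a)) / c1\<^sup>2) = r - b\<^sup>2 / (4 * a)" using c1(1) by simp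
      show ?thesis unfolding z model_pot_def distrib_left[of "c1\<^sup>2"] ee aa rr y_def[symmetric] by simp
    qed
    moreover have "normal_coeffs (sgn a) 0 ((r - b\<^sup>2 / (4 * a)) / c1\<^sup>2) e"
      using 1 by (simp add: normal_coeffs_def sgn_if)
    ultimately show ?thesis using c1(1) by (metis less_irrefl)
  next
    case 2
    then have e: "e = 0" using assms by blast
    define c1 where "c1 = root 3 b"
    have c1: "c1 \<noteq> 0" "c1 ^ 3 = b" using 2 by (simp_all add: c1_def odd_real_root_pow)
    have "a * (x - x0)\<^sup>2 + b * (x - x0) + r + e / (x - x0)\<^sup>2 = c1\<^sup>2 * model_pot 0 1 0 e (c1 * x + c1 * (r / b - x0))" for x
    proof -
      have "c1\<^sup>2 * (c1 * x + c1 * (r / b - x0)) = c1 ^ 3 * (x - x0 + r / b)"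
        by (simp add: algebra_simps power2_eq_square power3_eq_cube)
      also have "\<dots> = b * (x - x0) + r" unfolding c1(2) using 2 by (simp add: distrib_left)
      finally show ?thesis using 2 e by (simp add: model_pot_def)
    qed
    moreover have "normal_coeffs 0 1 0 e" by (simp add: normal_coeffs_def e)
    ultimately show ?thesis using c1(1) by blast
  next
    case 3
    define c1 where "c1 = (if r = 0 then 1 else sqrt \<bar>r\<bar>)"
    have c1: "c1 > 0" "c1\<^sup>2 * sgn r = r" by (simp_all add: c1_def abs_mult_sgn)
    have "a * (x - x0)\<^sup>2 + b * (x - x0) + r + e / (x - x0)\<^sup>2 = c1\<^sup>2 * model_pot 0 0 (sgn r) e (c1 * x + c1 * - x0)" for x
    proof -
      have z: "c1 * x + c1 * - x0 = c1 * (x - x0)" by (simp add: algebra_simps)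
      have ee: "c1\<^sup>2 * (e / (c1 * (x - x0))\<^sup>2) = e / (x - x0)\<^sup>2" using c1(1) by (simp add: power_mult_distrib)
      show ?thesis unfolding z model_pot_def distrib_left ee c1(2) using 3 by simp
    qed
    moreover have "normal_coeffs 0 0 (sgn r) e" by (auto simp: normal_coeffs_def sgn_if)
    ultimately show ?thesis using c1(1) by (metis less_irrefl)
  qed
qed

section \<open>Potentials and solution families of the list entries\<close>

text \<open>The parameters of \<open>W'' / W\<close> as a model potential. Entries with equal
  coefficients, such as \<open>C1_sqrt\<close> and \<open>C1_ln\<close>, are different solutions of
  one equation.\<close>

fun coeffs :: "entry \<Rightarrow> real \<times> real \<times> real \<times> real" where
  "coeffs (C1_cos \<alpha>) = (0, 0, 0, - \<alpha>\<^sup>2 - 1 / 4)"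
| "coeffs C1_sqrt = (0, 0, 0, - 1 / 4)"
| "coeffs C1_ln = (0, 0, 0, - 1 / 4)"
| "coeffs (C1_pow \<alpha> _ _) = (0, 0, 0, \<alpha>\<^sup>2 - 1 / 4)"
| "coeffs (C1p_Z \<beta> _ _) = (0, 0, - 1, \<beta>\<^sup>2 - 1 / 4)"
| "coeffs (C1p_Zt \<gamma> _ _) = (0, 0, - 1, - \<gamma>\<^sup>2 - 1 / 4)"
| "coeffs (C1pp_C \<beta> _ _) = (0, 0, 1, \<beta>\<^sup>2 - 1 / 4)"
| "coeffs (C1pp_Ct \<gamma> _ _) = (0, 0, 1, - \<gamma>\<^sup>2 - 1 / 4)"
| "coeffs (C1a \<kappa> \<nu> _ _) = (- 1, 0, - \<kappa>, Re (\<nu>\<^sup>2) - 1 / 4)"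
| "coeffs (C1b \<kappa> \<nu> _ _) = (1, 0, - \<kappa>, Re (\<nu>\<^sup>2) - 1 / 4)"
| "coeffs C2_one = (0, 0, 0, 0)"
| "coeffs C2_id = (0, 0, 0, 0)"
| "coeffs C2p_cos = (0, 0, - 1, 0)"
| "coeffs C2pp_exp = (0, 0, 1, 0)"
| "coeffs C2pp_cosh = (0, 0, 1, 0)"
| "coeffs C2pp_sinh = (0, 0, 1, 0)"
| "coeffs (C2a \<kappa> _ _) = (- 1, 0, - \<kappa>, 0)"
| "coeffs (C2b \<kappa> _ _) = (1, 0, - \<kappa>, 0)"
| "coeffs (C2c _ _) = (0, 1, 0, 0)"

definition entry_pot :: "entry \<Rightarrow> real \<Rightarrow> real" where
  "entry_pot e = (case coeffs e of (\<delta>, \<beta>, \<sigma>, \<epsilon>) \<Rightarrow> model_pot \<delta> \<beta> \<sigma> \<epsilon>)"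

text \<open>The points at which \<open>W_of\<close> solves its equation; \<open>C2a\<close> and \<open>C2b\<close> involve \<open>\<bar>x\<bar>\<close> as well.\<close>
definition model_dom :: "real \<Rightarrow> real \<Rightarrow> real set" where
  "model_dom \<delta> e = (if \<delta> = 0 \<and> e = 0 then UNIV else - {0})"

definition entry_dom :: "entry \<Rightarrow> real set" where
  "entry_dom e = (case coeffs e of (\<delta>, \<beta>, \<sigma>, \<epsilon>) \<Rightarrow> model_dom \<delta> \<epsilon>)"

lemma family_cong:
  assumes "family D q F" "\<And>x. x \<in> D \<Longrightarrow> q x = q2 x"
  shows "family D q2 F"
  using assms fund_cong unfolding family_def by blast

lemma sol_transform:
  assumes "open D" "sol D q y y'" "\<And>x. x \<in> D \<Longrightarrow> y x = z x"
  shows "sol D q z y'"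
  using assms unfolding sol_def by (metis has_vector_derivative_transform_open)

lemma family_sol:
  assumes "open D" "family D q F"
  shows "\<exists>W'. sol D q (F a b) W'"
proof -
  from assms(2) obtain f g f' g' where F: "\<And>a b x. x \<in> D \<Longrightarrow> F a b x = a * f x + b * g x"
    and fg: "sol D q f f'" "sol D q g g'" unfolding family_def fund_def by blast
  show ?thesis
    by (rule exI, rule sol_transform[OF assms(1) sol_lincomb[OF fg, of a b]]) (simp add: F)
qed

lemma family_rep:
  assumes "family D q F" "open_interval J" "J \<subseteq> D" "sol J q y y'"
  shows "\<exists>a b. \<forall>x\<in>J. y x = F a b x"
proof -
  from assms(1) obtain f g where F: "\<And>a b x. x \<in> D \<Longrightarrow> F a b x = a * f x + b * g x"
    and fg: "fund D q f g" unfolding family_def by blast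
  obtain a b where "\<And>x. x \<in> J \<Longrightarrow> y x = a * f x + b * g x" using fund_rep[OF assms(2,3) fg assms(4)] by metis
  then show ?thesis using F assms(3) by (metis subsetD)
qed

lemma family_zero: "family D q F \<Longrightarrow> x \<in> D \<Longrightarrow> F 0 0 x = 0"
  unfolding family_def by auto

lemma family_scale: "family D q F \<Longrightarrow> x \<in> D \<Longrightarrow> c * F a b x = F (c * a) (c * b) x"
  unfolding family_def by (auto simp: algebra_simps)

lemma family_unique:
  assumes "family D q F" "open_interval J" "J \<subseteq> D" "\<And>x. x \<in> J \<Longrightarrow> F a b x = F c d x"
  shows "a = c \<and> b = d"
proof -
  from assms(1) obtain f g where F: "\<And>a b x. x \<in> D \<Longrightarrow> F a b x = a * f x + b * g x"
    and fg: "fund D q f g" unfolding family_def by blast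
  show ?thesis
    by (rule fund_coeff_unique[OF assms(2,3) fg]) (use assms(3,4) F in \<open>auto simp: subset_iff\<close>)
qed

lemma families:
  "\<alpha> > 0 \<Longrightarrow> family (- {0}) (model_pot 0 0 0 (- \<alpha>\<^sup>2 - 1 / 4))
     (\<lambda>a b x. sqrt \<bar>x\<bar> * (a * cos (\<alpha> * ln \<bar>x\<bar>) + b * sin (\<alpha> * ln \<bar>x\<bar>)))"
  "family (- {0}) (model_pot 0 0 0 (- 1 / 4)) (\<lambda>a b x. sqrt \<bar>x\<bar> * (a + b * ln \<bar>x\<bar>))"
  "\<alpha> > 0 \<Longrightarrow> family (- {0}) (model_pot 0 0 0 (\<alpha>\<^sup>2 - 1 / 4)) (\<lambda>a b. W_of (C1_pow \<alpha> a b))"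
  "\<beta> \<ge> 0 \<Longrightarrow> family (- {0}) (model_pot 0 0 (- 1) (\<beta>\<^sup>2 - 1 / 4)) (\<lambda>a b. W_of (C1p_Z \<beta> a b))"
  "\<alpha> > 0 \<Longrightarrow> family (- {0}) (model_pot 0 0 (- 1) (- \<alpha>\<^sup>2 - 1 / 4)) (\<lambda>a b. W_of (C1p_Zt \<alpha> a b))"
  "\<beta> \<ge> 0 \<Longrightarrow> family (- {0}) (model_pot 0 0 1 (\<beta>\<^sup>2 - 1 / 4)) (\<lambda>a b. W_of (C1pp_C \<beta> a b))"
  "\<alpha> > 0 \<Longrightarrow> family (- {0}) (model_pot 0 0 1 (- \<alpha>\<^sup>2 - 1 / 4)) (\<lambda>a b. W_of (C1pp_Ct \<alpha> a b))"
  "nu_range \<nu> \<Longrightarrow> family (- {0}) (model_pot (- 1) 0 (- \<kappa>) (Re (\<nu>\<^sup>2) - 1 / 4)) (whit_comb_trig \<kappa> (\<nu> / 2))"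
  "nu_range \<nu> \<Longrightarrow> family (- {0}) (model_pot 1 0 (- \<kappa>) (Re (\<nu>\<^sup>2) - 1 / 4)) (whit_comb_exp \<kappa> (\<nu> / 2))"
  "family UNIV (model_pot 0 0 0 0) (\<lambda>a b x :: real. a + b * x)"
  "family UNIV (model_pot 0 0 (- 1) 0) (\<lambda>a b x :: real. a * cos x + b * sin x)"
  "family UNIV (model_pot 0 0 1 0) (\<lambda>a b x :: real. a * exp x + b * exp (- x))"
  "family UNIV (model_pot 0 1 0 0) (\<lambda>a b. W_of (C2c a b))"
  by (rule family_cong[OF family_euler_trig] family_cong[OF family_euler_ln] family_cong[OF family_euler_pow, folded W_of.simps]
      family_cong[OF family_Z] family_cong[OF family_Zt] family_cong[OF family_C] family_cong[OF family_Ct]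
      family_cong[OF family_whit_trig] family_cong[OF family_whit_exp] family_cong[OF family_linear]
      family_cong[OF family_trig] family_cong[OF family_exp] family_cong[OF family_airy];
      simp add: model_pot_def)+

text \<open>\<open>C2a\<close> and \<open>C2b\<close> are the Whittaker families at
  \<open>\<nu> = 1 / 2\<close>, where the inverse square disappears from the potential.\<close>

lemma nu_half: "nu_range (1 / 2)" "Re ((1 / 2 :: complex)\<^sup>2) - 1 / 4 = 0" "(1 / 2 :: complex) / 2 = 1 / 4"
  by (simp_all add: nu_range_def power2_eq_square)

lemma entry_e_nonzero:
  "\<alpha> > 0 \<Longrightarrow> - \<alpha>\<^sup>2 - 1 / 4 \<noteq> (0 :: real)"
  "\<beta> \<ge> 0 \<Longrightarrow> \<beta> \<noteq> 1 / 2 \<Longrightarrow> \<beta>\<^sup>2 - 1 / 4 \<noteq> (0 :: real)"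
proof -
  have "0 \<le> \<alpha>\<^sup>2" by simp
  then show "- \<alpha>\<^sup>2 - 1 / 4 \<noteq> (0 :: real)" by linarith
  assume b: "\<beta> \<ge> 0" "\<beta> \<noteq> 1 / 2"
  have "\<beta>\<^sup>2 - 1 / 4 = (\<beta> - 1 / 2) * (\<beta> + 1 / 2)" by (simp add: field_simps power2_eq_square)
  then show "\<beta>\<^sup>2 - 1 / 4 \<noteq> 0" using b by simp
qed

lemma entry_sol:
  assumes "valid_entry e"
  shows "\<exists>W'. sol (entry_dom e) (entry_pot e) (W_of e) W'"
proof -
  have o: "open (- {0::real})" "open (UNIV :: real set)" by auto
  have tr: "\<exists>W'. sol D q (W_of e) W'" if F: "open D" "family D q F" "\<And>x. x \<in> D \<Longrightarrow> F a b x = W_of e x"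
    for D q F a b
  proof -
    obtain W' where "sol D q (F a b) W'" using family_sol[OF F(1,2), of a b] by blast
    from sol_transform[OF F(1) this F(3)] show ?thesis by blast
  qed
  have ex: "\<exists>W'. sol (- {0}) q (\<lambda>x. Re (F a b x)) W'" if "family (- {0}) q F" for q and F :: "complex \<Rightarrow> complex \<Rightarrow> real \<Rightarrow> complex" and a b
    using family_sol[OF o(1) that, of a b] sol_Re_Im(1) by blast
  have W_eq: "W_of (C1a \<kappa> \<nu> a b) = whit_comb_trig \<kappa> (\<nu> / 2) a b"
    "W_of (C1b \<kappa> \<nu> a' b') = (\<lambda>x. Re (whit_comb_exp \<kappa> (\<nu> / 2) a' b' x))"
    "W_of (C2a \<kappa> a b) = whit_comb_trig \<kappa> (1 / 4) a b"
    "W_of (C2b \<kappa> a' b') = (\<lambda>x. Re (whit_comb_exp \<kappa> (1 / 4) a' b' x))" for \<kappa> \<nu> a b a' b'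
    by (rule ext, simp)+
  show ?thesis
  proof (cases e)
    case (C1_cos \<alpha>)
    then have "\<alpha> > 0" using assms by simp
    then have "\<exists>W'. sol (- {0}) (model_pot 0 0 0 (- \<alpha>\<^sup>2 - 1 / 4)) (W_of e) W'"
      by (intro tr[OF o(1) families(1), of \<alpha> 1 0]) (simp_all add: C1_cos)
    then show ?thesis using entry_e_nonzero(1)[OF \<open>\<alpha> > 0\<close>]
      by (simp add: entry_dom_def entry_pot_def model_dom_def C1_cos del: W_of.simps)
  next
    case C1_sqrt
    show ?thesis unfolding C1_sqrt
      by (simp add: entry_dom_def entry_pot_def model_dom_def)
        (rule tr[OF o(1) families(2)[simplified], of 1 0, unfolded C1_sqrt]; simp)
  next
    case C1_ln
    show ?thesis unfolding C1_ln
      by (simp add: entry_dom_def entry_pot_def model_dom_def)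
        (rule tr[OF o(1) families(2)[simplified], of 0 1, unfolded C1_ln]; simp)
  next
    case (C1_pow \<alpha> a b)
    then show ?thesis using assms entry_e_nonzero(2)[of \<alpha>] family_sol[OF o(1) families(3), of \<alpha> a b]
      by (simp add: entry_dom_def entry_pot_def model_dom_def del: W_of.simps)
  next
    case (C1p_Z \<alpha> a b)
    then show ?thesis using assms entry_e_nonzero(2)[of \<alpha>] family_sol[OF o(1) families(4), of \<alpha> a b]
      by (simp add: entry_dom_def entry_pot_def model_dom_def del: W_of.simps)
  next
    case (C1p_Zt \<alpha> a b)
    then show ?thesis using assms entry_e_nonzero(1)[of \<alpha>] family_sol[OF o(1) families(5), of \<alpha> a b]
      by (simp add: entry_dom_def entry_pot_def model_dom_def del: W_of.simps)
  next
    case (C1pp_C \<alpha> a b)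
    then show ?thesis using assms entry_e_nonzero(2)[of \<alpha>] family_sol[OF o(1) families(6), of \<alpha> a b]
      by (simp add: entry_dom_def entry_pot_def model_dom_def del: W_of.simps)
  next
    case (C1pp_Ct \<alpha> a b)
    then show ?thesis using assms entry_e_nonzero(1)[of \<alpha>] family_sol[OF o(1) families(7), of \<alpha> a b]
      by (simp add: entry_dom_def entry_pot_def model_dom_def del: W_of.simps)
  next
    case (C1a \<kappa> \<nu> a b)
    then show ?thesis using assms family_sol[OF o(1) families(8), of \<nu> \<kappa> a b]
      by (simp add: entry_dom_def entry_pot_def model_dom_def W_eq)
  next
    case (C1b \<kappa> \<nu> a b)
    then show ?thesis using assms ex[OF families(9), of \<nu> \<kappa> a b]
      by (simp add: entry_dom_def entry_pot_def model_dom_def W_eq)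
  next
    case (C2a \<kappa> a b)
    then show ?thesis using family_sol[OF o(1) families(8)[OF nu_half(1)], of \<kappa> a b]
      unfolding nu_half by (simp add: entry_dom_def entry_pot_def model_dom_def W_eq)
  next
    case (C2b \<kappa> a b)
    then show ?thesis using ex[OF families(9)[OF nu_half(1)], of \<kappa> a b]
      unfolding nu_half by (simp add: entry_dom_def entry_pot_def model_dom_def W_eq)
  next
    case (C2c a b)
    then show ?thesis using family_sol[OF o(2) families(13), of a b]
      by (simp add: entry_dom_def entry_pot_def model_dom_def del: W_of.simps)
  next
    case C2_one
    show ?thesis unfolding C2_one
      by (simp add: entry_dom_def entry_pot_def model_dom_def)
        (rule tr[OF o(2) families(10), of 1 0, unfolded C2_one]; simp)
  next
    case C2_id
    show ?thesis unfolding C2_id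
      by (simp add: entry_dom_def entry_pot_def model_dom_def)
        (rule tr[OF o(2) families(10), of 0 1, unfolded C2_id]; simp)
  next
    case C2p_cos
    show ?thesis unfolding C2p_cos
      by (simp add: entry_dom_def entry_pot_def model_dom_def)
        (rule tr[OF o(2) families(11), of 1 0, unfolded C2p_cos]; simp)
  next
    case C2pp_exp
    show ?thesis unfolding C2pp_exp
      by (simp add: entry_dom_def entry_pot_def model_dom_def)
        (rule tr[OF o(2) families(12), of 1 0, unfolded C2pp_exp]; simp)
  next
    case C2pp_cosh
    show ?thesis unfolding C2pp_cosh
      by (simp add: entry_dom_def entry_pot_def model_dom_def)
        (rule tr[OF o(2) families(12), of "1 / 2" "1 / 2", unfolded C2pp_cosh]; simp add: cosh_field_def)
  next
    case C2pp_sinh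
    show ?thesis unfolding C2pp_sinh
      by (simp add: entry_dom_def entry_pot_def model_dom_def)
        (rule tr[OF o(2) families(12), of "1 / 2" "- 1 / 2", unfolded C2pp_sinh]; simp add: sinh_field_def field_simps)
  qed
qed

lemma entry_dom_nonzero: "valid_entry e \<Longrightarrow> W_of e x \<noteq> 0 \<Longrightarrow> x \<in> entry_dom e"
  by (cases "x = 0"; cases e)
    (auto simp: entry_dom_def model_dom_def whit_comb_trig_def whit_comb_exp_def)

section \<open>Completeness of the list for the model potentials\<close>

lemma open_interval_side:
  assumes "open_interval J" "0 \<notin> J"
  shows "J \<subseteq> {0<..} \<or> J \<subseteq> {..<0::real}"
proof (rule ccontr)
  assume "\<not> ?thesis"
  then obtain x y where "x \<in> J" "y \<in> J" "x \<le> 0" "0 \<le> y" by (auto simp: subset_iff not_less)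
  then have "0 \<in> J" using connected_contains_Icc[OF open_intervalD(2)[OF assms(1)], of x y] by auto
  then show False using assms(2) by simp
qed

text \<open>\<open>valid_entry\<close> demands real values at all nonzero points, whereas a solution
  is given on \<open>J\<close> only. The imaginary part is itself a solution; as it vanishes on
  \<open>J\<close>, its coordinates are 0 on the half line around \<open>J\<close>. The combination
  is even, which settles the other half line.\<close>

lemma whit_comb_exp_real:
  assumes nu: "nu_range \<nu>" and J: "open_interval J" "0 \<notin> J"
    and r: "\<And>x. x \<in> J \<Longrightarrow> whit_comb_exp \<kappa> (\<nu> / 2) a b x \<in> \<real>" and x: "x \<noteq> 0"
  shows "whit_comb_exp \<kappa> (\<nu> / 2) a b x \<in> \<real>"
proof -
  let ?F = "whit_comb_exp \<kappa> (\<nu> / 2)" and ?q = "model_pot 1 0 (- \<kappa>) (Re (\<nu>\<^sup>2) - 1 / 4)"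
  have even: "?F a b (- x) = ?F a b x" for x by (simp add: whit_comb_exp_def)
  note fam = families(9)[OF nu, of \<kappa>]
  obtain W' where W': "sol (- {0}) ?q (?F a b) W'" using family_sol[OF _ fam] by auto
  have main: "Im (?F a b x) = 0" if H: "open_interval H" "J \<subseteq> H" "0 \<notin> H" "x \<in> H" for H x
  proof -
    have "sol (- {0}) ?q (\<lambda>x. complex_of_real (Im (?F a b x))) (\<lambda>x. complex_of_real (Im (W' x)))"
      by (rule sol_of_real[OF sol_Re_Im(2)[OF W']])
    moreover have sub: "H \<subseteq> - {0}" using H(3) by blast
    ultimately have "sol H ?q (\<lambda>x. complex_of_real (Im (?F a b x))) (\<lambda>x. complex_of_real (Im (W' x)))"
      using sol_subset by blast
    from family_rep[OF fam H(1) sub this] obtain c d where cd: "\<And>x. x \<in> H \<Longrightarrow> complex_of_real (Im (?F a b x)) = ?F c d x"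
      by blast
    have "?F c d x = ?F 0 0 x" if "x \<in> J" for x
    proof -
      have "?F c d x = 0" using cd[of x] r[OF that] that H(2) by (auto simp: complex_is_Real_iff)
      moreover have "?F 0 0 x = 0" using family_zero[OF fam, of x] that H(2,3) by auto
      ultimately show ?thesis by simp
    qed
    then have "c = 0 \<and> d = 0" by (intro family_unique[OF fam J(1)]) (use J(2) in auto)
    then have "complex_of_real (Im (?F a b x)) = 0" using cd[OF H(4)] family_zero[OF fam, of x] sub H(4) by auto
    then show ?thesis by simp
  qed
  have oi: "open_interval {0::real<..}" "open_interval {..<0::real}"
    by (auto simp: open_interval_def intro: exI[of _ 1] exI[of _ "-1"])
  have "Im (?F a b x) = 0"
  proof (cases "J \<subseteq> {0<..}")
    case True
    then have "Im (?F a b \<bar>x\<bar>) = 0" using main[OF oi(1)] x by auto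
    then show ?thesis using even[of x] by (cases "x > 0") auto
  next
    case False
    then have "J \<subseteq> {..<0}" using open_interval_side[OF J] by blast
    then have "Im (?F a b (- \<bar>x\<bar>)) = 0" using main[OF oi(2)] x by auto
    then show ?thesis using even[of x] by (cases "x > 0") auto
  qed
  then show ?thesis by (simp add: complex_is_Real_iff)
qed

text \<open>A nonnegative square comes from the real ray of \<open>nu_range\<close>, a negative one
  from the imaginary ray.\<close>

lemma nu_of_square: "\<exists>\<nu>. nu_range \<nu> \<and> Re (\<nu>\<^sup>2) = \<rho>"
proof (cases "\<rho> \<ge> 0")
  case True
  then show ?thesis by (intro exI[of _ "of_real (sqrt \<rho>)"]) (simp add: nu_range_def flip: of_real_power)
next
  case False
  then show ?thesis by (intro exI[of _ "\<i> * of_real (sqrt (- \<rho>))"]) (simp add: nu_range_def power2_eq_square)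
qed

lemma order_of_coeff:
  fixes e :: real
  shows "4 * e + 1 > 0 \<Longrightarrow> \<exists>\<alpha>>0. e = \<alpha>\<^sup>2 - 1 / 4" "4 * e + 1 < 0 \<Longrightarrow> \<exists>\<alpha>>0. e = - \<alpha>\<^sup>2 - 1 / 4"
    "4 * e + 1 \<ge> 0 \<Longrightarrow> \<exists>\<alpha>\<ge>0. e = \<alpha>\<^sup>2 - 1 / 4"
proof -
  show "\<exists>\<alpha>>0. e = \<alpha>\<^sup>2 - 1 / 4" if "4 * e + 1 > 0"
    by (rule exI[of _ "sqrt (4 * e + 1) / 2"]) (use that in \<open>simp add: power_divide field_simps\<close>)
  show "\<exists>\<alpha>>0. e = - \<alpha>\<^sup>2 - 1 / 4" if "4 * e + 1 < 0"
    by (rule exI[of _ "sqrt (- (4 * e + 1)) / 2"]) (use that in \<open>simp add: power_divide field_simps\<close>)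
  show "\<exists>\<alpha>\<ge>0. e = \<alpha>\<^sup>2 - 1 / 4" if "4 * e + 1 \<ge> 0"
    by (rule exI[of _ "sqrt (4 * e + 1) / 2"]) (use that in \<open>simp add: power_divide field_simps\<close>)
qed

lemma half_order: "e = \<alpha>\<^sup>2 - 1 / 4 \<Longrightarrow> e \<noteq> 0 \<Longrightarrow> \<alpha> \<noteq> 1 / 2" for e \<alpha> :: real
  by clarify (simp add: power_divide)

text \<open>A solution has two constants, not both 0 since \<open>W\<close> has no zeros. Dilations
  and translations that preserve the potential absorb a phase or a ratio of the constants and lead
  to functions without \<open>(a\<^sub>1, a\<^sub>2)\<close>; otherwise, and for
  \<open>C1_pow\<close>, the constants remain as parameters. The factor \<open>\<mu>\<close> is
  immaterial because \<open>B\<close> is a logarithmic derivative.\<close>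

lemma entry_complete:
  assumes nc: "normal_coeffs \<delta> \<beta> \<sigma> e" and J: "open_interval J" "J \<subseteq> model_dom \<delta> e"
    and W: "sol J (model_pot \<delta> \<beta> \<sigma> e) W W'" "\<And>z. z \<in> J \<Longrightarrow> W z \<noteq> 0"
  shows "\<exists>ent k d \<mu>. valid_entry ent \<and> k \<noteq> 0 \<and> \<mu> \<noteq> 0 \<and> (\<forall>z\<in>J. W_of ent (k * z + d) = \<mu> * W z)"
proof -
  obtain z0 where z0: "z0 \<in> J" using open_intervalD(3)[OF J(1)] by blast
  have rep: "\<exists>a b. (\<forall>z\<in>J. W z = F a b z) \<and> (a, b) \<noteq> (0, 0)"
    if fam: "family D (model_pot \<delta>' \<beta>' \<sigma>' e') F" "J \<subseteq> D" "\<delta> = \<delta>'" "\<beta> = \<beta>'" "\<sigma> = \<sigma>'" "e = e'"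
    for D F \<delta>' \<beta>' \<sigma>' e'
  proof -
    obtain a b where ab: "\<forall>z\<in>J. W z = F a b z"
      using family_rep[OF fam(1) J(1) fam(2) W(1)[unfolded fam(3-6)]] by blast
    moreover have "(a, b) \<noteq> (0, 0)"
      using ab W(2)[OF z0] z0 family_zero[OF fam(1)] fam(2) by auto
    ultimately show ?thesis by blast
  qed
  have id: ?thesis if "valid_entry ent" "\<And>z. z \<in> J \<Longrightarrow> W_of ent z = W z" for ent
    by (rule exI[of _ ent], rule exI[of _ 1], rule exI[of _ 0], rule exI[of _ 1]) (use that in simp)
  have polar: "\<exists>r \<phi>. r \<noteq> 0 \<and> a = r * cos \<phi> \<and> b = r * sin \<phi>" if "(a, b) \<noteq> (0, 0)" for a b :: real
    using polar_Ex[of a b] that by auto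
  consider "\<beta> = 0" "\<delta> = -1" | "\<beta> = 0" "\<delta> = 1" | "\<delta> = 0" "\<beta> = 0" "\<sigma> = 0" | "\<delta> = 0" "\<beta> = 0" "\<sigma> = -1"
    | "\<delta> = 0" "\<beta> = 0" "\<sigma> = 1" | "\<delta> = 0" "\<beta> = 1" "\<sigma> = 0" "e = 0"
    using nc unfolding normal_coeffs_def by blast
  then show ?thesis
  proof cases
    case 1
    obtain \<nu> where nu: "nu_range \<nu>" "Re (\<nu>\<^sup>2) = e + 1 / 4" using nu_of_square by blast
    have fam: "family (- {0}) (model_pot \<delta> \<beta> \<sigma> e) (whit_comb_trig (- \<sigma>) (\<nu> / 2))"
      using families(8)[OF nu(1), of "- \<sigma>"] nu(2) 1 by simp
    then obtain a b where ab: "\<And>z. z \<in> J \<Longrightarrow> W z = whit_comb_trig (- \<sigma>) (\<nu> / 2) a b z" "(a, b) \<noteq> (0, 0)"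
      using rep[OF fam _ refl refl refl refl] J(2) 1 by (auto simp: model_dom_def)
    show ?thesis
    proof (cases "\<nu> = 1 / 2")
      case True
      show ?thesis using ab[unfolded True nu_half(3)] by (intro id[of "C2a (- \<sigma>) a b"]) auto
    next
      case False
      then show ?thesis using ab nu by (intro id[of "C1a (- \<sigma>) \<nu> a b"]) auto
    qed
  next
    case 2
    obtain \<nu> where nu: "nu_range \<nu>" "Re (\<nu>\<^sup>2) = e + 1 / 4" using nu_of_square by blast
    have fam: "family (- {0}) (model_pot \<delta> \<beta> \<sigma> e) (whit_comb_exp (- \<sigma>) (\<nu> / 2))"
      using families(9)[OF nu(1), of "- \<sigma>"] nu(2) 2 by simp
    have J0: "J \<subseteq> - {0}" using J(2) 2 by (auto simp: model_dom_def)
    obtain a b where ab: "\<And>z. z \<in> J \<Longrightarrow> complex_of_real (W z) = whit_comb_exp (- \<sigma>) (\<nu> / 2) a b z"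
      using family_rep[OF fam J(1) J0 sol_of_real[OF W(1)]] by blast
    have "z0 \<in> - {0}" using z0 J0 by blast
    then have nz: "(a, b) \<noteq> (0, 0)"
      using ab[OF z0] W(2)[OF z0] family_zero[OF fam, of z0] by auto
    have re: "whit_comb_exp (- \<sigma>) (\<nu> / 2) a b z \<in> \<real>" if "z \<noteq> 0" for z
      by (rule whit_comb_exp_real[OF nu(1) J(1) _ _ that]) (use J0 ab in \<open>auto simp flip: ab\<close>)
    have Wz: "Re (whit_comb_exp (- \<sigma>) (\<nu> / 2) a b z) = W z" if "z \<in> J" for z
      using ab[OF that, symmetric] by simp
    show ?thesis
    proof (cases "\<nu> = 1 / 2")
      case True
      show ?thesis using nz re[unfolded True nu_half(3)] Wz[unfolded True nu_half(3)]
        by (intro id[of "C2b (- \<sigma>) a b"]) auto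
    next
      case False
      then show ?thesis using nz re Wz nu by (intro id[of "C1b (- \<sigma>) \<nu> a b"]) auto
    qed
  next
    case 3
    show ?thesis
    proof (cases "e = 0")
      case True
      obtain a b where ab: "\<And>z. z \<in> J \<Longrightarrow> W z = a + b * z" "(a, b) \<noteq> (0, 0)"
        using rep[OF families(10) subset_UNIV 3 True] by blast
      show ?thesis
      proof (cases "b = 0")
        case b: True
        then have "a \<noteq> 0" using ab(2) by simp
        then show ?thesis using ab(1) b
          by (intro exI[of _ C2_one] exI[of _ "1::real"] exI[of _ "0::real"] exI[of _ "1 / a"]) simp
      next
        case b: False
        then show ?thesis using ab(1)
          by (intro exI[of _ C2_id] exI[of _ "1::real"] exI[of _ "a / b"] exI[of _ "1 / b"]) (simp add: field_simps)
      qed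
    next
      case e: False
      then have J0: "J \<subseteq> - {0}" using J(2) by (auto simp: model_dom_def)
      consider "4 * e + 1 < 0" | "4 * e + 1 = 0" | "4 * e + 1 > 0" by linarith
      then show ?thesis
      proof cases
        case neg: 1
        then obtain \<alpha> where al: "\<alpha> > 0" "e = - \<alpha>\<^sup>2 - 1 / 4" using order_of_coeff(2) by blast
        obtain a b where ab: "\<And>z. z \<in> J \<Longrightarrow> W z = sqrt \<bar>z\<bar> * (a * cos (\<alpha> * ln \<bar>z\<bar>) + b * sin (\<alpha> * ln \<bar>z\<bar>))" "(a, b) \<noteq> (0, 0)"
          using rep[OF families(1)[OF al(1)] J0 3 al(2)] by blast
        obtain r \<phi> where r: "r \<noteq> 0" "a = r * cos \<phi>" "b = r * sin \<phi>" using polar[OF ab(2)] by blast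
        \<comment> \<open>Dilation by \<open>k\<close> shifts
          \<open>\<alpha> * ln \<bar>z\<bar>\<close> by \<open>- \<phi>\<close> and so brings the
          cosine to its phase.\<close>
        define k where "k = exp (- \<phi> / \<alpha>)"
        have k: "k > 0" "\<alpha> * ln k = - \<phi>" using al(1) by (simp_all add: k_def)
        have "W_of (C1_cos \<alpha>) (k * z + 0) = sqrt k / r * W z" if z: "z \<in> J" for z
        proof -
          have z0: "\<bar>z\<bar> > 0" using z J0 by auto
          have e: "\<alpha> * ln \<bar>k * z\<bar> = \<alpha> * ln \<bar>z\<bar> - \<phi>"
            using k z0 by (simp add: abs_mult ln_mult distrib_left)
          show ?thesis
            unfolding W_of.simps add_0_right e ab(1)[OF z] r(2,3) cos_diff
            using k(1) r(1) by (simp add: abs_mult real_sqrt_mult field_simps)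
        qed
        then show ?thesis using k(1) r(1) al(1)
          by (intro exI[of _ "C1_cos \<alpha>"] exI[of _ k] exI[of _ "0::real"] exI[of _ "sqrt k / r"]) (simp del: W_of.simps)
      next
        case zer: 2
        then have e4: "e = - 1 / 4" by simp
        obtain a b where ab: "\<And>z. z \<in> J \<Longrightarrow> W z = sqrt \<bar>z\<bar> * (a + b * ln \<bar>z\<bar>)" "(a, b) \<noteq> (0, 0)"
          using rep[OF families(2) J0 3 e4] by blast
        show ?thesis
        proof (cases "b = 0")
          case b: True
          then have "a \<noteq> 0" using ab(2) by simp
          then show ?thesis using ab(1) b
            by (intro exI[of _ C1_sqrt] exI[of _ "1::real"] exI[of _ "0::real"] exI[of _ "1 / a"]) simp
        next
          case b: False
          \<comment> \<open>Dilation by \<open>k\<close> adds \<open>a / b\<close> to the logarithm,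
            which absorbs the constant term.\<close>
          define k where "k = exp (a / b)"
          have k: "k > 0" "ln k = a / b" by (simp_all add: k_def)
          have "W_of C1_ln (k * z + 0) = sqrt k / b * W z" if z: "z \<in> J" for z
          proof -
            have z0: "\<bar>z\<bar> > 0" using z J0 by auto
            have e: "ln \<bar>k * z\<bar> = a / b + ln \<bar>z\<bar>" using k z0 by (simp add: abs_mult ln_mult)
            show ?thesis unfolding W_of.simps add_0_right e ab(1)[OF z]
              using k(1) b by (simp add: abs_mult real_sqrt_mult field_simps)
          qed
          then show ?thesis using k(1) b
            by (intro exI[of _ C1_ln] exI[of _ k] exI[of _ "0::real"] exI[of _ "sqrt k / b"]) (simp del: W_of.simps)
        qed
      next
        case pos: 3
        then obtain \<alpha> where al: "\<alpha> > 0" "e = \<alpha>\<^sup>2 - 1 / 4" using order_of_coeff(1) by blast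
        have "\<alpha> \<noteq> 1 / 2" using al(2) e by (rule half_order)
        moreover obtain a b where "\<And>z. z \<in> J \<Longrightarrow> W z = W_of (C1_pow \<alpha> a b) z" "(a, b) \<noteq> (0, 0)"
          using rep[OF families(3)[OF al(1)] J0 3 al(2)] by blast
        ultimately show ?thesis using al(1) by (intro id[of "C1_pow \<alpha> a b"]) auto
      qed
    qed
  next
    case 4
    show ?thesis
    proof (cases "e = 0")
      case True
      obtain a b where ab: "\<And>z. z \<in> J \<Longrightarrow> W z = a * cos z + b * sin z" "(a, b) \<noteq> (0, 0)"
        using rep[OF families(11) subset_UNIV 4 True] by blast
      obtain r \<phi> where r: "r \<noteq> 0" "a = r * cos \<phi>" "b = r * sin \<phi>" using polar[OF ab(2)] by blast
      have "W_of C2p_cos (1 * z + - \<phi>) = 1 / r * W z" if "z \<in> J" for z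
        using r by (simp add: ab(1)[OF that] cos_diff field_simps)
      then show ?thesis using r(1)
        by (intro exI[of _ C2p_cos] exI[of _ "1::real"] exI[of _ "- \<phi>"] exI[of _ "1 / r"]) (simp del: W_of.simps)
    next
      case e: False
      then have J0: "J \<subseteq> - {0}" using J(2) by (auto simp: model_dom_def)
      show ?thesis
      proof (cases "4 * e + 1 < 0")
        case True
        then obtain \<alpha> where al: "\<alpha> > 0" "e = - \<alpha>\<^sup>2 - 1 / 4" using order_of_coeff(2) by blast
        obtain a b where "\<And>z. z \<in> J \<Longrightarrow> W z = W_of (C1p_Zt \<alpha> a b) z" "(a, b) \<noteq> (0, 0)"
          using rep[OF families(5)[OF al(1)] J0 4 al(2)] by blast
        then show ?thesis using al(1) by (intro id[of "C1p_Zt \<alpha> a b"]) auto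
      next
        case False
        then obtain \<alpha> where al: "\<alpha> \<ge> 0" "e = \<alpha>\<^sup>2 - 1 / 4" using order_of_coeff(3)[of e] unfolding not_less by blast
        have "\<alpha> \<noteq> 1 / 2" using al(2) e by (rule half_order)
        moreover obtain a b where "\<And>z. z \<in> J \<Longrightarrow> W z = W_of (C1p_Z \<alpha> a b) z" "(a, b) \<noteq> (0, 0)"
          using rep[OF families(4)[OF al(1)] J0 4 al(2)] by blast
        ultimately show ?thesis using al(1) by (intro id[of "C1p_Z \<alpha> a b"]) auto
      qed
    qed
  next
    case 5
    show ?thesis
    proof (cases "e = 0")
      case True
      obtain a b where ab: "\<And>z. z \<in> J \<Longrightarrow> W z = a * exp z + b * exp (- z)" "(a, b) \<noteq> (0, 0)"
        using rep[OF families(12) subset_UNIV 5 True] by blast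
      consider "b = 0" "a \<noteq> 0" | "a = 0" "b \<noteq> 0" | "a / b > 0" | "a / b < 0" "a \<noteq> 0" "b \<noteq> 0"
        using ab(2) by (metis Pair_inject divide_eq_0_iff linorder_neqE_linordered_idom)
      then show ?thesis
      proof cases
        case 1
        then show ?thesis using ab(1)
          by (intro exI[of _ C2pp_exp] exI[of _ "1::real"] exI[of _ "0::real"] exI[of _ "1 / a"]) simp
      next
        \<comment> \<open>The decreasing exponential is the increasing one under the reflection
          \<open>k = - 1\<close>.\<close>
        case 2
        then show ?thesis using ab(1)
          by (intro exI[of _ C2pp_exp] exI[of _ "- 1::real"] exI[of _ "0::real"] exI[of _ "1 / b"]) simp
      next
        case 3
        then have nz: "a \<noteq> 0" "b \<noteq> 0" by auto
        \<comment> \<open>Translation by \<open>d\<close> multiplies the exponentials by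
          \<open>exp d\<close> and \<open>exp (- d)\<close>. Their ratio \<open>a / b\<close> is the
          square of \<open>exp d\<close>, so this \<open>d\<close> reproduces it.\<close>
        define d where "d = ln (a / b) / 2"
        have "exp d * exp d = exp (ln (a / b))" unfolding d_def mult_exp_exp by simp
        then have d: "exp d * exp d = a / b" using 3 by simp
        have "W_of C2pp_cosh (1 * z + d) = exp d / (2 * a) * W z" if "z \<in> J" for z
        proof -
          have "exp d * b / a = exp (- d)" using d nz by (simp add: exp_minus field_simps)
          then have "exp d / (2 * a) * (a * E + b * E') = (exp d * E + exp (- d) * E') / 2" for E E'
            using nz by (simp add: field_simps)
          moreover have "exp (1 * z + d) = exp d * exp z" "exp (- (1 * z + d)) = exp (- d) * exp (- z)"
            unfolding exp_add[symmetric] by simp_all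
          ultimately show ?thesis unfolding W_of.simps cosh_field_def ab(1)[OF that] by simp
        qed
        then show ?thesis using nz
          by (intro exI[of _ C2pp_cosh] exI[of _ "1::real"] exI[of _ d] exI[of _ "exp d / (2 * a)"]) (simp del: W_of.simps)
      next
        case 4
        define d where "d = ln (- a / b) / 2"
        have "exp d * exp d = exp (ln (- a / b))" unfolding d_def mult_exp_exp by simp
        then have d: "exp d * exp d = - a / b" using 4 by simp
        have "W_of C2pp_sinh (1 * z + d) = exp d / (2 * a) * W z" if "z \<in> J" for z
        proof -
          have "exp d * b / a = - exp (- d)" using d 4 by (simp add: exp_minus field_simps)
          then have "exp d / (2 * a) * (a * E + b * E') = (exp d * E - exp (- d) * E') / 2" for E E'
            using 4 by (simp add: field_simps)
          moreover have "exp (1 * z + d) = exp d * exp z" "exp (- (1 * z + d)) = exp (- d) * exp (- z)"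
            unfolding exp_add[symmetric] by simp_all
          ultimately show ?thesis unfolding W_of.simps sinh_field_def ab(1)[OF that] by simp
        qed
        then show ?thesis using 4
          by (intro exI[of _ C2pp_sinh] exI[of _ "1::real"] exI[of _ d] exI[of _ "exp d / (2 * a)"]) (simp del: W_of.simps)
      qed
    next
      case e: False
      then have J0: "J \<subseteq> - {0}" using J(2) by (auto simp: model_dom_def)
      show ?thesis
      proof (cases "4 * e + 1 < 0")
        case True
        then obtain \<alpha> where al: "\<alpha> > 0" "e = - \<alpha>\<^sup>2 - 1 / 4" using order_of_coeff(2) by blast
        obtain a b where "\<And>z. z \<in> J \<Longrightarrow> W z = W_of (C1pp_Ct \<alpha> a b) z" "(a, b) \<noteq> (0, 0)"
          using rep[OF families(7)[OF al(1)] J0 5 al(2)] by blast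
        then show ?thesis using al(1) by (intro id[of "C1pp_Ct \<alpha> a b"]) auto
      next
        case False
        then obtain \<alpha> where al: "\<alpha> \<ge> 0" "e = \<alpha>\<^sup>2 - 1 / 4" using order_of_coeff(3)[of e] unfolding not_less by blast
        have "\<alpha> \<noteq> 1 / 2" using al(2) e by (rule half_order)
        moreover obtain a b where "\<And>z. z \<in> J \<Longrightarrow> W z = W_of (C1pp_C \<alpha> a b) z" "(a, b) \<noteq> (0, 0)"
          using rep[OF families(6)[OF al(1)] J0 5 al(2)] by blast
        ultimately show ?thesis using al(1) by (intro id[of "C1pp_C \<alpha> a b"]) auto
      qed
    qed
  next
    case 6
    obtain a b where "\<And>z. z \<in> J \<Longrightarrow> W z = W_of (C2c a b) z" "(a, b) \<noteq> (0, 0)"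
      using rep[OF families(13) subset_UNIV 6] by blast
    then show ?thesis by (intro id[of "C2c a b"]) auto
  qed
qed

lemma open_interval_affine: "open_interval J \<Longrightarrow> c \<noteq> 0 \<Longrightarrow> open_interval ((\<lambda>x. c * x + d) ` J)" for c d :: real
proof -
  assume J: "open_interval J" and c: "c \<noteq> 0"
  have "(\<lambda>x. c * x + d) ` J = (\<lambda>x. d + c *\<^sub>R x) ` J" by (simp add: add.commute)
  then have "open ((\<lambda>x. c * x + d) ` J)" using open_affinity[OF open_intervalD(1)[OF J] c] by metis
  moreover have "connected ((\<lambda>x. c * x + d) ` J)"
    by (intro connected_continuous_image continuous_intros open_intervalD(2)[OF J])
  ultimately show ?thesis using open_intervalD(3)[OF J] by (simp add: open_interval_def)
qed

text \<open>Inverts \<open>B = 2 * s * W' / W\<close>: \<open>W\<close> is the exponential of an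
  antiderivative of \<open>s * B / 2\<close>, hence positive on the whole interval.\<close>

lemma potential_W:
  assumes I: "open_interval I" and B: "smooth_on I B" and s: "s * s = 1"
  obtains W where "sol I (potq s B) W (\<lambda>x. s / 2 * B x * W x)" "\<And>x. W x > 0"
proof -
  have "continuous_on I (\<lambda>x. s / 2 * B x)" using smooth_on_continuous[OF B] by (intro continuous_intros)
  then obtain F where F: "\<And>x. x \<in> I \<Longrightarrow> (F has_real_derivative s / 2 * B x) (at x)"
    using antiderivative_exists[OF I] by blast
  define W where "W = (\<lambda>x. exp (F x))"
  have W1: "(W has_real_derivative s / 2 * B x * W x) (at x)" if "x \<in> I" for x
    unfolding W_def by (auto intro!: derivative_eq_intros F that)
  have W2: "((\<lambda>x. s / 2 * B x * W x) has_real_derivative potq s B x * W x) (at x)" if x: "x \<in> I" for x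
  proof -
    have "((\<lambda>x. s / 2 * B x * W x) has_real_derivative s / 2 * deriv B x * W x + (s / 2 * B x * W x) * (s / 2 * B x)) (at x)"
      by (rule DERIV_mult[OF DERIV_cmult[OF smooth_on_DERIV[OF B x]] W1[OF x]])
    moreover have "s / 2 * deriv B x * W x + (s / 2 * B x * W x) * (s / 2 * B x)
      = s / 2 * deriv B x * W x + (s * s) * (B x)\<^sup>2 / 4 * W x" by (simp add: power2_eq_square)
    then have "s / 2 * deriv B x * W x + (s / 2 * B x * W x) * (s / 2 * B x) = potq s B x * W x"
      unfolding s potq_def by (simp add: algebra_simps)
    ultimately show ?thesis by simp
  qed
  show ?thesis
    by (rule that[of W]) (use W1 W2 in \<open>simp_all add: sol_def W_def flip: has_real_derivative_iff_has_vector_derivative\<close>)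
qed

text \<open>\<open>B\<close> is a multiple of the logarithmic derivative of \<open>W\<close>: the
  factor \<open>\<mu>\<close> cancels, and the chain rule supplies the factor \<open>1 / c1\<close>
  by which the equivalence group acts.\<close>

lemma equiv_K_from_W:
  assumes J: "open_interval J" and s: "s * s = 1" and c: "c1 \<noteq> 0" "\<mu> \<noteq> 0" and v: "valid_entry e"
    and W: "\<And>x. x \<in> J \<Longrightarrow> (W has_real_derivative s / 2 * B x * W x) (at x)" "\<And>x. x \<in> J \<Longrightarrow> W x \<noteq> 0"
    and eW: "\<And>x. x \<in> J \<Longrightarrow> W_of e (c1 * x + c3) = \<mu> * W x"
  shows "listed e ((\<lambda>x. c1 * x + c3) ` J) \<and> equiv_K J B ((\<lambda>x. c1 * x + c3) ` J) (B_of s e)"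
proof
  let ?I = "(\<lambda>x. c1 * x + c3) ` J"
  have oi: "open_interval ?I" by (rule open_interval_affine[OF J c(1)])
  show "listed e ?I" unfolding listed_def using v oi eW W(2) c(2) by auto
  have "B_of s e (c1 * x + c3) = B x / c1" if x: "x \<in> J" for x
  proof -
    let ?z = "c1 * x + c3"
    have xz: "(?z - c3) / c1 = x" using c(1) by simp
    have "((\<lambda>z. (z - c3) / c1) has_real_derivative 1 / c1) (at ?z)"
      using c(1) by (auto intro!: derivative_eq_intros)
    then have "((\<lambda>z. W ((z - c3) / c1)) has_real_derivative s / 2 * B x * W x * (1 / c1)) (at ?z)"
      by (rule DERIV_chain2[rotated]) (use W(1)[OF x] xz in simp)
    then have "((\<lambda>z. \<mu> * W ((z - c3) / c1)) has_real_derivative \<mu> * (s / 2 * B x * W x * (1 / c1))) (at ?z)"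
      by (rule DERIV_cmult)
    then have "(W_of e has_real_derivative \<mu> * (s / 2 * B x * W x * (1 / c1))) (at ?z)"
      by (rule has_field_derivative_transform_within_open[OF _ open_intervalD(1)[OF oi]])
        (use x eW c(1) in auto)
    then have d: "deriv (W_of e) ?z = \<mu> * (s / 2 * B x * W x * (1 / c1))" by (rule DERIV_imp_deriv)
    have "B_of s e ?z = (s * s) * (B x / c1)"
      unfolding B_of_def d eW[OF x] using W(2)[OF x] c by simp
    then show ?thesis by (simp add: s)
  qed
  then show "equiv_K J B ?I (B_of s e)" unfolding equiv_K_def using c(1) by blast
qed

text \<open>The exceptional point \<open>- c3 / c1\<close> is the preimage of the origin of the
  model potential; entries that involve \<open>\<bar>x\<bar>\<close> cannot be listed on an interval
  containing the origin.\<close>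

lemma complete_from_shape:
  assumes I: "open_interval I" and B: "smooth_on I B" and s: "s * s = 1"
    and shape: "\<And>x. x \<in> I \<Longrightarrow> potq s B x = a * (x - x0)\<^sup>2 + b * (x - x0) + r + \<epsilon> / (x - x0)\<^sup>2"
    and eb: "\<epsilon> \<noteq> 0 \<Longrightarrow> b = 0"
  shows "\<exists>p. \<forall>J. open_interval J \<and> J \<subseteq> I - {p} \<longrightarrow> (\<exists>e I'. listed e I' \<and> equiv_K J B I' (B_of s e))"
proof -
  obtain c1 c3 \<delta> \<beta> \<sigma> where c: "c1 \<noteq> 0" "normal_coeffs \<delta> \<beta> \<sigma> \<epsilon>"
    "\<And>x. a * (x - x0)\<^sup>2 + b * (x - x0) + r + \<epsilon> / (x - x0)\<^sup>2 = c1\<^sup>2 * model_pot \<delta> \<beta> \<sigma> \<epsilon> (c1 * x + c3)"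
    using normalize_potential[where e = \<epsilon> and b = b and a = a and ?x0.0 = x0 and r = r] eb by auto
  obtain W where W: "sol I (potq s B) W (\<lambda>x. s / 2 * B x * W x)" "\<And>x. W x > 0"
    using potential_W[OF I B s] by blast
  have W0: "W x \<noteq> 0" for x using W(2)[of x] by simp
  have Wd: "(W has_real_derivative s / 2 * B x * W x) (at x)"
    "((\<lambda>x. s / 2 * B x * W x) has_real_derivative potq s B x * W x) (at x)" if "x \<in> I" for x
    using W(1) that by (simp_all add: sol_def has_real_derivative_iff_has_vector_derivative)
  have "\<exists>e I'. listed e I' \<and> equiv_K J B I' (B_of s e)" if J: "open_interval J" "J \<subseteq> I - {- c3 / c1}" for J
  proof -
    let ?J = "(\<lambda>x. c1 * x + c3) ` J"
    let ?V = "\<lambda>z. W ((z - c3) / c1)" and ?V' = "\<lambda>z. s / 2 * B ((z - c3) / c1) * W ((z - c3) / c1) * (1 / c1)"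
    have oi: "open_interval ?J" by (rule open_interval_affine[OF J(1) c(1)])
    have dl: "((\<lambda>z. (z - c3) / c1) has_real_derivative 1 / c1) (at z)" for z
      using c(1) by (auto intro!: derivative_eq_intros)
    have sJ: "sol ?J (model_pot \<delta> \<beta> \<sigma> \<epsilon>) ?V ?V'"
      unfolding sol_def has_real_derivative_iff_has_vector_derivative[symmetric]
    proof (intro ballI conjI)
      fix z assume "z \<in> ?J"
      then obtain x where x: "x \<in> J" "z = c1 * x + c3" by blast
      have xz: "(z - c3) / c1 = x" using x c(1) by simp
      have xI: "x \<in> I" using x J(2) by blast
      show "(?V has_real_derivative ?V' z) (at z)"
        by (rule DERIV_chain2[OF _ dl]) (use Wd(1)[OF xI] xz in simp)
      have "((\<lambda>z. s / 2 * B ((z - c3) / c1) * W ((z - c3) / c1)) has_real_derivative potq s B x * W x * (1 / c1)) (at z)"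
        by (rule DERIV_chain2[of "\<lambda>x. s / 2 * B x * W x", OF _ dl]) (use Wd(2)[OF xI] xz in simp)
      then have "(?V' has_real_derivative potq s B x * W x * (1 / c1) * (1 / c1)) (at z)"
        by (rule DERIV_cmult_right)
      moreover have "potq s B x * W x * (1 / c1) * (1 / c1) = model_pot \<delta> \<beta> \<sigma> \<epsilon> z *\<^sub>R W ((z - c3) / c1)"
        unfolding xz shape[OF xI] c(3) x(2)[symmetric] using c(1) by (simp add: power2_eq_square)
      ultimately show "(?V' has_real_derivative model_pot \<delta> \<beta> \<sigma> \<epsilon> z *\<^sub>R W ((z - c3) / c1)) (at z)" by simp
    qed
    have "0 \<notin> ?J"
    proof
      assume "0 \<in> ?J"
      then obtain x where x: "x \<in> J" "c1 * x + c3 = 0" by auto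
      then have "x = - c3 / c1" using c(1) by (simp add: field_simps)
      then show False using x J(2) by blast
    qed
    then have "?J \<subseteq> model_dom \<delta> \<epsilon>" by (auto simp: model_dom_def)
    from entry_complete[OF c(2) oi this sJ W0] obtain e k d \<mu> where e: "valid_entry e" "k \<noteq> 0" "\<mu> \<noteq> 0"
      "\<And>z. z \<in> ?J \<Longrightarrow> W_of e (k * z + d) = \<mu> * W ((z - c3) / c1)"
      by blast
    have "W_of e ((k * c1) * x + (k * c3 + d)) = \<mu> * W x" if "x \<in> J" for x
      using e(4)[of "c1 * x + c3"] that c(1) by (simp add: algebra_simps)
    moreover have "(W has_real_derivative s / 2 * B x * W x) (at x)" if "x \<in> J" for x
      using Wd(1) J(2) that by blast
    moreover have "k * c1 \<noteq> 0" using e(2) c(1) by simp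
    ultimately show ?thesis
      using equiv_K_from_W[OF J(1) s _ e(3,1), of "k * c1" W B "k * c3 + d"] W0 by blast
  qed
  then show ?thesis by (intro exI[of _ "- c3 / c1"]) blast
qed

section \<open>Trivial fields and the kernels\<close>

text \<open>The span of \<open>vf_dt\<close> and \<open>vf_udu\<close> as a set that does not refer
  to any equation. Only values over \<open>T\<close> and \<open>I\<close> are prescribed, as in the
  essential algebras.\<close>

definition trivial_fields :: "real set \<Rightarrow> real set \<Rightarrow> vfield set" where
  "trivial_fields T I = {Q. \<exists>c d. \<forall>t\<in>T. \<forall>x\<in>I. \<forall>u. Q (t, x, u) = (c, 0, d * u)}"

lemma trivial_fields_basis:
  assumes "T \<noteq> {}" "I \<noteq> {}"
  shows "has_basis (dom3 T I) (trivial_fields T I) [vf_dt, vf_udu]"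
proof -
  have l: "lin_comb [vf_dt, vf_udu] c (t, x, u) = (c 0, 0, c 1 * u)" for c t x u
    by (simp add: lin_comb_def vf_dt_def vf_udu_def lessThan_Suc)
  obtain t x where tx: "t \<in> T" "x \<in> I" using assms by blast
  show ?thesis unfolding has_basis_def
  proof (intro conjI allI impI)
    fix Q
    show "Q \<in> trivial_fields T I \<longleftrightarrow> (\<exists>c. \<forall>p\<in>dom3 T I. Q p = lin_comb [vf_dt, vf_udu] c p)"
    proof
      assume "Q \<in> trivial_fields T I"
      then obtain c d where "\<forall>t\<in>T. \<forall>x\<in>I. \<forall>u. Q (t, x, u) = (c, 0, d * u)" by (auto simp: trivial_fields_def)
      then show "\<exists>c. \<forall>p\<in>dom3 T I. Q p = lin_comb [vf_dt, vf_udu] c p"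
        by (intro exI[of _ "\<lambda>n::nat. if n = 0 then c else d"]) (auto simp: l)
    next
      assume "\<exists>c. \<forall>p\<in>dom3 T I. Q p = lin_comb [vf_dt, vf_udu] c p"
      then show "Q \<in> trivial_fields T I" by (auto simp: trivial_fields_def l)
    qed
  next
    fix c :: "nat \<Rightarrow> real" and i
    assume "\<forall>p\<in>dom3 T I. lin_comb [vf_dt, vf_udu] c p = 0" "i < length [vf_dt, vf_udu]"
    then have "lin_comb [vf_dt, vf_udu] c (t, x, 1) = 0" "i = 0 \<or> i = 1" using tx by auto
    then show "c i = 0" unfolding l by (auto simp: zero_prod_def)
  qed
qed

lemma trivial_in_ess:
  assumes op: "open T" "open I"
  shows "trivial_fields T I \<subseteq> ess_algebra T I A B"
proof
  fix Q assume "Q \<in> trivial_fields T I"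
  then obtain c d where Q: "\<And>t x u. t \<in> T \<Longrightarrow> x \<in> I \<Longrightarrow> Q (t, x, u) = (c, 0, d * u)"
    unfolding trivial_fields_def by blast
  have "smooth_on (dom3 T I) (\<lambda>p. (c, 0 :: real, d * snd (snd p)))"
    by (intro smooth_on_Pair smooth_on_intros smooth_on_proj op open_dom3)
  then have sQ: "smooth_on (dom3 T I) Q"
    by (rule iffD2[OF smooth_on_cong[OF open_dom3[OF op]], rotated]) (auto simp: Q)
  have "Q \<in> lie_algebra T I A B \<longleftrightarrow> (\<forall>t\<in>T. \<forall>x\<in>I. (2 * 0 - 0) * A x = 0 * deriv A x \<and>
      2 * A x * 0 = A x * 0 + B x * 0 - B x * 0 - 0 - 0 * deriv B x \<and> 0 = A x * 0 + B x * (0::real))"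
    by (rule lie_algebra_criterion[OF op sQ, of "\<lambda>_. c" "\<lambda>_ _. 0" "\<lambda>_ _. d"]) (auto simp: Q)
  then have "Q \<in> lie_algebra T I A B" by simp
  moreover have "\<exists>\<tau> \<xi> \<eta>. \<forall>t\<in>T. \<forall>x\<in>I. \<forall>u. Q (t, x, u) = (\<tau> t, \<xi> t x, \<eta> t x * u)"
    by (rule exI[of _ "\<lambda>_. c"], rule exI[of _ "\<lambda>_ _. 0"], rule exI[of _ "\<lambda>_ _. d"]) (simp add: Q)
  ultimately show "Q \<in> ess_algebra T I A B" by (simp add: ess_algebra_def)
qed

text \<open>With \<tau> constant and \<xi> zero the second equation reduces to
  \<open>2 * A x * \<eta>\<^sub>x = 0\<close>; as \<open>A\<close> has no zeros, \<eta> does not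
  depend on \<open>x\<close>, and then by the third equation not on \<open>t\<close> either.\<close>

lemma detsys_trivial:
  assumes T: "open_interval T" and I: "open_interval I" and A: "\<And>x. x \<in> I \<Longrightarrow> A x \<noteq> 0"
    and d: "detsys T I A B \<tau> \<xi> \<eta>" and z: "\<And>t. t \<in> T \<Longrightarrow> deriv \<tau> t = 0" "\<And>t x. t \<in> T \<Longrightarrow> x \<in> I \<Longrightarrow> \<xi> t x = 0"
    and Q: "\<And>t x u. t \<in> T \<Longrightarrow> x \<in> I \<Longrightarrow> Q (t, x, u) = (\<tau> t, \<xi> t x, \<eta> t x * u)"
  shows "Q \<in> trivial_fields T I"
proof -
  note oT = open_intervalD(1)[OF T] and oI = open_intervalD(1)[OF I]
  obtain t0 x0 where 0: "t0 \<in> T" "x0 \<in> I" using open_intervalD(3)[OF T] open_intervalD(3)[OF I] by blast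
  have sm: "smooth_on T \<tau>" "\<And>x. x \<in> I \<Longrightarrow> smooth_on T (\<lambda>t. \<eta> t x)" "\<And>t. t \<in> T \<Longrightarrow> smooth_on I (\<eta> t)"
    using d by (auto simp: detsys_def)
  have xx: "deriv (\<xi> t) x = 0" if "t \<in> T" "x \<in> I" for t x
    by (rule deriv_zero_on_open[OF oI z(2)[OF that(1)] that(2)])
  have xxx: "deriv (deriv (\<xi> t)) x = 0" if "t \<in> T" "x \<in> I" for t x
    by (rule deriv_zero_on_open[OF oI xx[OF that(1)] that(2)])
  have xt: "deriv (\<lambda>s. \<xi> s x) t = 0" if "t \<in> T" "x \<in> I" for t x
    by (rule deriv_zero_on_open[OF oT z(2)[OF _ that(2)] that(1)])
  have ex: "deriv (\<eta> t) x = 0" if tx: "t \<in> T" "x \<in> I" for t x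
  proof -
    have "2 * A x * deriv (\<eta> t) x = A x * deriv (deriv (\<xi> t)) x + B x * deriv (\<xi> t) x
         - B x * deriv \<tau> t - deriv (\<lambda>s. \<xi> s x) t - \<xi> t x * deriv B x"
      using d tx by (auto simp: detsys_def)
    then show ?thesis using A[OF tx(2)] by (simp add: xx xxx xt z tx)
  qed
  have exx: "deriv (deriv (\<eta> t)) x = 0" if "t \<in> T" "x \<in> I" for t x
    by (rule deriv_zero_on_open[OF oI ex[OF that(1)] that(2)])
  have et: "deriv (\<lambda>s. \<eta> s x) t = 0" if tx: "t \<in> T" "x \<in> I" for t x
  proof -
    have "deriv (\<lambda>s. \<eta> s x) t = A x * deriv (deriv (\<eta> t)) x + B x * deriv (\<eta> t) x"
      using d tx by (auto simp: detsys_def)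
    then show ?thesis by (simp add: ex exx tx)
  qed
  have "\<tau> t = \<tau> t0" if "t \<in> T" for t
  proof (rule DERIV_zero_interval[OF T _ that 0(1)])
    fix r assume r: "r \<in> T"
    show "(\<tau> has_real_derivative 0) (at r)" using smooth_on_DERIV[OF sm(1) r] z(1)[OF r] by simp
  qed
  moreover have "\<eta> t x = \<eta> t0 x0" if tx: "t \<in> T" "x \<in> I" for t x
  proof -
    have "\<eta> t x = \<eta> t x0"
    proof (rule DERIV_zero_interval[OF I _ tx(2) 0(2)])
      fix y assume y: "y \<in> I"
      show "(\<eta> t has_real_derivative 0) (at y)" using smooth_on_DERIV[OF sm(3)[OF tx(1)] y] ex[OF tx(1) y] by simp
    qed
    also have "\<dots> = \<eta> t0 x0"
    proof (rule DERIV_zero_interval[OF T _ tx(1) 0(1), of "\<lambda>t. \<eta> t x0"])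
      fix r assume r: "r \<in> T"
      show "((\<lambda>t. \<eta> t x0) has_real_derivative 0) (at r)"
        using smooth_on_DERIV[OF sm(2)[OF 0(2)] r] et[OF r 0(2)] by simp
    qed
    finally show ?thesis .
  qed
  ultimately show ?thesis unfolding trivial_fields_def using Q z(2) by (auto intro!: exI[of _ "\<tau> t0"] exI[of _ "\<eta> t0 x0"])
qed

lemma extension_shape:
  assumes T: "open_interval T" and I: "open_interval I" and s: "s * s = 1" and B: "smooth_on I B"
    and d: "detsys T I (\<lambda>_. s) B \<tau> \<xi> \<eta>" and nt: "\<exists>t\<in>T. \<exists>x\<in>I. deriv \<tau> t \<noteq> 0 \<or> \<xi> t x \<noteq> 0"
  obtains x0 a b r e where "\<And>x. x \<in> I \<Longrightarrow> potq s B x = a * (x - x0)\<^sup>2 + b * (x - x0) + r + e / (x - x0)\<^sup>2"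
    "e \<noteq> 0 \<Longrightarrow> b = 0"
proof -
  obtain \<sigma> \<phi> where f: "smooth_on T \<tau>" "smooth_on T \<sigma>" "smooth_on T \<phi>"
    "\<And>t x u. t \<in> T \<Longrightarrow> x \<in> I \<Longrightarrow> ess_field s B \<tau> \<sigma> \<phi> (t, x, u) = (\<tau> t, \<xi> t x, \<eta> t x * u)"
    "\<And>t x. t \<in> T \<Longrightarrow> x \<in> I \<Longrightarrow> classifying s (potq s B) \<tau> \<sigma> \<phi> t x"
    using detsys_const[OF T I s B d] by metis
  have "\<xi> t x = deriv \<tau> t * x / 2 + \<sigma> t" if "t \<in> T" "x \<in> I" for t x
    using f(4)[OF that, of 0] by (simp add: ess_field_def)
  note xi = this
  have nt': "\<exists>t\<in>T. deriv \<tau> t \<noteq> 0 \<or> \<sigma> t \<noteq> 0"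
  proof -
    obtain t x where "t \<in> T" "x \<in> I" "deriv \<tau> t \<noteq> 0 \<or> \<xi> t x \<noteq> 0" using nt by blast
    then have "deriv \<tau> t \<noteq> 0 \<or> \<sigma> t \<noteq> 0" using xi[of t x] by auto
    with \<open>t \<in> T\<close> show ?thesis by blast
  qed
  have q: "(potq s B has_real_derivative deriv (potq s B) x) (at x)" if "x \<in> I" for x
    using potq_deriv[OF open_intervalD(1)[OF I] B that] DERIV_imp_deriv by metis
  show ?thesis
  proof (rule potential_shape[OF T I q f(1,2) f(5) nt'])
    fix x0 a b r e
    assume h: "\<And>x. x \<in> I \<Longrightarrow> potq s B x = a * (x - x0)\<^sup>2 + b * (x - x0) + r + e / (x - x0)\<^sup>2"
      "e \<noteq> 0 \<Longrightarrow> b = 0 \<and> x0 \<notin> I"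
    show ?thesis by (rule that[OF h(1)]) (simp_all add: h(2))
  qed
qed

text \<open>For \<open>B = x\<^sup>3\<close> the classifying condition is a polynomial identity of degree 6 in \<open>x\<close>.\<close>
lemma kernel_K_eq:
  assumes T: "open_interval T" and I: "open_interval I" and s: "s * s = 1"
  shows "kernel_K s T I = trivial_fields T I"
proof
  note oT = open_intervalD(1)[OF T] and oI = open_intervalD(1)[OF I]
  show "trivial_fields T I \<subseteq> kernel_K s T I"
    unfolding kernel_K_def using trivial_in_ess[OF oT oI] by blast
  show "kernel_K s T I \<subseteq> trivial_fields T I"
  proof
    fix Q assume "Q \<in> kernel_K s T I"
    define B where "B = (\<lambda>x::real. x ^ 3)"
    have B: "smooth_on I B" unfolding B_def by (intro smooth_on_intros oI)
    have "Q \<in> ess_algebra T I (\<lambda>_. s) B"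
      using \<open>Q \<in> kernel_K s T I\<close> B unfolding kernel_K_def in_K_def by blast
    then obtain \<tau> \<xi> \<eta> where Q: "\<And>t x u. t \<in> T \<Longrightarrow> x \<in> I \<Longrightarrow> Q (t, x, u) = (\<tau> t, \<xi> t x, \<eta> t x * u)"
      "detsys T I (\<lambda>_. s) B \<tau> \<xi> \<eta>" using ess_detsys[OF oT oI open_intervalD(3)[OF I]] by metis
    obtain \<sigma> \<phi> where f:
      "\<And>t x u. t \<in> T \<Longrightarrow> x \<in> I \<Longrightarrow> ess_field s B \<tau> \<sigma> \<phi> (t, x, u) = (\<tau> t, \<xi> t x, \<eta> t x * u)"
      "\<And>t x. t \<in> T \<Longrightarrow> x \<in> I \<Longrightarrow> classifying s (potq s B) \<tau> \<sigma> \<phi> t x"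
      using detsys_const[OF T I s B Q(2)] by metis
    have dB: "deriv B x = 3 * x\<^sup>2" for x
      by (rule DERIV_imp_deriv) (auto simp: B_def intro!: derivative_eq_intros)
    have q: "potq s B = (\<lambda>x. x ^ 6 / 4 + 3 / 2 * s * x\<^sup>2)"
      unfolding potq_def[abs_def] dB by (rule ext) (simp add: B_def flip: power_mult)
    have dq: "deriv (potq s B) x = 3 / 2 * x ^ 5 + 3 * s * x" for x
      unfolding q by (rule DERIV_imp_deriv) (auto intro!: derivative_eq_intros)
    have ts: "deriv \<tau> t = 0 \<and> \<sigma> t = 0" if t: "t \<in> T" for t
    proof -
      let ?R = "- 2 * s * deriv \<phi> t - s * deriv (deriv \<tau>) t / 2"
      \<comment> \<open>The two leading coefficients, \<open>3 * \<sigma> t\<close> in degree 5 and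
        \<open>2 * deriv \<tau> t\<close> in degree 6, come from the summand
        \<open>x ^ 6 / 4\<close> of the potential alone.\<close>
      let ?P = "[: - ?R, 6 * s * \<sigma> t - deriv (deriv \<sigma>) t, 6 * s * deriv \<tau> t - deriv (deriv (deriv \<tau>)) t / 4, 0, 0, 3 * \<sigma> t, 2 * deriv \<tau> t :]"
      have "?P = 0"
      proof (rule poly_zero_on_interval[OF I])
        fix x assume "x \<in> I"
        then show "poly ?P (x - 0) = 0"
          using f(2)[OF t, of x] unfolding classifying_def dq unfolding q
          by (simp add: field_simps eval_nat_numeral)
      qed
      then show ?thesis by simp
    qed
    have "\<xi> t x = 0" if "t \<in> T" "x \<in> I" for t x
      using f(1)[OF that, of 0] ts[OF that(1)] by (simp add: ess_field_def)
    note z = this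
    show "Q \<in> trivial_fields T I"
      by (rule detsys_trivial[OF T I _ Q(2) _ _ Q(1)]) (use ts s z in auto)
  qed
qed

text \<open>The equations with \<open>A = 1\<close> belong to the larger class, so its kernel lies
  in the kernel of the smaller class for the sign 1.\<close>

lemma kernel_Kbar_eq:
  assumes T: "open_interval T" and I: "open_interval I"
  shows "kernel_Kbar T I = trivial_fields T I"
proof
  show "trivial_fields T I \<subseteq> kernel_Kbar T I"
    unfolding kernel_Kbar_def using trivial_in_ess[OF open_intervalD(1)[OF T] open_intervalD(1)[OF I]] by blast
  have "kernel_Kbar T I \<subseteq> kernel_K 1 T I"
    unfolding kernel_Kbar_def kernel_K_def
  proof (rule Inf_superset_mono, clarify)
    fix B assume "in_K I B"
    then have "in_Kbar I (\<lambda>_. 1) B" by (simp add: in_Kbar_def in_K_def smooth_on_const)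
    then show "\<exists>A B'. ess_algebra T I (\<lambda>_. 1) B = ess_algebra T I A B' \<and> in_Kbar I A B'" by blast
  qed
  then show "kernel_Kbar T I \<subseteq> trivial_fields T I" using kernel_K_eq[OF T I, of 1] by simp
qed

section \<open>Reduction of the large class to constant \<open>A\<close>\<close>

text \<open>The induction generalises \<open>f\<close>: the derivative is \<open>f'\<close> composed
  with \<open>Y\<close>, times \<open>Y'\<close>. Here \<open>f'\<close> is again smooth, and
  \<open>Y'\<close> has one order less.\<close>

lemma C_k_on_real_comp:
  fixes f Y :: "real \<Rightarrow> real"
  assumes op: "open I" "open J" and YI: "\<And>y. y \<in> J \<Longrightarrow> Y y \<in> I"
  shows "C_k_on k J Y \<Longrightarrow> smooth_on I f \<Longrightarrow> C_k_on k J (\<lambda>y. f (Y y))"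
proof (induction k arbitrary: f)
  case 0
  show ?case
    using continuous_on_compose2[OF smooth_on_continuous[OF 0(2)], of J Y] 0(1) YI by auto
next
  case (Suc k)
  let ?Y' = "\<lambda>y. frechet_derivative Y (at y) 1"
  have dY: "(Y has_real_derivative ?Y' y) (at y)" if "y \<in> J" for y
  proof -
    have "Y differentiable (at y)" using Suc.prems(1) that by simp
    then obtain D where D: "(Y has_real_derivative D) (at y)" using real_differentiableE by blast
    show ?thesis using D frechet_derivative_real[OF D, of 1] by simp
  qed
  have "C_k_on k J (\<lambda>y. deriv f (Y y))"
    by (rule Suc.IH[OF C_k_on_Suc_D[OF Suc.prems(1)] smooth_on_deriv[OF op(1) Suc.prems(2)]])
  moreover have "C_k_on k J ?Y'" using Suc.prems(1) by simp
  ultimately have "C_k_on k J (\<lambda>y. deriv f (Y y) * ?Y' y)" by (rule C_k_on_mult[OF op(2)])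
  moreover have "((\<lambda>y. f (Y y)) has_real_derivative deriv f (Y y) * ?Y' y) (at y)" if "y \<in> J" for y
    by (rule DERIV_chain2[OF smooth_on_DERIV[OF Suc.prems(2) YI[OF that]] dY[OF that]])
  ultimately show ?case by (intro C_k_on_real_Suc[OF op(2)])
qed

lemma smooth_on_real_comp:
  fixes f Y :: "real \<Rightarrow> real"
  assumes "open I" "open J" "\<And>y. y \<in> J \<Longrightarrow> Y y \<in> I" "smooth_on I f" "smooth_on J Y"
  shows "smooth_on J (\<lambda>y. f (Y y))"
  unfolding smooth_on_def
proof
  fix k
  show "C_k_on k J (\<lambda>y. f (Y y))"
    by (rule C_k_on_real_comp[where I = I]) (use assms in \<open>simp_all add: smooth_on_def\<close>)
qed

text \<open>The inverse satisfies \<open>Y' = 1 / X' (Y y)\<close>; regularity of \<open>Y\<close>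
  passes to the right-hand side, so bootstrapping makes it smooth.\<close>

lemma smooth_inverse:
  assumes I: "open_interval I" and X: "smooth_on I X" and pos: "\<And>x. x \<in> I \<Longrightarrow> deriv X x > 0"
  obtains Y where "open_interval (X ` I)" "inj_on X I" "smooth_on (X ` I) Y" "\<And>x. x \<in> I \<Longrightarrow> Y (X x) = x"
    "\<And>x. x \<in> I \<Longrightarrow> (Y has_real_derivative inverse (deriv X x)) (at (X x))"
proof -
  note oI = open_intervalD(1)[OF I]
  have iv: "is_interval I" using open_intervalD(2)[OF I] by (simp add: is_interval_connected_1)
  have less: "X x < X y" if "x \<in> I" "y \<in> I" "x < y" for x y
  proof (rule DERIV_pos_imp_increasing[OF that(3)])
    fix z assume "x \<le> z" "z \<le> y"
    then have "z \<in> I" using iv that unfolding is_interval_1 by blast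
    then show "\<exists>d. (X has_real_derivative d) (at z) \<and> 0 < d" using smooth_on_DERIV[OF X] pos by blast
  qed
  then have inj: "inj_on X I" by (intro inj_onI) (metis linorder_neqE less_irrefl)
  have "open (X ` I)"
    using injective_eq_1d_open_map_UNIV[OF smooth_on_continuous[OF X] iv] inj oI by blast
  moreover have "connected (X ` I)"
    by (rule connected_continuous_image[OF smooth_on_continuous[OF X] open_intervalD(2)[OF I]])
  ultimately have J: "open_interval (X ` I)" using open_intervalD(3)[OF I] by (simp add: open_interval_def)
  define Y where "Y = inv_into I X"
  have YX: "Y (X x) = x" if "x \<in> I" for x unfolding Y_def by (rule inv_into_f_f[OF inj that])
  have dY: "(Y has_real_derivative inverse (deriv X x)) (at (X x))" if x: "x \<in> I" for x
    unfolding has_field_derivative_def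
  proof (rule has_derivative_inverse_on[where S = I and f' = "\<lambda>x. (*) (deriv X x)" and g' = "\<lambda>x. (*) (inverse (deriv X x))"])
    show "(X has_derivative (*) (deriv X z)) (at z)" if "z \<in> I" for z
      using smooth_on_DERIV[OF X that] by (simp add: has_field_derivative_def)
    show "(*) (deriv X x) \<circ> (*) (inverse (deriv X x)) = id" using pos[OF x] by (auto simp: fun_eq_iff)
  qed (use x oI YX in auto)
  define Y' where "Y' = (\<lambda>y. inverse (deriv X (Y y)))"
  have dY': "(Y has_real_derivative Y' y) (at y)" if "y \<in> X ` I" for y
    using that dY YX by (auto simp: Y'_def)
  have sg: "smooth_on I (\<lambda>x. inverse (deriv X x))"
    by (rule smooth_on_inverse[OF oI smooth_on_deriv[OF oI X]]) (use pos in force)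
  have mem: "Y y \<in> I" if "y \<in> X ` I" for y using that YX by auto
  have "smooth_on (X ` I) Y"
    by (rule smooth_on_real_I[OF open_intervalD(1)[OF J] dY'])
      (use C_k_on_real_comp[OF oI open_intervalD(1)[OF J] mem _ sg] in \<open>simp_all add: Y'_def\<close>)
  from that[OF J inj this YX dY] show ?thesis by blast
qed

text \<open>On a connected set \<open>A\<close> keeps one sign \<open>s\<close>. So
  \<open>s * A\<close> is smooth and positive, its power is smooth as well, and an antiderivative
  gives \<open>X\<close>.\<close>

lemma gauge_exists:
  assumes I: "open_interval I" and A: "smooth_on I A" "\<And>x. x \<in> I \<Longrightarrow> A x \<noteq> 0"
  obtains s X where "s * s = 1" "smooth_on I X" "\<And>x. x \<in> I \<Longrightarrow> deriv X x > 0"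
    "\<And>x. x \<in> I \<Longrightarrow> A x = s / (deriv X x)\<^sup>2"
proof -
  note oI = open_intervalD(1)[OF I]
  obtain x0 where x0: "x0 \<in> I" using open_intervalD(3)[OF I] by blast
  have iv: "is_interval (A ` I)"
    using connected_continuous_image[OF smooth_on_continuous[OF A(1)] open_intervalD(2)[OF I]]
    by (simp add: is_interval_connected_1)
  have "0 \<notin> A ` I" using A(2) by auto
  define s where "s = sgn (A x0)"
  have s: "s * s = 1" using A(2)[OF x0] by (simp add: s_def sgn_if)
  have sA: "s * A x > 0" if x: "x \<in> I" for x
  proof (rule ccontr)
    assume "\<not> ?thesis"
    then have "s * A x < 0" using A(2)[OF x] A(2)[OF x0] by (auto simp: s_def sgn_if)
    then have "(A x \<le> 0 \<and> 0 \<le> A x0) \<or> (A x0 \<le> 0 \<and> 0 \<le> A x)"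
      by (auto simp: s_def sgn_if split: if_splits)
    then have "0 \<in> A ` I" using iv x x0 unfolding is_interval_1 by blast
    then show False using \<open>0 \<notin> A ` I\<close> by blast
  qed
  define g where "g = (\<lambda>x. (s * A x) powr (- (1 / 2)))"
  have g: "smooth_on I g" unfolding g_def
    by (rule smooth_on_real_power_comp[OF oI smooth_on_mult[OF oI smooth_on_const A(1)] sA])
  obtain X where X: "\<And>x. x \<in> I \<Longrightarrow> (X has_real_derivative g x) (at x)"
    using antiderivative_exists[OF I smooth_on_continuous[OF g]] by blast
  have sX: "smooth_on I X" by (rule smooth_on_real_I[OF oI X]) (use g in \<open>auto simp: smooth_on_def\<close>)
  have dX: "deriv X x = g x" if "x \<in> I" for x by (rule DERIV_imp_deriv[OF X[OF that]])
  have Ag: "A x = s / (g x)\<^sup>2" if x: "x \<in> I" for x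
  proof -
    have "(g x)\<^sup>2 = (s * A x) powr (- 1)"
      by (simp add: g_def power2_eq_square flip: powr_add)
    then have "s / (g x)\<^sup>2 = s * s * A x"
      using sA[OF x] by (simp add: powr_minus divide_inverse)
    then show ?thesis by (simp add: s)
  qed
  show ?thesis
  proof (rule that[OF s sX])
    fix x assume x: "x \<in> I"
    show "deriv X x > 0" unfolding dX[OF x] g_def using sA[OF x] by (simp add: powr_gt_zero less_imp_neq[symmetric]) (metis less_irrefl mult_eq_0_iff)
    show "A x = s / (deriv X x)\<^sup>2" unfolding dX[OF x] by (rule Ag[OF x])
  qed
qed

text \<open>Covariance under \<open>y = X x\<close>: \<xi> is multiplied by \<open>X'\<close>, while
  \<tau> and \<eta> keep their values. \<open>Bh\<close> is \<open>X' * B + X'' * A\<close> with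
  \<open>A = s / X'\<^sup>2\<close>, the action of the equivalence group for time factor 1,
  expressed in \<open>y\<close> through the inverse \<open>Y\<close>.\<close>

lemma detsys_push:
  assumes oT: "open T" and s: "s * s = 1" and I: "open_interval I" and X: "smooth_on I X" and pos: "\<And>x. x \<in> I \<Longrightarrow> deriv X x > 0"
    and A: "\<And>x. x \<in> I \<Longrightarrow> A x = s / (deriv X x)\<^sup>2" and B: "smooth_on I B"
    and J: "open_interval (X ` I)" and Y: "smooth_on (X ` I) Y" "\<And>x. x \<in> I \<Longrightarrow> Y (X x) = x"
    "\<And>x. x \<in> I \<Longrightarrow> (Y has_real_derivative inverse (deriv X x)) (at (X x))"
    and d: "detsys T I A B \<tau> \<xi> \<eta>"
  defines "Bh \<equiv> \<lambda>y. (\<lambda>x. deriv X x * B x + s * (deriv (deriv X) x * inverse ((deriv X x)\<^sup>2))) (Y y)"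
  shows "smooth_on (X ` I) Bh"
    "detsys T (X ` I) (\<lambda>_. s) Bh \<tau> (\<lambda>t y. deriv X (Y y) * \<xi> t (Y y)) (\<lambda>t y. \<eta> t (Y y))"
proof -
  note oI = open_intervalD(1)[OF I] and oJ = open_intervalD(1)[OF J]
  define g where "g = deriv X"
  have g: "smooth_on I g" unfolding g_def by (rule smooth_on_deriv[OF oI X])
  have g1: "smooth_on I (deriv g)" by (rule smooth_on_deriv[OF oI g])
  note dg = smooth_on_DERIV[OF g] and dg1 = smooth_on_DERIV[OF g1]
  have g0: "g x > 0" if "x \<in> I" for x using pos[OF that] by (simp add: g_def)
  have YI: "Y y \<in> I" if "y \<in> X ` I" for y using that Y(2) by auto
  note comp = smooth_on_real_comp[OF oI oJ YI _ Y(1)]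
  have cd: "((\<lambda>y. f (Y y)) has_real_derivative D / g x) (at (X x))"
    if "x \<in> I" "(f has_real_derivative D) (at x)" for f D x
    using DERIV_chain2[OF _ Y(3)[OF that(1)], of f D] that Y(2) by (simp add: g_def divide_inverse)
  define b where "b = (\<lambda>x. g x * B x + s * (deriv g x * inverse ((g x)\<^sup>2)))"
  have sb: "smooth_on I b" unfolding b_def
    by (intro smooth_on_intros smooth_on_mult smooth_on_inverse oI g g1 B)
      (use g0 in force)
  have Bh: "Bh = (\<lambda>y. b (Y y))" by (simp add: Bh_def b_def g_def)
  show "smooth_on (X ` I) Bh" unfolding Bh by (rule comp[OF _ sb])
  have sm: "smooth_on T \<tau>" "\<And>x. x \<in> I \<Longrightarrow> smooth_on T (\<lambda>t. \<xi> t x)" "\<And>x. x \<in> I \<Longrightarrow> smooth_on T (\<lambda>t. \<eta> t x)"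
    "\<And>t. t \<in> T \<Longrightarrow> smooth_on I (\<xi> t)" "\<And>t. t \<in> T \<Longrightarrow> smooth_on I (\<eta> t)"
    and eq: "\<And>t x. t \<in> T \<Longrightarrow> x \<in> I \<Longrightarrow> (2 * deriv (\<xi> t) x - deriv \<tau> t) * A x = \<xi> t x * deriv A x"
    "\<And>t x. t \<in> T \<Longrightarrow> x \<in> I \<Longrightarrow> 2 * A x * deriv (\<eta> t) x = A x * deriv (deriv (\<xi> t)) x + B x * deriv (\<xi> t) x
         - B x * deriv \<tau> t - deriv (\<lambda>s. \<xi> s x) t - \<xi> t x * deriv B x"
    "\<And>t x. t \<in> T \<Longrightarrow> x \<in> I \<Longrightarrow> deriv (\<lambda>s. \<eta> s x) t = A x * deriv (deriv (\<eta> t)) x + B x * deriv (\<eta> t) x"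
    using d by (auto simp: detsys_def)
  show "detsys T (X ` I) (\<lambda>_. s) Bh \<tau> (\<lambda>t y. deriv X (Y y) * \<xi> t (Y y)) (\<lambda>t y. \<eta> t (Y y))"
    unfolding detsys_def
  proof (intro conjI ballI)
    show "smooth_on T \<tau>" by (rule sm)
  next
    fix y assume "y \<in> X ` I"
    note y = YI[OF this]
    show "smooth_on T (\<lambda>t. deriv X (Y y) * \<xi> t (Y y))" "smooth_on T (\<lambda>t. \<eta> t (Y y))"
      using smooth_on_linear_comp[OF _ bounded_linear_mult_right sm(2)[OF y], of "deriv X (Y y)"] oT sm(3)[OF y] by auto
  next
    fix t assume t: "t \<in> T"
    show "smooth_on (X ` I) (\<lambda>y. deriv X (Y y) * \<xi> t (Y y))"
      by (rule comp[of "\<lambda>x. deriv X x * \<xi> t x"]) (auto intro!: smooth_on_mult oI sm t g[unfolded g_def])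
    show "smooth_on (X ` I) (\<lambda>y. \<eta> t (Y y))" by (rule comp) (auto intro: sm t)
  next
    fix t y assume t: "t \<in> T" and "y \<in> X ` I"
    then obtain x where x: "x \<in> I" "y = X x" by blast
    have s0: "s \<noteq> 0" using s by auto
    have dA: "deriv A z = - 2 * s * deriv g z / (g z) ^ 3" if z: "z \<in> I" for z
    proof -
      have "((\<lambda>x. s / (g x)\<^sup>2) has_real_derivative - 2 * s * deriv g z / (g z) ^ 3) (at z)"
        using g0[OF z] by (auto intro!: derivative_eq_intros dg z simp: field_simps eval_nat_numeral)
      then have "(A has_real_derivative - 2 * s * deriv g z / (g z) ^ 3) (at z)"
        by (rule has_field_derivative_transform_within_open[OF _ oI z]) (simp add: A g_def)
      then show ?thesis by (rule DERIV_imp_deriv)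
    qed
    \<comment> \<open>The first determining equation solved for the \<open>x\<close>-derivative of
      \<xi>. It makes the derivative of \<open>g * \<xi>\<close> equal to
      \<open>g * deriv \<tau> t / 2\<close>, so in the variable \<open>y\<close> the new component
      has derivative \<open>deriv \<tau> t / 2\<close>.\<close>
    define R where "R = (\<lambda>x. deriv \<tau> t / 2 - \<xi> t x * deriv g x / g x)"
    have xi1: "deriv (\<xi> t) z = R z" if z: "z \<in> I" for z
    proof -
      have "(2 * deriv (\<xi> t) z - deriv \<tau> t) * (s / (g z)\<^sup>2) = \<xi> t z * (- 2 * s * deriv g z / (g z) ^ 3)"
        using eq(1)[OF t z] A[OF z] dA[OF z] by (simp add: g_def)
      then have "s * ((2 * deriv (\<xi> t) z - deriv \<tau> t) * g z) = s * (- 2 * \<xi> t z * deriv g z)"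
        using s0 g0[OF z] by (simp add: divide_simps eval_nat_numeral) (simp add: algebra_simps)
      then have "(2 * deriv (\<xi> t) z - deriv \<tau> t) * g z = - 2 * \<xi> t z * deriv g z"
        using s0 by (metis mult_left_cancel)
      then show ?thesis unfolding R_def using g0[OF z] by (simp add: field_simps)
    qed
    have dxi: "(\<xi> t has_real_derivative R z) (at z)" if z: "z \<in> I" for z
      using smooth_on_DERIV[OF sm(4)[OF t] z] xi1[OF z] by simp
    have "(R has_real_derivative - ((R x * deriv g x + \<xi> t x * deriv (deriv g) x) / g x) + \<xi> t x * (deriv g x)\<^sup>2 / (g x)\<^sup>2) (at x)"
      unfolding R_def[abs_def] using g0[OF x(1)] R_def
      by (auto intro!: derivative_eq_intros dg dg1 dxi x(1) simp: field_simps power2_eq_square)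
    then have "(deriv (\<xi> t) has_real_derivative - ((R x * deriv g x + \<xi> t x * deriv (deriv g) x) / g x) + \<xi> t x * (deriv g x)\<^sup>2 / (g x)\<^sup>2) (at x)"
      by (rule has_field_derivative_transform_within_open[OF _ oI x(1)]) (simp add: xi1)
    then have xi2: "deriv (deriv (\<xi> t)) x = - ((R x * deriv g x + \<xi> t x * deriv (deriv g) x) / g x) + \<xi> t x * (deriv g x)\<^sup>2 / (g x)\<^sup>2"
      by (rule DERIV_imp_deriv)
    have P1: "deriv (\<lambda>y. deriv X (Y y) * \<xi> t (Y y)) (X z) = deriv \<tau> t / 2" if z: "z \<in> I" for z
    proof -
      have "((\<lambda>x. g x * \<xi> t x) has_real_derivative deriv g z * \<xi> t z + R z * g z) (at z)"
        by (rule DERIV_mult[OF dg[OF z] dxi[OF z]])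
      from cd[OF z this] have "((\<lambda>y. g (Y y) * \<xi> t (Y y)) has_real_derivative deriv \<tau> t / 2) (at (X z))"
        using g0[OF z] by (simp add: R_def field_simps)
      then show ?thesis unfolding g_def by (rule DERIV_imp_deriv)
    qed
    have P2: "deriv (deriv (\<lambda>y. deriv X (Y y) * \<xi> t (Y y))) y = 0"
    proof -
      have "(deriv (\<lambda>y. deriv X (Y y) * \<xi> t (Y y)) has_real_derivative 0) (at y)"
        by (rule has_field_derivative_transform_within_open[OF DERIV_const[of "deriv \<tau> t / 2"] oJ])
          (use x P1 in auto)
      then show ?thesis by (rule DERIV_imp_deriv)
    qed
    have E1: "deriv (\<lambda>y. \<eta> t (Y y)) (X z) = deriv (\<eta> t) z / g z" if z: "z \<in> I" for z
      by (rule DERIV_imp_deriv[OF cd[OF z smooth_on_DERIV[OF sm(5)[OF t] z]]])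
    have E2: "deriv (deriv (\<lambda>y. \<eta> t (Y y))) y = (deriv (deriv (\<eta> t)) x / g x - deriv (\<eta> t) x * deriv g x / (g x)\<^sup>2) / g x"
    proof -
      have "((\<lambda>x. deriv (\<eta> t) x / g x) has_real_derivative (deriv (deriv (\<eta> t)) x / g x - deriv (\<eta> t) x * deriv g x / (g x)\<^sup>2)) (at x)"
        using g0[OF x(1)]
        by (auto intro!: derivative_eq_intros dg smooth_on_DERIV[OF smooth_on_deriv[OF oI sm(5)[OF t]]] x(1) simp: field_simps power2_eq_square)
      from cd[OF x(1) this] have "(deriv (\<lambda>y. \<eta> t (Y y)) has_real_derivative (deriv (deriv (\<eta> t)) x / g x - deriv (\<eta> t) x * deriv g x / (g x)\<^sup>2) / g x) (at (X x))"
        by (rule has_field_derivative_transform_within_open[OF _ oJ]) (use x E1 Y(2) in auto)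
      then show ?thesis unfolding x(2) by (rule DERIV_imp_deriv)
    qed
    have b1: "deriv Bh y = (deriv g x * B x + g x * deriv B x + s * (deriv (deriv g) x / (g x)\<^sup>2 - 2 * (deriv g x)\<^sup>2 / (g x) ^ 3)) / g x"
    proof -
      have "(b has_real_derivative (deriv g x * B x + g x * deriv B x + s * (deriv (deriv g) x / (g x)\<^sup>2 - 2 * (deriv g x)\<^sup>2 / (g x) ^ 3))) (at x)"
        unfolding b_def using g0[OF x(1)]
        by (auto intro!: derivative_eq_intros dg dg1 smooth_on_DERIV[OF B] x(1) simp: field_simps eval_nat_numeral)
      from DERIV_imp_deriv[OF cd[OF x(1) this]] show ?thesis by (simp add: Bh x(2))
    qed
    have b0: "Bh y = g x * B x + s * deriv g x / (g x)\<^sup>2" using x Y(2) by (simp add: Bh b_def divide_inverse)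
    have Yy: "Y y = x" using x Y(2) by simp
    show "(2 * deriv (\<lambda>y. deriv X (Y y) * \<xi> t (Y y)) y - deriv \<tau> t) * s = deriv X (Y y) * \<xi> t (Y y) * deriv (\<lambda>_. s) y"
      unfolding x(2) P1[OF x(1)] by simp
    have gx: "deriv X x = g x" by (simp add: g_def)
    have xt: "deriv (\<lambda>s. g x * \<xi> s x) t = g x * deriv (\<lambda>s. \<xi> s x) t"
      by (rule DERIV_imp_deriv[OF DERIV_cmult[OF smooth_on_DERIV[OF sm(2)[OF x(1)] t]]])
    have Ax: "A x = s / (g x)\<^sup>2" using A[OF x(1)] by (simp add: g_def)
    show "2 * s * deriv (\<lambda>y. \<eta> t (Y y)) y = s * deriv (deriv (\<lambda>y. deriv X (Y y) * \<xi> t (Y y))) y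
      + Bh y * deriv (\<lambda>y. deriv X (Y y) * \<xi> t (Y y)) y - Bh y * deriv \<tau> t
      - deriv (\<lambda>s. deriv X (Y y) * \<xi> s (Y y)) t - deriv X (Y y) * \<xi> t (Y y) * deriv Bh y"
    proof -
      have "2 * s * (deriv (\<eta> t) x / g x) = g x * (2 * (s / (g x)\<^sup>2) * deriv (\<eta> t) x)"
        using g0[OF x(1)] by (simp add: field_simps power2_eq_square)
      also have "\<dots> = g x * ((s / (g x)\<^sup>2) * (- ((R x * deriv g x + \<xi> t x * deriv (deriv g) x) / g x) + \<xi> t x * (deriv g x)\<^sup>2 / (g x)\<^sup>2) + B x * R x
         - B x * deriv \<tau> t - deriv (\<lambda>s. \<xi> s x) t - \<xi> t x * deriv B x)"
        using eq(2)[OF t x(1)] unfolding Ax xi1[OF x(1)] xi2 by simp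
      also have "\<dots> = s * 0 + (g x * B x + s * deriv g x / (g x)\<^sup>2) * (deriv \<tau> t / 2) - (g x * B x + s * deriv g x / (g x)\<^sup>2) * deriv \<tau> t
        - g x * deriv (\<lambda>s. \<xi> s x) t - g x * \<xi> t x * ((deriv g x * B x + g x * deriv B x + s * (deriv (deriv g) x / (g x)\<^sup>2 - 2 * (deriv g x)\<^sup>2 / (g x) ^ 3)) / g x)"
        unfolding R_def using g0[OF x(1)] by (simp add: field_simps eval_nat_numeral)
      finally show ?thesis unfolding P2 b1 b0 Yy gx xt unfolding x(2) P1[OF x(1)] E1[OF x(1)] .
    qed
    show "deriv (\<lambda>s. \<eta> s (Y y)) t = s * deriv (deriv (\<lambda>y. \<eta> t (Y y))) y + Bh y * deriv (\<lambda>y. \<eta> t (Y y)) y"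
      unfolding E2 b0 Yy unfolding x(2) E1[OF x(1)] eq(3)[OF t x(1)] Ax
      using g0[OF x(1)] by (simp add: field_simps eval_nat_numeral)
  qed
qed

text \<open>The gauge ends at \<open>A = s\<close>, the list has \<open>A = \<epsilon>\<close>.
  Passing from one to the other multiplies \<open>B\<close> by \<open>\<epsilon> * s\<close>, and
  the potential depends only on the square of \<open>B\<close> and on the derivative of sign times
  \<open>B\<close>, both of which are unchanged.\<close>

lemma potq_rescale:
  assumes "\<epsilon> * \<epsilon> = 1" "s * s = 1" "smooth_on J B" "y \<in> J"
  shows "potq \<epsilon> (\<lambda>y. \<epsilon> * s * B y) y = potq s B y"
proof -
  have "deriv (\<lambda>y. \<epsilon> * s * B y) y = \<epsilon> * s * deriv B y"
    by (rule DERIV_imp_deriv[OF DERIV_cmult[OF smooth_on_DERIV[OF assms(3,4)]]])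
  then have "potq \<epsilon> (\<lambda>y. \<epsilon> * s * B y) y = (\<epsilon> * \<epsilon>) * (s * s) * (B y)\<^sup>2 / 4 + (\<epsilon> * \<epsilon>) * s * deriv B y / 2"
    by (simp add: potq_def power2_eq_square mult_ac)
  then show ?thesis by (simp add: potq_def assms)
qed

text \<open>The equivalence is the gauge \<open>X\<close> followed by the affine map of
  \<open>complete_from_shape\<close>. Its time factor \<open>\<epsilon> * s * c1\<^sup>2\<close> is
  negative exactly when the signs \<open>s\<close> and \<open>\<epsilon>\<close> differ: time is
  then reversed.\<close>

lemma detsys_push_complete:
  assumes T: "open_interval T" and I: "open_interval I" and K: "in_Kbar I A B" and eps: "\<epsilon> * \<epsilon> = 1"
    and d: "detsys T I A B \<tau> \<xi> \<eta>" and nt: "\<exists>t\<in>T. \<exists>x\<in>I. deriv \<tau> t \<noteq> 0 \<or> \<xi> t x \<noteq> 0"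
  shows "\<exists>p. \<forall>J. open_interval J \<and> J \<subseteq> I - {p} \<longrightarrow> (\<exists>e I'. listed e I' \<and> equiv_Kbar J A B I' (\<lambda>_. \<epsilon>) (B_of \<epsilon> e))"
proof -
  note oI = open_intervalD(1)[OF I]
  have sm: "smooth_on I A" "smooth_on I B" "\<And>x. x \<in> I \<Longrightarrow> A x \<noteq> 0" using K by (auto simp: in_Kbar_def)
  obtain s X where X: "s * s = 1" "smooth_on I X" "\<And>x. x \<in> I \<Longrightarrow> deriv X x > 0" "\<And>x. x \<in> I \<Longrightarrow> A x = s / (deriv X x)\<^sup>2"
    using gauge_exists[OF I sm(1,3)] by blast
  obtain Y where Y: "open_interval (X ` I)" "inj_on X I" "smooth_on (X ` I) Y" "\<And>x. x \<in> I \<Longrightarrow> Y (X x) = x"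
    "\<And>x. x \<in> I \<Longrightarrow> (Y has_real_derivative inverse (deriv X x)) (at (X x))"
    using smooth_inverse[OF I X(2,3)] by blast
  define Bh where "Bh = (\<lambda>y. (\<lambda>x. deriv X x * B x + s * (deriv (deriv X) x * inverse ((deriv X x)\<^sup>2))) (Y y))"
  note push = detsys_push[OF open_intervalD(1)[OF T] X(1) I X(2,3,4) sm(2) Y(1,3,4,5) d, folded Bh_def]
  have nt': "\<exists>t\<in>T. \<exists>y\<in>X ` I. deriv \<tau> t \<noteq> 0 \<or> deriv X (Y y) * \<xi> t (Y y) \<noteq> 0"
  proof -
    obtain t x where tx: "t \<in> T" "x \<in> I" "deriv \<tau> t \<noteq> 0 \<or> \<xi> t x \<noteq> 0" using nt by blast
    then have "deriv \<tau> t \<noteq> 0 \<or> deriv X (Y (X x)) * \<xi> t (Y (X x)) \<noteq> 0" using Y(4)[OF tx(2)] X(3)[OF tx(2)] by auto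
    then show ?thesis using tx by blast
  qed
  define C where "C = (\<lambda>y. \<epsilon> * s * Bh y)"
  have sC: "smooth_on (X ` I) C"
    unfolding C_def by (rule smooth_on_mult[OF open_intervalD(1)[OF Y(1)] smooth_on_const push(1)])
  have qC: "potq \<epsilon> C y = potq s Bh y" if y: "y \<in> X ` I" for y
    unfolding C_def by (rule potq_rescale[OF eps X(1) push(1) y])
  obtain x0 a b r e where sh: "\<And>y. y \<in> X ` I \<Longrightarrow> potq s Bh y = a * (y - x0)\<^sup>2 + b * (y - x0) + r + e / (y - x0)\<^sup>2"
    "e \<noteq> 0 \<Longrightarrow> b = 0"
  proof (rule extension_shape[OF T Y(1) X(1) push nt'])
    fix x0 a b r e
    assume "\<And>y. y \<in> X ` I \<Longrightarrow> potq s Bh y = a * (y - x0)\<^sup>2 + b * (y - x0) + r + e / (y - x0)\<^sup>2" "e \<noteq> 0 \<Longrightarrow> b = 0"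
    then show ?thesis by (rule that)
  qed
  have sh': "potq \<epsilon> C y = a * (y - x0)\<^sup>2 + b * (y - x0) + r + e / (y - x0)\<^sup>2" if "y \<in> X ` I" for y
    using sh(1)[OF that] qC[OF that] by simp
  obtain p where p: "\<And>J. open_interval J \<Longrightarrow> J \<subseteq> X ` I - {p} \<Longrightarrow> \<exists>e I'. listed e I' \<and> equiv_K J C I' (B_of \<epsilon> e)"
    using complete_from_shape[OF Y(1) sC eps sh' sh(2)] by blast
  have "\<exists>e I'. listed e I' \<and> equiv_Kbar J A B I' (\<lambda>_. \<epsilon>) (B_of \<epsilon> e)" if J: "open_interval J" "J \<subseteq> I - {Y p}" for J
  proof -
    have JI: "J \<subseteq> I" using J(2) by blast
    note oJ = open_intervalD(1)[OF J(1)]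
    have XJ: "smooth_on J X" by (rule smooth_on_subset[OF X(2) JI])
    have "open_interval (X ` J)"
      by (rule smooth_inverse[OF J(1) XJ]) (use X(3) JI in auto)
    moreover have "X ` J \<subseteq> X ` I - {p}" using J(2) Y(4) by force
    ultimately obtain e I' where e: "listed e I'" "equiv_K (X ` J) C I' (B_of \<epsilon> e)" using p by blast
    obtain c1 c3 where c: "c1 \<noteq> 0" "I' = (\<lambda>x. c1 * x + c3) ` (X ` J)"
      "\<forall>y\<in>X ` J. B_of \<epsilon> e (c1 * y + c3) = C y / c1"
      using e(2)[unfolded equiv_K_def] by (elim exE conjE) (rule that)
    let ?X = "\<lambda>x. c1 * X x + c3"
    have d1: "deriv ?X x = c1 * deriv X x" if "x \<in> J" for x
      using DERIV_imp_deriv[OF DERIV_add[OF DERIV_cmult[OF smooth_on_DERIV[OF XJ that], of c1] DERIV_const[of c3]]] by simp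
    have d2: "deriv (deriv ?X) x = c1 * deriv (deriv X) x" if x: "x \<in> J" for x
    proof (rule DERIV_imp_deriv)
      show "(deriv ?X has_real_derivative c1 * deriv (deriv X) x) (at x)"
        by (rule has_field_derivative_transform_within_open[OF DERIV_cmult[OF smooth_on_DERIV[OF smooth_on_deriv[OF oJ XJ] x]] oJ x])
          (simp add: d1)
    qed
    have es: "\<epsilon> \<noteq> 0" "s \<noteq> 0" using eps X(1) mult_zero_left zero_neq_one by metis+
    have inv: "1 / (\<epsilon> * s) = \<epsilon> * s"
    proof -
      have "(\<epsilon> * s) * (\<epsilon> * s) = (\<epsilon> * \<epsilon>) * (s * s)" by simp
      then have "(\<epsilon> * s) * (\<epsilon> * s) = 1" by (simp only: eps X(1))
      then show ?thesis using es by (simp add: divide_eq_eq)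
    qed
    have "equiv_Kbar J A B I' (\<lambda>_. \<epsilon>) (B_of \<epsilon> e)" unfolding equiv_Kbar_def
    proof (intro exI[of _ "\<epsilon> * s * c1\<^sup>2"] exI[of _ ?X] conjI ballI)
      show "\<epsilon> * s * c1\<^sup>2 \<noteq> 0" using es c(1) by simp
      show "smooth_on J ?X" by (intro smooth_on_add smooth_on_mult smooth_on_const XJ oJ)
      show "I' = ?X ` J" unfolding c(2) image_image by simp
      fix x assume x: "x \<in> J"
      then have xI: "x \<in> I" using JI by blast
      have g0: "deriv X x \<noteq> 0" using X(3)[OF xI] by simp
      show "deriv ?X x \<noteq> 0" using d1[OF x] c(1) g0 by simp
      have "(deriv ?X x)\<^sup>2 / (\<epsilon> * s * c1\<^sup>2) * A x = 1 / (\<epsilon> * s) * s"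
        unfolding d1[OF x] X(4)[OF xI] using c(1) g0 es by (simp add: field_simps)
      also have "\<dots> = \<epsilon> * (s * s)" unfolding inv by simp
      finally show "\<epsilon> = (deriv ?X x)\<^sup>2 / (\<epsilon> * s * c1\<^sup>2) * A x" by (simp add: X(1))
      have "deriv ?X x / (\<epsilon> * s * c1\<^sup>2) * B x + deriv (deriv ?X) x / (\<epsilon> * s * c1\<^sup>2) * A x
        = 1 / (\<epsilon> * s) * (deriv X x * B x + deriv (deriv X) x * A x) / c1"
        unfolding d1[OF x] d2[OF x] using c(1) es by (simp add: field_simps power2_eq_square)
      also have "\<dots> = C (X x) / c1"
        unfolding inv C_def Bh_def Y(4)[OF xI] X(4)[OF xI] by (simp add: divide_inverse algebra_simps)
      finally show "B_of \<epsilon> e (?X x) = deriv ?X x / (\<epsilon> * s * c1\<^sup>2) * B x + deriv (deriv ?X) x / (\<epsilon> * s * c1\<^sup>2) * A x"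
        using bspec[OF c(3) imageI[OF x]] by simp
    qed
    then show ?thesis using e(1) by blast
  qed
  then show ?thesis by blast
qed

section \<open>Bases of the essential algebras\<close>

text \<open>Multiplied by \<open>x ^ 3\<close> the condition is a polynomial of degree at most 5 in
  \<open>x\<close>, and the right-hand side lists its coefficients. The pole of \<open>q'\<close>
  produces the constant one, \<open>- 4 * e * \<sigma> t\<close>.\<close>

lemma classifying_model:
  assumes I: "open_interval I" and q: "\<And>x. x \<in> I \<Longrightarrow> q x = model_pot \<delta> \<beta> r e x" and e: "e \<noteq> 0 \<Longrightarrow> 0 \<notin> I"
  shows "(\<forall>x\<in>I. classifying s q \<tau> \<sigma> \<phi> t x) \<longleftrightarrow>
    deriv (deriv (deriv \<tau>)) t = 16 * \<delta> * deriv \<tau> t \<and> deriv (deriv \<sigma>) t = 4 * \<delta> * \<sigma> t + 3 * \<beta> * deriv \<tau> t \<and>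
    (e \<noteq> 0 \<longrightarrow> \<sigma> t = 0) \<and> 2 * s * deriv \<phi> t = - s * deriv (deriv \<tau>) t / 2 - 2 * r * deriv \<tau> t - 2 * \<beta> * \<sigma> t"
    (is "?L \<longleftrightarrow> ?R")
proof -
  let ?P = "[: - 4 * e * \<sigma> t, 0, 0, 2 * r * deriv \<tau> t + 2 * \<beta> * \<sigma> t + 2 * s * deriv \<phi> t + s * deriv (deriv \<tau>) t / 2,
     3 * \<beta> * deriv \<tau> t + 4 * \<delta> * \<sigma> t - deriv (deriv \<sigma>) t, 4 * \<delta> * deriv \<tau> t - deriv (deriv (deriv \<tau>)) t / 4 :]"
  have dq: "deriv q x = 2 * \<delta> * x + \<beta> - 2 * e / x ^ 3" if x: "x \<in> I" for x
  proof (rule DERIV_imp_deriv)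
    have "(model_pot \<delta> \<beta> r e has_real_derivative 2 * \<delta> * x + \<beta> - 2 * e / x ^ 3) (at x)"
    proof (cases "e = 0")
      case True
      then show ?thesis unfolding model_pot_def[abs_def] by (auto intro!: derivative_eq_intros)
    next
      case False
      then have "x \<noteq> 0" using e x by auto
      then show ?thesis unfolding model_pot_def[abs_def]
        by (auto intro!: derivative_eq_intros simp: field_simps eval_nat_numeral)
    qed
    then show "(q has_real_derivative 2 * \<delta> * x + \<beta> - 2 * e / x ^ 3) (at x)"
      by (rule has_field_derivative_transform_within_open[OF _ open_intervalD(1)[OF I] x]) (simp add: q)
  qed
  have sc: "- 4 * e * \<sigma> t / x ^ 3 * x ^ 3 = - 4 * e * \<sigma> t" if "x \<in> I" for x
    using e that by (cases "e = 0") auto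
  have cl: "classifying s q \<tau> \<sigma> \<phi> t x \<longleftrightarrow> - 4 * e * \<sigma> t / x ^ 3
      + (2 * r * deriv \<tau> t + 2 * \<beta> * \<sigma> t + 2 * s * deriv \<phi> t + s * deriv (deriv \<tau>) t / 2)
      + (3 * \<beta> * deriv \<tau> t + 4 * \<delta> * \<sigma> t - deriv (deriv \<sigma>) t) * x
      + (4 * \<delta> * deriv \<tau> t - deriv (deriv (deriv \<tau>)) t / 4) * x\<^sup>2 = 0" if x: "x \<in> I" for x
  proof (cases "e = 0")
    case True
    show ?thesis unfolding classifying_def dq[OF x] q[OF x] model_pot_def True
      by (simp add: algebra_simps power2_eq_square)
  next
    case False
    then have "x \<noteq> 0" using e x by auto
    then have "x * (2 * \<delta> * x + \<beta> - 2 * e / x ^ 3) + 2 * model_pot \<delta> \<beta> r e x = 4 * \<delta> * x\<^sup>2 + 3 * \<beta> * x + 2 * r"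
      by (simp add: model_pot_def field_simps eval_nat_numeral)
    then show ?thesis unfolding classifying_def dq[OF x] q[OF x]
      by (simp add: algebra_simps)
  qed
  show ?thesis
  proof
    assume ?L
    have "?P = 0"
    proof (rule poly_zero_on_interval[OF I])
      fix x assume x: "x \<in> I"
      have "poly ?P x = x ^ 3 * (- 4 * e * \<sigma> t / x ^ 3
      + (2 * r * deriv \<tau> t + 2 * \<beta> * \<sigma> t + 2 * s * deriv \<phi> t + s * deriv (deriv \<tau>) t / 2)
      + (3 * \<beta> * deriv \<tau> t + 4 * \<delta> * \<sigma> t - deriv (deriv \<sigma>) t) * x
      + (4 * \<delta> * deriv \<tau> t - deriv (deriv (deriv \<tau>)) t / 4) * x\<^sup>2)"
        using sc[OF x] by (simp add: algebra_simps eval_nat_numeral)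
      then show "poly ?P (x - 0) = 0" using \<open>?L\<close> cl[OF x] x by simp
    qed
    then show ?R by auto
  next
    assume R: ?R
    have h: "- 4 * e * \<sigma> t = 0" "2 * r * deriv \<tau> t + 2 * \<beta> * \<sigma> t + 2 * s * deriv \<phi> t + s * deriv (deriv \<tau>) t / 2 = 0"
      "3 * \<beta> * deriv \<tau> t + 4 * \<delta> * \<sigma> t - deriv (deriv \<sigma>) t = 0" "4 * \<delta> * deriv \<tau> t - deriv (deriv (deriv \<tau>)) t / 4 = 0"
      using R by auto
    show ?L
    proof
      fix x assume x: "x \<in> I"
      show "classifying s q \<tau> \<sigma> \<phi> t x" unfolding cl[OF x] h by simp
    qed
  qed
qed

text \<open>The global solutions \<open>(\<tau>, \<sigma>)\<close> of the determining equations for the model potential; \<open>S\<close> is an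
  antiderivative of \<open>\<beta> \<sigma>\<close> and enters \<open>\<phi>\<close>.\<close>
definition dsol :: "real \<Rightarrow> real \<Rightarrow> (real \<Rightarrow> real) \<Rightarrow> (real \<Rightarrow> real) \<Rightarrow> (real \<Rightarrow> real) \<Rightarrow> bool" where
  "dsol \<delta> \<beta> f s S \<longleftrightarrow> (\<forall>t. (f has_real_derivative deriv f t) (at t) \<and>
     (deriv f has_real_derivative deriv (deriv f) t) (at t) \<and>
     (deriv (deriv f) has_real_derivative 16 * \<delta> * deriv f t) (at t) \<and>
     (s has_real_derivative deriv s t) (at t) \<and>
     (deriv s has_real_derivative 4 * \<delta> * s t + 3 * \<beta> * deriv f t) (at t) \<and>
     (S has_real_derivative \<beta> * s t) (at t))"

lemma dsolI:
  assumes "\<And>t. (f has_real_derivative f1 t) (at t)" "\<And>t. (f1 has_real_derivative f2 t) (at t)"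
    "\<And>t. (f2 has_real_derivative 16 * \<delta> * f1 t) (at t)" "\<And>t. (s has_real_derivative s1 t) (at t)"
    "\<And>t. (s1 has_real_derivative 4 * \<delta> * s t + 3 * \<beta> * f1 t) (at t)" "\<And>t. (S has_real_derivative \<beta> * s t) (at t)"
  shows "dsol \<delta> \<beta> f s S" "deriv f = f1" "deriv (deriv f) = f2" "deriv s = s1"
proof -
  show 1: "deriv f = f1" "deriv s = s1" using DERIV_imp_deriv[OF assms(1)] DERIV_imp_deriv[OF assms(4)] by auto
  then show 2: "deriv (deriv f) = f2" using DERIV_imp_deriv[OF assms(2)] by auto
  show "dsol \<delta> \<beta> f s S" unfolding dsol_def 2 unfolding 1 using assms by blast
qed

lemma dsolD:
  assumes "dsol \<delta> \<beta> f s S"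
  shows "(f has_real_derivative deriv f t) (at t)" "(deriv f has_real_derivative deriv (deriv f) t) (at t)"
    "(deriv (deriv f) has_real_derivative 16 * \<delta> * deriv f t) (at t)" "(s has_real_derivative deriv s t) (at t)"
    "(deriv s has_real_derivative 4 * \<delta> * s t + 3 * \<beta> * deriv f t) (at t)" "(S has_real_derivative \<beta> * s t) (at t)"
  using assms by (simp_all add: dsol_def)

lemma dsol_lincomb:
  assumes F: "dsol \<delta> \<beta> f s S" and G: "dsol \<delta> \<beta> g r R"
  shows "dsol \<delta> \<beta> (\<lambda>t. b * f t + c * g t) (\<lambda>t. b * s t + c * r t) (\<lambda>t. b * S t + c * R t)"
    "deriv (\<lambda>t. b * f t + c * g t) = (\<lambda>t. b * deriv f t + c * deriv g t)"
    "deriv (deriv (\<lambda>t. b * f t + c * g t)) = (\<lambda>t. b * deriv (deriv f) t + c * deriv (deriv g) t)"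
    "deriv (\<lambda>t. b * s t + c * r t) = (\<lambda>t. b * deriv s t + c * deriv r t)"
proof -
  note d = DERIV_add[OF DERIV_cmult DERIV_cmult]
  have a: "16 * \<delta> * (b * deriv f t + c * deriv g t) = b * (16 * \<delta> * deriv f t) + c * (16 * \<delta> * deriv g t)"
    "4 * \<delta> * (b * s t + c * r t) + 3 * \<beta> * (b * deriv f t + c * deriv g t)
      = b * (4 * \<delta> * s t + 3 * \<beta> * deriv f t) + c * (4 * \<delta> * r t + 3 * \<beta> * deriv g t)"
    "\<beta> * (b * s t + c * r t) = b * (\<beta> * s t) + c * (\<beta> * r t)" for t
    by (simp_all add: algebra_simps)
  note D = dsolI[where f = "\<lambda>t. b * f t + c * g t" and s = "\<lambda>t. b * s t + c * r t" and S = "\<lambda>t. b * S t + c * R t"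
    and ?f1.0 = "\<lambda>t. b * deriv f t + c * deriv g t" and ?f2.0 = "\<lambda>t. b * deriv (deriv f) t + c * deriv (deriv g) t"
    and ?s1.0 = "\<lambda>t. b * deriv s t + c * deriv r t" and \<delta> = \<delta> and \<beta> = \<beta>, unfolded a,
    OF d[OF dsolD(1)[OF F] dsolD(1)[OF G]] d[OF dsolD(2)[OF F] dsolD(2)[OF G]] d[OF dsolD(3)[OF F] dsolD(3)[OF G]]
      d[OF dsolD(4)[OF F] dsolD(4)[OF G]] d[OF dsolD(5)[OF F] dsolD(5)[OF G]] d[OF dsolD(6)[OF F] dsolD(6)[OF G]]]
  show "dsol \<delta> \<beta> (\<lambda>t. b * f t + c * g t) (\<lambda>t. b * s t + c * r t) (\<lambda>t. b * S t + c * R t)"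
    "deriv (\<lambda>t. b * f t + c * g t) = (\<lambda>t. b * deriv f t + c * deriv g t)"
    "deriv (deriv (\<lambda>t. b * f t + c * g t)) = (\<lambda>t. b * deriv (deriv f) t + c * deriv (deriv g) t)"
    "deriv (\<lambda>t. b * s t + c * r t) = (\<lambda>t. b * deriv s t + c * deriv r t)" by (rule D)+
qed

text \<open>The derivative of each function in the list is a linear combination of the functions of
  the list, so all of them gain one order of regularity together.\<close>

lemma dsol_smooth:
  assumes F: "dsol \<delta> \<beta> f s S"
  shows "smooth_on T f" "smooth_on T (deriv f)" "smooth_on T s" "smooth_on T S"
proof -
  note d = dsolD[OF F]
  have "C_k_on k UNIV f \<and> C_k_on k UNIV (deriv f) \<and> C_k_on k UNIV (deriv (deriv f)) \<and> C_k_on k UNIV s \<and>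
    C_k_on k UNIV (deriv s) \<and> C_k_on k UNIV S" for k
  proof (induction k)
    case 0
    have c: "(g has_real_derivative g' t) (at t) \<Longrightarrow> isCont g t" for g g' :: "real \<Rightarrow> real" and t by (rule DERIV_isCont)
    show ?case using d[THEN DERIV_isCont] by (simp add: continuous_at_imp_continuous_on)
  next
    case (Suc k)
    then have c: "C_k_on k UNIV (\<lambda>t. 16 * \<delta> * deriv f t)" "C_k_on k UNIV (\<lambda>t. 4 * \<delta> * s t + 3 * \<beta> * deriv f t)"
      "C_k_on k UNIV (\<lambda>t. \<beta> * s t)"
      by (auto intro!: C_k_on_add C_k_on_mult C_k_on_const)
    from Suc c show ?case
      by (intro conjI C_k_on_real_Suc[OF open_UNIV d(1)] C_k_on_real_Suc[OF open_UNIV d(2)] C_k_on_real_Suc[OF open_UNIV d(3)]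
        C_k_on_real_Suc[OF open_UNIV d(4)] C_k_on_real_Suc[OF open_UNIV d(5)] C_k_on_real_Suc[OF open_UNIV d(6)]) blast+
  qed
  then have "smooth_on UNIV f" "smooth_on UNIV (deriv f)" "smooth_on UNIV s" "smooth_on UNIV S"
    by (simp_all add: smooth_on_def)
  then show "smooth_on T f" "smooth_on T (deriv f)" "smooth_on T s" "smooth_on T S"
    using smooth_on_subset by blast+
qed

text \<open>The last argument solves the equation for \<open>\<phi>\<close> in
  \<open>classifying_model\<close>, integrated in \<open>t\<close>; \<open>s * s = 1\<close> moves
  the sign to the right-hand side, and \<open>S\<close> stands for the integral of
  \<open>\<beta> * \<sigma>\<close>.\<close>

definition dfield :: "real \<Rightarrow> real \<Rightarrow> (real \<Rightarrow> real) \<Rightarrow> (real \<Rightarrow> real) \<Rightarrow> (real \<Rightarrow> real) \<Rightarrow> (real \<Rightarrow> real) \<Rightarrow> vfield" where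
  "dfield s r B f g S = ess_field s B f g (\<lambda>t. - deriv f t / 4 - s * r * f t - s * S t)"

lemma dfield_lincomb:
  assumes F: "dsol \<delta> \<beta> f \<sigma> S" and G: "dsol \<delta> \<beta> g \<rho> R"
  shows "dfield s r B (\<lambda>t. b * f t + c * g t) (\<lambda>t. b * \<sigma> t + c * \<rho> t) (\<lambda>t. b * S t + c * R t) p
    = b *\<^sub>R dfield s r B f \<sigma> S p + c *\<^sub>R dfield s r B g \<rho> R p"
  by (cases p) (simp add: dfield_def ess_field_def dsol_lincomb(2-4)[OF F G] dsol_lincomb(3)[OF F G, unfolded dsol_lincomb(2)[OF F G]] algebra_simps add_divide_distrib diff_divide_distrib)

lemma ess_field_cong:
  assumes "open T" "t \<in> T" "\<And>t. t \<in> T \<Longrightarrow> \<tau> t = \<tau>' t" "\<And>t. t \<in> T \<Longrightarrow> \<sigma> t = \<sigma>' t" "\<phi> t = \<phi>' t"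
  shows "ess_field s B \<tau> \<sigma> \<phi> (t, x, u) = ess_field s B \<tau>' \<sigma>' \<phi>' (t, x, u)"
proof -
  have c: "deriv f r = deriv g r" if "\<And>t. t \<in> T \<Longrightarrow> f t = g t" "r \<in> T" for f g :: "real \<Rightarrow> real" and r
    by (rule deriv_cong_ev) (use that assms(1) in \<open>auto simp: eventually_nhds\<close>)
  have "deriv \<tau> r = deriv \<tau>' r" if "r \<in> T" for r by (rule c[OF assms(3) that])
  from c[OF this assms(2)] this[OF assms(2)] c[OF assms(4,2)] assms(3,4)[OF assms(2)] assms(5)
  show ?thesis by (simp add: ess_field_def)
qed

lemma dsol_field:
  assumes T: "open_interval T" and I: "open_interval I" and s: "s * s = 1" and B: "smooth_on I B"
    and q: "\<And>x. x \<in> I \<Longrightarrow> potq s B x = model_pot \<delta> \<beta> r e x" and e: "e \<noteq> 0 \<Longrightarrow> 0 \<notin> I"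
    and F: "dsol \<delta> \<beta> f \<sigma> S" and z: "\<And>t. e \<noteq> 0 \<Longrightarrow> \<sigma> t = 0"
    and Q: "\<And>p. p \<in> dom3 T I \<Longrightarrow> Q p = a *\<^sub>R vf_dt p + d *\<^sub>R vf_udu p + dfield s r B f \<sigma> S p"
  shows "Q \<in> ess_algebra T I (\<lambda>_. s) B"
proof -
  note oT = open_intervalD(1)[OF T]
  note d = dsolD[OF F]
  define \<tau> where "\<tau> = (\<lambda>t. a + f t)"
  define \<phi> where "\<phi> = (\<lambda>t. d - deriv f t / 4 - s * r * f t - s * S t)"
  have tv: "\<tau> t = a + f t" for t by (simp add: \<tau>_def)
  have t1: "deriv \<tau> = deriv f"
    using DERIV_imp_deriv[OF DERIV_add[OF DERIV_const[of a] d(1)]] by (simp add: \<tau>_def fun_eq_iff)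
  have t3: "deriv (deriv (deriv f)) t = 16 * \<delta> * deriv f t" "deriv (deriv \<sigma>) t = 4 * \<delta> * \<sigma> t + 3 * \<beta> * deriv f t" for t
    using d(3,5)[THEN DERIV_imp_deriv] by simp_all
  have "(\<phi> has_real_derivative 0 - deriv (deriv f) t / 4 - s * r * deriv f t - s * (\<beta> * \<sigma> t)) (at t)" for t
    unfolding \<phi>_def by (intro DERIV_diff DERIV_const DERIV_cdivide DERIV_cmult d)
  then have p1: "deriv \<phi> t = - deriv (deriv f) t / 4 - s * r * deriv f t - s * (\<beta> * \<sigma> t)" for t
    using DERIV_imp_deriv by fastforce
  have sm: "smooth_on T \<tau>" "smooth_on T \<sigma>" "smooth_on T \<phi>"
    unfolding \<tau>_def \<phi>_def
    by (intro smooth_on_add smooth_on_diff smooth_on_divide_const smooth_on_mult smooth_on_const dsol_smooth[OF F] oT)+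
  have p2: "2 * s * deriv \<phi> t = - s * deriv (deriv f) t / 2 - 2 * r * deriv f t - 2 * \<beta> * \<sigma> t" for t
  proof -
    have "2 * s * deriv \<phi> t = - s * deriv (deriv f) t / 2 - 2 * (s * s) * r * deriv f t - 2 * (s * s) * \<beta> * \<sigma> t"
      unfolding p1 by (simp add: algebra_simps)
    then show ?thesis by (simp add: s)
  qed
  have "\<forall>x\<in>I. classifying s (potq s B) \<tau> \<sigma> \<phi> t x" for t
    by (rule iffD2[OF classifying_model[OF I q e]]) (use t3 p2 z in \<open>simp_all add: t1\<close>)
  moreover have "\<forall>p\<in>dom3 T I. Q p = ess_field s B \<tau> \<sigma> \<phi> p"
    using Q tv by (auto simp: ess_field_def dfield_def vf_dt_def vf_udu_def t1 \<phi>_def algebra_simps)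
  ultimately show ?thesis unfolding ess_algebra_const_iff[OF T I s B] using sm by blast
qed

text \<open>The derivative of \<tau> solves \<open>y'' = 16 * \<delta> * y\<close>, for which
  \<open>deriv f\<close> and \<open>deriv g\<close> are a basis; the constant lost by
  differentiation is the multiple of \<open>vf_dt\<close>. Subtracting the parts \<open>f1\<close>
  and \<open>g1\<close> of \<sigma> leaves a solution of \<open>y'' = 4 * \<delta> * y\<close>, with
  basis \<open>h\<close> and \<open>k\<close>. What remains of \<phi> is constant and is the
  multiple of \<open>vf_udu\<close>. A pole in the potential enforces \<sigma> = 0, which excludes
  \<open>h\<close> and \<open>k\<close>.\<close>

lemma essential_span:
  assumes T: "open_interval T" and I: "open_interval I" and s: "s * s = 1" and B: "smooth_on I B"
    and q: "\<And>x. x \<in> I \<Longrightarrow> potq s B x = model_pot \<delta> \<beta> r e x" and e: "e \<noteq> 0 \<Longrightarrow> 0 \<notin> I"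
    and P: "dsol \<delta> \<beta> (\<lambda>_. 0) h H" "dsol \<delta> \<beta> (\<lambda>_. 0) k K" and D: "dsol \<delta> \<beta> f f1 F" "dsol \<delta> \<beta> g g1 G"
    and wD: "\<And>t. deriv f t * deriv (deriv g) t - deriv (deriv f) t * deriv g t \<noteq> 0"
    and wP: "\<And>t. h t * deriv k t - deriv h t * k t \<noteq> 0"
    and z: "\<And>t. e \<noteq> 0 \<Longrightarrow> f1 t = 0 \<and> g1 t = 0"
  defines "comb \<equiv> \<lambda>a d p q b c z. a *\<^sub>R vf_dt z + d *\<^sub>R vf_udu z
    + (p *\<^sub>R dfield s r B (\<lambda>_. 0) h H z + q *\<^sub>R dfield s r B (\<lambda>_. 0) k K z)
    + (b *\<^sub>R dfield s r B f f1 F z + c *\<^sub>R dfield s r B g g1 G z)"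
  shows "Q \<in> ess_algebra T I (\<lambda>_. s) B \<longleftrightarrow>
    (\<exists>a d p q b c. (e \<noteq> 0 \<longrightarrow> p = 0 \<and> q = 0) \<and> (\<forall>z\<in>dom3 T I. Q z = comb a d p q b c z))" (is "_ \<longleftrightarrow> ?R")
    and "(\<And>z. z \<in> dom3 T I \<Longrightarrow> comb a d p q b c z = 0) \<Longrightarrow> a = 0 \<and> d = 0 \<and> p = 0 \<and> q = 0 \<and> b = 0 \<and> c = 0"
proof -
  note oT = open_intervalD(1)[OF T] and oI = open_intervalD(1)[OF I]
  obtain t0 x0 where 0: "t0 \<in> T" "x0 \<in> I" using open_intervalD(3)[OF T] open_intervalD(3)[OF I] by blast
  \<comment> \<open>The factors 1 and the products with 0 keep the shape
    \<open>b * _ + c * _\<close> of \<open>dsol_lincomb\<close>, which is applied to each pair and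
    then to the sum of the two.\<close>
  define t' s' S' where "t' = (\<lambda>p q b c t. 1 * (p * 0 + q * 0) + 1 * (b * f t + c * g t))"
    and "s' = (\<lambda>p q b c t. 1 * (p * h t + q * k t) + 1 * (b * f1 t + c * g1 t))"
    and "S' = (\<lambda>p q b c t. 1 * (p * H t + q * K t) + 1 * (b * F t + c * G t))"
  have ds: "dsol \<delta> \<beta> (t' p q b c) (s' p q b c) (S' p q b c)" for p q b c
    unfolding t'_def s'_def S'_def by (intro dsol_lincomb(1) P D)
  have comb: "comb a d p q b c z = a *\<^sub>R vf_dt z + d *\<^sub>R vf_udu z + dfield s r B (t' p q b c) (s' p q b c) (S' p q b c) z"
    for a d p q b c z
    unfolding t'_def s'_def S'_def comb_def
    by (subst dfield_lincomb[OF dsol_lincomb(1)[OF P] dsol_lincomb(1)[OF D]], subst dfield_lincomb[OF P], subst dfield_lincomb[OF D]) simp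
  have rv: "(\<lambda>_. c) = (\<lambda>_. c :: real)" for c ..
  have fD: "fund UNIV (\<lambda>_. 16 * \<delta>) (deriv f) (deriv g)"
    unfolding fund_def sol_def using wD dsolD(2,3)[OF D(1)] dsolD(2,3)[OF D(2)]
    by (intro exI[of _ "deriv (deriv f)"] exI[of _ "deriv (deriv g)"]) (simp flip: has_real_derivative_iff_has_vector_derivative)
  have fP: "fund UNIV (\<lambda>_. 4 * \<delta>) h k"
    unfolding fund_def sol_def using wP dsolD(4,5)[OF P(1)] dsolD(4,5)[OF P(2)]
    by (intro exI[of _ "deriv h"] exI[of _ "deriv k"]) (simp flip: has_real_derivative_iff_has_vector_derivative)
  show "Q \<in> ess_algebra T I (\<lambda>_. s) B \<longleftrightarrow> ?R"
  proof
    assume ?R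
    then obtain a d p q b c where Q: "e \<noteq> 0 \<longrightarrow> p = 0 \<and> q = 0" "\<And>z. z \<in> dom3 T I \<Longrightarrow> Q z = comb a d p q b c z" by blast
    show "Q \<in> ess_algebra T I (\<lambda>_. s) B"
      by (rule dsol_field[OF T I s B q e ds _ Q(2)[unfolded comb]]) (use Q(1) z in \<open>auto simp: s'_def\<close>)
  next
    assume "Q \<in> ess_algebra T I (\<lambda>_. s) B"
    then obtain \<tau> \<sigma> \<phi> where sm: "smooth_on T \<tau>" "smooth_on T \<sigma>" "smooth_on T \<phi>"
      and Q: "\<forall>p\<in>dom3 T I. Q p = ess_field s B \<tau> \<sigma> \<phi> p" and cl: "\<forall>t\<in>T. \<forall>x\<in>I. classifying s (potq s B) \<tau> \<sigma> \<phi> t x"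
      unfolding ess_algebra_const_iff[OF T I s B] by blast
    note st1 = smooth_on_deriv[OF oT sm(1)] and ss1 = smooth_on_deriv[OF oT sm(2)]
    note st2 = smooth_on_deriv[OF oT st1]
    have ode: "deriv (deriv (deriv \<tau>)) t = 16 * \<delta> * deriv \<tau> t" "deriv (deriv \<sigma>) t = 4 * \<delta> * \<sigma> t + 3 * \<beta> * deriv \<tau> t"
      "e \<noteq> 0 \<longrightarrow> \<sigma> t = 0" "2 * s * deriv \<phi> t = - s * deriv (deriv \<tau>) t / 2 - 2 * r * deriv \<tau> t - 2 * \<beta> * \<sigma> t"
      if "t \<in> T" for t
      using cl that classifying_model[OF I q e, where s = s and \<tau> = \<tau> and \<sigma> = \<sigma> and \<phi> = \<phi> and t = t] by blast+
    have "sol T (\<lambda>_. 16 * \<delta>) (deriv \<tau>) (deriv (deriv \<tau>))"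
      unfolding sol_def using smooth_on_DERIV[OF st1] smooth_on_DERIV[OF st2] ode(1)
      by (simp flip: has_real_derivative_iff_has_vector_derivative)
    then obtain b c where bc: "\<And>t. t \<in> T \<Longrightarrow> deriv \<tau> t = b * deriv f t + c * deriv g t"
      using fund_rep[OF T subset_UNIV fD] by blast
    have "\<tau> t - (b * f t + c * g t) = \<tau> t0 - (b * f t0 + c * g t0)" if "t \<in> T" for t
    proof (rule DERIV_zero_interval[OF T _ that 0(1), of "\<lambda>t. \<tau> t - (b * f t + c * g t)"])
      fix t assume t: "t \<in> T"
      have "((\<lambda>t. \<tau> t - (b * f t + c * g t)) has_real_derivative deriv \<tau> t - (b * deriv f t + c * deriv g t)) (at t)"
        by (intro DERIV_diff DERIV_add DERIV_cmult smooth_on_DERIV[OF sm(1) t] dsolD(1)[OF D(1)] dsolD(1)[OF D(2)])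
      then show "((\<lambda>t. \<tau> t - (b * f t + c * g t)) has_real_derivative 0) (at t)" using bc[OF t] by simp
    qed
    then obtain a where a: "\<And>t. t \<in> T \<Longrightarrow> \<tau> t = a + (b * f t + c * g t)" by (metis diff_add_cancel)
    have dd: "deriv (deriv \<tau>) t = b * deriv (deriv f) t + c * deriv (deriv g) t" if t: "t \<in> T" for t
    proof (rule DERIV_imp_deriv)
      show "(deriv \<tau> has_real_derivative b * deriv (deriv f) t + c * deriv (deriv g) t) (at t)"
        by (rule has_field_derivative_transform_within_open[OF DERIV_add[OF DERIV_cmult[OF dsolD(2)[OF D(1)]] DERIV_cmult[OF dsolD(2)[OF D(2)]]] oT t])
          (simp add: bc)
    qed
    let ?y = "\<lambda>t. \<sigma> t - (b * f1 t + c * g1 t)" and ?y' = "\<lambda>t. deriv \<sigma> t - (b * deriv f1 t + c * deriv g1 t)"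
    have "sol T (\<lambda>_. 4 * \<delta>) ?y ?y'"
      unfolding sol_def has_real_derivative_iff_has_vector_derivative[symmetric]
    proof (intro ballI conjI)
      fix t assume t: "t \<in> T"
      show "(?y has_real_derivative ?y' t) (at t)"
        by (intro DERIV_diff DERIV_add DERIV_cmult smooth_on_DERIV[OF sm(2) t] dsolD(4)[OF D(1)] dsolD(4)[OF D(2)])
      have "(?y' has_real_derivative deriv (deriv \<sigma>) t - (b * (4 * \<delta> * f1 t + 3 * \<beta> * deriv f t) + c * (4 * \<delta> * g1 t + 3 * \<beta> * deriv g t))) (at t)"
        by (intro DERIV_diff DERIV_add DERIV_cmult smooth_on_DERIV[OF ss1 t] dsolD(5)[OF D(1)] dsolD(5)[OF D(2)])
      then show "(?y' has_real_derivative (4 * \<delta>) *\<^sub>R ?y t) (at t)"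
        unfolding ode(2)[OF t] bc[OF t] by (rule DERIV_cong) (simp add: algebra_simps)
    qed
    then obtain p q where pq: "\<And>t. t \<in> T \<Longrightarrow> ?y t = p * h t + q * k t"
      using fund_rep[OF T subset_UNIV fP] by blast
    have pq0: "p = 0 \<and> q = 0" if "e \<noteq> 0"
      by (rule fund_coeff_zero[OF T subset_UNIV fP]) (use pq ode(3) z that in force)
    have sg: "\<sigma> t = s' p q b c t" if "t \<in> T" for t using pq[OF that] by (simp add: s'_def)
    let ?w = "\<lambda>t. - deriv (t' p q b c) t / 4 - s * r * t' p q b c t - s * S' p q b c t"
    have "\<phi> t - ?w t = \<phi> t0 - ?w t0" if "t \<in> T" for t
    proof (rule DERIV_zero_interval[OF T _ that 0(1), of "\<lambda>t. \<phi> t - ?w t"])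
      fix t assume t: "t \<in> T"
      have "((\<lambda>t. \<phi> t - ?w t) has_real_derivative deriv \<phi> t - (- deriv (deriv (t' p q b c)) t / 4 - s * r * deriv (t' p q b c) t - s * (\<beta> * s' p q b c t))) (at t)"
        by (intro DERIV_diff DERIV_cmult DERIV_cdivide DERIV_minus smooth_on_DERIV[OF sm(3) t] dsolD(1,2,6)[OF ds])
      note h = this
      have d12: "deriv (t' p q b c) = (\<lambda>t. b * deriv f t + c * deriv g t)"
        "deriv (deriv (t' p q b c)) = (\<lambda>t. b * deriv (deriv f) t + c * deriv (deriv g) t)"
        using dsol_lincomb(2,3)[OF D, of b c] by (simp_all add: t'_def)
      have d\<phi>: "deriv \<phi> t = - deriv (deriv \<tau>) t / 4 - s * r * deriv \<tau> t - s * \<beta> * \<sigma> t"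
      proof -
        have "(s * s) * deriv \<phi> t = s * (2 * s * deriv \<phi> t) / 2" by simp
        also have "\<dots> = - (s * s) * deriv (deriv \<tau>) t / 4 - s * r * deriv \<tau> t - s * \<beta> * \<sigma> t"
          unfolding ode(4)[OF t] by (simp add: field_simps)
        finally show ?thesis by (simp add: s)
      qed
      show "((\<lambda>t. \<phi> t - ?w t) has_real_derivative 0) (at t)"
        by (rule DERIV_cong[OF h])
          (unfold d\<phi> bc[OF t] dd[OF t] sg[OF t] d12(2)[unfolded d12(1)] d12(1), simp add: algebra_simps add_divide_distrib)
    qed
    then obtain d where d: "\<And>t. t \<in> T \<Longrightarrow> \<phi> t = d + ?w t" by (metis diff_add_cancel)
    have "Q (t, x, u) = comb a d p q b c (t, x, u)" if tx: "t \<in> T" "x \<in> I" for t x u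
    proof -
      have "Q (t, x, u) = ess_field s B (\<lambda>t. a + t' p q b c t) (s' p q b c) (\<lambda>t. d + ?w t) (t, x, u)"
        using Q tx ess_field_cong[OF oT tx(1), of \<tau> "\<lambda>t. a + t' p q b c t" \<sigma> "s' p q b c" \<phi> "\<lambda>t. d + ?w t"] a sg d
        by (simp add: t'_def)
      moreover have "deriv (\<lambda>t. a + t' p q b c t) = deriv (t' p q b c)"
        using DERIV_imp_deriv[OF DERIV_add[OF DERIV_const[of a] dsolD(1)[OF ds]]] by (simp add: fun_eq_iff)
      ultimately show ?thesis unfolding comb
        by (simp add: ess_field_def dfield_def vf_dt_def vf_udu_def algebra_simps)
    qed
    then have "\<forall>z\<in>dom3 T I. Q z = comb a d p q b c z" by auto
    then show ?R using pq0 by blast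
  qed
  assume zero: "\<And>z. z \<in> dom3 T I \<Longrightarrow> comb a d p q b c z = 0"
  have c1: "a + (b * f t + c * g t) = 0" "deriv (t' p q b c) t * x / 2 + s' p q b c t = 0" if "t \<in> T" "x \<in> I" for t x
    using zero[of "(t, x, 0)"] that unfolding comb
    by (simp_all add: dfield_def ess_field_def vf_dt_def vf_udu_def zero_prod_def t'_def)
  have "b * deriv f t + c * deriv g t = 0" if "t \<in> T" for t
  proof -
    have "((\<lambda>t. a + (b * f t + c * g t)) has_real_derivative 0 + (b * deriv f t + c * deriv g t)) (at t)"
      by (intro DERIV_add DERIV_const DERIV_cmult dsolD(1)[OF D(1)] dsolD(1)[OF D(2)])
    then have "((\<lambda>_. 0) has_real_derivative 0 + (b * deriv f t + c * deriv g t)) (at t)"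
      by (rule has_field_derivative_transform_within_open[OF _ oT that]) (use c1(1) 0 in auto)
    from DERIV_unique[OF this DERIV_const] show ?thesis by simp
  qed
  then have bc: "b = 0" "c = 0" using fund_coeff_zero[OF T subset_UNIV fD] by blast+
  have a: "a = 0" using c1(1)[OF 0] bc by simp
  have t0': "t' p q 0 0 = (\<lambda>_. 0)" by (simp add: t'_def)
  have "p * h t + q * k t = 0" if "t \<in> T" for t using c1(2)[OF that 0(2)] by (simp add: bc t0' s'_def)
  then have pq: "p = 0" "q = 0" using fund_coeff_zero[OF T subset_UNIV fP] by blast+
  have "d = 0" using zero[of "(t0, x0, 1)"] 0 by (simp add: comb_def a bc pq vf_udu_def zero_prod_def)
  then show "a = 0 \<and> d = 0 \<and> p = 0 \<and> q = 0 \<and> b = 0 \<and> c = 0" using a bc pq by simp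
qed

lemma has_basis_6:
  assumes "\<And>Q. Q \<in> V \<longleftrightarrow> (\<exists>a d p q b c. \<forall>z\<in>D. Q z = a *\<^sub>R v0 z + d *\<^sub>R v1 z + (p *\<^sub>R v2 z + q *\<^sub>R v3 z) + (b *\<^sub>R v4 z + c *\<^sub>R v5 z))"
    and "\<And>a d p q b c. (\<And>z. z \<in> D \<Longrightarrow> a *\<^sub>R v0 z + d *\<^sub>R v1 z + (p *\<^sub>R v2 z + q *\<^sub>R v3 z) + (b *\<^sub>R v4 z + c *\<^sub>R v5 z) = 0) \<Longrightarrow> a = 0 \<and> d = 0 \<and> p = 0 \<and> q = 0 \<and> b = 0 \<and> c = 0"
  shows "has_basis D V [v0, v1, v2, v3, v4, v5]"
proof -
  have l: "lin_comb [v0, v1, v2, v3, v4, v5] c z = c 0 *\<^sub>R v0 z + c 1 *\<^sub>R v1 z + (c 2 *\<^sub>R v2 z + c 3 *\<^sub>R v3 z) + (c 4 *\<^sub>R v4 z + c 5 *\<^sub>R v5 z)" for c z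
    by (simp add: lin_comb_def lessThan_Suc eval_nat_numeral)
  show ?thesis unfolding has_basis_def l
  proof (intro conjI allI impI)
    fix Q
    show "Q \<in> V \<longleftrightarrow> (\<exists>c :: nat \<Rightarrow> real. \<forall>z\<in>D. Q z = c 0 *\<^sub>R v0 z + c 1 *\<^sub>R v1 z + (c 2 *\<^sub>R v2 z + c 3 *\<^sub>R v3 z) + (c 4 *\<^sub>R v4 z + c 5 *\<^sub>R v5 z))"
    proof
      assume "Q \<in> V"
      then obtain a d p q b c where "\<forall>z\<in>D. Q z = a *\<^sub>R v0 z + d *\<^sub>R v1 z + (p *\<^sub>R v2 z + q *\<^sub>R v3 z) + (b *\<^sub>R v4 z + c *\<^sub>R v5 z)" using assms(1) by blast
      then show "\<exists>c :: nat \<Rightarrow> real. \<forall>z\<in>D. Q z = c 0 *\<^sub>R v0 z + c 1 *\<^sub>R v1 z + (c 2 *\<^sub>R v2 z + c 3 *\<^sub>R v3 z) + (c 4 *\<^sub>R v4 z + c 5 *\<^sub>R v5 z)"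
        by (intro exI[of _ "\<lambda>i. [a, d, p, q, b, c] ! i"]) (simp add: eval_nat_numeral)
    next
      assume "\<exists>c :: nat \<Rightarrow> real. \<forall>z\<in>D. Q z = c 0 *\<^sub>R v0 z + c 1 *\<^sub>R v1 z + (c 2 *\<^sub>R v2 z + c 3 *\<^sub>R v3 z) + (c 4 *\<^sub>R v4 z + c 5 *\<^sub>R v5 z)"
      then show "Q \<in> V" unfolding assms(1) by blast
    qed
  next
    fix c :: "nat \<Rightarrow> real" and i
    assume h: "\<forall>z\<in>D. c 0 *\<^sub>R v0 z + c 1 *\<^sub>R v1 z + (c 2 *\<^sub>R v2 z + c 3 *\<^sub>R v3 z) + (c 4 *\<^sub>R v4 z + c 5 *\<^sub>R v5 z) = 0" and i: "i < length [v0, v1, v2, v3, v4, v5]"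
    have "c 0 = 0 \<and> c 1 = 0 \<and> c 2 = 0 \<and> c 3 = 0 \<and> c 4 = 0 \<and> c 5 = 0" by (rule assms(2)) (rule bspec[OF h])
    moreover have "i = 0 \<or> i = 1 \<or> i = 2 \<or> i = 3 \<or> i = 4 \<or> i = 5" using i by auto
    ultimately show "c i = 0" by auto
  qed
qed

lemma has_basis_4:
  assumes "\<And>Q. Q \<in> V \<longleftrightarrow> (\<exists>a d b c. \<forall>z\<in>D. Q z = a *\<^sub>R v0 z + d *\<^sub>R v1 z + (b *\<^sub>R v2 z + c *\<^sub>R v3 z))"
    and "\<And>a d b c. (\<And>z. z \<in> D \<Longrightarrow> a *\<^sub>R v0 z + d *\<^sub>R v1 z + (b *\<^sub>R v2 z + c *\<^sub>R v3 z) = 0) \<Longrightarrow> a = 0 \<and> d = 0 \<and> b = 0 \<and> c = 0"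
  shows "has_basis D V [v0, v1, v2, v3]"
proof -
  have l: "lin_comb [v0, v1, v2, v3] c z = c 0 *\<^sub>R v0 z + c 1 *\<^sub>R v1 z + (c 2 *\<^sub>R v2 z + c 3 *\<^sub>R v3 z)" for c z
    by (simp add: lin_comb_def lessThan_Suc eval_nat_numeral)
  show ?thesis unfolding has_basis_def l
  proof (intro conjI allI impI)
    fix Q
    show "Q \<in> V \<longleftrightarrow> (\<exists>c :: nat \<Rightarrow> real. \<forall>z\<in>D. Q z = c 0 *\<^sub>R v0 z + c 1 *\<^sub>R v1 z + (c 2 *\<^sub>R v2 z + c 3 *\<^sub>R v3 z))"
    proof
      assume "Q \<in> V"
      then obtain a d b c where "\<forall>z\<in>D. Q z = a *\<^sub>R v0 z + d *\<^sub>R v1 z + (b *\<^sub>R v2 z + c *\<^sub>R v3 z)" using assms(1) by blast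
      then show "\<exists>c :: nat \<Rightarrow> real. \<forall>z\<in>D. Q z = c 0 *\<^sub>R v0 z + c 1 *\<^sub>R v1 z + (c 2 *\<^sub>R v2 z + c 3 *\<^sub>R v3 z)"
        by (intro exI[of _ "\<lambda>i. [a, d, b, c] ! i"]) (simp add: eval_nat_numeral)
    next
      assume "\<exists>c :: nat \<Rightarrow> real. \<forall>z\<in>D. Q z = c 0 *\<^sub>R v0 z + c 1 *\<^sub>R v1 z + (c 2 *\<^sub>R v2 z + c 3 *\<^sub>R v3 z)"
      then show "Q \<in> V" unfolding assms(1) by blast
    qed
  next
    fix c :: "nat \<Rightarrow> real" and i
    assume h: "\<forall>z\<in>D. c 0 *\<^sub>R v0 z + c 1 *\<^sub>R v1 z + (c 2 *\<^sub>R v2 z + c 3 *\<^sub>R v3 z) = 0" and i: "i < length [v0, v1, v2, v3]"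
    have "c 0 = 0 \<and> c 1 = 0 \<and> c 2 = 0 \<and> c 3 = 0" by (rule assms(2)) (rule bspec[OF h])
    moreover have "i = 0 \<or> i = 1 \<or> i = 2 \<or> i = 3" using i by auto
    ultimately show "c i = 0" by auto
  qed
qed

lemma essential_basis:
  assumes T: "open_interval T" and I: "open_interval I" and s: "s * s = 1" and B: "smooth_on I B"
    and q: "\<And>x. x \<in> I \<Longrightarrow> potq s B x = model_pot \<delta> \<beta> r e x" and e: "e \<noteq> 0 \<Longrightarrow> 0 \<notin> I"
    and P: "dsol \<delta> \<beta> (\<lambda>_. 0) h H" "dsol \<delta> \<beta> (\<lambda>_. 0) k K" and D: "dsol \<delta> \<beta> f f1 F" "dsol \<delta> \<beta> g g1 G"
    and wD: "\<And>t. deriv f t * deriv (deriv g) t - deriv (deriv f) t * deriv g t \<noteq> 0"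
    and wP: "\<And>t. h t * deriv k t - deriv h t * k t \<noteq> 0"
    and z: "\<And>t. e \<noteq> 0 \<Longrightarrow> f1 t = 0 \<and> g1 t = 0"
  shows "e = 0 \<Longrightarrow> has_basis (dom3 T I) (ess_algebra T I (\<lambda>_. s) B)
      [vf_dt, vf_udu, dfield s r B (\<lambda>_. 0) h H, dfield s r B (\<lambda>_. 0) k K, dfield s r B f f1 F, dfield s r B g g1 G]"
    and "e \<noteq> 0 \<Longrightarrow> has_basis (dom3 T I) (ess_algebra T I (\<lambda>_. s) B)
      [vf_dt, vf_udu, dfield s r B f f1 F, dfield s r B g g1 G]"
proof -
  note span = essential_span[OF T I s B q e P D wD wP z]
  show "has_basis (dom3 T I) (ess_algebra T I (\<lambda>_. s) B)
      [vf_dt, vf_udu, dfield s r B (\<lambda>_. 0) h H, dfield s r B (\<lambda>_. 0) k K, dfield s r B f f1 F, dfield s r B g g1 G]" if "e = 0"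
    by (rule has_basis_6) (use that in \<open>simp add: span(1)\<close>, rule span(2))
  show "has_basis (dom3 T I) (ess_algebra T I (\<lambda>_. s) B)
      [vf_dt, vf_udu, dfield s r B f f1 F, dfield s r B g g1 G]" if e0: "e \<noteq> 0"
  proof (rule has_basis_4)
    fix Q
    show "Q \<in> ess_algebra T I (\<lambda>_. s) B \<longleftrightarrow> (\<exists>a d b c. \<forall>z\<in>dom3 T I. Q z = a *\<^sub>R vf_dt z + d *\<^sub>R vf_udu z
        + (b *\<^sub>R dfield s r B f f1 F z + c *\<^sub>R dfield s r B g g1 G z))"
      by (simp add: span(1) e0)
  next
    fix a d b c
    assume "\<And>z. z \<in> dom3 T I \<Longrightarrow> a *\<^sub>R vf_dt z + d *\<^sub>R vf_udu z
        + (b *\<^sub>R dfield s r B f f1 F z + c *\<^sub>R dfield s r B g g1 G z) = 0"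
    then show "a = 0 \<and> d = 0 \<and> b = 0 \<and> c = 0" using span(2)[of a d 0 0 b c] by simp
  qed
qed

text \<open>The parameter \<open>\<kappa>\<close> is \<open>- r\<close>, as the model potentials
  contain \<open>- \<kappa>\<close> as their constant term. In \<open>vf_P\<close> the value of
  \<open>r\<close> is free because \<tau> is 0 there.\<close>

lemma vf_dfield:
  assumes "s * s = 1"
  shows "vf_P s B h = dfield s r B (\<lambda>_. 0) h (\<lambda>_. 0)"
    "vf_D s B \<kappa> f = dfield s (- \<kappa>) B f (\<lambda>_. 0) (\<lambda>_. 0)"
    "vf_Pbar s B h = dfield s 0 B (\<lambda>_. 0) h (antideriv h)"
proof -
  have s: "s * (s * a) = a" for a using assms by (simp flip: mult.assoc)
  show "vf_P s B h = dfield s r B (\<lambda>_. 0) h (\<lambda>_. 0)"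
    "vf_D s B \<kappa> f = dfield s (- \<kappa>) B f (\<lambda>_. 0) (\<lambda>_. 0)"
    "vf_Pbar s B h = dfield s 0 B (\<lambda>_. 0) h (antideriv h)"
    by (auto simp: fun_eq_iff vf_P_def vf_D_def vf_Pbar_def dfield_def ess_field_def algebra_simps s add_divide_distrib)
qed

lemma antideriv_DERIV:
  assumes "\<And>t. (F has_real_derivative f t) (at t)"
  shows "(antideriv f has_real_derivative f t) (at t)"
proof -
  have "\<forall>t. (antideriv f has_real_derivative f t) (at t)"
    unfolding antideriv_def by (rule someI[of _ F]) (use assms in blast)
  then show ?thesis by blast
qed

lemma smooth_on_model_pot:
  assumes "open D" "e \<noteq> 0 \<Longrightarrow> 0 \<notin> D"
  shows "smooth_on D (model_pot \<delta> \<beta> r e)"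
proof (cases "e = 0")
  case True
  then have "model_pot \<delta> \<beta> r e = (\<lambda>x. \<delta> * x ^ 2 + \<beta> * x + r)" by (simp add: model_pot_def fun_eq_iff)
  then show ?thesis using assms(1) by (auto intro!: smooth_on_add smooth_on_mult smooth_on_const smooth_on_id smooth_on_power)
next
  case False
  have m: "model_pot \<delta> \<beta> r e = (\<lambda>x. \<delta> * x ^ 2 + \<beta> * x + r + e * inverse (x ^ 2))"
    by (simp add: model_pot_def fun_eq_iff divide_inverse)
  show ?thesis unfolding m
    by (intro smooth_on_add smooth_on_mult smooth_on_const smooth_on_id smooth_on_power smooth_on_inverse assms(1)) (use False assms(2) in auto)
qed

text \<open>For \<open>B = 2 * s * W' / W\<close> the equation of \<open>W\<close> becomes the
  Riccati equation \<open>B' = 2 * s * q - s / 2 * B\<^sup>2\<close>. It yields smoothness of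
  \<open>B\<close> by bootstrapping and, solved for \<open>q\<close>, the potential.\<close>

lemma listed_facts:
  assumes L: "listed e I" and s: "s * s = 1"
  obtains W' where "I \<subseteq> entry_dom e" "sol I (entry_pot e) (W_of e) W'" "\<And>x. x \<in> I \<Longrightarrow> B_of s e x = 2 * s * W' x / W_of e x"
    "smooth_on I (B_of s e)" "\<And>x. x \<in> I \<Longrightarrow> potq s (B_of s e) x = entry_pot e x"
proof -
  have v: "valid_entry e" and I: "open_interval I" and W0: "\<And>x. x \<in> I \<Longrightarrow> W_of e x \<noteq> 0" using L by (auto simp: listed_def)
  note oI = open_intervalD(1)[OF I]
  have sub: "I \<subseteq> entry_dom e" using entry_dom_nonzero[OF v W0] by blast
  obtain W' where W: "sol I (entry_pot e) (W_of e) W'" using entry_sol[OF v] sol_subset[OF _ sub] by blast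
  have d: "(W_of e has_real_derivative W' x) (at x)" "(W' has_real_derivative entry_pot e x * W_of e x) (at x)" if "x \<in> I" for x
    using W that by (simp_all add: sol_def has_real_derivative_iff_has_vector_derivative)
  have Bx: "B_of s e x = 2 * s * W' x / W_of e x" if "x \<in> I" for x
    using DERIV_imp_deriv[OF d(1)[OF that]] by (simp add: B_of_def)
  have dB: "(B_of s e has_real_derivative 2 * s * entry_pot e x - s / 2 * (B_of s e x * B_of s e x)) (at x)" if x: "x \<in> I" for x
  proof -
    have "((\<lambda>x. 2 * s * W' x / W_of e x) has_real_derivative
      (2 * s * (entry_pot e x * W_of e x) * W_of e x - 2 * s * W' x * W' x) / (W_of e x * W_of e x)) (at x)"
      by (rule DERIV_divide[OF DERIV_cmult[OF d(2)[OF x]] d(1)[OF x] W0[OF x]])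
    then have "(B_of s e has_real_derivative
      (2 * s * (entry_pot e x * W_of e x) * W_of e x - 2 * s * W' x * W' x) / (W_of e x * W_of e x)) (at x)"
      by (rule has_field_derivative_transform_within_open[OF _ oI x]) (simp add: Bx)
    moreover have "(2 * s * (entry_pot e x * W_of e x) * W_of e x - 2 * s * W' x * W' x) / (W_of e x * W_of e x)
      = 2 * s * entry_pot e x - s / 2 * (B_of s e x * B_of s e x)"
    proof -
      have "s / 2 * (B_of s e x * B_of s e x) = (s * s) * (2 * s * W' x * W' x) / (W_of e x * W_of e x)"
        by (simp add: Bx[OF x])
      then show ?thesis using W0[OF x] by (simp add: s diff_divide_distrib)
    qed
    ultimately show ?thesis by simp
  qed
  have q: "smooth_on I (entry_pot e)"
  proof -
    obtain \<delta> \<beta> r E where c: "coeffs e = (\<delta>, \<beta>, r, E)" by (cases "coeffs e")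
    have "E \<noteq> 0 \<Longrightarrow> 0 \<notin> I" using sub by (auto simp: entry_dom_def model_dom_def c split: if_splits)
    then show ?thesis using smooth_on_model_pot[OF oI, of E \<delta> \<beta> r] by (simp add: entry_pot_def[abs_def] c)
  qed
  have sm: "smooth_on I (B_of s e)"
  proof (rule smooth_on_real_I[OF oI dB])
    fix k assume "C_k_on k I (B_of s e)"
    moreover have "C_k_on k I (\<lambda>x. 2 * s * entry_pot e x + (- s / 2) * (B_of s e x * B_of s e x))"
      using q calculation by (intro C_k_on_add C_k_on_mult C_k_on_const oI) (auto simp: smooth_on_def)
    ultimately show "C_k_on k I (\<lambda>x. 2 * s * entry_pot e x - s / 2 * (B_of s e x * B_of s e x))" by simp
  qed
  have "potq s (B_of s e) x = entry_pot e x" if x: "x \<in> I" for x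
  proof -
    have "potq s (B_of s e) x = (B_of s e x)\<^sup>2 / 4 + (s * s) * entry_pot e x - (s * s) * (B_of s e x * B_of s e x) / 4"
      unfolding potq_def DERIV_imp_deriv[OF dB[OF x]] by (simp add: algebra_simps add_divide_distrib diff_divide_distrib)
    then show ?thesis by (simp add: s power2_eq_square)
  qed
  from that[OF sub W Bx sm this] show ?thesis by blast
qed

lemma dsol_P:
  assumes "\<And>t. (h has_real_derivative h1 t) (at t)" "\<And>t. (h1 has_real_derivative 4 * \<delta> * h t) (at t)"
    "\<And>t. (H has_real_derivative \<beta> * h t) (at t)"
  shows "dsol \<delta> \<beta> (\<lambda>_. 0) h H" "deriv h = h1"
proof -
  have a: "((\<lambda>_. 0) has_real_derivative 16 * \<delta> * 0) (at t)" "(h1 has_real_derivative 4 * \<delta> * h t + 3 * \<beta> * 0) (at t)" for t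
    using assms(2)[of t] by simp_all
  note D = dsolI[of "\<lambda>_. 0" "\<lambda>_. 0" "\<lambda>_. 0", OF DERIV_const DERIV_const a(1) assms(1) a(2) assms(3)]
  show "dsol \<delta> \<beta> (\<lambda>_. 0) h H" "deriv h = h1" by (rule D)+
qed

lemma dsol_D:
  assumes "\<And>t. (f has_real_derivative f1 t) (at t)" "\<And>t. (f1 has_real_derivative f2 t) (at t)"
    "\<And>t. (f2 has_real_derivative 16 * \<delta> * f1 t) (at t)"
  shows "dsol \<delta> 0 f (\<lambda>_. 0) (\<lambda>_. 0)" "deriv f = f1" "deriv (deriv f) = f2"
proof -
  have a: "((\<lambda>_. 0) has_real_derivative 4 * \<delta> * 0 + 3 * 0 * f1 t) (at t)" "((\<lambda>_. 0) has_real_derivative 0 * 0) (at t)" for t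
    by simp_all
  note D = dsolI[of f f1 f2 \<delta> "\<lambda>_. 0" "\<lambda>_. 0" 0 "\<lambda>_. 0", OF assms DERIV_const a]
  show "dsol \<delta> 0 f (\<lambda>_. 0) (\<lambda>_. 0)" "deriv f = f1" "deriv (deriv f) = f2" by (rule D)+
qed

text \<open>For \<open>\<beta> = 0\<close> the equations for \<tau> and \<sigma> decouple:
  \<open>h\<close> and \<open>k\<close> give the fields without \<tau>, while \<open>f\<close> and
  \<open>g\<close> are completed by \<sigma> = 0.\<close>

lemma basis_sep:
  assumes T: "open_interval T" and I: "open_interval I" and s: "s * s = 1" and B: "smooth_on I B"
    and q: "\<And>x. x \<in> I \<Longrightarrow> potq s B x = model_pot \<delta> 0 (- \<kappa>) e x" and e: "e \<noteq> 0 \<Longrightarrow> 0 \<notin> I"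
    and h: "\<And>t. (h has_real_derivative h1 t) (at t)" "\<And>t. (h1 has_real_derivative 4 * \<delta> * h t) (at t)"
    and k: "\<And>t. (k has_real_derivative k1 t) (at t)" "\<And>t. (k1 has_real_derivative 4 * \<delta> * k t) (at t)"
    and f: "\<And>t. (f has_real_derivative f1 t) (at t)" "\<And>t. (f1 has_real_derivative f2 t) (at t)"
      "\<And>t. (f2 has_real_derivative 16 * \<delta> * f1 t) (at t)"
    and g: "\<And>t. (g has_real_derivative g1 t) (at t)" "\<And>t. (g1 has_real_derivative g2 t) (at t)"
      "\<And>t. (g2 has_real_derivative 16 * \<delta> * g1 t) (at t)"
    and w: "\<And>t. f1 t * g2 t - f2 t * g1 t \<noteq> 0" "\<And>t. h t * k1 t - h1 t * k t \<noteq> 0"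
  shows "e = 0 \<Longrightarrow> has_basis (dom3 T I) (ess_algebra T I (\<lambda>_. s) B)
      [vf_dt, vf_udu, vf_P s B h, vf_P s B k, vf_D s B \<kappa> f, vf_D s B \<kappa> g]"
    and "e \<noteq> 0 \<Longrightarrow> has_basis (dom3 T I) (ess_algebra T I (\<lambda>_. s) B) [vf_dt, vf_udu, vf_D s B \<kappa> f, vf_D s B \<kappa> g]"
proof -
  have z: "((\<lambda>_. 0) has_real_derivative 0 * y) (at t)" for t y :: real by simp
  note P = dsol_P[OF h z] dsol_P[OF k z] and D = dsol_D[OF f] dsol_D[OF g]
  have w1: "deriv f t * deriv (deriv g) t - deriv (deriv f) t * deriv g t \<noteq> 0" for t
    unfolding D(3) D(6) unfolding D(2) D(5) by (rule w(1))
  have w2: "h t * deriv k t - deriv h t * k t \<noteq> 0" for t unfolding P by (rule w(2))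
  have "e \<noteq> 0 \<Longrightarrow> (0::real) = 0 \<and> (0::real) = 0" by simp
  note b = essential_basis[OF T I s B q e P(1,3) D(1,4) w1 w2 this]
  show "e = 0 \<Longrightarrow> has_basis (dom3 T I) (ess_algebra T I (\<lambda>_. s) B)
      [vf_dt, vf_udu, vf_P s B h, vf_P s B k, vf_D s B \<kappa> f, vf_D s B \<kappa> g]"
    "e \<noteq> 0 \<Longrightarrow> has_basis (dom3 T I) (ess_algebra T I (\<lambda>_. s) B) [vf_dt, vf_udu, vf_D s B \<kappa> f, vf_D s B \<kappa> g]"
    unfolding vf_dfield(1)[OF s, where r = "- \<kappa>"] vf_dfield(2)[OF s] by (rule b; assumption)+
qed

lemma nu_square:
  assumes "nu_range \<nu>" "\<nu> \<noteq> 1 / 2"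
  shows "Re (\<nu>\<^sup>2) - 1 / 4 \<noteq> 0"
proof
  assume h: "Re (\<nu>\<^sup>2) - 1 / 4 = 0"
  show False
  proof (cases "Im \<nu> = 0 \<and> Re \<nu> \<ge> 0")
    case True
    then have "(Re \<nu>)\<^sup>2 = (1 / 2)\<^sup>2" using h by (simp add: power2_eq_square)
    then have "Re \<nu> = 1 / 2" using True by (metis power2_eq_iff_nonneg zero_le_divide_1_iff zero_le_numeral)
    then show False using True assms(2) by (simp add: complex_eq_iff)
  next
    case False
    then have "Re \<nu> = 0" using assms(1) by (auto simp: nu_range_def)
    then have "- (Im \<nu>)\<^sup>2 - 1 / 4 = 0" using h by (simp add: power2_eq_square)
    then show False using zero_le_power2[of "Im \<nu>"] by linarith
  qed
qed

lemma fields_basis: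
  assumes T: "open_interval T" and L: "listed e I" and s: "s * s = 1"
  shows "has_basis (dom3 T I) (ess_algebra T I (\<lambda>_. s) (B_of s e)) ([vf_dt, vf_udu] @ fields s (B_of s e) e)"
proof -
  have v: "valid_entry e" and I: "open_interval I" using L by (auto simp: listed_def)
  define B where "B = B_of s e"
  obtain sub: "I \<subseteq> entry_dom e" and sm: "smooth_on I B" and q: "\<And>x. x \<in> I \<Longrightarrow> potq s B x = entry_pot e x"
    unfolding B_def by (rule listed_facts[OF L s]) blast
  have qc: "potq s B x = model_pot \<delta> \<beta> r E x" if "coeffs e = (\<delta>, \<beta>, r, E)" "x \<in> I" for \<delta> \<beta> r E x
    using q[OF that(2)] that(1) by (simp add: entry_pot_def)
  have E0: "0 \<notin> I" if "coeffs e = (\<delta>, \<beta>, r, E)" "E \<noteq> 0" for \<delta> \<beta> r E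
    using sub that by (auto simp: entry_dom_def model_dom_def split: if_splits)
  let ?H = "\<lambda>L. has_basis (dom3 T I) (ess_algebra T I (\<lambda>_. s) B) (vf_dt # vf_udu # L)"
  have lin: "E = 0 \<Longrightarrow> ?H [vf_P s B (\<lambda>t. 1), vf_P s B (\<lambda>t. t), vf_D s B \<kappa> (\<lambda>t. t), vf_D s B \<kappa> (\<lambda>t. t\<^sup>2)]"
    "E \<noteq> 0 \<Longrightarrow> ?H [vf_D s B \<kappa> (\<lambda>t. t), vf_D s B \<kappa> (\<lambda>t. t\<^sup>2)]" if c: "coeffs e = (0, 0, - \<kappa>, E)" for \<kappa> E
  proof -
    have d: "((\<lambda>_. 1) has_real_derivative 0) (at t)" "((\<lambda>_. 0) has_real_derivative 4 * 0 * 1) (at t)"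
      "((\<lambda>t. t) has_real_derivative 1) (at t)" "((\<lambda>_. 1) has_real_derivative 4 * 0 * t) (at t)"
      "((\<lambda>t. t) has_real_derivative 1) (at t)" "((\<lambda>_. 1) has_real_derivative 0) (at t)" "((\<lambda>_. 0) has_real_derivative 16 * 0 * 1) (at t)"
      "((\<lambda>t. t\<^sup>2) has_real_derivative 2 * t) (at t)" "((\<lambda>t. 2 * t) has_real_derivative 2) (at t)"
      "((\<lambda>_. 2) has_real_derivative 16 * 0 * (2 * t)) (at t)" for t :: real
      by (auto intro!: derivative_eq_intros)
    have w: "1 * 2 - 0 * (2 * t) \<noteq> 0" "1 * 1 - 0 * t \<noteq> 0" for t :: real by simp_all
    note b = basis_sep[OF T I s sm qc[OF c] E0[OF c] d w]
    show "E = 0 \<Longrightarrow> ?H [vf_P s B (\<lambda>t. 1), vf_P s B (\<lambda>t. t), vf_D s B \<kappa> (\<lambda>t. t), vf_D s B \<kappa> (\<lambda>t. t\<^sup>2)]"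
      "E \<noteq> 0 \<Longrightarrow> ?H [vf_D s B \<kappa> (\<lambda>t. t), vf_D s B \<kappa> (\<lambda>t. t\<^sup>2)]" by (rule b; assumption)+
  qed
  have trig: "E = 0 \<Longrightarrow> ?H [vf_P s B (\<lambda>t. sin (2 * t)), vf_P s B (\<lambda>t. cos (2 * t)), vf_D s B \<kappa> (\<lambda>t. cos (4 * t)), vf_D s B \<kappa> (\<lambda>t. sin (4 * t))]"
    "E \<noteq> 0 \<Longrightarrow> ?H [vf_D s B \<kappa> (\<lambda>t. cos (4 * t)), vf_D s B \<kappa> (\<lambda>t. sin (4 * t))]" if c: "coeffs e = (- 1, 0, - \<kappa>, E)" for \<kappa> E
  proof -
    have d: "((\<lambda>t. sin (2 * t)) has_real_derivative 2 * cos (2 * t)) (at t)" "((\<lambda>t. 2 * cos (2 * t)) has_real_derivative 4 * - 1 * sin (2 * t)) (at t)"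
      "((\<lambda>t. cos (2 * t)) has_real_derivative - 2 * sin (2 * t)) (at t)" "((\<lambda>t. - 2 * sin (2 * t)) has_real_derivative 4 * - 1 * cos (2 * t)) (at t)"
      "((\<lambda>t. cos (4 * t)) has_real_derivative - 4 * sin (4 * t)) (at t)" "((\<lambda>t. - 4 * sin (4 * t)) has_real_derivative - 16 * cos (4 * t)) (at t)"
      "((\<lambda>t. - 16 * cos (4 * t)) has_real_derivative 16 * - 1 * (- 4 * sin (4 * t))) (at t)"
      "((\<lambda>t. sin (4 * t)) has_real_derivative 4 * cos (4 * t)) (at t)" "((\<lambda>t. 4 * cos (4 * t)) has_real_derivative - 16 * sin (4 * t)) (at t)"
      "((\<lambda>t. - 16 * sin (4 * t)) has_real_derivative 16 * - 1 * (4 * cos (4 * t))) (at t)" for t :: real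
      by (auto intro!: derivative_eq_intros)
    have sc: "sin x * sin x + cos x * cos x = 1" for x :: real by (simp flip: power2_eq_square)
    have w: "(- 4 * sin (4 * t)) * (- 16 * sin (4 * t)) - (- 16 * cos (4 * t)) * (4 * cos (4 * t)) \<noteq> 0"
      "sin (2 * t) * (- 2 * sin (2 * t)) - (2 * cos (2 * t)) * cos (2 * t) \<noteq> 0" for t :: real
    proof -
      have "(- 4 * sin (4 * t)) * (- 16 * sin (4 * t)) - (- 16 * cos (4 * t)) * (4 * cos (4 * t))
        = 64 * (sin (4 * t) * sin (4 * t) + cos (4 * t) * cos (4 * t))"
        "sin (2 * t) * (- 2 * sin (2 * t)) - (2 * cos (2 * t)) * cos (2 * t)
        = - 2 * (sin (2 * t) * sin (2 * t) + cos (2 * t) * cos (2 * t))" by algebra+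
      then show "(- 4 * sin (4 * t)) * (- 16 * sin (4 * t)) - (- 16 * cos (4 * t)) * (4 * cos (4 * t)) \<noteq> 0"
        "sin (2 * t) * (- 2 * sin (2 * t)) - (2 * cos (2 * t)) * cos (2 * t) \<noteq> 0" unfolding sc by simp_all
    qed
    note b = basis_sep[OF T I s sm qc[OF c] E0[OF c] d w]
    show "E = 0 \<Longrightarrow> ?H [vf_P s B (\<lambda>t. sin (2 * t)), vf_P s B (\<lambda>t. cos (2 * t)), vf_D s B \<kappa> (\<lambda>t. cos (4 * t)), vf_D s B \<kappa> (\<lambda>t. sin (4 * t))]"
      "E \<noteq> 0 \<Longrightarrow> ?H [vf_D s B \<kappa> (\<lambda>t. cos (4 * t)), vf_D s B \<kappa> (\<lambda>t. sin (4 * t))]"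
      by (rule b; assumption)+
  qed
  have expo: "E = 0 \<Longrightarrow> ?H [vf_P s B (\<lambda>t. exp (2 * t)), vf_P s B (\<lambda>t. exp (- 2 * t)), vf_D s B \<kappa> (\<lambda>t. exp (4 * t)), vf_D s B \<kappa> (\<lambda>t. exp (- 4 * t))]"
    "E \<noteq> 0 \<Longrightarrow> ?H [vf_D s B \<kappa> (\<lambda>t. exp (4 * t)), vf_D s B \<kappa> (\<lambda>t. exp (- 4 * t))]" if c: "coeffs e = (1, 0, - \<kappa>, E)" for \<kappa> E
  proof -
    have ed: "((\<lambda>t. exp (c * t)) has_real_derivative c * exp (c * t)) (at t)" for c t :: real
      by (auto intro!: derivative_eq_intros)
    have ek: "((\<lambda>t. k * exp (c * t)) has_real_derivative k * (c * exp (c * t))) (at t)" for k c t :: real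
      by (rule DERIV_cmult[OF ed])
    have d: "((\<lambda>t. exp (2 * t)) has_real_derivative 2 * exp (2 * t)) (at t)" "((\<lambda>t. 2 * exp (2 * t)) has_real_derivative 4 * 1 * exp (2 * t)) (at t)"
      "((\<lambda>t. exp (- 2 * t)) has_real_derivative - 2 * exp (- 2 * t)) (at t)" "((\<lambda>t. - 2 * exp (- 2 * t)) has_real_derivative 4 * 1 * exp (- 2 * t)) (at t)"
      "((\<lambda>t. exp (4 * t)) has_real_derivative 4 * exp (4 * t)) (at t)" "((\<lambda>t. 4 * exp (4 * t)) has_real_derivative 16 * exp (4 * t)) (at t)"
      "((\<lambda>t. 16 * exp (4 * t)) has_real_derivative 16 * 1 * (4 * exp (4 * t))) (at t)"
      "((\<lambda>t. exp (- 4 * t)) has_real_derivative - 4 * exp (- 4 * t)) (at t)" "((\<lambda>t. - 4 * exp (- 4 * t)) has_real_derivative 16 * exp (- 4 * t)) (at t)"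
      "((\<lambda>t. 16 * exp (- 4 * t)) has_real_derivative 16 * 1 * (- 4 * exp (- 4 * t))) (at t)" for t :: real
      by ((rule ed) | (rule DERIV_cong[OF ek], simp))+
    have ee: "exp (4 * t) * exp (- 4 * t) = 1" "exp (2 * t) * exp (- 2 * t) = 1" for t :: real by (simp_all flip: exp_add)
    have w: "(4 * exp (4 * t)) * (16 * exp (- 4 * t)) - (16 * exp (4 * t)) * (- 4 * exp (- 4 * t)) \<noteq> 0"
      "exp (2 * t) * (- 2 * exp (- 2 * t)) - (2 * exp (2 * t)) * exp (- 2 * t) \<noteq> 0" for t :: real
    proof -
      have "(4 * a) * (16 * b) - (16 * a) * (- 4 * b) = 128 * (a * b)" "c * (- 2 * d) - (2 * c) * d = - 4 * (c * d)"
        for a b c d :: real by simp_all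
      then show "(4 * exp (4 * t)) * (16 * exp (- 4 * t)) - (16 * exp (4 * t)) * (- 4 * exp (- 4 * t)) \<noteq> 0"
        "exp (2 * t) * (- 2 * exp (- 2 * t)) - (2 * exp (2 * t)) * exp (- 2 * t) \<noteq> 0" unfolding ee by simp_all
    qed
    note b = basis_sep[OF T I s sm qc[OF c] E0[OF c] d w]
    show "E = 0 \<Longrightarrow> ?H [vf_P s B (\<lambda>t. exp (2 * t)), vf_P s B (\<lambda>t. exp (- 2 * t)), vf_D s B \<kappa> (\<lambda>t. exp (4 * t)), vf_D s B \<kappa> (\<lambda>t. exp (- 4 * t))]"
      "E \<noteq> 0 \<Longrightarrow> ?H [vf_D s B \<kappa> (\<lambda>t. exp (4 * t)), vf_D s B \<kappa> (\<lambda>t. exp (- 4 * t))]"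
      by (rule b; assumption)+
  qed
  \<comment> \<open>With \<open>\<delta> = 0\<close> and \<open>\<beta> = 1\<close> the functions
    are coupled by \<open>\<sigma>'' = 3 * \<tau>'\<close>. Hence \<tau> = \<open>t\<close> calls
    for \<sigma> = \<open>3 / 2 * t\<^sup>2\<close>, and \<tau> = \<open>t\<^sup>2\<close> for
    \<sigma> = \<open>t ^ 3\<close>; this is the origin of the terms with \<open>vf_Pbar\<close> in
    the last two fields.\<close>
  have airy: "?H [vf_Pbar s B (\<lambda>t. 1), vf_Pbar s B (\<lambda>t. t), (\<lambda>p. vf_D s B 0 (\<lambda>t. t) p + (3 / 2) *\<^sub>R vf_Pbar s B (\<lambda>t. t\<^sup>2) p),
      (\<lambda>p. vf_D s B 0 (\<lambda>t. t\<^sup>2) p + vf_Pbar s B (\<lambda>t. t ^ 3) p)]" if c: "coeffs e = (0, 1, 0, 0)"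
  proof -
    have F: "((\<lambda>t. t) has_real_derivative 1) (at t)" "((\<lambda>t. t\<^sup>2 / 2) has_real_derivative t) (at t)"
      "((\<lambda>t. t ^ 3 / 3) has_real_derivative t\<^sup>2) (at t)" "((\<lambda>t. t ^ 4 / 4) has_real_derivative t ^ 3) (at t)" for t :: real
      by (auto intro!: derivative_eq_intros)
    note a3 = antideriv_DERIV[OF F(3)]
    have a: "(antideriv (\<lambda>_. 1) has_real_derivative 1 * 1) (at t)" "(antideriv (\<lambda>t. t) has_real_derivative 1 * t) (at t)"
      "(antideriv (\<lambda>t. t ^ 3) has_real_derivative 1 * t ^ 3) (at t)" for t :: real
      unfolding mult_1 by (rule antideriv_DERIV[OF F(1)] antideriv_DERIV[OF F(2)] antideriv_DERIV[OF F(4)])+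
    have a': "((\<lambda>t. 3 / 2 * antideriv power2 t) has_real_derivative 1 * (3 / 2 * t\<^sup>2)) (at t)" for t :: real
      using DERIV_cmult[OF a3, of "3 / 2"] by simp
    have z: "((\<lambda>_. c) has_real_derivative 4 * 0 * y) (at t)" for c y t :: real by simp
    have P: "dsol 0 1 (\<lambda>_. 0) (\<lambda>t. 1) (antideriv (\<lambda>t. 1))" "dsol 0 1 (\<lambda>_. 0) (\<lambda>t. t) (antideriv (\<lambda>t. t))"
      by (rule dsol_P[OF DERIV_const z a(1)] dsol_P[OF DERIV_ident z a(2)])+
    have x1: "((\<lambda>t. t) has_real_derivative 1) (at t)" "((\<lambda>_. 1) has_real_derivative 0) (at t)"
      "((\<lambda>_. 0) has_real_derivative 16 * 0 * 1) (at t)" "((\<lambda>t. 3 / 2 * t\<^sup>2) has_real_derivative 3 * t) (at t)"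
      "((\<lambda>t. 3 * t) has_real_derivative 4 * 0 * (3 / 2 * t\<^sup>2) + 3 * 1 * 1) (at t)" for t :: real
      by (auto intro!: derivative_eq_intros)
    have x2: "((\<lambda>t. t\<^sup>2) has_real_derivative 2 * t) (at t)" "((\<lambda>t. 2 * t) has_real_derivative 2) (at t)"
      "((\<lambda>_. 2) has_real_derivative 16 * 0 * (2 * t)) (at t)" "((\<lambda>t. t ^ 3) has_real_derivative 3 * t\<^sup>2) (at t)"
      "((\<lambda>t. 3 * t\<^sup>2) has_real_derivative 4 * 0 * t ^ 3 + 3 * 1 * (2 * t)) (at t)" for t :: real
      by (auto intro!: derivative_eq_intros)
    note D1 = dsolI[OF x1 a'] and D2 = dsolI[OF x2 a(3)]
    have w: "deriv (\<lambda>t. t) t * deriv (deriv (\<lambda>t. t\<^sup>2)) t - deriv (deriv (\<lambda>t. t)) t * deriv (\<lambda>t. t\<^sup>2) t \<noteq> 0"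
      "1 * deriv (\<lambda>t. t) t - deriv (\<lambda>_. 1) t * t \<noteq> 0" for t :: real
      unfolding D1 D2 by simp_all
    have e1: "(\<lambda>p. vf_D s B 0 (\<lambda>t. t) p + (3 / 2) *\<^sub>R vf_Pbar s B (\<lambda>t. t\<^sup>2) p)
        = dfield s 0 B (\<lambda>t. t) (\<lambda>t. 3 / 2 * t\<^sup>2) (\<lambda>t. 3 / 2 * antideriv (\<lambda>t. t\<^sup>2) t)"
    proof (rule ext)
      fix p :: point
      obtain t x u where p: "p = (t, x, u)" by (cases p)
      have "s * (s * a) = a" for a using s by (simp flip: mult.assoc)
      then show "vf_D s B 0 (\<lambda>t. t) p + (3 / 2) *\<^sub>R vf_Pbar s B (\<lambda>t. t\<^sup>2) p
        = dfield s 0 B (\<lambda>t. t) (\<lambda>t. 3 / 2 * t\<^sup>2) (\<lambda>t. 3 / 2 * antideriv (\<lambda>t. t\<^sup>2) t) p"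
        unfolding p vf_D_def vf_Pbar_def vf_P_def dfield_def ess_field_def prod.case D1(3) D1(2,4) D2(3) D2(2,4)
        by (simp add: algebra_simps add_divide_distrib)
    qed
    have e2: "(\<lambda>p. vf_D s B 0 (\<lambda>t. t\<^sup>2) p + vf_Pbar s B (\<lambda>t. t ^ 3) p) = dfield s 0 B (\<lambda>t. t\<^sup>2) (\<lambda>t. t ^ 3) (antideriv (\<lambda>t. t ^ 3))"
    proof (rule ext)
      fix p :: point
      obtain t x u where p: "p = (t, x, u)" by (cases p)
      have "s * (s * a) = a" for a using s by (simp flip: mult.assoc)
      then show "vf_D s B 0 (\<lambda>t. t\<^sup>2) p + vf_Pbar s B (\<lambda>t. t ^ 3) p = dfield s 0 B (\<lambda>t. t\<^sup>2) (\<lambda>t. t ^ 3) (antideriv (\<lambda>t. t ^ 3)) p"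
        unfolding p vf_D_def vf_Pbar_def vf_P_def dfield_def ess_field_def prod.case D1(3) D1(2,4) D2(3) D2(2,4)
        by (simp add: algebra_simps add_divide_distrib)
    qed
    have "(0::real) \<noteq> 0 \<Longrightarrow> 0 \<notin> I" and zz: "\<And>t::real. (0::real) \<noteq> 0 \<Longrightarrow> 3 / 2 * t\<^sup>2 = 0 \<and> t ^ 3 = 0" by simp_all
    note b = essential_basis(1)[OF T I s sm qc[OF c] this(1) P D1(1) D2(1) w zz]
    show ?thesis unfolding e1 e2 unfolding vf_dfield(3)[OF s] by (rule b) simp_all
  qed
  have "?H (fields s B e)"
  proof (cases e)
    case (C1_cos \<alpha>) then show ?thesis using lin(2)[of 0 "- \<alpha>\<^sup>2 - 1 / 4"] v entry_e_nonzero(1)[of \<alpha>] by simp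
  next
    case C1_sqrt then show ?thesis using lin(2)[of 0 "- 1 / 4"] by simp
  next
    case C1_ln then show ?thesis using lin(2)[of 0 "- 1 / 4"] by simp
  next
    case (C1_pow \<alpha> a b) then show ?thesis using lin(2)[of 0 "\<alpha>\<^sup>2 - 1 / 4"] v entry_e_nonzero(2)[of \<alpha>] by simp
  next
    case (C1p_Z \<alpha> a b) then show ?thesis using lin(2)[of 1 "\<alpha>\<^sup>2 - 1 / 4"] v entry_e_nonzero(2)[of \<alpha>] by simp
  next
    case (C1p_Zt \<alpha> a b) then show ?thesis using lin(2)[of 1 "- \<alpha>\<^sup>2 - 1 / 4"] v entry_e_nonzero(1)[of \<alpha>] by simp
  next
    case (C1pp_C \<alpha> a b) then show ?thesis using lin(2)[of "- 1" "\<alpha>\<^sup>2 - 1 / 4"] v entry_e_nonzero(2)[of \<alpha>] by simp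
  next
    case (C1pp_Ct \<alpha> a b) then show ?thesis using lin(2)[of "- 1" "- \<alpha>\<^sup>2 - 1 / 4"] v entry_e_nonzero(1)[of \<alpha>] by simp
  next
    case (C1a \<kappa> \<nu> a b) then show ?thesis using trig(2)[of \<kappa> "Re (\<nu>\<^sup>2) - 1 / 4"] v nu_square[of \<nu>] by simp
  next
    case (C1b \<kappa> \<nu> a b) then show ?thesis using expo(2)[of \<kappa> "Re (\<nu>\<^sup>2) - 1 / 4"] v nu_square[of \<nu>] by simp
  next
    case C2_one then show ?thesis using lin(1)[of 0 0] by simp
  next
    case C2_id then show ?thesis using lin(1)[of 0 0] by simp
  next
    case C2p_cos then show ?thesis using lin(1)[of 1 0] by simp
  next
    case C2pp_exp then show ?thesis using lin(1)[of "- 1" 0] by simp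
  next
    case C2pp_cosh then show ?thesis using lin(1)[of "- 1" 0] by simp
  next
    case C2pp_sinh then show ?thesis using lin(1)[of "- 1" 0] by simp
  next
    case (C2a \<kappa> a b) then show ?thesis using trig(1)[of \<kappa> 0] by simp
  next
    case (C2b \<kappa> a b) then show ?thesis using expo(1)[of \<kappa> 0] by simp
  next
    case (C2c a b) then show ?thesis using airy by simp
  qed
  then show ?thesis by (simp add: B_def)
qed

lemma lin_comb_Cons: "lin_comb (v # vs) c z = c 0 *\<^sub>R v z + lin_comb vs (\<lambda>i. c (Suc i)) z"
  by (simp add: lin_comb_def sum.lessThan_Suc_shift del: sum.lessThan_Suc)

text \<open>Were the third basis field trivial, it would be a combination of the first two; this
  relation, with coefficient \<open>- 1\<close> at index 2, contradicts independence.\<close>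

lemma basis_extends:
  assumes b: "has_basis (dom3 T I) V (vf_dt # vf_udu # v # vs)"
  shows "\<not> V \<subseteq> trivial_fields T I"
proof
  assume V: "V \<subseteq> trivial_fields T I"
  have z: "lin_comb vs (\<lambda>_. 0) p = 0" for p by (simp add: lin_comb_def)
  have "v \<in> V \<longleftrightarrow> (\<exists>c. \<forall>p\<in>dom3 T I. v p = lin_comb (vf_dt # vf_udu # v # vs) c p)"
    by (rule spec[OF conjunct1[OF b[unfolded has_basis_def]]])
  moreover have "\<forall>p\<in>dom3 T I. v p = lin_comb (vf_dt # vf_udu # v # vs) (\<lambda>i. if i = 2 then 1 else 0) p"
    by (simp add: lin_comb_Cons z)
  ultimately have "v \<in> V" by blast
  then obtain c d where v: "\<And>t x u. t \<in> T \<Longrightarrow> x \<in> I \<Longrightarrow> v (t, x, u) = (c, 0, d * u)"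
    using V unfolding trivial_fields_def by blast
  let ?c = "\<lambda>i::nat. if i = 0 then c else if i = 1 then d else if i = 2 then - 1 else 0"
  have "\<forall>p\<in>dom3 T I. lin_comb (vf_dt # vf_udu # v # vs) ?c p = 0"
  proof
    fix p assume "p \<in> dom3 T I"
    then obtain t x u where p: "p = (t, x, u)" "t \<in> T" "x \<in> I" by auto
    show "lin_comb (vf_dt # vf_udu # v # vs) ?c p = 0"
      by (simp add: p(1) v[OF p(2,3)] lin_comb_Cons z vf_dt_def vf_udu_def prod_eq_iff)
  qed
  from mp[OF spec[OF conjunct2[OF b[unfolded has_basis_def]]] this, rule_format, of 2]
  show False by simp
qed

section \<open>Inequivalence\<close>

text \<open>Multiplication by \<open>x\<^sup>2 * (c1 * x + c3)\<^sup>2\<close> makes the relation a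
  polynomial identity on the whole line. Its values at 0 and at \<open>- c3 / c1\<close>, the places
  of the two poles, give \<open>E * c3\<^sup>2 = 0\<close> and \<open>E' * c3\<^sup>2 = 0\<close>.
  In the comparison of the other coefficients the even powers of \<open>c1\<close> are positive, so
  normalised signs agree, and \<open>c1 ^ 3 = 1\<close> leaves only \<open>c1 = 1\<close>.\<close>

lemma coeffs_rigid:
  assumes I: "open_interval I" and c1: "c1 \<noteq> 0"
    and nc: "normal_coeffs \<delta> \<beta> r E" "normal_coeffs \<delta>' \<beta>' r' E'" and b0: "\<beta> \<noteq> 0 \<Longrightarrow> E = 0" "\<beta>' \<noteq> 0 \<Longrightarrow> E' = 0"
    and e0: "E \<noteq> 0 \<Longrightarrow> 0 \<notin> I" and e0': "\<And>x. E' \<noteq> 0 \<Longrightarrow> x \<in> I \<Longrightarrow> c1 * x + c3 \<noteq> 0"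
    and eq: "\<And>x. x \<in> I \<Longrightarrow> model_pot \<delta> \<beta> r E x = c1\<^sup>2 * model_pot \<delta>' \<beta>' r' E' (c1 * x + c3)"
  shows "(\<delta>', \<beta>', r', E') = (\<delta>, \<beta>, r, E)" "\<delta> \<noteq> 0 \<or> r \<noteq> 0 \<Longrightarrow> c1 = 1 \<or> c1 = - 1" "\<delta> \<noteq> 0 \<or> E \<noteq> 0 \<or> \<beta> \<noteq> 0 \<Longrightarrow> c3 = 0" "\<beta> \<noteq> 0 \<Longrightarrow> c1 = 1"
proof -
  let ?p = "[:E, 0, r, \<beta>, \<delta>:] * [:c3, c1:]\<^sup>2 - smult (c1\<^sup>2) ([:0, 0, 1:] * pcompose [:E', 0, r', \<beta>', \<delta>':] [:c3, c1:])"
  have m: "model_pot a b r e z * z\<^sup>2 = a * z ^ 4 + b * z ^ 3 + r * z\<^sup>2 + e" if "e \<noteq> 0 \<longrightarrow> z \<noteq> 0" for a b r e z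
    using that by (cases "z = 0") (auto simp: model_pot_def field_simps eval_nat_numeral)
  have pp: "poly ?p x = (\<delta> * x ^ 4 + \<beta> * x ^ 3 + r * x\<^sup>2 + E) * (c1 * x + c3)\<^sup>2
      - c1\<^sup>2 * (x\<^sup>2 * (\<delta>' * (c1 * x + c3) ^ 4 + \<beta>' * (c1 * x + c3) ^ 3 + r' * (c1 * x + c3)\<^sup>2 + E'))" for x
    by (simp add: poly_pcompose algebra_simps eval_nat_numeral)
  have "?p = 0"
  proof (rule poly_zero_on_interval[OF I])
    fix x assume x: "x \<in> I"
    have h: "E \<noteq> 0 \<longrightarrow> x \<noteq> 0" "E' \<noteq> 0 \<longrightarrow> c1 * x + c3 \<noteq> 0" using e0 e0' x by auto
    note m1 = m[OF h(1)] and m2 = m[OF h(2)]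
    have "poly ?p (x - 0) = model_pot \<delta> \<beta> r E x * x\<^sup>2 * (c1 * x + c3)\<^sup>2
        - c1\<^sup>2 * (x\<^sup>2 * (model_pot \<delta>' \<beta>' r' E' (c1 * x + c3) * (c1 * x + c3)\<^sup>2))"
      by (simp only: m1 m2 pp diff_zero)
    also have "\<dots> = 0" unfolding eq[OF x] by simp
    finally show "poly ?p (x - 0) = 0" .
  qed
  then have pz: "poly ?p x = 0" for x by simp
  have Ec: "E * c3\<^sup>2 = 0" using pz[of 0] unfolding pp by simp
  have Ec': "E' * c3\<^sup>2 = 0"
  proof -
    have z: "c1 * (- c3 / c1) + c3 = 0" using c1 by simp
    show ?thesis using pz[of "- c3 / c1"] c1 unfolding pp z by auto
  qed
  have main: "E = E' \<and> \<delta> = c1 ^ 4 * \<delta>' \<and> \<beta> = c1 ^ 3 * (2 * \<delta>' * c3 + \<beta>') \<and> r = c1\<^sup>2 * (\<delta>' * c3\<^sup>2 + \<beta>' * c3 + r')"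
  proof (cases "c3 = 0")
    case True
    let ?q = "[:E - E', 0, r - c1\<^sup>2 * r', \<beta> - c1 ^ 3 * \<beta>', \<delta> - c1 ^ 4 * \<delta>':]"
    have "?q = 0"
    proof (rule poly_zero_on_interval[of "{1<..<2}"])
      show "open_interval {1<..<2::real}" by (simp add: open_interval_def)
      fix x :: real assume x: "x \<in> {1<..<2}"
      have "poly ?p x = c1\<^sup>2 * x\<^sup>2 * poly ?q x" unfolding pp unfolding True by (simp add: algebra_simps eval_nat_numeral)
      then show "poly ?q (x - 0) = 0" using pz[of x] c1 x by simp
    qed
    then show ?thesis using True by simp
  next
    case False
    then have E: "E = 0" "E' = 0" using Ec Ec' by auto
    let ?q = "[:r - c1\<^sup>2 * (\<delta>' * c3\<^sup>2 + \<beta>' * c3 + r'), \<beta> - c1 ^ 3 * (2 * \<delta>' * c3 + \<beta>'), \<delta> - c1 ^ 4 * \<delta>':]"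
    have "?q = 0"
    proof (rule poly_zero_on_interval[OF I])
      fix x assume x: "x \<in> I"
      show "poly ?q (x - 0) = 0" using eq[OF x] unfolding E model_pot_def by (simp add: algebra_simps eval_nat_numeral)
    qed
    then show ?thesis using E by simp
  qed
  then have mE: "E = E'" and m\<delta>: "\<delta> = c1 ^ 4 * \<delta>'" and m\<beta>: "\<beta> = c1 ^ 3 * (2 * \<delta>' * c3 + \<beta>')"
    and mr: "r = c1\<^sup>2 * (\<delta>' * c3\<^sup>2 + \<beta>' * c3 + r')" by blast+
  have p4: "c1 ^ 4 > 0" and p2: "c1\<^sup>2 > 0" using c1 by simp_all
  have one: "c1 = 1 \<or> c1 = - 1" if "c1 ^ 4 = 1"
  proof -
    have "(c1\<^sup>2 - 1) * (c1\<^sup>2 + 1) = 0" using that by (simp add: algebra_simps eval_nat_numeral)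
    moreover have "c1\<^sup>2 + 1 \<noteq> 0" using p2 by linarith
    ultimately have "c1\<^sup>2 = 1" by simp
    then show ?thesis by (simp add: power2_eq_1_iff)
  qed
  have "\<delta> = 0 \<or> \<delta> = 1 \<or> \<delta> = - 1" "\<delta>' = 0 \<or> \<delta>' = 1 \<or> \<delta>' = - 1" using nc by (auto simp: normal_coeffs_def)
  moreover obtain P where "P > 0" "\<delta> = P * \<delta>'" using m\<delta> p4 by blast
  ultimately have d: "\<delta>' = \<delta>" by auto
  have "(\<delta>', \<beta>', r', E') = (\<delta>, \<beta>, r, E) \<and> (\<delta> \<noteq> 0 \<or> r \<noteq> 0 \<longrightarrow> c1 = 1 \<or> c1 = - 1) \<and> (\<delta> \<noteq> 0 \<or> E \<noteq> 0 \<or> \<beta> \<noteq> 0 \<longrightarrow> c3 = 0) \<and> (\<beta> \<noteq> 0 \<longrightarrow> c1 = 1)"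
  proof (cases "\<delta> = 0")
    case False
    have "c1 ^ 4 * \<delta> = \<delta>" using m\<delta> unfolding d by (rule sym)
    then have c4: "c1 ^ 4 = 1" using False by simp
    have bb: "\<beta> = 0" "\<beta>' = 0" using nc False unfolding d normal_coeffs_def by blast+
    have "c1 ^ 3 * (2 * \<delta> * c3) = 0" using m\<beta> unfolding d bb by simp
    then have c3: "c3 = 0" using c1 False by simp
    have "c1\<^sup>2 = 1" using one[OF c4] by auto
    then have "r = r'" using mr unfolding c3 by simp
    then show ?thesis using one[OF c4] mE d bb c3 by simp
  next
    case True
    have b: "\<beta> = c1 ^ 3 * \<beta>'" "r = c1\<^sup>2 * (\<beta>' * c3 + r')" using m\<beta> mr unfolding d True by simp_all
    show ?thesis
    proof (cases "\<beta> = 0")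
      case False
      then have "\<beta> = 1" "\<beta>' = 1" "r = 0" "r' = 0" using nc b True d by (auto simp: normal_coeffs_def)
      moreover have "c1 ^ 3 = 1" using b calculation by simp
      moreover have "c1 = 1"
      proof -
        have "(c1 - 1) * (c1\<^sup>2 + c1 + 1) = 0" using \<open>c1 ^ 3 = 1\<close> by (simp add: algebra_simps eval_nat_numeral)
        moreover have "c1\<^sup>2 + c1 + 1 > 0"
        proof -
          have "c1\<^sup>2 + c1 + 1 = (c1 + 1 / 2)\<^sup>2 + 3 / 4" by (simp add: power2_eq_square algebra_simps)
          then show ?thesis using zero_le_power2[of "c1 + 1 / 2"] by linarith
        qed
        ultimately show ?thesis by simp
      qed
      ultimately show ?thesis using b mE d True c1 by auto
    next
      case b0: True
      then have b': "\<beta>' = 0" using b c1 by simp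
      then have r: "r = c1\<^sup>2 * r'" using b by simp
      have rs: "r = 0 \<or> r = 1 \<or> r = - 1" "r' = 0 \<or> r' = 1 \<or> r' = - 1"
        using nc[unfolded d True b0 b' normal_coeffs_def] by auto
      define P where "P = c1\<^sup>2"
      have P: "P > 0" "r = P * r'" using r p2 by (simp_all add: P_def)
      have rr: "r' = r" using rs P by (elim disjE) simp_all
      have "c1 = 1 \<or> c1 = - 1" if "r \<noteq> 0"
      proof -
        have "P = 1" using P(2) that unfolding rr by simp
        then show ?thesis unfolding P_def by (simp add: power2_eq_1_iff)
      qed
      moreover have "c3 = 0" if "E \<noteq> 0" using Ec that by simp
      ultimately show ?thesis using mE d True b0 b' rr by simp
    qed
  qed
  then show "(\<delta>', \<beta>', r', E') = (\<delta>, \<beta>, r, E)" "\<delta> \<noteq> 0 \<or> r \<noteq> 0 \<Longrightarrow> c1 = 1 \<or> c1 = - 1"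
    "\<delta> \<noteq> 0 \<or> E \<noteq> 0 \<or> \<beta> \<noteq> 0 \<Longrightarrow> c3 = 0" "\<beta> \<noteq> 0 \<Longrightarrow> c1 = 1" by blast+
qed

text \<open>A group is either one constructor or a set of parameter-free functions that solve the
  same equation; the latter, numbered 2, 10 and 12, must be told apart by the functions
  themselves.\<close>

fun entry_group :: "entry \<Rightarrow> nat" where
  "entry_group (C1_cos _) = 1" | "entry_group C1_sqrt = 2" | "entry_group C1_ln = 2" | "entry_group (C1_pow _ _ _) = 3"
| "entry_group (C1p_Z _ _ _) = 4" | "entry_group (C1p_Zt _ _ _) = 5" | "entry_group (C1pp_C _ _ _) = 6"
| "entry_group (C1pp_Ct _ _ _) = 7" | "entry_group (C1a _ _ _ _) = 8" | "entry_group (C1b _ _ _ _) = 9"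
| "entry_group C2_one = 10" | "entry_group C2_id = 10" | "entry_group C2p_cos = 11" | "entry_group C2pp_exp = 12"
| "entry_group C2pp_cosh = 12" | "entry_group C2pp_sinh = 12" | "entry_group (C2a _ _ _) = 13"
| "entry_group (C2b _ _ _) = 14" | "entry_group (C2c _ _) = 15"

text \<open>Shows that the group is determined by the coefficients and hence shared by equivalent
  entries. The thresholds 0 and \<open>- 1 / 4\<close> of \<open>E\<close> are the orders
  \<open>1 / 2\<close> and 0.\<close>

lemma entry_group_coeffs:
  assumes "valid_entry e"
  shows "entry_group e = (case coeffs e of (\<delta>, \<beta>, r, E) \<Rightarrow>
    if \<beta> = 1 then 15 else if \<delta> = - 1 then (if E = 0 then 13 else 8) else if \<delta> = 1 then (if E = 0 then 14 else 9)
    else if r = 0 then (if E = 0 then 10 else if E = - 1 / 4 then 2 else if E < - 1 / 4 then 1 else 3)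
    else if r = - 1 then (if E = 0 then 11 else if E < - 1 / 4 then 5 else 4)
    else (if E = 0 then 12 else if E < - 1 / 4 then 7 else 6))"
proof (cases e)
  case (C1_cos \<alpha>)
  then show ?thesis using assms entry_e_nonzero(1)[of \<alpha>] by simp
next
  case C1_sqrt
  then show ?thesis using assms  by simp
next
  case C1_ln
  then show ?thesis using assms  by simp
next
  case (C1_pow \<alpha> a b)
  then show ?thesis using assms entry_e_nonzero(2)[of \<alpha>] by simp
next
  case (C1p_Z \<alpha> a b)
  then show ?thesis using assms entry_e_nonzero(2)[of \<alpha>] by simp
next
  case (C1p_Zt \<alpha> a b)
  then show ?thesis using assms entry_e_nonzero(1)[of \<alpha>] by simp
next
  case (C1pp_C \<alpha> a b)
  then show ?thesis using assms entry_e_nonzero(2)[of \<alpha>] by simp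
next
  case (C1pp_Ct \<alpha> a b)
  then show ?thesis using assms entry_e_nonzero(1)[of \<alpha>] by simp
next
  case (C1a \<kappa> \<nu> a b)
  then show ?thesis using assms nu_square[of \<nu>] by simp
next
  case (C1b \<kappa> \<nu> a b)
  then show ?thesis using assms nu_square[of \<nu>] by simp
qed (auto simp: power2_eq_square)

lemma nu_inj:
  assumes "nu_range \<nu>" "nu_range \<mu>" "Re (\<nu>\<^sup>2) = Re (\<mu>\<^sup>2)"
  shows "\<nu> = \<mu>"
proof -
  have s: "Re (z\<^sup>2) = (Re z)\<^sup>2 - (Im z)\<^sup>2" for z by (simp add: power2_eq_square)
  have c: "(Im z = 0 \<and> Re z \<ge> 0 \<and> Re (z\<^sup>2) \<ge> 0 \<and> Re z = sqrt (Re (z\<^sup>2))) \<or> (Re z = 0 \<and> Im z > 0 \<and> Re (z\<^sup>2) < 0 \<and> Im z = sqrt (- Re (z\<^sup>2)))"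
    if "nu_range z" for z using that unfolding nu_range_def s by (elim disjE conjE) simp_all
  have "Re \<nu> = Re \<mu> \<and> Im \<nu> = Im \<mu>"
    using c[OF assms(1)] c[OF assms(2)] unfolding assms(3) by (elim disjE conjE; intro conjI; linarith)
  then show ?thesis by (simp add: complex_eq_iff)
qed

lemma family_proportional:
  assumes F: "family D q F" and I: "open_interval I" "I \<subseteq> D" and c: "c \<noteq> 0" and eq: "\<And>x. x \<in> I \<Longrightarrow> F a' b' x = c * F a b x"
  shows "proportional a b a' b'"
proof -
  have "F a' b' x = F (c * a) (c * b) x" if "x \<in> I" for x
    using eq[OF that] family_scale[OF F] I(2) that by (metis subsetD)
  from family_unique[OF F I this] show ?thesis unfolding proportional_def using c by blast
qed

text \<open>Equivalence of the drifts is equality of logarithmic derivatives, so the two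
  \<open>W\<close> differ by the affine map and a constant factor \<open>l\<close>. The potentials
  are then related as in \<open>coeffs_rigid\<close>, which leaves little freedom in
  \<open>c1\<close> and \<open>c3\<close>; the coefficients are compared within one family.\<close>

lemma listed_equiv_same:
  assumes L: "listed e I" and L': "listed e' I'" and s: "s * s = 1" and eq: "equiv_K I (B_of s e) I' (B_of s e')"
  shows "same_entry e e'"
proof -
  have v: "valid_entry e" "valid_entry e'" and I: "open_interval I"
    and W0: "\<And>x. x \<in> I \<Longrightarrow> W_of e x \<noteq> 0" "\<And>x. x \<in> I' \<Longrightarrow> W_of e' x \<noteq> 0" using L L' by (auto simp: listed_def)
  have s0: "s \<noteq> 0" using s by auto
  note oI = open_intervalD(1)[OF I]
  obtain x0 where x0: "x0 \<in> I" using open_intervalD(3)[OF I] by blast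
  obtain c1 c3 where c1: "c1 \<noteq> 0" and I': "I' = (\<lambda>x. c1 * x + c3) ` I"
    and Beq: "\<forall>x\<in>I. B_of s e' (c1 * x + c3) = B_of s e x / c1"
    using eq[unfolded equiv_K_def] by (elim exE conjE) (rule that)
  obtain V where 1: "I \<subseteq> entry_dom e" "sol I (entry_pot e) (W_of e) V" "\<And>x. x \<in> I \<Longrightarrow> B_of s e x = 2 * s * V x / W_of e x"
    "smooth_on I (B_of s e)" "\<And>x. x \<in> I \<Longrightarrow> potq s (B_of s e) x = entry_pot e x" by (rule listed_facts[OF L s]) blast
  obtain V' where 2: "I' \<subseteq> entry_dom e'" "sol I' (entry_pot e') (W_of e') V'" "\<And>x. x \<in> I' \<Longrightarrow> B_of s e' x = 2 * s * V' x / W_of e' x"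
    "smooth_on I' (B_of s e')" "\<And>x. x \<in> I' \<Longrightarrow> potq s (B_of s e') x = entry_pot e' x" by (rule listed_facts[OF L' s]) blast
  have zI: "c1 * x + c3 \<in> I'" if "x \<in> I" for x using that I' by blast
  have dl: "((\<lambda>x. c1 * x + c3) has_real_derivative c1) (at x)" for x by (auto intro!: derivative_eq_intros)
  have q: "entry_pot e x = c1\<^sup>2 * entry_pot e' (c1 * x + c3)" if x: "x \<in> I" for x
  proof -
    have "((\<lambda>x. c1 * B_of s e' (c1 * x + c3)) has_real_derivative c1 * (deriv (B_of s e') (c1 * x + c3) * c1)) (at x)"
      by (rule DERIV_cmult[OF DERIV_chain2[OF smooth_on_DERIV[OF 2(4) zI[OF x]] dl]])
    then have "(B_of s e has_real_derivative c1 * (deriv (B_of s e') (c1 * x + c3) * c1)) (at x)"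
      by (rule has_field_derivative_transform_within_open[OF _ oI x]) (use Beq c1 in simp)
    then have d: "deriv (B_of s e) x = c1 * (deriv (B_of s e') (c1 * x + c3) * c1)" by (rule DERIV_imp_deriv)
    have b: "B_of s e x = c1 * B_of s e' (c1 * x + c3)" using bspec[OF Beq x] c1 by simp
    show ?thesis unfolding 1(5)[OF x, symmetric] 2(5)[OF zI[OF x], symmetric] potq_def d b
      by (simp add: power2_eq_square algebra_simps)
  qed
  have quot: "W_of e' (c1 * x + c3) / W_of e x = W_of e' (c1 * x0 + c3) / W_of e x0" if "x \<in> I" for x
  proof (rule DERIV_zero_interval[OF I _ that x0, of "\<lambda>x. W_of e' (c1 * x + c3) / W_of e x"])
    fix x assume x: "x \<in> I"
    let ?z = "c1 * x + c3"
    have dW: "(W_of e has_real_derivative V x) (at x)" "(W_of e' has_real_derivative V' ?z) (at ?z)"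
      using 1(2) 2(2) x zI[OF x] by (simp_all add: sol_def has_real_derivative_iff_has_vector_derivative)
    have "2 * s * V' ?z / W_of e' ?z = 2 * s * V x / W_of e x / c1"
      using bspec[OF Beq x] unfolding 1(3)[OF x] 2(3)[OF zI[OF x]] .
    then have k: "V' ?z * c1 * W_of e x = V x * W_of e' ?z"
      using s0 c1 W0(1)[OF x] W0(2)[OF zI[OF x]] by (simp add: field_simps)
    have "((\<lambda>x. W_of e' (c1 * x + c3) / W_of e x) has_real_derivative
      (V' ?z * c1 * W_of e x - W_of e' ?z * V x) / (W_of e x * W_of e x)) (at x)"
      by (rule DERIV_divide[OF DERIV_chain2[OF dW(2) dl] dW(1) W0(1)[OF x]])
    then show "((\<lambda>x. W_of e' (c1 * x + c3) / W_of e x) has_real_derivative 0) (at x)"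
      unfolding k by (simp add: mult.commute)
  qed
  define l where "l = W_of e' (c1 * x0 + c3) / W_of e x0"
  have l: "W_of e' (c1 * x + c3) = l * W_of e x" if "x \<in> I" for x
    using quot[OF that, folded l_def] W0(1)[OF that] by (simp add: divide_eq_eq)
  have ln: "l \<noteq> 0" unfolding l_def using W0(1)[OF x0] W0(2)[OF zI[OF x0]] by simp
  obtain \<delta> \<beta> r E where ce: "coeffs e = (\<delta>, \<beta>, r, E)" by (cases "coeffs e")
  obtain \<delta>' \<beta>' r' E' where ce': "coeffs e' = (\<delta>', \<beta>', r', E')" by (cases "coeffs e'")
  have nc: "normal_coeffs \<delta> \<beta> r E" if "coeffs f = (\<delta>, \<beta>, r, E)" for f \<delta> \<beta> r E
    using that by (cases f) (auto simp: normal_coeffs_def)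
  have b0: "E = 0" if "coeffs f = (\<delta>, \<beta>, r, E)" "\<beta> \<noteq> 0" for f \<delta> \<beta> r E
    using that by (cases f) auto
  have E0: "0 \<notin> J" if "coeffs f = (\<delta>, \<beta>, r, E)" "J \<subseteq> entry_dom f" "E \<noteq> 0" for f \<delta> \<beta> r E J
    using that by (auto simp: entry_dom_def model_dom_def split: if_splits)
  have nz: "c1 * x + c3 \<noteq> 0" if "E' \<noteq> 0" "x \<in> I" for x using E0[OF ce' 2(1) that(1)] zI[OF that(2)] by auto
  have qm: "model_pot \<delta> \<beta> r E x = c1\<^sup>2 * model_pot \<delta>' \<beta>' r' E' (c1 * x + c3)" if "x \<in> I" for x
    using q[OF that] by (simp add: entry_pot_def ce ce')
  have rig: "(\<delta>', \<beta>', r', E') = (\<delta>, \<beta>, r, E)" "\<delta> \<noteq> 0 \<or> r \<noteq> 0 \<Longrightarrow> c1 = 1 \<or> c1 = - 1"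
    "\<delta> \<noteq> 0 \<or> E \<noteq> 0 \<or> \<beta> \<noteq> 0 \<Longrightarrow> c3 = 0" "\<beta> \<noteq> 0 \<Longrightarrow> c1 = 1"
    by (rule coeffs_rigid[OF I c1 nc[OF ce] nc[OF ce'] b0[OF ce] b0[OF ce'] E0[OF ce 1(1)] nz qm]; assumption)+
  have cc: "coeffs e' = coeffs e" using rig(1) ce ce' by simp
  have gg: "entry_group e' = entry_group e" unfolding entry_group_coeffs[OF v(1)] entry_group_coeffs[OF v(2)] cc ..
  have dom: "I \<subseteq> - {0}" if "E \<noteq> 0 \<or> \<delta> \<noteq> 0" using 1(1) that by (auto simp: entry_dom_def ce model_dom_def split: if_splits)
  \<comment> \<open>Here \<open>c3 = 0\<close> and \<open>c1\<close> is 1 or - 1, and a function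
    even in \<open>x\<close> does not see the reflection.\<close>
  have even: "f x = l * W_of e x"
    if "(\<delta> \<noteq> 0 \<or> r \<noteq> 0) \<and> (\<delta> \<noteq> 0 \<or> E \<noteq> 0)" "W_of e' = f" "\<And>x. f (- x) = f x" "x \<in> I" for f x
  proof -
    have "c3 = 0" "c1 = 1 \<or> c1 = - 1" using rig(2,3) that(1) by blast+
    then show ?thesis using l[OF that(4)] that(3)[of x] unfolding that(2) by (elim disjE) simp_all
  qed
  note fprop = family_proportional[OF _ I _ ln]
  \<comment> \<open>The product of the coefficients of \<open>exp x\<close> and
    \<open>exp (- x)\<close> is invariant under translation and reflection and is multiplied by
    \<open>l\<^sup>2\<close> under scaling of \<open>W\<close>. Its sign separates the exponential
    from the hyperbolic cosine and sine.\<close>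
  have expo: "same_entry e e'" if g: "entry_group e = 12"
  proof -
    have R: "\<exists>A B. (\<forall>x. W_of f x = A * exp x + B * exp (- x)) \<and> A * B = (if f = C2pp_exp then 0 else if f = C2pp_cosh then 1 / 4 else - 1 / 4)"
      if "f = C2pp_exp \<or> f = C2pp_cosh \<or> f = C2pp_sinh" for f
      using that
    proof (elim disjE)
      show ?thesis if "f = C2pp_exp" using that by (intro exI[of _ 1] exI[of _ 0]) simp
      show ?thesis if "f = C2pp_cosh" using that by (intro exI[of _ "1 / 2"] exI[of _ "1 / 2"]) (simp add: cosh_field_def add_divide_distrib)
      show ?thesis if "f = C2pp_sinh" using that by (intro exI[of _ "1 / 2"] exI[of _ "- 1 / 2"]) (simp add: sinh_field_def diff_divide_distrib)
    qed
    have ee: "e = C2pp_exp \<or> e = C2pp_cosh \<or> e = C2pp_sinh" using g by (cases e) auto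
    have ee': "e' = C2pp_exp \<or> e' = C2pp_cosh \<or> e' = C2pp_sinh" using g gg by (cases e') auto
    obtain A B where A: "\<And>x. W_of e x = A * exp x + B * exp (- x)"
      "A * B = (if e = C2pp_exp then 0 else if e = C2pp_cosh then 1 / 4 else - 1 / 4)" using R[OF ee] by blast
    obtain A' B' where A': "\<And>x. W_of e' x = A' * exp x + B' * exp (- x)"
      "A' * B' = (if e' = C2pp_exp then 0 else if e' = C2pp_cosh then 1 / 4 else - 1 / 4)" using R[OF ee'] by blast
    have "r \<noteq> 0" using ee ce by auto
    then consider "c1 = 1" | "c1 = - 1" using rig(2) by blast
    then have "A' * B' = l\<^sup>2 * (A * B)"
    proof cases
      case 1
      have "A' * exp c3 * exp x + B' * exp (- c3) * exp (- x) = l * A * exp x + l * B * exp (- x)" if "x \<in> I" for x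
        using l[OF that] unfolding A A' 1 by (simp add: exp_add exp_diff exp_minus field_simps)
      from family_unique[OF families(12) I subset_UNIV this]
      have "A' * exp c3 = l * A" "B' * exp (- c3) = l * B" by blast+
      then have "(A' * exp c3) * (B' * exp (- c3)) = (l * A) * (l * B)" by (simp only:)
      then have "A' * B' * (exp c3 * exp (- c3)) = l\<^sup>2 * (A * B)" by (simp only: power2_eq_square mult_ac)
      then show ?thesis by (simp flip: exp_add)
    next
      case 2
      have "B' * exp (- c3) * exp x + A' * exp c3 * exp (- x) = l * A * exp x + l * B * exp (- x)" if "x \<in> I" for x
        using l[OF that] unfolding A A' 2 by (simp add: exp_add exp_diff exp_minus field_simps)
      from family_unique[OF families(12) I subset_UNIV this]
      have "B' * exp (- c3) = l * A" "A' * exp c3 = l * B" by blast+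
      then have "(B' * exp (- c3)) * (A' * exp c3) = (l * A) * (l * B)" by (simp only:)
      then have "A' * B' * (exp c3 * exp (- c3)) = l\<^sup>2 * (A * B)" by (simp only: power2_eq_square mult_ac)
      then show ?thesis by (simp flip: exp_add)
    qed
    moreover have "l\<^sup>2 > 0" using ln by simp
    ultimately have K: "l\<^sup>2 > 0" "A' * B' = l\<^sup>2 * (A * B)" by blast+
    define K where "K = l\<^sup>2"
    show ?thesis using ee ee' A(2) A'(2) K[folded K_def] by auto
  qed
  show ?thesis
  proof (cases e)
    case (C1_cos \<alpha>)
    then obtain \<alpha>' where e': "e' = C1_cos \<alpha>'" using gg by (cases e') auto
    then show ?thesis using C1_cos cc v by simp
  next
    case C1_sqrt
    have c3: "c3 = 0" using rig(3) ce C1_sqrt by simp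
    have False if e': "e' = C1_ln"
    proof -
      have "sqrt \<bar>x\<bar> * (sqrt \<bar>c1\<bar> * ln \<bar>c1\<bar> + sqrt \<bar>c1\<bar> * ln \<bar>x\<bar>) = sqrt \<bar>x\<bar> * (l + 0 * ln \<bar>x\<bar>)" if "x \<in> I" for x
        using l[OF that] dom ce C1_sqrt that c1 c3 by (auto simp: e' abs_mult real_sqrt_mult ln_mult algebra_simps)
      from family_unique[OF families(2) I dom this] ce C1_sqrt show False using c1 by simp
    qed
    moreover have "e' = C1_sqrt \<or> e' = C1_ln" using gg C1_sqrt by (cases e') auto
    ultimately show ?thesis using C1_sqrt by auto
  next
    case C1_ln
    have c3: "c3 = 0" using rig(3) ce C1_ln by simp
    have False if e': "e' = C1_sqrt"
    proof -
      have "sqrt \<bar>x\<bar> * (sqrt \<bar>c1\<bar> + 0 * ln \<bar>x\<bar>) = sqrt \<bar>x\<bar> * (0 + l * ln \<bar>x\<bar>)" if "x \<in> I" for x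
        using l[OF that] by (simp add: e' C1_ln c3 abs_mult real_sqrt_mult algebra_simps)
      from family_unique[OF families(2) I dom this] ce C1_ln show False using c1 by simp
    qed
    moreover have "e' = C1_sqrt \<or> e' = C1_ln" using gg C1_ln by (cases e') auto
    ultimately show ?thesis using C1_ln by auto
  next
    case (C1_pow \<alpha> a b)
    then obtain \<alpha>' a' b' where e': "e' = C1_pow \<alpha>' a' b'" using gg by (cases e') auto
    have \<alpha>: "\<alpha>' = \<alpha>" "\<alpha> > 0" "E \<noteq> 0" using cc v ce C1_pow entry_e_nonzero(2)[of \<alpha>] by (auto simp: e')
    have c3: "c3 = 0" using rig(3) \<alpha> by simp
    \<comment> \<open>The dilation multiplies the coefficients by \<open>k powr \<alpha>\<close> and
      \<open>k powr (- \<alpha>)\<close> besides a common factor. Solving for \<open>a'\<close> and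
      \<open>b'\<close> inverts these powers, so the witness for \<open>same_entry\<close> is
      \<open>inverse k\<close>.\<close>
    define k where "k = \<bar>c1\<bar>"
    have k: "k > 0" using c1 by (simp add: k_def)
    have "W_of (C1_pow \<alpha> (sqrt k * k powr \<alpha> * a') (sqrt k * k powr (- \<alpha>) * b')) x = l * W_of (C1_pow \<alpha> a b) x" if "x \<in> I" for x
      using l[OF that] unfolding e' C1_pow \<alpha>(1) c3
      by (simp add: abs_mult real_sqrt_mult powr_mult algebra_simps k_def)
    from fprop[OF families(3)[OF \<alpha>(2)] dom this] \<alpha>(3)
    obtain c where c: "c \<noteq> 0" "sqrt k * k powr \<alpha> * a' = c * a" "sqrt k * k powr (- \<alpha>) * b' = c * b"
      by (auto simp: proportional_def)
    have p: "k powr \<alpha> * k powr (- \<alpha>) = 1" using k by (simp flip: powr_add)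
    have ab: "a' = c / sqrt k * (a * k powr (- \<alpha>))" "b' = c / sqrt k * (b * k powr \<alpha>)"
    proof -
      have "c * a * k powr (- \<alpha>) = sqrt k * a' * (k powr \<alpha> * k powr (- \<alpha>))" unfolding c(2)[symmetric] by simp
      then show "a' = c / sqrt k * (a * k powr (- \<alpha>))" unfolding p using k by (simp add: field_simps)
      have "c * b * k powr \<alpha> = sqrt k * b' * (k powr \<alpha> * k powr (- \<alpha>))" unfolding c(3)[symmetric] by simp
      then show "b' = c / sqrt k * (b * k powr \<alpha>)" unfolding p using k by (simp add: field_simps)
    qed
    have ik: "inverse k powr \<alpha> = k powr (- \<alpha>)" "inverse k powr (- \<alpha>) = k powr \<alpha>"
      using k by (simp_all add: powr_minus powr_divide inverse_eq_divide)
    have "proportional (a * inverse k powr \<alpha>) (b * inverse k powr (- \<alpha>)) a' b'"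
      unfolding proportional_def ik using ab c(1) k by (intro exI[of _ "c / sqrt k"]) simp
    then show ?thesis using k unfolding C1_pow e' \<alpha>(1) by (auto intro!: exI[of _ "inverse k"])
  next
    case (C1p_Z \<alpha> a b)
    then obtain \<alpha>' a' b' where e': "e' = C1p_Z \<alpha>' a' b'" using gg by (cases e') auto
    have \<alpha>: "\<alpha>' = \<alpha>" "\<alpha> \<ge> 0" "E \<noteq> 0" "r \<noteq> 0" using cc v ce C1p_Z entry_e_nonzero(2)[of \<alpha>] by (auto simp: e')
    have "W_of e' x = l * W_of e x" if "x \<in> I" for x
      by (rule even[OF _ refl _ that]) (use \<alpha> in \<open>auto simp: e'\<close>)
    from fprop[OF families(4)[OF \<alpha>(2)] dom this[unfolded e' C1p_Z \<alpha>(1)]] have "proportional a b a' b'" using \<alpha>(3) by simp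
    then show ?thesis using e' C1p_Z \<alpha> by simp
  next
    case (C1p_Zt \<alpha> a b)
    then obtain \<alpha>' a' b' where e': "e' = C1p_Zt \<alpha>' a' b'" using gg by (cases e') auto
    have \<alpha>: "\<alpha>' = \<alpha>" "\<alpha> > 0" "E \<noteq> 0" "r \<noteq> 0" using cc v ce C1p_Zt entry_e_nonzero(1)[of \<alpha>] by (auto simp: e')
    have "W_of e' x = l * W_of e x" if "x \<in> I" for x
      by (rule even[OF _ refl _ that]) (use \<alpha> in \<open>auto simp: e'\<close>)
    from fprop[OF families(5)[OF \<alpha>(2)] dom this[unfolded e' C1p_Zt \<alpha>(1)]] have "proportional a b a' b'" using \<alpha>(3) by simp
    then show ?thesis using e' C1p_Zt \<alpha> by simp
  next
    case (C1pp_C \<alpha> a b)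
    then obtain \<alpha>' a' b' where e': "e' = C1pp_C \<alpha>' a' b'" using gg by (cases e') auto
    have \<alpha>: "\<alpha>' = \<alpha>" "\<alpha> \<ge> 0" "E \<noteq> 0" "r \<noteq> 0" using cc v ce C1pp_C entry_e_nonzero(2)[of \<alpha>] by (auto simp: e')
    have "W_of e' x = l * W_of e x" if "x \<in> I" for x
      by (rule even[OF _ refl _ that]) (use \<alpha> in \<open>auto simp: e'\<close>)
    from fprop[OF families(6)[OF \<alpha>(2)] dom this[unfolded e' C1pp_C \<alpha>(1)]] have "proportional a b a' b'" using \<alpha>(3) by simp
    then show ?thesis using e' C1pp_C \<alpha> by simp
  next
    case (C1pp_Ct \<alpha> a b)
    then obtain \<alpha>' a' b' where e': "e' = C1pp_Ct \<alpha>' a' b'" using gg by (cases e') auto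
    have \<alpha>: "\<alpha>' = \<alpha>" "\<alpha> > 0" "E \<noteq> 0" "r \<noteq> 0" using cc v ce C1pp_Ct entry_e_nonzero(1)[of \<alpha>] by (auto simp: e')
    have "W_of e' x = l * W_of e x" if "x \<in> I" for x
      by (rule even[OF _ refl _ that]) (use \<alpha> in \<open>auto simp: e'\<close>)
    from fprop[OF families(7)[OF \<alpha>(2)] dom this[unfolded e' C1pp_Ct \<alpha>(1)]] have "proportional a b a' b'" using \<alpha>(3) by simp
    then show ?thesis using e' C1pp_Ct \<alpha> by simp
  next
    case (C1a \<kappa> \<nu> a b)
    then obtain \<kappa>' \<nu>' a' b' where e': "e' = C1a \<kappa>' \<nu>' a' b'" using gg by (cases e') auto
    have \<nu>: "nu_range \<nu>" "nu_range \<nu>'" "Re (\<nu>\<^sup>2) = Re (\<nu>'\<^sup>2)" "\<kappa>' = \<kappa>" "\<delta> \<noteq> 0" using cc v ce C1a by (auto simp: e')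
    note \<nu>\<nu> = nu_inj[OF \<nu>(1-3), symmetric]
    have "W_of e' x = l * W_of e x" if "x \<in> I" for x
      by (rule even[OF _ refl _ that]) (use \<nu> in \<open>auto simp: e' whit_comb_trig_def\<close>)
    from fprop[OF families(8)[OF \<nu>(1), of \<kappa>] dom this[unfolded e' C1a W_of.simps \<nu>\<nu> \<nu>(4)]]
    have "proportional a b a' b'" using \<nu>(5) by simp
    then show ?thesis using e' C1a \<nu> \<nu>\<nu> by simp
  next
    case (C1b \<kappa> \<nu> a b)
    then obtain \<kappa>' \<nu>' a' b' where e': "e' = C1b \<kappa>' \<nu>' a' b'" using gg by (cases e') auto
    have \<nu>: "nu_range \<nu>" "nu_range \<nu>'" "Re (\<nu>\<^sup>2) = Re (\<nu>'\<^sup>2)" "\<kappa>' = \<kappa>" "\<delta> \<noteq> 0" using cc v ce C1b by (auto simp: e')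
    note \<nu>\<nu> = nu_inj[OF \<nu>(1-3), symmetric]
    \<comment> \<open>The coefficients are complex, so the comparison takes place in the complex
      family; validity identifies its members with the real functions \<open>W_of\<close>.\<close>
    have re: "whit_comb_exp \<kappa> (\<nu> / 2) a b x = of_real (W_of e x)" "whit_comb_exp \<kappa> (\<nu> / 2) a' b' x = of_real (W_of e' x)" if "x \<noteq> 0" for x
      using v that by (auto simp: C1b e' \<nu>\<nu> \<nu>(4) of_real_Re)
    have "W_of e' x = l * W_of e x" if "x \<in> I" for x
      by (rule even[OF _ refl _ that]) (use \<nu> in \<open>auto simp: e' whit_comb_exp_def\<close>)
    note WW = this
    have "whit_comb_exp \<kappa> (\<nu> / 2) a' b' x = of_real l * whit_comb_exp \<kappa> (\<nu> / 2) a b x" if "x \<in> I" for x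
    proof -
      have x0: "x \<noteq> 0" using dom \<nu>(5) that by auto
      show ?thesis unfolding re[OF x0] WW[OF that] by simp
    qed
    from family_proportional[OF families(9)[OF \<nu>(1), of \<kappa>] I dom _ this] have "proportional a b a' b'" using \<nu>(5) ln by simp
    then show ?thesis using e' C1b \<nu> \<nu>\<nu> by simp
  next
    case C2_one
    have False if e': "e' = C2_id"
    proof -
      have "c3 + c1 * x = l + 0 * x" if "x \<in> I" for x using l[OF that] by (simp add: e' C2_one)
      from family_unique[OF families(10) I subset_UNIV this] show False using c1 by simp
    qed
    moreover have "e' = C2_one \<or> e' = C2_id" using gg C2_one by (cases e') auto
    ultimately show ?thesis using C2_one by auto
  next
    case C2_id
    have False if e': "e' = C2_one"
    proof -
      have "1 + 0 * x = 0 + l * x" if "x \<in> I" for x using l[OF that] by (simp add: e' C2_id)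
      from family_unique[OF families(10) I subset_UNIV this] show False by simp
    qed
    moreover have "e' = C2_one \<or> e' = C2_id" using gg C2_id by (cases e') auto
    ultimately show ?thesis using C2_id by auto
  next
    case C2p_cos
    then have "e' = C2p_cos" using gg by (cases e') auto
    then show ?thesis using C2p_cos by simp
  next
    case (C2a \<kappa> a b)
    then obtain \<kappa>' a' b' where e': "e' = C2a \<kappa>' a' b'" using gg by (cases e') auto
    have \<nu>: "\<kappa>' = \<kappa>" "\<delta> \<noteq> 0" using cc ce C2a by (auto simp: e')
    have "W_of e' x = l * W_of e x" if "x \<in> I" for x
      by (rule even[OF _ refl _ that]) (use \<nu> in \<open>auto simp: e' whit_comb_trig_def\<close>)
    from fprop[OF families(8)[OF nu_half(1), of \<kappa>, unfolded nu_half(2,3)] dom this[unfolded e' C2a W_of.simps \<nu>(1)]]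
    have "proportional a b a' b'" using \<nu>(2) by simp
    then show ?thesis using e' C2a \<nu> by simp
  next
    case (C2b \<kappa> a b)
    then obtain \<kappa>' a' b' where e': "e' = C2b \<kappa>' a' b'" using gg by (cases e') auto
    have \<nu>: "\<kappa>' = \<kappa>" "\<delta> \<noteq> 0" using cc ce C2b by (auto simp: e')
    have re: "whit_comb_exp \<kappa> (1 / 4) a b x = of_real (W_of e x)" "whit_comb_exp \<kappa> (1 / 4) a' b' x = of_real (W_of e' x)" if "x \<noteq> 0" for x
      using v that by (auto simp: C2b e' \<nu>(1) of_real_Re)
    have "W_of e' x = l * W_of e x" if "x \<in> I" for x
      by (rule even[OF _ refl _ that]) (use \<nu> in \<open>auto simp: e' whit_comb_exp_def\<close>)
    note WW = this
    have "whit_comb_exp \<kappa> (1 / 4) a' b' x = of_real l * whit_comb_exp \<kappa> (1 / 4) a b x" if "x \<in> I" for x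
    proof -
      have x0: "x \<noteq> 0" using dom \<nu>(2) that by auto
      show ?thesis unfolding re[OF x0] WW[OF that] by simp
    qed
    from family_proportional[OF families(9)[OF nu_half(1), of \<kappa>, unfolded nu_half(2,3)] I dom _ this] have "proportional a b a' b'" using \<nu>(2) ln by simp
    then show ?thesis using e' C2b \<nu> by simp
  next
    case (C2c a b)
    then obtain a' b' where e': "e' = C2c a' b'" using gg by (cases e') auto
    have c: "c1 = 1" "c3 = 0" using rig(3,4) ce C2c by auto
    have "proportional a b a' b'"
      by (rule fprop[OF families(13) subset_UNIV]) (use l c in \<open>simp add: e' C2c del: W_of.simps\<close>)
    then show ?thesis using e' C2c by simp
  qed (rule expo, simp)+
qed

section \<open>Equivalences of the larger class between equations with constant \<open>A\<close>,
  and assembly of the theorem\<close>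

text \<open>Equal constant \<open>A\<close> on both sides forces the square of
  \<open>deriv X\<close> to be the time factor \<open>c\<close>. Differentiation gives a vanishing
  second derivative, so \<open>X\<close> is affine with slope \<open>m\<close> and
  \<open>c = m * m\<close>, and the transformation of \<open>B\<close> becomes division by
  \<open>m\<close>.\<close>

lemma equiv_Kbar_const:
  assumes I: "open_interval I" and s: "s * s = 1" and eq: "equiv_Kbar I (\<lambda>_. s) B I' (\<lambda>_. s) B'"
  shows "equiv_K I B I' B'"
proof -
  note oI = open_intervalD(1)[OF I]
  obtain c X where c: "c \<noteq> 0" and X: "smooth_on I X" "\<forall>x\<in>I. deriv X x \<noteq> 0" "I' = X ` I"
    and A: "\<forall>x\<in>I. s = (deriv X x)\<^sup>2 / c * s"
    and B: "\<forall>x\<in>I. B' (X x) = deriv X x / c * B x + deriv (deriv X) x / c * s"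
    using eq[unfolded equiv_Kbar_def] by (elim exE conjE) (rule that)
  have s0: "s \<noteq> 0" using s by auto
  have sq: "(deriv X x)\<^sup>2 = c" if "x \<in> I" for x using bspec[OF A that] s0 c by (simp add: field_simps)
  note sX = smooth_on_deriv[OF oI X(1)]
  have d2: "deriv (deriv X) x = 0" if x: "x \<in> I" for x
  proof -
    have "((\<lambda>x. deriv X x * deriv X x) has_real_derivative deriv (deriv X) x * deriv X x + deriv (deriv X) x * deriv X x) (at x)"
      by (rule DERIV_mult[OF smooth_on_DERIV[OF sX x] smooth_on_DERIV[OF sX x]])
    then have "((\<lambda>_. c) has_real_derivative deriv (deriv X) x * deriv X x + deriv (deriv X) x * deriv X x) (at x)"
      by (rule has_field_derivative_transform_within_open[OF _ oI x]) (simp add: sq[symmetric] power2_eq_square)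
    from DERIV_unique[OF this DERIV_const] show ?thesis using bspec[OF X(2) x] by simp
  qed
  obtain x0 where x0: "x0 \<in> I" using open_intervalD(3)[OF I] by blast
  define m where "m = deriv X x0"
  have m: "deriv X x = m" if x: "x \<in> I" for x unfolding m_def
  proof (rule DERIV_zero_interval[OF I _ x x0])
    fix y assume y: "y \<in> I"
    show "(deriv X has_real_derivative 0) (at y)" using smooth_on_DERIV[OF sX y] d2[OF y] by simp
  qed
  have m0: "m \<noteq> 0" using bspec[OF X(2) x0] by (simp add: m_def)
  have mc: "c = m * m" using sq[OF x0] by (simp add: m_def power2_eq_square)
  define n where "n = X x0 - m * x0"
  have Xl: "X x = m * x + n" if x: "x \<in> I" for x
  proof -
    have "X x - m * x = X x0 - m * x0"
    proof (rule DERIV_zero_interval[OF I _ x x0, of "\<lambda>x. X x - m * x"])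
      fix y assume y: "y \<in> I"
      show "((\<lambda>x. X x - m * x) has_real_derivative 0) (at y)"
        using DERIV_diff[OF smooth_on_DERIV[OF X(1) y] DERIV_cmult_Id[of m]] m[OF y] by simp
    qed
    then show ?thesis by (simp add: n_def)
  qed
  have img: "I' = (\<lambda>x. m * x + n) ` I" unfolding X(3) by (rule image_cong[OF refl Xl])
  have "B' (m * x + n) = B x / m" if x: "x \<in> I" for x
    using bspec[OF B x] unfolding Xl[OF x] m[OF x] d2[OF x] mc using m0 by simp
  then show ?thesis unfolding equiv_K_def using m0 img by blast
qed

lemma nontrivial_detsys:
  assumes T: "open_interval T" and I: "open_interval I" and A: "\<And>x. x \<in> I \<Longrightarrow> A x \<noteq> 0"
    and Q: "Q \<in> ess_algebra T I A B" "Q \<notin> trivial_fields T I"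
  obtains \<tau> \<xi> \<eta> where "detsys T I A B \<tau> \<xi> \<eta>" "\<exists>t\<in>T. \<exists>x\<in>I. deriv \<tau> t \<noteq> 0 \<or> \<xi> t x \<noteq> 0"
proof (rule ess_detsys[OF open_intervalD(1)[OF T] open_intervalD(1)[OF I] open_intervalD(3)[OF I] Q(1)])
  fix \<tau> \<xi> \<eta>
  assume f: "\<And>t x u. t \<in> T \<Longrightarrow> x \<in> I \<Longrightarrow> Q (t, x, u) = (\<tau> t, \<xi> t x, \<eta> t x * u)" and d: "detsys T I A B \<tau> \<xi> \<eta>"
  have "\<exists>t\<in>T. \<exists>x\<in>I. deriv \<tau> t \<noteq> 0 \<or> \<xi> t x \<noteq> 0"
  proof (rule ccontr)
    assume n: "\<not> ?thesis"
    obtain x0 where "x0 \<in> I" using open_intervalD(3)[OF I] by blast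
    then have z: "\<And>t. t \<in> T \<Longrightarrow> deriv \<tau> t = 0" "\<And>t x. t \<in> T \<Longrightarrow> x \<in> I \<Longrightarrow> \<xi> t x = 0" using n by blast+
    have "Q \<in> trivial_fields T I" by (rule detsys_trivial[OF T I A d z f])
    then show False using Q(2) by simp
  qed
  then show ?thesis by (rule that[OF d])
qed

theorem theorem55:
  fixes \<epsilon> :: real and T :: "real set"
  assumes eps: "\<epsilon> \<in> {- 1, 1}"
    and T: "open_interval T"
  shows
    \<comment> \<open>kernels\<close>
    "(\<forall>I. open_interval I \<longrightarrow>
        has_basis (dom3 T I) (kernel_K \<epsilon> T I) [vf_dt, vf_udu] \<and>
        has_basis (dom3 T I) (kernel_Kbar T I) [vf_dt, vf_udu])
    \<comment> \<open>equations without extension\<close>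
   \<and> (\<forall>I B. open_interval I \<and> in_K I B \<and> \<not> extension_K \<epsilon> T I B \<longrightarrow>
        has_basis (dom3 T I) (ess_algebra T I (\<lambda>_. \<epsilon>) B) [vf_dt, vf_udu])
   \<and> (\<forall>I A B. open_interval I \<and> in_Kbar I A B \<and> \<not> extension_Kbar T I A B \<longrightarrow>
        has_basis (dom3 T I) (ess_algebra T I A B) [vf_dt, vf_udu])
    \<comment> \<open>the listed equations are extensions, with the given algebras\<close>
   \<and> (\<forall>e I. listed e I \<longrightarrow>
        extension_K \<epsilon> T I (B_of \<epsilon> e) \<and>
        extension_Kbar T I (\<lambda>_. \<epsilon>) (B_of \<epsilon> e) \<and>
        has_basis (dom3 T I) (ess_algebra T I (\<lambda>_. \<epsilon>) (B_of \<epsilon> e))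
          ([vf_dt, vf_udu] @ fields \<epsilon> (B_of \<epsilon> e) e))
    \<comment> \<open>completeness; locally, that is, away from at most one point\<close>
   \<and> (\<forall>I B. open_interval I \<and> extension_K \<epsilon> T I B \<longrightarrow>
        (\<exists>p. \<forall>J. open_interval J \<and> J \<subseteq> I - {p} \<longrightarrow>
           (\<exists>e I'. listed e I' \<and> equiv_K J B I' (B_of \<epsilon> e))))
   \<and> (\<forall>I A B. open_interval I \<and> extension_Kbar T I A B \<longrightarrow>
        (\<exists>p. \<forall>J. open_interval J \<and> J \<subseteq> I - {p} \<longrightarrow>
           (\<exists>e I'. listed e I' \<and> equiv_Kbar J A B I' (\<lambda>_. \<epsilon>) (B_of \<epsilon> e))))
    \<comment> \<open>inequivalence\<close>
   \<and> (\<forall>e I e' I'. listed e I \<and> listed e' I' \<and>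
          equiv_K I (B_of \<epsilon> e) I' (B_of \<epsilon> e') \<longrightarrow> same_entry e e')
   \<and> (\<forall>e I e' I'. listed e I \<and> listed e' I' \<and>
          equiv_Kbar I (\<lambda>_. \<epsilon>) (B_of \<epsilon> e) I' (\<lambda>_. \<epsilon>) (B_of \<epsilon> e') \<longrightarrow> same_entry e e')"
proof -
  have s: "\<epsilon> * \<epsilon> = 1" using eps by auto
  then have s0: "\<epsilon> \<noteq> 0" by auto
  note oT = open_intervalD(1)[OF T]
  note kK = kernel_K_eq[OF T _ s] and kKb = kernel_Kbar_eq[OF T]
  have tb: "has_basis (dom3 T I) (trivial_fields T I) [vf_dt, vf_udu]" if "open_interval I" for I
    by (rule trivial_fields_basis[OF open_intervalD(3)[OF T] open_intervalD(3)[OF that]])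
  have sub: "trivial_fields T I \<subseteq> ess_algebra T I A B" if "open_interval I" for I A B
    by (rule trivial_in_ess[OF oT open_intervalD(1)[OF that]])
  have neK: "has_basis (dom3 T I) (ess_algebra T I (\<lambda>_. \<epsilon>) B) [vf_dt, vf_udu]"
    if "open_interval I" "in_K I B" "\<not> extension_K \<epsilon> T I B" for I B
  proof -
    have "trivial_fields T I = ess_algebra T I (\<lambda>_. \<epsilon>) B"
      using that(2,3) sub[OF that(1), of "\<lambda>_. \<epsilon>" B] unfolding extension_K_def kK[OF that(1)] by blast
    then show ?thesis using tb[OF that(1)] by simp
  qed
  have neKb: "has_basis (dom3 T I) (ess_algebra T I A B) [vf_dt, vf_udu]"
    if "open_interval I" "in_Kbar I A B" "\<not> extension_Kbar T I A B" for I A B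
  proof -
    have "trivial_fields T I = ess_algebra T I A B"
      using that(2,3) sub[OF that(1), of A B] unfolding extension_Kbar_def kKb[OF that(1)] by blast
    then show ?thesis using tb[OF that(1)] by simp
  qed
  have ext: "extension_K \<epsilon> T I (B_of \<epsilon> e) \<and> extension_Kbar T I (\<lambda>_. \<epsilon>) (B_of \<epsilon> e) \<and>
      has_basis (dom3 T I) (ess_algebra T I (\<lambda>_. \<epsilon>) (B_of \<epsilon> e)) ([vf_dt, vf_udu] @ fields \<epsilon> (B_of \<epsilon> e) e)"
    if L: "listed e I" for e I
  proof -
    have I: "open_interval I" using L by (simp add: listed_def)
    note b = fields_basis[OF T L s]
    obtain v vs where "fields \<epsilon> (B_of \<epsilon> e) e = v # vs" by (cases e) auto
    then have "\<not> ess_algebra T I (\<lambda>_. \<epsilon>) (B_of \<epsilon> e) \<subseteq> trivial_fields T I" using basis_extends b by simp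
    moreover have "smooth_on I (B_of \<epsilon> e)" by (rule listed_facts[OF L s])
    ultimately show ?thesis
      using b sub[OF I, of "\<lambda>_. \<epsilon>" "B_of \<epsilon> e"] s0
      unfolding extension_K_def extension_Kbar_def kK[OF I] kKb[OF I] in_K_def in_Kbar_def
      by (auto simp: smooth_on_const)
  qed
  have cK: "\<exists>p. \<forall>J. open_interval J \<and> J \<subseteq> I - {p} \<longrightarrow> (\<exists>e I'. listed e I' \<and> equiv_K J B I' (B_of \<epsilon> e))"
    if I: "open_interval I" and x: "extension_K \<epsilon> T I B" for I B
  proof -
    have B: "smooth_on I B" using x by (simp add: extension_K_def in_K_def)
    obtain Q where Q: "Q \<in> ess_algebra T I (\<lambda>_. \<epsilon>) B" "Q \<notin> trivial_fields T I"
      using x unfolding extension_K_def kK[OF I] by blast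
    obtain \<tau> \<xi> \<eta> where d: "detsys T I (\<lambda>_. \<epsilon>) B \<tau> \<xi> \<eta>" "\<exists>t\<in>T. \<exists>x\<in>I. deriv \<tau> t \<noteq> 0 \<or> \<xi> t x \<noteq> 0"
      by (rule nontrivial_detsys[OF T I s0 Q])
    show ?thesis
    proof (rule extension_shape[OF T I s B d])
      fix x0 a b r e
      assume h: "\<And>x. x \<in> I \<Longrightarrow> potq \<epsilon> B x = a * (x - x0)\<^sup>2 + b * (x - x0) + r + e / (x - x0)\<^sup>2" "e \<noteq> 0 \<Longrightarrow> b = 0"
      show ?thesis by (rule complete_from_shape[OF I B s h])
    qed
  qed
  have cKb: "\<exists>p. \<forall>J. open_interval J \<and> J \<subseteq> I - {p} \<longrightarrow> (\<exists>e I'. listed e I' \<and> equiv_Kbar J A B I' (\<lambda>_. \<epsilon>) (B_of \<epsilon> e))"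
    if I: "open_interval I" and x: "extension_Kbar T I A B" for I A B
  proof -
    have K: "in_Kbar I A B" using x by (simp add: extension_Kbar_def)
    then have A: "\<And>x. x \<in> I \<Longrightarrow> A x \<noteq> 0" by (simp add: in_Kbar_def)
    obtain Q where Q: "Q \<in> ess_algebra T I A B" "Q \<notin> trivial_fields T I"
      using x unfolding extension_Kbar_def kKb[OF I] by blast
    obtain \<tau> \<xi> \<eta> where d: "detsys T I A B \<tau> \<xi> \<eta>" "\<exists>t\<in>T. \<exists>x\<in>I. deriv \<tau> t \<noteq> 0 \<or> \<xi> t x \<noteq> 0"
      by (rule nontrivial_detsys[OF T I A Q])
    show ?thesis by (rule detsys_push_complete[OF T I K s d])
  qed
  have iK: "same_entry e e'" if "listed e I" "listed e' I'" "equiv_K I (B_of \<epsilon> e) I' (B_of \<epsilon> e')" for e I e' I'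
    by (rule listed_equiv_same[OF that(1,2) s that(3)])
  have iKb: "same_entry e e'"
    if "listed e I" "listed e' I'" "equiv_Kbar I (\<lambda>_. \<epsilon>) (B_of \<epsilon> e) I' (\<lambda>_. \<epsilon>) (B_of \<epsilon> e')" for e I e' I'
    by (rule iK[OF that(1,2) equiv_Kbar_const[OF _ s that(3)]]) (use that(1) in \<open>simp add: listed_def\<close>)
  show ?thesis
    apply (intro conjI allI impI; (elim conjE)?)
    subgoal for I using tb[of I] kK[of I] by simp
    subgoal for I using tb[of I] kKb[of I] by simp
    subgoal by (rule neK)
    subgoal by (rule neKb)
    subgoal by (rule conjunct1[OF ext])
    subgoal by (rule conjunct1[OF conjunct2[OF ext]])
    subgoal by (rule conjunct2[OF conjunct2[OF ext]])
    subgoal by (rule cK)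
    subgoal by (rule cKb)
    subgoal by (rule iK)
    subgoal by (rule iKb)
    done
qed

end
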